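(* Let $(\eta)=\{\eta_n\}_{n=0}^\infty$ be a sequence of complex numbers. (a) If $1<p<\infty$ and $\mathcal R_{(\eta)}\in\mathcal K(H^p)$, then $$M_p(r,F_{(\eta)}')=o\left(\frac{\log\frac{1}{1-r}}{(1-r)^{1-\frac1p}}\right),\quad\text{as } r\to 1.$$ (b) If $1<p\le 2$ and $F_{(\eta)}\in\lambda^p_{1/p}$, then $\mathcal R_{(\eta)}\in\mathcal K(H^p)$. (c) If $2<p<\infty$ and $F_{(\eta)}\in\lambda^q_{1/q}$ for some $q\in(2,p)$, then $\mathcal R_{(\eta)}\in\mathcal K(H^p)$. (d) $\mathcal R_{(\eta)}\in\mathcal K(H^2)$ if and only if $F_{(\eta)}\in\lambda^2_{1/2}$.
   Context: $\mathbb D$ is the open unit disc in $\mathbb C$, and $\mathrm{Hol}(\mathbb D)$ is the space of analytic functions in $\mathbb D$. For $f\in \mathrm{Hol}(\mathbb D)$, $0<r<1$, $0<p<\infty$, $M_p(r,f)=\left(\frac1{2\pi}\int_0^{2\pi}|f(re^{it})|^p\,dt\right)^{1/p}$. The Hardy space $H^p$ consists of those $f\in\mathrm{Hol}(\mathbb D)$ with $\|f\|_{H^p}=\sup_{0<r<1}M_p(r,f)<\infty$. Rhaly operator: for a complex sequence $(\eta)=\{\eta_n\}_{n=0}^\infty$ and $f(z)=\sum_{n=0}^\infty a_nz^n\in\mathrm{Hol}(\mathbb D)$, formally $\mathcal R_{(\eta)}(f)(z)=\sum_{n=0}^\infty\eta_n\left(\sum_{k=0}^na_k\right)z^n$, whenever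 the right-hand side defines an analytic function in $\mathbb D$. If the power series $\sum\eta_nz^n$ defines an analytic function in $\mathbb D$, set $F_{(\eta)}(z)=\sum_{n=0}^\infty\eta_nz^n$. (On a subspace of $\mathrm{Hol}(\mathbb D)$ containing the constants, $\mathcal R_{(\eta)}$ is well defined into $\mathrm{Hol}(\mathbb D)$ if and only if this power series defines an analytic function in $\mathbb D$; a hypothesis such as $F_{(\eta)}\in X$ includes that it does.) For Banach spaces $X,Y$, $\mathcal K(X,Y)$ denotes the compact linear operators from $X$ into $Y$, and $\mathcal K(X)=\mathcal K(X,X)$. The notation $\mathcal R_{(\eta)}\in\mathcal K(X,Y)$ means that $\mathcal R_{(\eta)}$ is well defined on $X$, maps $X$ into $Y$, and is compact. Little-oh mean Lipschitz spaces: for $1\le p<\infty$ and $f$ with boundary values $f(e^{i\theta})$ a.e., $\omega_p(\delta,f)=\sup_{0<|t|\le\delta}\left(\frac1{2\pi}\int_{-\pi}^{\pi}|f(e^{i(\theta+t)})-f(e^{i\theta})|^p\,d\theta\right)^{1/p}$. For $0<\alpha\le1$, $\lambda^p_\alpha$ is the space of $f\in H^p$ with $\omega_p(\delta,f)=o(\delta^\alpha)$ as $\delta\to0$; equivalently, $f\in\mathrm{Hol}(\mathbb D)$ with $M_p(r,f')=o((1-r)^{\alpha-1})$ as $r\to1$. *)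

theory Defs
  imports "HOL-Complex_Analysis.Complex_Analysis" "HOL-Library.Landau_Symbols"
begin

text \<open>An analytic function on the open unit disc is represented by the function on all of
  \<open>\<complex>\<close> that vanishes off the disc. Equality of representatives is then equality on the disc,
  and spaces of such functions are genuine vector spaces under the pointwise operations.\<close>

definition Hol_disc :: "(complex \<Rightarrow> complex) set" where
  "Hol_disc = {f. f holomorphic_on ball 0 1 \<and> (\<forall>z. z \<notin> ball 0 1 \<longrightarrow> f z = 0)}"

text \<open>\<open>disc_fun c\<close> is meaningful only if \<open>disc_series c\<close> holds (\<open>suminf\<close> is unspecified for a
  divergent series); the two are therefore always used together.\<close>

definition disc_series :: "(nat \<Rightarrow> complex) \<Rightarrow> bool" where
  "disc_series c \<longleftrightarrow> (\<forall>z\<in>ball 0 1. summable (\<lambda>n. c n * z ^ n))"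

definition disc_fun :: "(nat \<Rightarrow> complex) \<Rightarrow> complex \<Rightarrow> complex" where
  "disc_fun c z = (if z \<in> ball 0 1 then (\<Sum>n. c n * z ^ n) else 0)"

definition taylor_coeff :: "(complex \<Rightarrow> complex) \<Rightarrow> nat \<Rightarrow> complex" where
  "taylor_coeff f n = (deriv ^^ n) f 0 / fact n"

definition integral_mean :: "real \<Rightarrow> real \<Rightarrow> (complex \<Rightarrow> complex) \<Rightarrow> real" where
  "integral_mean p r f =
     (1 / (2 * pi) * integral {0..2 * pi} (\<lambda>t. norm (f (of_real r * cis t)) powr p)) powr (1 / p)"

definition hardy :: "real \<Rightarrow> (complex \<Rightarrow> complex) set" where
  "hardy p = {f \<in> Hol_disc. bdd_above ((\<lambda>r. integral_mean p r f) ` {0<..<1})}"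

definition hardy_norm :: "real \<Rightarrow> (complex \<Rightarrow> complex) \<Rightarrow> real" where
  "hardy_norm p f = (SUP r\<in>{0<..<1}. integral_mean p r f)"

definition has_boundary_values :: "(complex \<Rightarrow> complex) \<Rightarrow> bool" where
  "has_boundary_values f \<longleftrightarrow>
     (AE \<theta> in lborel. \<exists>l. ((\<lambda>r. f (of_real r * cis \<theta>)) \<longlongrightarrow> l) (at_left (1::real)))"

definition boundary_value :: "(complex \<Rightarrow> complex) \<Rightarrow> real \<Rightarrow> complex" where
  "boundary_value f \<theta> = Lim (at_left (1::real)) (\<lambda>r. f (of_real r * cis \<theta>))"

definition mean_modulus :: "real \<Rightarrow> real \<Rightarrow> (complex \<Rightarrow> complex) \<Rightarrow> real" where
  "mean_modulus p \<delta> f =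
     (SUP t\<in>{t. 0 < \<bar>t\<bar> \<and> \<bar>t\<bar> \<le> \<delta>}.
        (1 / (2 * pi) * integral {-pi..pi}
           (\<lambda>\<theta>. norm (boundary_value f (\<theta> + t) - boundary_value f \<theta>) powr p)) powr (1 / p))"

text \<open>For \<open>p \<ge> 1\<close>, existence of the boundary values is automatic on \<open>hardy p\<close> (Fatou's theorem).
  The integral and the supremum in \<open>mean_modulus\<close> are finite there as well, since the boundary
  function belongs to \<open>L\<^sup>p\<close>. The condition is made explicit because \<open>boundary_value\<close> has no
  meaning where the radial limit fails to exist.\<close>

definition little_lipschitz :: "real \<Rightarrow> real \<Rightarrow> (complex \<Rightarrow> complex) set" where
  "little_lipschitz p \<alpha> =
     {f \<in> hardy p. has_boundary_values f \<and>
        (\<lambda>\<delta>. mean_modulus p \<delta> f) \<in> o[at_right 0](\<lambda>\<delta>. \<delta> powr \<alpha>)}"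

text \<open>The spaces are given by a carrier and a norm, since the integrability exponent is a term
  and not part of a type.\<close>

definition compact_linear_op ::
  "(complex \<Rightarrow> complex) set \<Rightarrow> ((complex \<Rightarrow> complex) \<Rightarrow> real) \<Rightarrow>
   (complex \<Rightarrow> complex) set \<Rightarrow> ((complex \<Rightarrow> complex) \<Rightarrow> real) \<Rightarrow>
   ((complex \<Rightarrow> complex) \<Rightarrow> complex \<Rightarrow> complex) \<Rightarrow> bool" where
  "compact_linear_op X normX Y normY T \<longleftrightarrow>
     (\<forall>f\<in>X. T f \<in> Y) \<and>
     (\<forall>f\<in>X. \<forall>g\<in>X. T (\<lambda>z. f z + g z) = (\<lambda>z. T f z + T g z)) \<and>
     (\<forall>c. \<forall>f\<in>X. T (\<lambda>z. c * f z) = (\<lambda>z. c * T f z)) \<and>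
     (\<forall>u :: nat \<Rightarrow> complex \<Rightarrow> complex.
        (\<forall>n. u n \<in> X) \<and> (\<exists>C. \<forall>n. normX (u n) \<le> C) \<longrightarrow>
        (\<exists>g\<in>Y. \<exists>s :: nat \<Rightarrow> nat. strict_mono s \<and>
           (\<lambda>n. normY (\<lambda>z. T (u (s n)) z - g z)) \<longlonglongrightarrow> 0))"

definition rhaly_coeff :: "(nat \<Rightarrow> complex) \<Rightarrow> (complex \<Rightarrow> complex) \<Rightarrow> nat \<Rightarrow> complex" where
  "rhaly_coeff \<eta> f n = \<eta> n * (\<Sum>k\<le>n. taylor_coeff f k)"

definition rhaly :: "(nat \<Rightarrow> complex) \<Rightarrow> (complex \<Rightarrow> complex) \<Rightarrow> complex \<Rightarrow> complex" where
  "rhaly \<eta> f = disc_fun (rhaly_coeff \<eta> f)"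

definition rhaly_well_defined :: "(nat \<Rightarrow> complex) \<Rightarrow> (complex \<Rightarrow> complex) set \<Rightarrow> bool" where
  "rhaly_well_defined \<eta> X \<longleftrightarrow> (\<forall>f\<in>X. disc_series (rhaly_coeff \<eta> f))"

definition rhaly_compact :: "(nat \<Rightarrow> complex) \<Rightarrow> real \<Rightarrow> bool" where
  "rhaly_compact \<eta> p \<longleftrightarrow>
     rhaly_well_defined \<eta> (hardy p) \<and>
     compact_linear_op (hardy p) (hardy_norm p) (hardy p) (hardy_norm p) (rhaly \<eta>)"

definition symbol_in :: "(nat \<Rightarrow> complex) \<Rightarrow> (complex \<Rightarrow> complex) set \<Rightarrow> bool" where
  "symbol_in \<eta> X \<longleftrightarrow> disc_series \<eta> \<and> disc_fun \<eta> \<in> X"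

end

theory Submission imports Defs begin

text \<open>In the coordinate \<open>w\<close> with \<open>z = e\<^sup>i\<^sup>w\<close> the disc becomes the upper half-plane and \<open>F\<close> becomes the periodic
  function \<open>\<Phi>(w) = F(e\<^sup>i\<^sup>w)\<close>. Membership of \<open>F\<close> in the little-oh space with exponents \<open>p\<close> and \<open>1/p\<close> amounts to
  \<open>(*)\<close>: the \<open>L\<^sup>p\<close> mean of \<open>\<Phi>'\<close> on the line \<open>Im w = y\<close> is \<open>o(y\<^sup>1\<^sup>/\<^sup>p\<^sup>-\<^sup>1)\<close>.

  Necessity. The Rhaly operator maps the kernel \<open>(1-a)\<^sup>1\<^sup>-\<^sup>1\<^sup>/\<^sup>p / (1 - a z)\<close> to \<open>(1-a)\<^sup>-\<^sup>1\<^sup>/\<^sup>p (F(z) - a F(a z))\<close>. The kernels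
  are bounded in \<open>H\<^sup>p\<close> and tend to \<open>0\<close> coefficientwise as \<open>a \<rightarrow> 1\<close>, so by compactness their images tend to
  \<open>0\<close> in norm. These images are essentially vertical increments of \<open>\<Phi>\<close>, which control \<open>\<Phi>'\<close>; hence \<open>(*)\<close>,
  which is stronger than the estimate in (a).

  Sufficiency. On the line of height \<open>y\<close> the derivative of the image of \<open>f\<close> has \<open>L\<^sup>q\<close> mean at most a multiple of
  \<open>y\<^sup>1\<^sup>/\<^sup>q\<^sup>-\<^sup>1 \<integral> \<bar>f(\<theta>)\<bar> / (y + \<bar>\<theta>\<bar>) d\<theta>\<close>, where \<open>(*)\<close> holds with exponent \<open>q\<close>. If \<open>q = p \<le> 2\<close>, the \<open>L\<^sup>p\<close> norms of the dyadic
  averages of the image are compared scale by scale by Clarkson's inequality; if \<open>q < p\<close>, its level sets are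
  estimated scale by scale. In both cases the sum over the scales is bounded by a Schur test, so the norm of the
  operator is bounded by the constant in \<open>(*)\<close>. Applied to \<open>F(z) - F(e\<^sup>-\<^sup>\<delta> z)\<close>, whose constant tends to \<open>0\<close>, this
  approximates the operator in norm by compact ones.\<close>


section \<open>Integral means\<close>

text \<open>The logarithmic coordinate turns circles into horizontal lines, on which real
  translations preserve every L^p mean, and differentiation multiplies the n-th coefficient by
  \<open>\<i> * n\<close> without shifting the index. All operator estimates are made on lines of
  positive height and for dilates of \<open>f\<close>, with constants that depend on neither;
  boundary values enter only in the equivalence between the modulus of continuity and the derivative
  condition. The obstacle is a logarithm. For \<open>f\<close> in L^p the integral of |f| / (y +
  |\<theta>|) is of order y^(-1/p), so with q = p the derivative of the image has mean of order 1/y,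
  and adding up the scales by the triangle inequality diverges. The contributions of the scales must
  be added in l^p instead. Clarkson's inequality does this for p at most 2; a gap q < p does it
  through level sets. Compactness is verified on sequences: the coefficientwise limit of a
  subsequence is found first, and its image serves as the norm limit, so completeness of the Hardy
  space is never invoked.\<close>

lemma continuous_on_norm_powr [continuous_intros]:
  fixes f :: "'a::topological_space \<Rightarrow> 'b::real_normed_vector"
  assumes "continuous_on S f" "p > 0"
  shows "continuous_on S (\<lambda>x. norm (f x) powr p)"
  using assms by (intro continuous_on_powr') (auto intro!: continuous_intros)

text \<open>Convexity of t^p in tangent form. After division by c^p it is Young's inequality with
  exponents 1/p and 1 - 1/p.\<close>

lemma powr_tangent_le:
  fixes p t c :: real
  assumes "p \<ge> 1" "t \<ge> 0" "c \<ge> 0"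
  shows "c powr p + p * c powr (p - 1) * (t - c) \<le> t powr p"
proof (cases "c = 0")
  case True
  then show ?thesis using assms by (cases "p = 1") auto
next
  case False
  then have c: "c > 0" using assms by simp
  have "c powr p + p * c powr (p - 1) * (t - c) = c powr p * (1 + p * (t / c - 1))"
    using c by (simp add: powr_diff field_simps)
  also have "\<dots> \<le> c powr p * (t / c) powr p"
  proof (cases "t = 0")
    case True
    then show ?thesis using assms c by (simp add: mult_le_0_iff)
  next
    case False
    then have t: "t / c > 0" using assms c by simp
    have "((t / c) powr p) powr (1 / p) * 1 powr (1 - 1 / p) \<le> (1 / p) * (t / c) powr p + (1 - 1 / p) * 1"
      using assms t by (intro Youngs_inequality_0) auto
    then have "t / c \<le> (1 / p) * (t / c) powr p + (1 - 1 / p)"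
      using assms t by (simp add: powr_powr)
    then have "p * (t / c) \<le> p * ((1 / p) * (t / c) powr p + (1 - 1 / p))"
      using assms by (intro mult_left_mono) auto
    then have "1 + p * (t / c - 1) \<le> (t / c) powr p"
      using assms by (simp add: algebra_simps)
    then show ?thesis by (intro mult_left_mono) auto
  qed
  also have "\<dots> = t powr p" using c assms by (simp add: powr_divide)
  finally show ?thesis .
qed

lemma integral_pos_continuous:
  fixes w :: "real \<Rightarrow> real"
  assumes "a < b" "continuous_on {a..b} w" "\<And>x. x \<in> {a..b} \<Longrightarrow> w x > 0"
  shows "integral {a..b} w > 0"
proof -
  have "integral {a..b} w \<ge> 0"
    using assms by (intro integral_nonneg integrable_continuous_interval) (auto intro: less_imp_le)
  moreover have "integral {a..b} w \<noteq> 0"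
  proof
    assume "integral {a..b} w = 0"
    then have "w a = 0" using integral_eq_0_iff[of a b w] assms(1,2) assms(3)[THEN less_imp_le] by auto
    with assms(3)[of a] assms(1) show False by simp
  qed
  ultimately show ?thesis by simp
qed

text \<open>Jensen's inequality for the quotient \<open>u / w\<close> and the measure with density \<open>w\<close>.
  The weight is the free parameter in the integral Minkowski inequality and in the Schur test.\<close>

lemma integral_powr_le_weighted:
  fixes u w :: "real \<Rightarrow> real"
  assumes p: "p \<ge> 1" and ab: "a < b"
    and cu: "continuous_on {a..b} u" and cw: "continuous_on {a..b} w"
    and u: "\<And>x. x \<in> {a..b} \<Longrightarrow> u x \<ge> 0" and w: "\<And>x. x \<in> {a..b} \<Longrightarrow> w x > 0"
  shows "(integral {a..b} u) powr p
      \<le> (integral {a..b} w) powr (p - 1) * integral {a..b} (\<lambda>x. u x powr p * w x powr (1 - p))"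
proof -
  define U where "U = integral {a..b} u"
  define W where "W = integral {a..b} w"
  have W: "W > 0" unfolding W_def by (rule integral_pos_continuous) (use assms in auto)
  have U: "U \<ge> 0" unfolding U_def using assms by (intro integral_nonneg integrable_continuous_interval) auto
  \<comment> \<open>\<open>c\<close> is the mean of \<open>u / w\<close> for the density
    \<open>w\<close>. With the tangent taken at this point the linear term integrates to
    zero.\<close>
  define c where "c = U / W"
  have c: "c \<ge> 0" using U W by (simp add: c_def)
  have cont: "continuous_on {a..b} (\<lambda>x. u x powr p * w x powr (1 - p))"
    using p w u cu cw
    by (intro continuous_on_mult continuous_on_powr' continuous_intros) (auto simp: less_imp_le dest: w)
  have int: "(\<lambda>x. c powr p * w x + p * c powr (p - 1) * (u x - c * w x)) integrable_on {a..b}"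
    by (intro integrable_continuous_interval continuous_intros cu cw)
  have pt: "c powr p * w x + p * c powr (p - 1) * (u x - c * w x) \<le> u x powr p * w x powr (1 - p)"
    if x: "x \<in> {a..b}" for x
  proof -
    have "c powr p + p * c powr (p - 1) * (u x / w x - c) \<le> (u x / w x) powr p"
      using p c u[OF x] w[OF x] by (intro powr_tangent_le) auto
    then have "w x * (c powr p + p * c powr (p - 1) * (u x / w x - c)) \<le> w x * (u x / w x) powr p"
      using w[OF x] by (intro mult_left_mono) auto
    also have "w x * (u x / w x) powr p = u x powr p * w x powr (1 - p)"
      using w[OF x] u[OF x] by (simp add: powr_divide powr_diff field_simps)
    also have "w x * (c powr p + p * c powr (p - 1) * (u x / w x - c)) =
        c powr p * w x + p * c powr (p - 1) * (u x - c * w x)"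
      using w[OF x] by (simp add: field_simps)
    finally show ?thesis .
  qed
  have "integral {a..b} (\<lambda>x. c powr p * w x + p * c powr (p - 1) * (u x - c * w x))
      \<le> integral {a..b} (\<lambda>x. u x powr p * w x powr (1 - p))"
    by (intro integral_le int pt integrable_continuous_interval cont) auto
  moreover have "integral {a..b} (\<lambda>x. c powr p * w x + p * c powr (p - 1) * (u x - c * w x))
      = c powr p * W + p * c powr (p - 1) * (U - c * W)"
  proof -
    have "((\<lambda>x. c powr p * w x + p * c powr (p - 1) * (u x - c * w x)) has_integral
        c powr p * W + p * c powr (p - 1) * (U - c * W)) {a..b}"
      unfolding U_def W_def
      by (intro has_integral_add has_integral_mult_right has_integral_diff integrable_integral
          integrable_continuous_interval cu cw)
    then show ?thesis by (rule integral_unique)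
  qed
  ultimately have "c powr p * W \<le> integral {a..b} (\<lambda>x. u x powr p * w x powr (1 - p))"
    using W by (simp add: c_def)
  then have "W powr (p - 1) * (c powr p * W) \<le> W powr (p - 1) * integral {a..b} (\<lambda>x. u x powr p * w x powr (1 - p))"
    by (intro mult_left_mono) auto
  moreover have "W powr (p - 1) * (c powr p * W) = U powr p"
    using W U unfolding c_def by (simp add: powr_divide powr_diff)
  ultimately show ?thesis by (simp add: U_def W_def)
qed

section \<open>Normalised L^p norms over one period and Minkowski's inequality\<close>

definition Lpn :: "real \<Rightarrow> (real \<Rightarrow> complex) \<Rightarrow> real" where
  "Lpn p u = (1 / (2 * pi) * integral {0..2 * pi} (\<lambda>t. norm (u t) powr p)) powr (1 / p)"

lemma Lpn_nonneg [simp]: "Lpn p u \<ge> 0"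
  by (simp add: Lpn_def)

lemma integral_norm_powr_nonneg [simp]: "integral S (\<lambda>t. norm (u t) powr p) \<ge> 0"
  by (cases "(\<lambda>t. norm (u t) powr p) integrable_on S")
     (auto intro: integral_nonneg simp: not_integrable_integral)

lemma Lpn_powr: "p > 0 \<Longrightarrow> Lpn p u powr p = 1 / (2 * pi) * integral {0..2 * pi} (\<lambda>t. norm (u t) powr p)"
  by (simp add: Lpn_def powr_powr)

lemma Lpn_le_iff:
  assumes "p > 0" "W \<ge> 0"
  shows "Lpn p u \<le> W \<longleftrightarrow> integral {0..2 * pi} (\<lambda>t. norm (u t) powr p) \<le> 2 * pi * W powr p"
proof -
  have "Lpn p u \<le> W \<longleftrightarrow> Lpn p u powr p \<le> W powr p"
  proof
    show "Lpn p u powr p \<le> W powr p" if "Lpn p u \<le> W" using that assms by (intro powr_mono2) auto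
    show "Lpn p u \<le> W" if "Lpn p u powr p \<le> W powr p"
    proof (rule ccontr)
      assume "\<not> Lpn p u \<le> W"
      then have "W powr p < Lpn p u powr p" using assms by (intro powr_less_mono2) auto
      with that show False by simp
    qed
  qed
  also have "\<dots> \<longleftrightarrow> integral {0..2 * pi} (\<lambda>t. norm (u t) powr p) \<le> 2 * pi * W powr p"
    using assms by (simp add: Lpn_powr field_simps)
  finally show ?thesis .
qed

lemma integral_eq_Lpn:
  "p > 0 \<Longrightarrow> integral {0..2 * pi} (\<lambda>t. norm (u t) powr p) = 2 * pi * Lpn p u powr p"
  by (simp add: Lpn_powr)

lemma Lpn_mono:
  assumes "p > 0" "continuous_on {0..2*pi} u" "continuous_on {0..2*pi} v"
    "\<And>t. t \<in> {0..2*pi} \<Longrightarrow> norm (u t) \<le> norm (v t)"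
  shows "Lpn p u \<le> Lpn p v"
proof -
  have "integral {0..2*pi} (\<lambda>t. norm (u t) powr p) \<le> integral {0..2*pi} (\<lambda>t. norm (v t) powr p)"
    using assms by (intro integral_le integrable_continuous_interval continuous_intros powr_mono2) auto
  then show ?thesis using assms by (simp add: Lpn_le_iff integral_eq_Lpn)
qed

lemma Lpn_le_const:
  assumes "p > 0" "continuous_on {0..2*pi} u" "\<And>t. t \<in> {0..2*pi} \<Longrightarrow> norm (u t) \<le> c" "c \<ge> 0"
  shows "Lpn p u \<le> c"
proof -
  have "integral {0..2*pi} (\<lambda>t. norm (u t) powr p) \<le> integral {0..2*pi} (\<lambda>t. c powr p)"
    using assms by (intro integral_le integrable_continuous_interval continuous_intros powr_mono2) auto
  then show ?thesis using assms by (simp add: Lpn_le_iff)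
qed

lemma Lpn_cmult:
  assumes "p > 0" shows "Lpn p (\<lambda>t. c * u t) = norm c * Lpn p u"
proof -
  define J where "J = 1 / (2 * pi) * integral {0..2 * pi} (\<lambda>t. norm (u t) powr p)"
  have "1 / (2 * pi) * integral {0..2 * pi} (\<lambda>t. norm (c * u t) powr p) = norm c powr p * J"
    by (simp add: norm_mult powr_mult J_def)
  then have "Lpn p (\<lambda>t. c * u t) = (norm c powr p * J) powr (1 / p)"
    by (simp only: Lpn_def)
  also have "\<dots> = (norm c powr p) powr (1 / p) * J powr (1 / p)"
    by (rule powr_mult)
  also have "\<dots> = norm c * Lpn p u"
    using assms by (simp add: powr_powr Lpn_def J_def)
  finally show ?thesis .
qed

lemma continuous_on_sliceR:
  assumes "continuous_on (S \<times> T) (\<lambda>(s, x). u s x)" "s \<in> S"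
  shows "continuous_on T (u s)"
proof -
  have "continuous_on T (\<lambda>x. (\<lambda>(s, x). u s x) (s, x))"
    by (rule continuous_on_compose2[OF assms(1)]) (use assms(2) in \<open>auto intro!: continuous_intros\<close>)
  then show ?thesis by simp
qed

lemma continuous_on_sliceL:
  assumes "continuous_on (S \<times> T) (\<lambda>(s, x). u s x)" "x \<in> T"
  shows "continuous_on S (\<lambda>s. u s x)"
proof -
  have "continuous_on S (\<lambda>s. (\<lambda>(s, x). u s x) (s, x))"
    by (rule continuous_on_compose2[OF assms(1)]) (use assms(2) in \<open>auto intro!: continuous_intros\<close>)
  then show ?thesis by simp
qed

lemma continuous_on_Times_swap:
  assumes "continuous_on (S \<times> T) (\<lambda>(s, x). u s x)"
  shows "continuous_on (T \<times> S) (\<lambda>(x, s). u s x)"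
proof -
  have "continuous_on (T \<times> S) (\<lambda>z. (\<lambda>(s, x). u s x) (snd z, fst z))"
    by (rule continuous_on_compose2[OF assms]) (auto intro!: continuous_intros)
  then show ?thesis by (simp add: case_prod_unfold)
qed

text \<open>Jensen's inequality in \<open>s\<close> with weight \<open>w\<close>, followed by an
  exchange of the two integrals. The continuous positive majorant \<open>w\<close> stands in for the
  norms of \<open>u s\<close>, so their dependence on \<open>s\<close> need not be studied and
  negative powers of the weight are harmless.\<close>

lemma Lpn_minkowski_integral:
  fixes u :: "real \<Rightarrow> real \<Rightarrow> complex"
  assumes p: "p \<ge> 1" and ab: "a < b"
    and cu: "continuous_on ({a..b} \<times> {0..2*pi}) (\<lambda>(s, x). u s x)"
    and cw: "continuous_on {a..b} w" and w: "\<And>s. s \<in> {a..b} \<Longrightarrow> w s > 0"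
    and le: "\<And>s. s \<in> {a..b} \<Longrightarrow> Lpn p (u s) \<le> w s"
    and cv: "continuous_on {0..2*pi} v"
    and v: "\<And>x. x \<in> {0..2*pi} \<Longrightarrow> norm (v x) \<le> integral {a..b} (\<lambda>s. norm (u s x))"
  shows "Lpn p v \<le> integral {a..b} w"
proof -
  define W where "W = integral {a..b} w"
  have W: "W > 0" unfolding W_def by (rule integral_pos_continuous) (use assms in auto)
  let ?F = "\<lambda>s x. norm (u s x) powr p * w s powr (1 - p)"
  have cus: "continuous_on {0..2*pi} (u s)" if "s \<in> {a..b}" for s
    using that by (rule continuous_on_sliceR[OF cu])
  have cux: "continuous_on {a..b} (\<lambda>s. u s x)" if "x \<in> {0..2*pi}" for x
    using that by (rule continuous_on_sliceL[OF cu])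
  have cF: "continuous_on ({a..b} \<times> {0..2*pi}) (\<lambda>(s, x). ?F s x)"
  proof -
    have "continuous_on ({a..b} \<times> {0..2*pi}) (\<lambda>z. norm (u (fst z) (snd z)) powr p * w (fst z) powr (1 - p))"
      using cu p w
      by (intro continuous_intros continuous_on_compose2[OF cw]) (auto simp: case_prod_unfold dest: w)
    then show ?thesis by (simp add: case_prod_unfold)
  qed
  have cF': "continuous_on (cbox (a, 0) (b, 2*pi)) (\<lambda>(s, x). ?F s x)"
    using cF by (simp add: cbox_Pair_eq)
  have swap: "integral {a..b} (\<lambda>s. integral {0..2*pi} (?F s)) = integral {0..2*pi} (\<lambda>x. integral {a..b} (\<lambda>s. ?F s x))"
    using integral_swap_continuous[OF cF'] by simp
  have cI: "continuous_on {0..2*pi} (\<lambda>x. integral {a..b} (\<lambda>s. ?F s x))"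
  proof -
    have "continuous_on ({0..2*pi} \<times> cbox a b) (\<lambda>(x, s). ?F s x)"
      using continuous_on_Times_swap[OF cF] by simp
    from integral_continuous_on_param[OF this] show ?thesis by simp
  qed
  have cJ: "continuous_on {a..b} (\<lambda>s. integral {0..2*pi} (?F s))"
  proof -
    have "continuous_on ({a..b} \<times> cbox 0 (2*pi)) (\<lambda>(s, x). ?F s x)"
      using cF by simp
    from integral_continuous_on_param[OF this] show ?thesis by simp
  qed
  have "integral {0..2*pi} (\<lambda>x. norm (v x) powr p) \<le> integral {0..2*pi} (\<lambda>x. W powr (p - 1) * integral {a..b} (\<lambda>s. ?F s x))"
  proof (rule integral_le)
    show "(\<lambda>x. norm (v x) powr p) integrable_on {0..2 * pi}"
      using p by (intro integrable_continuous_interval continuous_intros cv) auto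
    show "(\<lambda>x. W powr (p - 1) * integral {a..b} (\<lambda>s. ?F s x)) integrable_on {0..2 * pi}"
      by (intro integrable_continuous_interval continuous_intros cI)
    fix x assume x: "x \<in> {0..2*pi}"
    have "norm (v x) powr p \<le> (integral {a..b} (\<lambda>s. norm (u s x))) powr p"
      using v[OF x] p by (intro powr_mono2) auto
    also have "\<dots> \<le> W powr (p - 1) * integral {a..b} (\<lambda>s. ?F s x)"
      unfolding W_def using p ab w cux[OF x] cw
      by (intro integral_powr_le_weighted) (auto intro!: continuous_intros)
    finally show "norm (v x) powr p \<le> W powr (p - 1) * integral {a..b} (\<lambda>s. ?F s x)" .
  qed
  also have "\<dots> = W powr (p - 1) * integral {a..b} (\<lambda>s. integral {0..2*pi} (?F s))"
    by (simp only: swap integral_mult_right)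
  also have "\<dots> \<le> W powr (p - 1) * integral {a..b} (\<lambda>s. 2 * pi * w s)"
  proof (intro mult_left_mono integral_le integrable_continuous_interval cJ)
    show "continuous_on {a..b} (\<lambda>s. 2 * pi * w s)" by (intro continuous_intros cw)
    fix s assume s: "s \<in> {a..b}"
    have "integral {0..2*pi} (?F s) = integral {0..2*pi} (\<lambda>x. norm (u s x) powr p) * w s powr (1 - p)"
      by simp
    also have "\<dots> \<le> 2 * pi * w s powr p * w s powr (1 - p)"
      using le[OF s] p w[OF s] by (intro mult_right_mono) (simp_all add: Lpn_le_iff)
    also have "\<dots> = 2 * pi * w s" using w[OF s] by (simp add: powr_diff)
    finally show "integral {0..2*pi} (?F s) \<le> 2 * pi * w s" .
  qed auto
  also have "\<dots> = 2 * pi * W powr p" using W by (simp add: W_def powr_diff)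
  finally show ?thesis using W p by (simp add: Lpn_le_iff W_def)
qed

lemma convex_powr_two:
  fixes a b :: real
  assumes "p \<ge> 1" "a \<ge> 0" "b \<ge> 0" "s \<ge> 0" "t \<ge> 0" "s + t = 1"
  shows "(s * a + t * b) powr p \<le> s * a powr p + t * b powr p"
proof -
  define c where "c = s * a + t * b"
  have c: "c \<ge> 0" using assms by (simp add: c_def)
  have "s * (c powr p + p * c powr (p - 1) * (a - c)) + t * (c powr p + p * c powr (p - 1) * (b - c))
     \<le> s * a powr p + t * b powr p"
    using assms c by (intro add_mono mult_left_mono powr_tangent_le) auto
  moreover have "s * (c powr p + p * c powr (p - 1) * (a - c)) + t * (c powr p + p * c powr (p - 1) * (b - c))
     = (s + t) * c powr p + p * c powr (p - 1) * (s * a + t * b - (s + t) * c)"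
    by (simp add: algebra_simps)
  ultimately show ?thesis using assms(6) by (simp add: c_def)
qed

text \<open>The two-point form of the weighted Jensen inequality. Taking for \<open>A\<close> and
  \<open>B\<close> the norms of the two summands and integrating gives the triangle
  inequality.\<close>

lemma add_powr_le_weighted:
  fixes a b A B p :: real
  assumes p: "p \<ge> 1" and ab: "a \<ge> 0" "b \<ge> 0" and AB: "A > 0" "B > 0"
  shows "(a + b) powr p \<le> (A + B) powr (p - 1) * (A powr (1 - p) * a powr p + B powr (1 - p) * b powr p)"
proof -
  define S where "S = A + B"
  have S: "S > 0" using AB by (simp add: S_def)
  define s t where "s = A / S" and "t = B / S"
  have st: "s \<ge> 0" "t \<ge> 0" "s + t = 1"
    using S AB by (auto simp: s_def t_def S_def simp flip: add_divide_distrib)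
  have "S * (s * (a / A)) = a" "S * (t * (b / B)) = b"
    using AB S by (auto simp: s_def t_def)
  then have "a + b = S * (s * (a / A) + t * (b / B))" by (simp add: distrib_left)
  then have "(a + b) powr p = S powr p * (s * (a / A) + t * (b / B)) powr p"
    by (simp only: powr_mult)
  also have "\<dots> \<le> S powr p * (s * (a / A) powr p + t * (b / B) powr p)"
  proof (rule mult_left_mono)
    show "(s * (a / A) + t * (b / B)) powr p \<le> s * (a / A) powr p + t * (b / B) powr p"
      by (rule convex_powr_two[OF p _ _ st]) (use ab AB in auto)
  qed simp
  also have "\<dots> = S powr (p - 1) * (S * s * (a / A) powr p + S * t * (b / B) powr p)"
    using S by (simp add: powr_diff field_simps)
  also have "S * s * (a / A) powr p = A powr (1 - p) * a powr p"
    using S AB ab by (simp add: s_def powr_diff powr_divide)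
  also have "S * t * (b / B) powr p = B powr (1 - p) * b powr p"
    using S AB ab by (simp add: t_def powr_diff powr_divide)
  finally show ?thesis by (simp add: S_def)
qed

lemma Lpn_triangle_le:
  assumes p: "p \<ge> 1" and c: "continuous_on {0..2*pi} u" "continuous_on {0..2*pi} v" "continuous_on {0..2*pi} z"
    and z: "\<And>x. x \<in> {0..2*pi} \<Longrightarrow> norm (z x) \<le> norm (u x) + norm (v x)"
  shows "Lpn p z \<le> Lpn p u + Lpn p v"
proof (rule field_le_epsilon)
  fix e :: real assume e: "e > 0"
  \<comment> \<open>The weights are the norms themselves, enlarged by \<open>e / 2\<close> so that
    they stay positive when a norm vanishes.\<close>
  define A B where "A = Lpn p u + e / 2" and "B = Lpn p v + e / 2"
  have AB: "A > 0" "B > 0" using e by (auto simp: A_def B_def add_nonneg_pos)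
  have p0: "p > 0" using p by simp
  let ?R = "\<lambda>x. (A + B) powr (p - 1) * (A powr (1 - p) * norm (u x) powr p + B powr (1 - p) * norm (v x) powr p)"
  have "integral {0..2*pi} (\<lambda>x. norm (z x) powr p) \<le> integral {0..2*pi} ?R"
  proof (intro integral_le integrable_continuous_interval continuous_on_mult continuous_on_add continuous_on_const continuous_on_norm_powr c p0)
    fix x assume x: "x \<in> {0..2*pi}"
    have "norm (z x) powr p \<le> (norm (u x) + norm (v x)) powr p"
      using z[OF x] p by (intro powr_mono2) auto
    also have "\<dots> \<le> ?R x" by (rule add_powr_le_weighted[OF p _ _ AB]) auto
    finally show "norm (z x) powr p \<le> ?R x" .
  qed
  also have "\<dots> = (A + B) powr (p - 1) * (A powr (1 - p) * (2 * pi * Lpn p u powr p) + B powr (1 - p) * (2 * pi * Lpn p v powr p))"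
    unfolding integral_eq_Lpn[OF p0, symmetric]
    by (intro integral_unique has_integral_add has_integral_mult_right integrable_integral
        integrable_continuous_interval continuous_on_norm_powr c p0)
  also have "\<dots> \<le> (A + B) powr (p - 1) * (A powr (1 - p) * (2 * pi * A powr p) + B powr (1 - p) * (2 * pi * B powr p))"
    using p0 e by (intro mult_left_mono add_mono powr_mono2) (auto simp: A_def B_def)
  also have "A powr (1 - p) * (2 * pi * A powr p) = 2 * pi * A"
    using AB by (simp add: powr_diff)
  also have "B powr (1 - p) * (2 * pi * B powr p) = 2 * pi * B"
    using AB by (simp add: powr_diff)
  also have "(A + B) powr (p - 1) * (2 * pi * A + 2 * pi * B) = 2 * pi * (A + B) powr p"
  proof -
    have "(A + B) powr p = (A + B) powr (p - 1) * (A + B) powr 1"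
      by (subst powr_add[symmetric]) simp
    then show ?thesis using AB by (simp add: algebra_simps)
  qed
  finally have "Lpn p z \<le> A + B" using AB p0 by (simp add: Lpn_le_iff)
  then show "Lpn p z \<le> Lpn p u + Lpn p v + e" by (simp add: A_def B_def)
qed

text \<open>The derivative of the integral over \<open>{s..s + 2*pi}\<close> with respect to
  \<open>s\<close> is \<open>v (s + 2*pi) - v s\<close>, which vanishes.\<close>

lemma integral_periodic_shift:
  fixes v :: "real \<Rightarrow> 'a::euclidean_space"
  assumes c: "continuous_on UNIV v" and per: "\<And>x. v (x + 2*pi) = v x"
  shows "integral {t..t + 2*pi} v = integral {0..2*pi} v"
proof -
  \<comment> \<open>The primitive starts at \<open>-R\<close>, to the left of both \<open>t\<close>
    and 0, so one primitive serves for the whole comparison.\<close>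
  define R where "R = \<bar>t\<bar> + 1"
  define I where "I = (\<lambda>s. integral {s..s + 2*pi} v)"
  define J where "J = (\<lambda>x. integral {-R..x} v)"
  have int: "v integrable_on {a..b}" for a b
    using c by (intro integrable_continuous_interval) (rule continuous_on_subset, auto)
  have IJ: "I s = J (s + 2*pi) - J s" if "s \<in> {-R..R}" for s
    using Henstock_Kurzweil_Integration.integral_combine[of "-R" s "s + 2*pi" v] that int by (simp add: I_def J_def algebra_simps)
  have dJ: "(J has_vector_derivative v x) (at x)" if "-R < x" for x
  proof -
    have "(J has_vector_derivative v x) (at x within {-R..x+1})"
      unfolding J_def using c that
      by (intro integral_has_vector_derivative) (auto intro: continuous_on_subset)
    then show ?thesis using that by (subst (asm) at_within_interior) (auto)
  qed
  have "((\<lambda>s. J (s + 2*pi) - J s) has_vector_derivative 0) (at s)" if "-R < s" for s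
  proof -
    have "((\<lambda>s. J (s + 2*pi)) has_vector_derivative v (s + 2*pi)) (at s)"
    proof -
      have "(J \<circ> (\<lambda>s. s + 2*pi) has_vector_derivative 1 *\<^sub>R v (s + 2*pi)) (at s)"
        using that pi_gt_zero
        by (intro vector_diff_chain_at dJ) (auto intro!: derivative_eq_intros less_trans[OF that])
      then show ?thesis by (simp add: o_def)
    qed
    from has_vector_derivative_diff[OF this dJ[OF that]] show ?thesis by (simp add: per)
  qed
  then have "((\<lambda>s. J (s + 2*pi) - J s) has_derivative (\<lambda>h. 0)) (at s within {-R<..})" if "s \<in> {-R<..}" for s
    using that by (simp add: has_vector_derivative_def has_derivative_at_withinI)
  then have "(\<lambda>s. J (s + 2*pi) - J s) t = (\<lambda>s. J (s + 2*pi) - J s) 0"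
    by (intro has_derivative_zero_unique[of "{-R<..}"]) (auto simp: R_def)
  then have "I t = I 0" using IJ[of t] IJ[of 0] unfolding R_def by (simp add: abs_if split: if_splits)
  then show ?thesis by (simp add: I_def)
qed

lemma integral_shift_plus: "integral {a..b} (\<lambda>x. f (x + c)) = integral {a + c..b + c} f"
  for f :: "real \<Rightarrow> 'a::euclidean_space"
  using integral_shift_Icc_real[of a b f c] by (simp add: o_def add.commute)

lemma Lpn_shift:
  assumes "p > 0" "continuous_on UNIV u" and per: "\<And>x. u (x + 2*pi) = u x"
  shows "Lpn p (\<lambda>x. u (x + t)) = Lpn p u"
proof -
  have "integral {0..2*pi} (\<lambda>x. norm (u (x + t)) powr p) = integral {t..t + 2*pi} (\<lambda>x. norm (u x) powr p)"
    using integral_shift_plus[of 0 "2*pi" "\<lambda>x. norm (u x) powr p" t] by (simp add: add.commute)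
  also have "\<dots> = integral {0..2*pi} (\<lambda>x. norm (u x) powr p)"
    using assms by (intro integral_periodic_shift continuous_intros) auto
  finally show ?thesis by (simp add: Lpn_def)
qed

lemma integral_norm_le_Lpn:
  assumes p: "p \<ge> 1" and c: "continuous_on {0..2*pi} u"
  shows "integral {0..2*pi} (\<lambda>x. norm (u x)) \<le> 2 * pi * Lpn p u"
proof -
  have p0: "p > 0" using p by simp
  have "(integral {0..2*pi} (\<lambda>x. norm (u x))) powr p
      \<le> (integral {0..2*pi} (\<lambda>x. 1)) powr (p - 1) * integral {0..2*pi} (\<lambda>x. norm (u x) powr p * 1 powr (1 - p))"
    using p c by (intro integral_powr_le_weighted) (auto intro!: continuous_intros)
  also have "\<dots> = (2 * pi * Lpn p u) powr p"
    using p0 by (simp add: integral_eq_Lpn powr_mult powr_diff)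
  finally have *: "(integral {0..2*pi} (\<lambda>x. norm (u x))) powr p \<le> (2 * pi * Lpn p u) powr p" .
  show ?thesis
  proof (rule ccontr)
    assume "\<not> ?thesis"
    then have "(2 * pi * Lpn p u) powr p < (integral {0..2*pi} (\<lambda>x. norm (u x))) powr p"
      using p0 by (intro powr_less_mono2) auto
    with * show False by simp
  qed
qed

section \<open>Periodic functions on the upper half-plane\<close>

definition uhp :: "complex set" where "uhp = {w. Im w > 0}"

text \<open>These are the functions g(e^(iw)) with g holomorphic in the punctured disc. The class is
  closed under differentiation and under translations that do not lower the imaginary part.\<close>

definition per_hol :: "(complex \<Rightarrow> complex) \<Rightarrow> bool" where
  "per_hol U \<longleftrightarrow> U holomorphic_on uhp \<and> (\<forall>w\<in>uhp. U (w + of_real (2*pi)) = U w)"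

abbreviation Hn :: "real \<Rightarrow> real \<Rightarrow> (complex \<Rightarrow> complex) \<Rightarrow> real" where
  "Hn p y U \<equiv> Lpn p (\<lambda>x. U (Complex x y))"

lemma open_uhp [simp]: "open uhp"
  unfolding uhp_def by (rule open_halfspace_Im_gt)

lemma in_uhp [simp]: "w \<in> uhp \<longleftrightarrow> Im w > 0"
  by (simp add: uhp_def)

lemma Complex_add_shift: "Complex x y + c = Complex (x + Re c) (y + Im c)"
  by (simp add: complex_eq_iff)

lemma per_hol_holomorphic: "per_hol U \<Longrightarrow> U holomorphic_on uhp"
  by (simp add: per_hol_def)

lemma per_hol_continuous: "per_hol U \<Longrightarrow> continuous_on uhp U"
  by (simp add: per_hol_def holomorphic_on_imp_continuous_on)

lemma per_hol_continuous_compose: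
  assumes "per_hol U" "continuous_on S f" "\<And>x. x \<in> S \<Longrightarrow> Im (f x) > 0"
  shows "continuous_on S (\<lambda>x. U (f x))"
  by (rule continuous_on_compose2[OF per_hol_continuous[OF assms(1)] assms(2)]) (use assms(3) in auto)

lemma per_hol_line:
  assumes "per_hol U" "y > 0"
  shows "continuous_on S (\<lambda>x. U (Complex x y))"
  using assms(2) by (intro per_hol_continuous_compose[OF assms(1)]) (auto intro!: continuous_intros)

lemma per_hol_periodic: "per_hol U \<Longrightarrow> y > 0 \<Longrightarrow> U (Complex (x + 2*pi) y) = U (Complex x y)"
  unfolding per_hol_def by (drule conjunct2, drule bspec[of _ _ "Complex x y"])
    (auto simp: Complex_add_shift)

lemma per_hol_shift: 
  assumes "per_hol U" "Im c \<ge> 0" shows "per_hol (\<lambda>w. U (w + c))"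
  unfolding per_hol_def
proof (intro conjI ballI)
  show "(\<lambda>w. U (w + c)) holomorphic_on uhp"
    by (rule holomorphic_on_compose_gen[OF _ per_hol_holomorphic[OF assms(1)], of "\<lambda>w. w + c" uhp, unfolded o_def])
       (use assms(2) in \<open>auto intro!: holomorphic_intros\<close>)
  fix w assume "w \<in> uhp"
  then have "U ((w + c) + of_real (2*pi)) = U (w + c)"
    using assms by (auto simp: per_hol_def)
  then show "U (w + of_real (2*pi) + c) = U (w + c)" by (simp add: add_ac)
qed

lemma per_hol_field_differentiable: "per_hol U \<Longrightarrow> Im w > 0 \<Longrightarrow> U field_differentiable at w"
  using holomorphic_on_imp_differentiable_at[of U uhp w] by (simp add: per_hol_holomorphic)

lemma deriv_shift:
  assumes "per_hol U" "Im (w + c) > 0"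
  shows "deriv (\<lambda>w. U (w + c)) w = deriv U (w + c)"
proof (rule DERIV_imp_deriv)
  have "(U has_field_derivative deriv U (w + c)) (at (w + c))"
    using per_hol_field_differentiable[OF assms] field_differentiable_derivI by blast
  then show "((\<lambda>w. U (w + c)) has_field_derivative deriv U (w + c)) (at w)"
    by (simp add: DERIV_shift)
qed

lemma per_hol_deriv:
  assumes "per_hol U" shows "per_hol (deriv U)"
  unfolding per_hol_def
proof (intro conjI ballI)
  show "deriv U holomorphic_on uhp"
    using assms by (intro holomorphic_deriv per_hol_holomorphic) auto
  fix w assume w: "w \<in> uhp"
  have "deriv U (w + of_real (2*pi)) = deriv (\<lambda>w. U (w + of_real (2*pi))) w"
    using assms w by (subst deriv_shift) auto
  also have "\<dots> = deriv U w"
    using w assms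
    by (intro deriv_cong_ev eventually_mono[OF eventually_nhds_in_open[of uhp]])
       (auto simp: per_hol_def)
  finally show "deriv U (w + of_real (2*pi)) = deriv U w" .
qed

lemma per_hol_diff: "per_hol U \<Longrightarrow> per_hol V \<Longrightarrow> per_hol (\<lambda>w. U w - V w)"
  by (auto simp: per_hol_def intro!: holomorphic_intros)

lemma deriv_per_hol_diff:
  "per_hol U \<Longrightarrow> per_hol V \<Longrightarrow> Im w > 0 \<Longrightarrow> deriv (\<lambda>w. U w - V w) w = deriv U w - deriv V w"
  by (intro deriv_diff per_hol_field_differentiable)

section \<open>Cauchy estimates, increments and samples on horizontal lines\<close>

lemma Hn_shift:
  assumes "per_hol U" "p > 0" "y + Im c > 0"
  shows "Hn p y (\<lambda>w. U (w + c)) = Hn p (y + Im c) U"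
proof -
  have "Hn p y (\<lambda>w. U (w + c)) = Lpn p (\<lambda>x. (\<lambda>x. U (Complex x (y + Im c))) (x + Re c))"
    by (simp add: Complex_add_shift)
  also have "\<dots> = Hn p (y + Im c) U"
    using assms by (intro Lpn_shift per_hol_line) (auto simp: per_hol_periodic)
  finally show ?thesis .
qed

text \<open>Cauchy's formula writes the derivative as an average of U(w + c) / c over the circle |c|
  = \<rho>. By Minkowski and translation invariance only the heights between y - \<rho> and y +
  \<rho> matter.\<close>

lemma Hn_deriv_le:
  assumes U: "per_hol U" and p: "p \<ge> 1" and \<rho>: "0 < \<rho>" "\<rho> < y"
    and B: "\<And>v. \<bar>v - y\<bar> \<le> \<rho> \<Longrightarrow> Hn p v U \<le> B"
  shows "Hn p y (deriv U) \<le> B / \<rho>"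
proof (rule field_le_epsilon)
  fix e :: real assume e: "e > 0"
  have B0: "B \<ge> 0" using order_trans[OF Lpn_nonneg B[of y]] \<rho> by simp
  define c where "c = (\<lambda>s. of_real \<rho> * exp (2 * of_real pi * \<i> * of_real s))"
  have cn: "norm (c s) = \<rho>" for s using \<rho> by (simp add: c_def norm_mult)
  have cI: "\<bar>Im (c s)\<bar> \<le> \<rho>" for s using abs_Im_le_cmod[of "c s"] by (simp add: cn)
  have pos: "y + Im (c s) > 0" for s using cI[of s] \<rho> by linarith
  have cc: "continuous_on S c" for S unfolding c_def by (intro continuous_intros)
  \<comment> \<open>The summand \<open>e\<close> keeps the Minkowski weight positive when
    \<open>B\<close> is 0; the same device recurs in the next estimates.\<close>
  have "Hn p y (deriv U) \<le> integral {0..1::real} (\<lambda>s. B / \<rho> + e)"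
  proof (rule Lpn_minkowski_integral[OF p])
    show "continuous_on ({0..1} \<times> {0..2 * pi}) (\<lambda>(s, x). U (Complex x y + c s) / of_real \<rho>)"
      using \<rho> pos unfolding case_prod_unfold
      by (intro continuous_intros per_hol_continuous_compose[OF U] continuous_on_compose2[OF cc]) (auto intro!: continuous_intros)
    show "Lpn p (\<lambda>x. U (Complex x y + c s) / of_real \<rho>) \<le> B / \<rho> + e" for s
    proof -
      have "Lpn p (\<lambda>x. U (Complex x y + c s) / of_real \<rho>) = Lpn p (\<lambda>x. of_real (1 / \<rho>) * U (Complex x y + c s))"
        by (simp add: field_simps)
      also have "\<dots> = 1 / \<rho> * Hn p (y + Im (c s)) U"
        using \<rho> p Hn_shift[OF U _ pos, of p s] by (subst Lpn_cmult) (auto simp: norm_divide)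
      also have "\<dots> \<le> 1 / \<rho> * B" using \<rho> cI[of s] by (intro mult_left_mono B) auto
      finally show ?thesis using e by simp
    qed
    show "continuous_on {0..2 * pi} (\<lambda>x. deriv U (Complex x y))"
      using \<rho> by (intro per_hol_line per_hol_deriv U) auto
    fix x
    let ?w = "Complex x y"
    have sub: "cball ?w \<rho> \<subseteq> uhp"
    proof
      fix z assume "z \<in> cball ?w \<rho>"
      then have "\<bar>Im (?w - z)\<bar> \<le> \<rho>" using abs_Im_le_cmod[of "?w - z"] by (simp add: dist_norm)
      then show "z \<in> uhp" using \<rho> by simp
    qed
    have sub': "ball ?w \<rho> \<subseteq> uhp" using ball_subset_cball sub by (rule order_trans)
    have "((\<lambda>u. U u / (u - ?w) ^ Suc 1) has_contour_integral 2 * pi * \<i> / fact 1 * (deriv ^^ 1) U ?w)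
       (circlepath ?w \<rho>)"
      using \<rho> sub sub'
      by (intro Cauchy_has_contour_integral_higher_derivative_circlepath)
         (auto intro: continuous_on_subset[OF per_hol_continuous[OF U]]
           holomorphic_on_subset[OF per_hol_holomorphic[OF U]])
    moreover have "U (circlepath ?w \<rho> s) / (circlepath ?w \<rho> s - ?w) ^ Suc 1 * vector_derivative (circlepath ?w \<rho>) (at s within {0..1})
        = U (?w + c s) / (c s)\<^sup>2 * (2 * pi * \<i> * c s)" if "s \<in> {0..1}" for s
    proof -
      have "vector_derivative (circlepath ?w \<rho>) (at s within {0..1}) = 2 * pi * \<i> * c s"
        using vector_derivative_circlepath01[of s ?w \<rho>] that by (simp add: c_def)
      moreover have "circlepath ?w \<rho> s = ?w + c s" by (simp add: circlepath c_def)
      ultimately show ?thesis by (simp add: power2_eq_square)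
    qed
    ultimately have "((\<lambda>s. U (?w + c s) / (c s)\<^sup>2 * (2 * pi * \<i> * c s)) has_integral 2 * pi * \<i> / fact 1 * (deriv ^^ 1) U ?w) {0..1}"
      unfolding has_contour_integral_def by (subst (asm) has_integral_cong) auto
    then have "((\<lambda>s. U (?w + c s) / (c s)\<^sup>2 * (2 * pi * \<i> * c s)) has_integral 2 * pi * \<i> * deriv U ?w) {0..1}"
      by simp
    then have eq: "2 * pi * \<i> * deriv U ?w = integral {0..1} (\<lambda>s. U (?w + c s) / (c s)\<^sup>2 * (2 * pi * \<i> * c s))"
      by (simp add: integral_unique)
    have "norm (2 * pi * \<i> * deriv U ?w) \<le> integral {0..1} (\<lambda>s. 2 * pi * norm (U (?w + c s) / of_real \<rho>))"
      unfolding eq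
    proof (rule integral_norm_bound_integral)
      have cu: "continuous_on {0..1} (\<lambda>s. U (?w + c s))"
        using pos by (intro per_hol_continuous_compose[OF U] continuous_intros cc) auto
      have c0: "c s \<noteq> 0" for s using cn[of s] \<rho> by auto
      show "(\<lambda>s. U (?w + c s) / (c s)\<^sup>2 * (2 * pi * \<i> * c s)) integrable_on {0..1}"
        using c0 by (intro integrable_continuous_interval continuous_intros cu cc) auto
      show "(\<lambda>s. 2 * pi * norm (U (?w + c s) / of_real \<rho>)) integrable_on {0..1}"
        using \<rho> by (intro integrable_continuous_interval continuous_intros cu) auto
      show "norm (U (?w + c s) / (c s)\<^sup>2 * (2 * pi * \<i> * c s)) \<le> 2 * pi * norm (U (?w + c s) / of_real \<rho>)" for s
        using \<rho> by (simp add: norm_mult norm_divide norm_power cn power2_eq_square mult_ac)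
    qed
    then show "norm (deriv U (Complex x y)) \<le> integral {0..1} (\<lambda>s. norm (U (Complex x y + c s) / of_real \<rho>))"
      by (simp add: norm_mult)
  qed (use e B0 \<rho> in \<open>auto intro!: add_nonneg_pos\<close>)
  then show "Hn p y (deriv U) \<le> B / \<rho> + e" by simp
qed

lemma has_vector_derivative_per_hol:
  assumes "per_hol U" "(f has_vector_derivative f') (at s within S)" "Im (f s) > 0"
  shows "((\<lambda>s. U (f s)) has_vector_derivative f' * deriv U (f s)) (at s within S)"
proof -
  have "(U has_field_derivative deriv U (f s)) (at (f s) within f ` S)"
    using per_hol_field_differentiable[OF assms(1,3)] field_differentiable_derivI has_field_derivative_at_within by blast
  from field_vector_diff_chain_within[OF assms(2) this] show ?thesis by (simp add: o_def mult.commute)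
qed

lemma per_hol_diff_integral:
  assumes U: "per_hol U" and "Im w > 0" "Im c \<ge> 0"
  shows "((\<lambda>s. c * deriv U (w + of_real s * c)) has_integral U (w + c) - U w) {0..1}"
proof -
  have "((\<lambda>s. c * deriv U (w + of_real s * c)) has_integral U (w + of_real 1 * c) - U (w + of_real 0 * c)) {0..1}"
  proof (rule fundamental_theorem_of_calculus)
    fix s :: real assume "s \<in> {0..1}"
    then show "((\<lambda>s. U (w + of_real s * c)) has_vector_derivative c * deriv U (w + of_real s * c)) (at s within {0..1})"
      using assms
      by (intro has_vector_derivative_per_hol[OF U]) (auto intro!: derivative_eq_intros add_pos_nonneg)
  qed auto
  then show ?thesis by simp
qed

text \<open>The mean value inequality in L^p: the increment is the integral of the derivative along
  the segment from w to w + c, to which Minkowski applies.\<close>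

lemma Hn_diff_le:
  assumes U: "per_hol U" and p: "p \<ge> 1" and y: "y > 0" and c: "Im c \<ge> 0"
    and B: "\<And>s. s \<in> {0..1} \<Longrightarrow> Hn p (y + s * Im c) (deriv U) \<le> B"
  shows "Hn p y (\<lambda>w. U (w + c) - U w) \<le> norm c * B"
proof (rule field_le_epsilon)
  fix e :: real assume e: "e > 0"
  have B0: "B \<ge> 0" using order_trans[OF Lpn_nonneg B[of 0]] by simp
  have pos: "s \<in> {0..1} \<Longrightarrow> 0 < y + s * Im c" for s using y c by (auto intro: add_pos_nonneg)
  have U': "per_hol (deriv U)" by (rule per_hol_deriv[OF U])
  have "Hn p y (\<lambda>w. U (w + c) - U w) \<le> integral {0..1::real} (\<lambda>s. norm c * B + e)"
  proof (rule Lpn_minkowski_integral[OF p])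
    show "continuous_on ({0..1} \<times> {0..2 * pi}) (\<lambda>(s, x). c * deriv U (Complex x y + of_real s * c))"
      using pos unfolding case_prod_unfold
      by (intro continuous_intros per_hol_continuous_compose[OF U']) (auto intro!: continuous_intros)
    show "Lpn p (\<lambda>x. c * deriv U (Complex x y + of_real s * c)) \<le> norm c * B + e" if s: "s \<in> {0..1}" for s
    proof -
      have "Lpn p (\<lambda>x. c * deriv U (Complex x y + of_real s * c)) = norm c * Hn p (y + s * Im c) (deriv U)"
        using p Hn_shift[OF U', of p y "of_real s * c"] pos[OF s] by (subst Lpn_cmult) auto
      also have "\<dots> \<le> norm c * B" by (intro mult_left_mono B s) auto
      finally show ?thesis using e by simp
    qed
    show "continuous_on {0..2 * pi} (\<lambda>x. U (Complex x y + c) - U (Complex x y))"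
      using y c by (intro continuous_intros per_hol_continuous_compose[OF U]) auto
    fix x
    have i: "((\<lambda>s. c * deriv U (Complex x y + of_real s * c)) has_integral U (Complex x y + c) - U (Complex x y)) {0..1}"
      using y c by (intro per_hol_diff_integral U) auto
    show "norm (U (Complex x y + c) - U (Complex x y)) \<le> integral {0..1} (\<lambda>s. norm (c * deriv U (Complex x y + of_real s * c)))"
      unfolding integral_unique[OF i, symmetric]
      using i pos by (intro integral_norm_bound_integral integrable_continuous_interval)
        (auto intro!: continuous_intros per_hol_continuous_compose[OF U'])
  qed (use e B0 in \<open>auto intro!: add_nonneg_pos\<close>)
  then show "Hn p y (\<lambda>w. U (w + c) - U w) \<le> norm c * B + e" by simp
qed

text \<open>With \<open>D\<^sub>u(w) = U(w + u c) - U(w)\<close> one has \<open>c U'(w) = D\<^sub>1(w) - \<integral>\<^sub>0\<^sup>1 c D\<^sub>u'(w) du\<close>,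
  and \<open>D\<^sub>u'\<close> is controlled by \<open>D\<^sub>u\<close> through Cauchy's estimate. Thus increments of step \<open>\<bar>c\<bar> \<approx> y\<close>
  in any fixed direction control the derivative.\<close>

lemma Hn_deriv_le_of_increments:
  assumes U: "per_hol U" and p: "p \<ge> 1" and y: "y > 0" and c: "Im c \<ge> 0"
    and B: "\<And>u v. u \<in> {0..1} \<Longrightarrow> v \<ge> y / 2 \<Longrightarrow> Hn p v (\<lambda>w. U (w + of_real u * c) - U w) \<le> B"
  shows "norm c * Hn p y (deriv U) \<le> B + norm c * (2 * B / y)"
proof (rule field_le_epsilon)
  fix e :: real assume e: "e > 0"
  have U': "per_hol (deriv U)" by (rule per_hol_deriv[OF U])
  have p0: "p > 0" using p by simp
  have B0: "B \<ge> 0" using order_trans[OF Lpn_nonneg B[of 0 y]] y by simp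
  have pos: "s \<in> {0..1} \<Longrightarrow> 0 < y + s * Im c" for s using y c by (auto intro: add_pos_nonneg)
  define D where "D = (\<lambda>u x. c * (deriv U (Complex x y + of_real u * c) - deriv U (Complex x y)))"
  have cD: "continuous_on ({0..1} \<times> {0..2 * pi}) (\<lambda>(u, x). D u x)"
    unfolding D_def case_prod_unfold using pos y
    by (intro continuous_intros per_hol_continuous_compose[OF U']) (auto intro!: continuous_intros)
  have cDx: "continuous_on {0..1} (\<lambda>u. D u x)" if "x \<in> {0..2*pi}" for x
    using that by (rule continuous_on_sliceL[OF cD])
  have intD: "(\<lambda>u. norm (D u x)) integrable_on {0..1}" if "x \<in> {0..2*pi}" for x
    by (intro integrable_continuous_interval continuous_on_norm cDx that)
  \<comment> \<open>A pointwise majorant of the error term, made complex-valued so that it can enter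
    the triangle inequality for \<open>Lpn\<close>.\<close>
  define v where "v = (\<lambda>x. complex_of_real (integral {0..1} (\<lambda>u. norm (D u x))))"
  have cv: "continuous_on {0..2*pi} v"
  proof -
    have "continuous_on ({0..2*pi} \<times> cbox 0 1) (\<lambda>(x, u). norm (D u x))"
      using continuous_on_Times_swap[OF cD] by (auto simp: case_prod_unfold intro!: continuous_intros)
    from integral_continuous_on_param[OF this] show ?thesis unfolding v_def by (auto intro!: continuous_intros)
  qed
  have "Lpn p v \<le> integral {0..1::real} (\<lambda>u. norm c * (B / (y / 2)) + e)"
  proof (rule Lpn_minkowski_integral[OF p _ cD])
    fix u :: real assume u: "u \<in> {0..1}"
    let ?c = "of_real u * c"
    have Du: "per_hol (\<lambda>w. U (w + ?c) - U w)"
      using u c by (intro per_hol_diff per_hol_shift U) auto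
    have "Lpn p (D u) = norm c * Lpn p (\<lambda>x. deriv U (Complex x y + ?c) - deriv U (Complex x y))"
      unfolding D_def using p0 by (rule Lpn_cmult)
    also have "(\<lambda>x. deriv U (Complex x y + ?c) - deriv U (Complex x y)) = (\<lambda>x. deriv (\<lambda>w. U (w + ?c) - U w) (Complex x y))"
      using u c y pos[OF u] by (subst deriv_per_hol_diff) (auto intro!: per_hol_shift U simp: deriv_shift[OF U])
    \<comment> \<open>Cauchy's estimate with radius y/2, which is why the increments must be
      controlled at all heights from y/2 on.\<close>
    also have "norm c * Lpn p \<dots> \<le> norm c * (B / (y / 2))"
      proof (intro mult_left_mono Hn_deriv_le[OF Du p] B[OF u])
        show "y / 2 \<le> v" if "\<bar>v - y\<bar> \<le> y / 2" for v using that abs_ge_minus_self[of "v - y"] by linarith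
      qed (use y in auto)
    finally show "Lpn p (D u) \<le> norm c * (B / (y / 2)) + e" using e by simp
  next
    show "norm (v x) \<le> integral {0..1} (\<lambda>s. norm (D s x))" if "x \<in> {0..2*pi}" for x
      using integral_nonneg[OF intD[OF that]] by (simp add: v_def)
  qed (use e B0 y cv in \<open>auto intro!: add_nonneg_pos\<close>)
  then have v: "Lpn p v \<le> norm c * (2 * B / y) + e" by (simp add: field_simps)
  have "norm c * Hn p y (deriv U) = Lpn p (\<lambda>x. c * deriv U (Complex x y))"
    using p0 by (simp add: Lpn_cmult)
  also have "\<dots> \<le> Hn p y (\<lambda>w. U (w + c) - U w) + Lpn p v"
  proof (rule Lpn_triangle_le[OF p _ cv])
    show "continuous_on {0..2 * pi} (\<lambda>x. U (Complex x y + c) - U (Complex x y))"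
      using y c by (intro continuous_intros per_hol_continuous_compose[OF U]) auto
    show "continuous_on {0..2 * pi} (\<lambda>x. c * deriv U (Complex x y))"
      using y c by (intro continuous_intros per_hol_continuous_compose[OF U']) auto
    fix x assume x: "x \<in> {0..2*pi}"
    have "((\<lambda>s. c * deriv U (Complex x y + of_real s * c) - c * deriv U (Complex x y)) has_integral
       (U (Complex x y + c) - U (Complex x y)) - c * deriv U (Complex x y)) {0..1}"
      using y c has_integral_const_real[of "c * deriv U (Complex x y)" 0 1]
      by (intro has_integral_diff per_hol_diff_integral U) auto
    then have i: "((\<lambda>u. D u x) has_integral (U (Complex x y + c) - U (Complex x y)) - c * deriv U (Complex x y)) {0..1}"
      by (simp add: D_def algebra_simps)
    have "norm (integral {0..1} (\<lambda>u. D u x)) \<le> integral {0..1} (\<lambda>u. norm (D u x))"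
      using integrable_continuous_interval[OF cDx[OF x]] intD[OF x] by (rule integral_norm_bound_integral) simp
    moreover have "\<dots> = norm (v x)"
      using integral_nonneg[OF intD[OF x]] by (simp add: v_def)
    ultimately have "norm ((U (Complex x y + c) - U (Complex x y)) - c * deriv U (Complex x y)) \<le> norm (v x)"
      using integral_unique[OF i] by simp
    then show "norm (c * deriv U (Complex x y)) \<le> norm (U (Complex x y + c) - U (Complex x y)) + norm (v x)"
      using norm_triangle_ineq4[of "U (Complex x y + c) - U (Complex x y)" "(U (Complex x y + c) - U (Complex x y)) - c * deriv U (Complex x y)"]
      by simp
  qed
  also have "\<dots> \<le> B + (norm c * (2 * B / y) + e)"
    using v B[of 1 y] y by (intro add_mono) auto
  finally show "norm c * Hn p y (deriv U) \<le> B + norm c * (2 * B / y) + e" by simp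
qed

text \<open>A one-dimensional Sobolev inequality: |f(a)| is at most the mean of |f| over the
  interval plus the integral of |f'|. Convexity of t^p separates the two terms, and Jensen is
  applied to each.\<close>

lemma norm_powr_le_averages:
  fixes f :: "real \<Rightarrow> complex"
  assumes p: "p \<ge> 1" and l: "l > 0"
    and f: "\<And>x. x \<in> {a..a+l} \<Longrightarrow> (f has_vector_derivative f' x) (at x within {a..a+l})"
    and cf': "continuous_on {a..a+l} f'"
  shows "norm (f a) powr p \<le> 2 powr (p - 1) * (1 / l * integral {a..a+l} (\<lambda>x. norm (f x) powr p)
      + l powr (p - 1) * integral {a..a+l} (\<lambda>x. norm (f' x) powr p))"
proof -
  have p0: "p > 0" using p by simp
  have cf: "continuous_on {a..a+l} f"
    using f by (meson continuous_on_vector_derivative)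
  define I where "I = integral {a..a+l} (\<lambda>x. norm (f x))"
  define J where "J = integral {a..a+l} (\<lambda>x. norm (f' x))"
  have nn: "I \<ge> 0" "J \<ge> 0" using cf cf' unfolding I_def J_def
    by (auto intro!: integral_nonneg integrable_continuous_interval continuous_intros)
  have "norm (f a) \<le> norm (f x) + J" if x: "x \<in> {a..a+l}" for x
  proof -
    have "(f' has_integral f x - f a) {a..x}"
      using x by (intro fundamental_theorem_of_calculus)
        (auto intro: has_vector_derivative_within_subset[OF f])
    then have "f x - f a = integral {a..x} f'" by (simp add: integral_unique)
    also have "norm \<dots> \<le> integral {a..x} (\<lambda>x. norm (f' x))"
      using x by (intro integral_norm_bound_integral integrable_continuous_interval continuous_on_norm
          continuous_on_subset[OF cf']) auto
    also have "\<dots> \<le> J" unfolding J_def using x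
      by (intro integral_subset_le integrable_continuous_interval continuous_on_norm continuous_on_subset[OF cf']) auto
    finally show ?thesis using norm_triangle_ineq2[of "f a" "f x"] by (simp add: norm_minus_commute)
  qed
  then have "integral {a..a+l} (\<lambda>x. norm (f a)) \<le> integral {a..a+l} (\<lambda>x. norm (f x) + J)"
    using cf by (intro integral_le integrable_continuous_interval continuous_intros) auto
  also have "\<dots> = I + l * J"
    using cf l unfolding I_def by (subst integral_add) (auto intro!: integrable_continuous_interval continuous_intros)
  finally have "norm (f a) \<le> I / l + J" using l by (simp add: field_simps)
  then have "norm (f a) powr p \<le> (2 * (1/2 * (I / l) + 1/2 * J)) powr p"
    using p by (intro powr_mono2) auto
  also have "\<dots> = 2 powr p * (1/2 * (I / l) + 1/2 * J) powr p"
    using nn l by (subst powr_mult) auto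
  also have "\<dots> \<le> 2 powr p * (1/2 * (I / l) powr p + 1/2 * J powr p)"
    using nn l p by (intro mult_left_mono convex_powr_two) auto
  also have "\<dots> = 2 powr (p - 1) * ((I / l) powr p + J powr p)"
    by (simp add: powr_diff field_simps)
  also have "\<dots> \<le> 2 powr (p - 1) * (1 / l * integral {a..a+l} (\<lambda>x. norm (f x) powr p)
      + l powr (p - 1) * integral {a..a+l} (\<lambda>x. norm (f' x) powr p))"
  proof (intro mult_left_mono add_mono)
    have "J powr p \<le> (integral {a..a+l} (\<lambda>x. 1)) powr (p - 1) * integral {a..a+l} (\<lambda>x. norm (f' x) powr p * 1 powr (1 - p))"
      unfolding J_def using p l cf' by (intro integral_powr_le_weighted) (auto intro!: continuous_intros)
    then show "J powr p \<le> l powr (p - 1) * integral {a..a+l} (\<lambda>x. norm (f' x) powr p)" using l by simp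
    have "I powr p \<le> (integral {a..a+l} (\<lambda>x. 1)) powr (p - 1) * integral {a..a+l} (\<lambda>x. norm (f x) powr p * 1 powr (1 - p))"
      unfolding I_def using p l cf by (intro integral_powr_le_weighted) (auto intro!: continuous_intros)
    then have "I powr p \<le> l powr (p - 1) * integral {a..a+l} (\<lambda>x. norm (f x) powr p)" using l by simp
    then have "I powr p / l powr p \<le> l powr (p - 1) * integral {a..a+l} (\<lambda>x. norm (f x) powr p) / l powr p"
      by (intro divide_right_mono) auto
    then show "(I / l) powr p \<le> 1 / l * integral {a..a+l} (\<lambda>x. norm (f x) powr p)"
      using l nn by (simp add: powr_divide powr_diff field_simps)
  qed auto
  finally show ?thesis .
qed

lemma sum_integral_blocks_le:
  fixes g :: "real \<Rightarrow> real"
  assumes c: "continuous_on UNIV g" and g: "\<And>x. g x \<ge> 0" and l: "0 \<le> l" "l \<le> d"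
  shows "(\<Sum>j<n. integral {b + real j * d..b + real j * d + l} g) \<le> integral {b..b + real n * d} g"
proof (induction n)
  case (Suc n)
  have int: "g integrable_on {s..t}" for s t
    using c by (intro integrable_continuous_interval) (rule continuous_on_subset, auto)
  have d: "d \<ge> 0" using l by simp
  have "integral {b + real n * d..b + real n * d + l} g \<le> integral {b + real n * d..b + real (Suc n) * d} g"
    using l g by (intro integral_subset_le int) (auto simp: algebra_simps)
  moreover have "integral {b..b + real n * d} g + integral {b + real n * d..b + real (Suc n) * d} g = integral {b..b + real (Suc n) * d} g"
    using d by (intro Henstock_Kurzweil_Integration.integral_combine int) (auto simp: mult_right_mono)
  ultimately show ?case using Suc by simp
qed simp

text \<open>A sampling inequality of Marcinkiewicz-Zygmund type. Each sample is charged to the block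
  of length \<open>l\<close> to its right; the blocks are disjoint because \<open>l\<close> does not
  exceed the spacing \<open>d\<close>. The length is left free so that it can be matched to the
  height at which one samples.\<close>

lemma sum_samples_le:
  assumes U: "per_hol U" and p: "p \<ge> 1" and y: "y > 0" and l: "0 < l" "l \<le> d" and nd: "real n * d = 2 * pi"
  shows "(\<Sum>j<n. norm (U (Complex (b + real j * d) y)) powr p)
     \<le> 2 powr (p - 1) * (2 * pi) * (Hn p y U powr p / l + l powr (p - 1) * Hn p y (deriv U) powr p)"
proof -
  have p0: "p > 0" using p by simp
  define f where "f = (\<lambda>x. U (Complex x y))"
  define f' where "f' = (\<lambda>x. deriv U (Complex x y))"
  have cf: "continuous_on UNIV f" and cf': "continuous_on UNIV f'"
    unfolding f_def f'_def using y by (auto intro!: per_hol_line per_hol_deriv U)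
  have der: "(f has_vector_derivative f' x) (at x within S)" for x S
  proof -
    have "((\<lambda>x. Complex x y) has_vector_derivative 1) (at x within S)"
      using has_vector_derivative_add[OF has_vector_derivative_of_real[OF DERIV_ident] has_vector_derivative_const[of "\<i> * of_real y"]]
      by (simp add: Complex_eq)
    from has_vector_derivative_per_hol[OF U this] y show ?thesis by (simp add: f_def f'_def)
  qed
  have perf: "f (x + 2*pi) = f x" "f' (x + 2*pi) = f' x" for x
    using y by (auto simp: f_def f'_def per_hol_periodic U per_hol_deriv)
  have per: "integral {b..b + real n * d} (\<lambda>x. norm (f x) powr p) = 2 * pi * Hn p y U powr p"
    "integral {b..b + real n * d} (\<lambda>x. norm (f' x) powr p) = 2 * pi * Hn p y (deriv U) powr p"
    unfolding nd
    using integral_periodic_shift[OF continuous_on_norm_powr[OF cf p0], of b]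
      integral_periodic_shift[OF continuous_on_norm_powr[OF cf' p0], of b] perf p0
    by (simp_all add: integral_eq_Lpn) (simp_all add: f_def f'_def)
  have "(\<Sum>j<n. norm (f (b + real j * d)) powr p)
     \<le> (\<Sum>j<n. 2 powr (p - 1) * (1 / l * integral {b + real j * d..b + real j * d+l} (\<lambda>x. norm (f x) powr p)
      + l powr (p - 1) * integral {b + real j * d..b + real j * d+l} (\<lambda>x. norm (f' x) powr p)))"
    using p l cf' by (intro sum_mono norm_powr_le_averages der) (auto intro: continuous_on_subset)
  also have "\<dots> = 2 powr (p - 1) * (1 / l * (\<Sum>j<n. integral {b + real j * d..b + real j * d+l} (\<lambda>x. norm (f x) powr p))
      + l powr (p - 1) * (\<Sum>j<n. integral {b + real j * d..b + real j * d+l} (\<lambda>x. norm (f' x) powr p)))"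
    by (simp add: sum.distrib sum_distrib_left distrib_left)
  also have "\<dots> \<le> 2 powr (p - 1) * (1 / l * integral {b..b + real n * d} (\<lambda>x. norm (f x) powr p)
      + l powr (p - 1) * integral {b..b + real n * d} (\<lambda>x. norm (f' x) powr p))"
    using l p0 by (intro mult_left_mono add_mono sum_integral_blocks_le continuous_intros cf cf') auto
  also have "\<dots> = 2 powr (p - 1) * (2 * pi) * (Hn p y U powr p / l + l powr (p - 1) * Hn p y (deriv U) powr p)"
    unfolding per by (simp add: algebra_simps)
  finally show ?thesis by (simp add: f_def)
qed

section \<open>The kernel of the Rhaly operator\<close>

lemma disc_series_summable_norm:
  assumes "disc_series c" "0 \<le> r" "r < 1"
  shows "summable (\<lambda>n. norm (c n) * r ^ n)"
proof -
  have "summable (\<lambda>n. c n * of_real ((r + 1) / 2) ^ n)"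
    using assms by (auto simp: disc_series_def norm_divide simp flip: of_real_add)
  from powser_insidea[OF this, of "of_real r"] assms show ?thesis
    by (simp add: norm_mult norm_power abs_if split: if_splits)
qed

lemma disc_seriesI:
  assumes "\<And>r. 0 < r \<Longrightarrow> r < 1 \<Longrightarrow> summable (\<lambda>n. norm (c n) * r ^ n)"
  shows "disc_series c"
  unfolding disc_series_def
proof
  fix z :: complex assume z: "z \<in> ball 0 1"
  define R where "R = (norm z + 1) / 2"
  have R: "0 < R" "R < 1" "norm z \<le> R" using z norm_ge_zero[of z] by (auto simp: R_def simp del: norm_ge_zero)
  have "norm (norm (c n) * norm z ^ n) \<le> norm (c n) * R ^ n" for n
    using R mult_left_mono[OF power_mono[of "norm z" R n], of "norm (c n)"] by simp
  then have "summable (\<lambda>n. norm (c n) * norm z ^ n)"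
    by (rule summable_comparison_test'[OF assms[OF R(1,2)], of 0])
  then show "summable (\<lambda>n. c n * z ^ n)"
    by (intro summable_norm_cancel[of "\<lambda>n. c n * z ^ n"]) (simp add: norm_mult norm_power)
qed

lemma disc_series_le:
  assumes "disc_series c" "\<And>n. norm (d n) \<le> C * norm (c n)"
  shows "disc_series d"
proof (rule disc_seriesI)
  fix r :: real assume r: "0 < r" "r < 1"
  have "summable (\<lambda>n. C * (norm (c n) * r ^ n))"
    using r by (intro summable_mult disc_series_summable_norm assms(1)) auto
  then show "summable (\<lambda>n. norm (d n) * r ^ n)"
  proof (rule summable_comparison_test'[of _ 0])
    show "norm (norm (d n) * r ^ n) \<le> C * (norm (c n) * r ^ n)" for n
      using mult_right_mono[OF assms(2)[of n], of "r ^ n"] r by (simp add: mult.assoc abs_mult)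
  qed
qed

lemma disc_series_mult_nat:
  assumes c: "disc_series c"
  shows "disc_series (\<lambda>n. of_nat n * c n)"
  unfolding disc_series_def
proof
  fix z :: complex assume z: "z \<in> ball 0 1"
  have "summable (\<lambda>n. diffs c n * z ^ n)"
    by (rule termdiff_converges[of z 1]) (use c z in \<open>auto simp: disc_series_def\<close>)
  from diffs_equiv[OF this] have "(\<lambda>n. z * (of_nat n * c n * z ^ (n - Suc 0))) sums (z * (\<Sum>n. diffs c n * z ^ n))"
    by (rule sums_mult)
  moreover have "z * (of_nat n * c n * z ^ (n - Suc 0)) = of_nat n * c n * z ^ n" for n
    by (cases n) auto
  ultimately show "summable (\<lambda>n. of_nat n * c n * z ^ n)" by (auto simp: sums_iff)
qed

lemma disc_series_mult_Suc: "disc_series c \<Longrightarrow> disc_series (\<lambda>n. of_nat (Suc n) * c n)"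
proof -
  assume c: "disc_series c"
  have "summable (\<lambda>n. of_nat n * c n * z ^ n + c n * z ^ n)" if "z \<in> ball 0 1" for z
    using c disc_series_mult_nat[OF c] that by (intro summable_add) (auto simp: disc_series_def)
  then show ?thesis by (simp add: disc_series_def algebra_simps)
qed

lemma disc_fun_sums: "disc_series c \<Longrightarrow> z \<in> ball 0 1 \<Longrightarrow> (\<lambda>n. c n * z ^ n) sums disc_fun c z"
  by (auto simp: disc_series_def disc_fun_def summable_sums)

lemma disc_fun_holomorphic:
  assumes "disc_series c" shows "disc_fun c holomorphic_on ball 0 1"
  by (rule power_series_holomorphic[of 0 1 c]) (use disc_fun_sums[OF assms] in auto)

lemma disc_fun_Hol_disc: "disc_series c \<Longrightarrow> disc_fun c \<in> Hol_disc"
  by (auto simp: Hol_disc_def disc_fun_holomorphic disc_fun_def)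

lemma Hol_disc_taylor:
  assumes "f \<in> Hol_disc"
  shows "disc_series (taylor_coeff f)" "disc_fun (taylor_coeff f) = f"
proof -
  have s: "(\<lambda>n. taylor_coeff f n * z ^ n) sums f z" if "z \<in> ball 0 1" for z
    using holomorphic_power_series[of f 0 1 z] assms that by (simp add: Hol_disc_def taylor_coeff_def)
  then show "disc_series (taylor_coeff f)" by (auto simp: disc_series_def sums_iff)
  show "disc_fun (taylor_coeff f) = f"
    using s assms by (auto simp: disc_fun_def sums_iff Hol_disc_def)
qed

section \<open>The substitution z = e^(iw), Fourier coefficients and Taylor coefficients\<close>

definition lift :: "(complex \<Rightarrow> complex) \<Rightarrow> complex \<Rightarrow> complex" where
  "lift f w = f (exp (\<i> * w))"

lemma exp_i_Complex: "exp (\<i> * Complex x y) = of_real (exp (- y)) * cis x"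
  by (simp add: exp_eq_polar)

lemma per_hol_lift:
  assumes "f holomorphic_on ball 0 1" shows "per_hol (lift f)"
  unfolding per_hol_def
proof (intro conjI ballI)
  show "lift f holomorphic_on uhp"
    unfolding lift_def
    by (rule holomorphic_on_compose_gen[OF _ assms, of "\<lambda>w. exp (\<i> * w)" uhp, unfolded o_def])
       (auto intro!: holomorphic_intros)
  fix w :: complex
  have "exp (\<i> * (w + of_real (2*pi))) = exp (\<i> * w) * exp (2 * of_real pi * \<i>)"
    by (subst exp_add[symmetric]) (simp add: algebra_simps)
  then show "lift f (w + of_real (2*pi)) = lift f w" by (simp add: lift_def)
qed

lemma per_hol_lift_disc_fun: "disc_series c \<Longrightarrow> per_hol (lift (disc_fun c))"
  by (intro per_hol_lift disc_fun_holomorphic)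

lemma per_hol_lift_Hol_disc: "f \<in> Hol_disc \<Longrightarrow> per_hol (lift f)"
  by (intro per_hol_lift) (simp add: Hol_disc_def)

lemma integral_mean_eq_Hn: "integral_mean p (exp (- y)) f = Hn p y (lift f)"
  by (simp add: integral_mean_def Lpn_def lift_def exp_i_Complex)

lemma integral_mean_eq_Hn': "0 < r \<Longrightarrow> integral_mean p r f = Hn p (- ln r) (lift f)"
  using integral_mean_eq_Hn[of p "- ln r" f] by simp

lemma lift_sums:
  assumes "disc_series c" "Im w > 0"
  shows "(\<lambda>n. c n * exp (\<i> * w) ^ n) sums lift (disc_fun c) w"
  unfolding lift_def using assms by (intro disc_fun_sums) auto

text \<open>Each term c e^(inw) is an eigenfunction of differentiation in \<open>w\<close>, so the
  derivative is again the lift of a power series with the same indexing.\<close>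

lemma deriv_lift_disc_fun:
  assumes c: "disc_series c" and w: "Im w > 0"
  shows "deriv (lift (disc_fun c)) w = lift (disc_fun (\<lambda>n. \<i> * of_nat n * c n)) w"
proof (rule DERIV_imp_deriv)
  define z where "z = exp (\<i> * w)"
  have z: "norm z < 1" using w by (simp add: z_def)
  have d: "((\<lambda>z. \<Sum>n. c n * z ^ n) has_field_derivative (\<Sum>n. diffs c n * z ^ n)) (at z)"
    by (rule termdiffs_strong'[of 1]) (use c z in \<open>auto simp: disc_series_def\<close>)
  have "(disc_fun c has_field_derivative (\<Sum>n. diffs c n * z ^ n)) (at z)"
    by (rule has_field_derivative_transform_within_open[OF d open_ball[of 0 1]]) (use z in \<open>auto simp: disc_fun_def\<close>)
  moreover have "((\<lambda>w. exp (\<i> * w)) has_field_derivative \<i> * z) (at w)"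
    by (auto intro!: derivative_eq_intros simp: z_def)
  ultimately have "((\<lambda>w. disc_fun c (exp (\<i> * w))) has_field_derivative (\<Sum>n. diffs c n * z ^ n) * (\<i> * z)) (at w)"
    unfolding z_def by (rule DERIV_chain2)
  moreover have "(\<Sum>n. diffs c n * z ^ n) * (\<i> * z) = lift (disc_fun (\<lambda>n. \<i> * of_nat n * c n)) w"
  proof -
    have "summable (\<lambda>n. diffs c n * z ^ n)"
      by (rule termdiff_converges[of z 1]) (use c z in \<open>auto simp: disc_series_def\<close>)
    from sums_mult[OF diffs_equiv[OF this], of "\<i> * z"]
    have "(\<lambda>n. \<i> * z * (of_nat n * c n * z ^ (n - Suc 0))) sums (\<i> * z * (\<Sum>n. diffs c n * z ^ n))" .
    moreover have "\<i> * z * (of_nat n * c n * z ^ (n - Suc 0)) = \<i> * of_nat n * c n * z ^ n" for n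
      by (cases n) auto
    ultimately have "(\<lambda>n. \<i> * of_nat n * c n * z ^ n) sums (\<i> * z * (\<Sum>n. diffs c n * z ^ n))" by simp
    then show ?thesis using z by (simp add: sums_iff lift_def disc_fun_def z_def[symmetric] mult_ac)
  qed
  ultimately show "(lift (disc_fun c) has_field_derivative lift (disc_fun (\<lambda>n. \<i> * of_nat n * c n)) w) (at w)"
    by (simp add: lift_def[abs_def])
qed

lemma disc_series_i_nat: "disc_series c \<Longrightarrow> disc_series (\<lambda>n. \<i> * of_nat n * c n)"
  by (rule disc_series_le[OF disc_series_mult_nat, of c _ 1]) (auto simp: norm_mult)

lemma integral_sums_uniform:
  fixes g :: "nat \<Rightarrow> real \<Rightarrow> complex"
  assumes c: "\<And>n. continuous_on {a..b} (g n)"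
    and M: "\<And>n x. x \<in> {a..b} \<Longrightarrow> norm (g n x) \<le> M n" and sm: "summable M"
  shows "(\<lambda>n. integral {a..b} (g n)) sums integral {a..b} (\<lambda>x. \<Sum>n. g n x)"
proof -
  have "uniform_limit {a..b} (\<lambda>n x. \<Sum>i<n. g i x) (\<lambda>x. \<Sum>i. g i x) sequentially"
    using M sm by (intro Weierstrass_m_test) auto
  then obtain I J where I: "\<And>n. ((\<lambda>x. \<Sum>i<n. g i x) has_integral I n) {a..b}"
    and J: "((\<lambda>x. \<Sum>i. g i x) has_integral J) {a..b}" and IJ: "I \<longlonglongrightarrow> J"
    by (rule uniform_limit_integral) (use c in \<open>auto intro!: continuous_on_sum\<close>)
  have "I n = (\<Sum>i<n. integral {a..b} (g i))" for n
    using integral_unique[OF I[of n]] c by (subst (asm) integral_sum) (auto intro!: integrable_continuous_interval)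
  then have "I = (\<lambda>n. \<Sum>i<n. integral {a..b} (g i))" by blast
  with IJ J show ?thesis by (simp add: sums_def integral_unique)
qed

lemma integral_cis_of_int: 
  "integral {a..a + 2*pi} (\<lambda>t. cis (of_int k * t)) = (if k = 0 then of_real (2 * pi) else 0)"
proof (cases "k = 0")
  case True
  then show ?thesis by (simp add: scaleR_conv_of_real)
next
  case False
  have "((\<lambda>t. cis (of_int k * t)) has_integral
      cis (of_int k * (a + 2*pi)) / (\<i> * of_int k) - cis (of_int k * a) / (\<i> * of_int k)) {a..a+2*pi}"
  proof (rule fundamental_theorem_of_calculus)
    fix t
    have "((\<lambda>t. exp (\<i> * of_int k * of_real t) / (\<i> * of_int k)) has_vector_derivative exp (\<i> * of_int k * of_real t)) (at t within {a..a + 2*pi})"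
      using False
      by (auto intro!: derivative_eq_intros has_vector_derivative_real_field)
    then show "((\<lambda>t. cis (of_int k * t) / (\<i> * of_int k)) has_vector_derivative cis (of_int k * t)) (at t within {a..a + 2*pi})"
      by (simp add: cis_conv_exp mult_ac)
  qed auto
  moreover have "cis (of_int k * (a + 2*pi)) = cis (of_int k * a)"
    using cis_multiple_2pi[of "of_int k"] by (simp add: distrib_left mult_ac flip: cis_mult)
  ultimately show ?thesis using False by (simp add: integral_unique)
qed

text \<open>Termwise integration and orthogonality of the exponentials. The starting point
  \<open>a\<close> is free because both \<open>{0..2*pi}\<close> and \<open>{-pi..pi}\<close> occur
  as period intervals.\<close>

lemma disc_fun_coeff_integral:
  assumes c: "disc_series c" and r: "0 \<le> r" "r < 1"
  shows "integral {a..a + 2*pi} (\<lambda>t. disc_fun c (of_real r * cis t) * cis (- (of_nat k * t))) = of_real (2 * pi) * c k * of_real r ^ k"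
proof -
  define g where "g = (\<lambda>n t. c n * of_real r ^ n * cis (of_int (int n - int k) * t))"
  have eq: "disc_fun c (of_real r * cis t) * cis (- (of_nat k * t)) = (\<Sum>n. g n t)" for t
  proof -
    have "(\<lambda>n. c n * (of_real r * cis t) ^ n * cis (- (of_nat k * t))) sums (disc_fun c (of_real r * cis t) * cis (- (of_nat k * t)))"
      using c r by (intro sums_mult2 disc_fun_sums) (auto simp: norm_mult)
    moreover have "c n * (of_real r * cis t) ^ n * cis (- (of_nat k * t)) = g n t" for n
    proof -
      have "cis t ^ n * cis (- (real k * t)) = cis (of_int (int n - int k) * t)"
        unfolding Complex.DeMoivre cis_mult by (simp add: left_diff_distrib)
      then show ?thesis by (simp add: g_def power_mult_distrib mult.assoc)
    qed
    ultimately show ?thesis by (simp add: sums_iff)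
  qed
  have "(\<lambda>n. integral {a..a + 2*pi} (g n)) sums integral {a..a + 2*pi} (\<lambda>x. \<Sum>n. g n x)"
  proof (rule integral_sums_uniform[of _ _ _ "\<lambda>n. norm (c n) * r ^ n"])
    show "continuous_on {a..a + 2*pi} (g n)" for n unfolding g_def by (intro continuous_intros)
    show "norm (g n x) \<le> norm (c n) * r ^ n" for n x using r by (simp add: g_def norm_mult norm_power)
  qed (use c r in \<open>auto intro: disc_series_summable_norm\<close>)
  moreover have "integral {a..a + 2*pi} (g n) = (if n = k then of_real (2 * pi) * c k * of_real r ^ k else 0)" for n
    unfolding g_def using integral_cis_of_int[of a "int n - int k"] by simp
  ultimately have "(\<lambda>n. if n = k then of_real (2 * pi) * c k * of_real r ^ k else 0) sums integral {a..a + 2*pi} (\<lambda>x. \<Sum>n. g n x)"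
    by simp
  moreover have "(\<lambda>n. if n = k then of_real (2 * pi) * c k * of_real r ^ k else 0) sums (of_real (2 * pi) * c k * of_real r ^ k)"
    by (rule sums_single)
  ultimately show ?thesis by (simp add: eq sums_unique2)
qed

text \<open>The given series and the Taylor series represent the same function, so their Fourier
  coefficients on the circle of radius 1/2 coincide.\<close>

lemma taylor_coeff_disc_fun:
  assumes "disc_series c" shows "taylor_coeff (disc_fun c) = c"
proof
  fix k
  note H = Hol_disc_taylor[OF disc_fun_Hol_disc[OF assms]]
  from disc_fun_coeff_integral[OF assms, of "1/2" 0 k] disc_fun_coeff_integral[OF H(1), of "1/2" 0 k]
  show "taylor_coeff (disc_fun c) k = c k" by (simp add: H(2))
qed

text \<open>Partial sums of the Taylor series of \<open>f\<close> are integrals of the boundary values against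
  \<open>\<Sum>\<^sub>k\<^sub>\<le>\<^sub>n e\<^sup>-\<^sup>i\<^sup>k\<^sup>\<theta>\<close>. Hence \<open>kern c w\<close> with \<open>c\<^sub>n = i n \<eta>\<^sub>n\<close> is the kernel of the derivative of the Rhaly
  operator, and summing the geometric progression expresses it through \<open>F'(z) - e\<^sup>-\<^sup>i\<^sup>\<theta> F'(z e\<^sup>-\<^sup>i\<^sup>\<theta>)\<close>.\<close>

definition geo :: "nat \<Rightarrow> real \<Rightarrow> complex" where
  "geo n \<theta> = (\<Sum>k\<le>n. cis (- (of_nat k * \<theta>)))"

definition kern :: "(nat \<Rightarrow> complex) \<Rightarrow> complex \<Rightarrow> real \<Rightarrow> complex" where
  "kern c w \<theta> = (\<Sum>n. c n * geo n \<theta> * exp (\<i> * w) ^ n)"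

section \<open>Continuity, integral representation and closed form of the kernel\<close>

lemma norm_geo_le: "norm (geo n \<theta>) \<le> of_nat (Suc n)"
  unfolding geo_def by (rule order_trans[OF norm_sum]) simp

lemma continuous_on_geo [continuous_intros]: "continuous_on S f \<Longrightarrow> continuous_on S (\<lambda>x. geo n (f x))"
  unfolding geo_def by (intro continuous_intros)

lemma geo_closed: "(1 - cis (- \<theta>)) * geo n \<theta> = 1 - cis (- \<theta>) ^ Suc n"
proof -
  have "geo n \<theta> = (\<Sum>k<Suc n. cis (- \<theta>) ^ k)"
    unfolding geo_def lessThan_Suc_atMost by (intro sum.cong) (simp_all add: Complex.DeMoivre)
  then show ?thesis by (simp only: one_diff_power_eq)
qed

lemma disc_series_geo:
  assumes "disc_series c" shows "disc_series (\<lambda>n. c n * geo n \<theta>)"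
proof (rule disc_series_le[OF disc_series_mult_Suc[OF assms], of _ 1])
  fix n
  have "norm (c n) * norm (geo n \<theta>) \<le> norm (c n) * of_nat (Suc n)"
    by (intro mult_left_mono norm_geo_le) auto
  then show "norm (c n * geo n \<theta>) \<le> 1 * norm (of_nat (Suc n) * c n)"
    by (simp add: norm_mult mult.commute del: of_nat_Suc)
qed

lemma norm_kern_term_le:
  "norm (c n * geo n \<theta> * exp (\<i> * w) ^ n) \<le> norm (of_nat (Suc n) * c n) * exp (- Im w) ^ n"
proof -
  have "norm (c n) * norm (geo n \<theta>) * exp (- Im w) ^ n \<le> norm (c n) * of_nat (Suc n) * exp (- Im w) ^ n"
    by (intro mult_right_mono mult_left_mono norm_geo_le) auto
  then show ?thesis by (simp add: norm_mult norm_power mult_ac del: of_nat_Suc)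
qed

lemma continuous_on_kern:
  assumes c: "disc_series c" and y: "y > 0"
  shows "continuous_on S (\<lambda>(\<theta>, x). kern c (Complex x y) \<theta>)"
proof -
  have "uniform_limit S (\<lambda>n z. \<Sum>i<n. c i * geo i (fst z) * exp (\<i> * Complex (snd z) y) ^ i)
     (\<lambda>z. \<Sum>i. c i * geo i (fst z) * exp (\<i> * Complex (snd z) y) ^ i) sequentially"
  proof (rule Weierstrass_m_test)
    show "norm (c n * geo n (fst z) * exp (\<i> * Complex (snd z) y) ^ n) \<le> norm (of_nat (Suc n) * c n) * exp (- y) ^ n" for n and z :: "real \<times> real"
      using norm_kern_term_le[of c n "fst z" "Complex (snd z) y"] by (simp del: of_nat_Suc)
    show "summable (\<lambda>n. norm (of_nat (Suc n) * c n) * exp (- y) ^ n)"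
      using y by (intro disc_series_summable_norm disc_series_mult_Suc c) auto
  qed
  then have "continuous_on S (\<lambda>z. \<Sum>i. c i * geo i (fst z) * exp (\<i> * Complex (snd z) y) ^ i)"
    by (rule uniform_limit_theorem[rotated]) (auto intro!: always_eventually continuous_intros)
  then show ?thesis by (simp add: kern_def case_prod_unfold)
qed

text \<open>Integrating over the circle of radius \<open>r\<close> inside the disc puts the factors
  r^k into the partial sums and leaves the kernel, which depends only on the symbol, untouched. No
  boundary values of the function are needed.\<close>

lemma integral_kern:
  assumes c: "disc_series c" and a: "disc_series a" and r: "0 \<le> r" "r < 1" and w: "Im w > 0"
  shows "integral {-pi..pi} (\<lambda>\<theta>. disc_fun a (of_real r * cis \<theta>) * kern c w \<theta>)
    = of_real (2 * pi) * lift (disc_fun (\<lambda>n. c n * (\<Sum>k\<le>n. a k * of_real r ^ k))) w"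
    and "disc_series (\<lambda>n. c n * (\<Sum>k\<le>n. a k * of_real r ^ k))"
proof -
  let ?f = "\<lambda>\<theta>. disc_fun a (of_real r * cis \<theta>)"
  have cf: "continuous_on {-pi..pi} ?f"
    by (rule continuous_on_compose2[OF holomorphic_on_imp_continuous_on[OF disc_fun_holomorphic[OF a]]])
       (use r in \<open>auto intro!: continuous_intros simp: norm_mult\<close>)
  have "bounded (?f ` {-pi..pi})"
    by (intro compact_imp_bounded compact_continuous_image cf compact_Icc)
  then obtain B where B: "\<And>\<theta>. \<theta> \<in> {-pi..pi} \<Longrightarrow> norm (?f \<theta>) \<le> B"
    unfolding bounded_iff by blast
  have B0: "B \<ge> 0" using order_trans[OF norm_ge_zero B[of 0]] by simp
  define g where "g = (\<lambda>n \<theta>. ?f \<theta> * (c n * geo n \<theta> * exp (\<i> * w) ^ n))"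
  have sm: "summable (\<lambda>n. c n * geo n \<theta> * exp (\<i> * w) ^ n)" for \<theta>
    using disc_series_geo[OF c] w by (auto simp: disc_series_def)
  have "(\<lambda>n. integral {-pi..pi} (g n)) sums integral {-pi..pi} (\<lambda>x. \<Sum>n. g n x)"
  proof (rule integral_sums_uniform[of _ _ _ "\<lambda>n. B * (norm (of_nat (Suc n) * c n) * exp (- Im w) ^ n)"])
    show "continuous_on {-pi..pi} (g n)" for n unfolding g_def by (intro continuous_intros cf)
    show "norm (g n x) \<le> B * (norm (of_nat (Suc n) * c n) * exp (- Im w) ^ n)" if "x \<in> {-pi..pi}" for n x
      unfolding g_def norm_mult[of "?f x"] using B[OF that] B0 by (intro mult_mono norm_kern_term_le) auto
    show "summable (\<lambda>n. B * (norm (of_nat (Suc n) * c n) * exp (- Im w) ^ n))"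
      using w by (intro summable_mult disc_series_summable_norm disc_series_mult_Suc c) auto
  qed
  also have "(\<lambda>x. \<Sum>n. g n x) = (\<lambda>\<theta>. ?f \<theta> * kern c w \<theta>)"
    unfolding g_def kern_def using suminf_mult[OF sm] by (simp add: fun_eq_iff)
  finally have s1: "(\<lambda>n. integral {-pi..pi} (g n)) sums integral {-pi..pi} (\<lambda>\<theta>. ?f \<theta> * kern c w \<theta>)" .
  have I: "integral {-pi..pi} (\<lambda>\<theta>. ?f \<theta> * geo n \<theta>) = of_real (2 * pi) * (\<Sum>k\<le>n. a k * of_real r ^ k)" for n
  proof -
    have "integral {-pi..pi} (\<lambda>\<theta>. ?f \<theta> * geo n \<theta>) = integral {-pi..pi} (\<lambda>\<theta>. \<Sum>k\<le>n. ?f \<theta> * cis (- (of_nat k * \<theta>)))"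
      by (simp add: geo_def sum_distrib_left)
    also have "\<dots> = (\<Sum>k\<le>n. integral {-pi..pi} (\<lambda>\<theta>. ?f \<theta> * cis (- (of_nat k * \<theta>))))"
      by (intro integral_sum integrable_continuous_interval continuous_intros cf) auto
    also have "\<dots> = (\<Sum>k\<le>n. of_real (2 * pi) * a k * of_real r ^ k)"
      using disc_fun_coeff_integral[OF a r, of "-pi"] by simp
    finally show ?thesis by (simp add: sum_distrib_left mult.assoc)
  qed
  have "integral {-pi..pi} (g n) = of_real (2 * pi) * (c n * (\<Sum>k\<le>n. a k * of_real r ^ k) * exp (\<i> * w) ^ n)" for n
  proof -
    have "g n = (\<lambda>\<theta>. (?f \<theta> * geo n \<theta>) * (c n * exp (\<i> * w) ^ n))" by (simp add: g_def fun_eq_iff mult_ac)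
    then have "integral {-pi..pi} (g n) = integral {-pi..pi} (\<lambda>\<theta>. ?f \<theta> * geo n \<theta>) * (c n * exp (\<i> * w) ^ n)"
      by (simp only: integral_mult_left)
    then show ?thesis unfolding I by (simp only: mult_ac)
  qed
  with s1 have s2: "(\<lambda>n. of_real (2 * pi) * (c n * (\<Sum>k\<le>n. a k * of_real r ^ k) * exp (\<i> * w) ^ n)) sums integral {-pi..pi} (\<lambda>\<theta>. ?f \<theta> * kern c w \<theta>)"
    by simp
  show d: "disc_series (\<lambda>n. c n * (\<Sum>k\<le>n. a k * of_real r ^ k))"
  proof (rule disc_series_le[OF disc_series_mult_Suc[OF c], of _ "\<Sum>k. norm (a k) * r ^ k"])
    fix n
    have "norm (\<Sum>k\<le>n. a k * of_real r ^ k) \<le> (\<Sum>k\<le>n. norm (a k) * r ^ k)"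
      using r by (intro order_trans[OF norm_sum]) (simp add: norm_mult norm_power)
    also have "\<dots> \<le> (\<Sum>k. norm (a k) * r ^ k)"
      using r by (intro sum_le_suminf disc_series_summable_norm a) auto
    finally have 1: "norm (\<Sum>k\<le>n. a k * of_real r ^ k) \<le> (\<Sum>k. norm (a k) * r ^ k)" .
    then have 2: "(\<Sum>k. norm (a k) * r ^ k) \<ge> 0" using norm_ge_zero order_trans by blast
    have "norm (c n) * 1 \<le> norm (c n) * real (Suc n)" by (intro mult_left_mono) auto
    with 1 2 have "norm (c n) * norm (\<Sum>k\<le>n. a k * of_real r ^ k) \<le> (norm (c n) * real (Suc n)) * (\<Sum>k. norm (a k) * r ^ k)"
      by (intro mult_mono) auto
    then show "norm (c n * (\<Sum>k\<le>n. a k * of_real r ^ k)) \<le> (\<Sum>k. norm (a k) * r ^ k) * norm (of_nat (Suc n) * c n)"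
      by (simp add: norm_mult mult_ac del: of_nat_Suc)
  qed
  have "(\<lambda>n. of_real (2 * pi) * (c n * (\<Sum>k\<le>n. a k * of_real r ^ k) * exp (\<i> * w) ^ n)) sums
     (of_real (2 * pi) * lift (disc_fun (\<lambda>n. c n * (\<Sum>k\<le>n. a k * of_real r ^ k))) w)"
    by (intro sums_mult lift_sums d w)
  with s2 show "integral {-pi..pi} (\<lambda>\<theta>. ?f \<theta> * kern c w \<theta>) = of_real (2 * pi) * lift (disc_fun (\<lambda>n. c n * (\<Sum>k\<le>n. a k * of_real r ^ k))) w"
    by (rule sums_unique2)
qed

text \<open>The factor turns the geometric sum into 1 - e^(-i(n+1)\<theta>), and multiplying z^n by
  e^(-in\<theta>) is the translation of \<open>w\<close> by \<open>- \<theta>\<close>. What remains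
  is an increment of the lifted function.\<close>

lemma kern_mult:
  assumes c: "disc_series c" and w: "Im w > 0"
  shows "(1 - cis (- \<theta>)) * kern c w \<theta> = lift (disc_fun c) w - cis (- \<theta>) * lift (disc_fun c) (w - of_real \<theta>)"
proof -
  have "(\<lambda>n. (1 - cis (- \<theta>)) * (c n * geo n \<theta> * exp (\<i> * w) ^ n)) sums ((1 - cis (- \<theta>)) * kern c w \<theta>)"
    unfolding kern_def using disc_series_geo[OF c] w by (intro sums_mult summable_sums) (auto simp: disc_series_def)
  moreover have "(1 - cis (- \<theta>)) * (c n * geo n \<theta> * exp (\<i> * w) ^ n) =
      c n * exp (\<i> * w) ^ n - cis (- \<theta>) * (c n * exp (\<i> * (w - of_real \<theta>)) ^ n)" for n
  proof -
    have e: "exp (\<i> * (w - of_real \<theta>)) = cis (- \<theta>) * exp (\<i> * w)"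
      by (simp add: cis_conv_exp exp_add[symmetric] algebra_simps)
    have "(1 - cis (- \<theta>)) * (c n * geo n \<theta> * exp (\<i> * w) ^ n) = c n * ((1 - cis (- \<theta>)) * geo n \<theta>) * exp (\<i> * w) ^ n"
      by (simp only: mult_ac)
    also have "\<dots> = c n * exp (\<i> * w) ^ n - cis (- \<theta>) * (c n * exp (\<i> * (w - of_real \<theta>)) ^ n)"
      unfolding geo_closed e by (simp add: power_mult_distrib algebra_simps)
    finally show ?thesis .
  qed
  ultimately have "(\<lambda>n. c n * exp (\<i> * w) ^ n - cis (- \<theta>) * (c n * exp (\<i> * (w - of_real \<theta>)) ^ n)) sums ((1 - cis (- \<theta>)) * kern c w \<theta>)"
    by simp
  moreover have "(\<lambda>n. c n * exp (\<i> * w) ^ n - cis (- \<theta>) * (c n * exp (\<i> * (w - of_real \<theta>)) ^ n)) sums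
     (lift (disc_fun c) w - cis (- \<theta>) * lift (disc_fun c) (w - of_real \<theta>))"
    using c w by (intro sums_diff sums_mult lift_sums) auto
  ultimately show ?thesis by (rule sums_unique2)
qed

text \<open>At \<theta> = 0 the identity \<open>kern_mult\<close> reads 0 = 0. There
  \<open>geo n 0\<close> is n + 1, and the factor n is recovered from the derivative.\<close>

lemma kern_0:
  assumes c: "disc_series c" and w: "Im w > 0"
  shows "kern c w 0 = lift (disc_fun c) w - \<i> * deriv (lift (disc_fun c)) w"
proof -
  have "(\<lambda>n. c n * exp (\<i> * w) ^ n - \<i> * ((\<i> * of_nat n * c n) * exp (\<i> * w) ^ n)) sums
    (lift (disc_fun c) w - \<i> * lift (disc_fun (\<lambda>n. \<i> * of_nat n * c n)) w)"
    using c w by (intro sums_diff sums_mult lift_sums disc_series_i_nat)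
  moreover have "c n * exp (\<i> * w) ^ n - \<i> * ((\<i> * of_nat n * c n) * exp (\<i> * w) ^ n) = c n * geo n 0 * exp (\<i> * w) ^ n" for n
  proof -
    have "\<i> * ((\<i> * of_nat n * c n) * exp (\<i> * w) ^ n) = (\<i> * \<i>) * (of_nat n * c n * exp (\<i> * w) ^ n)"
      by (simp only: mult_ac)
    then show ?thesis by (simp add: geo_def distrib_left distrib_right mult_ac)
  qed
  ultimately show ?thesis unfolding kern_def using deriv_lift_disc_fun[OF c w] by (simp add: sums_iff)
qed

text \<open>Jordan's inequality: the concave sine lies above its chord.\<close>

lemma sin_ge_linear:
  assumes "0 \<le> x" "x \<le> pi / 2" shows "2 * x / pi \<le> sin x"
proof -
  have "concave_on {0..pi/2} sin"
    by (rule f''_le0_imp_concave[where f' = cos and f'' = "\<lambda>x. - sin x"])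
       (auto intro!: derivative_eq_intros sin_ge_zero)
  from concave_onD[OF this, of "2 * x / pi" 0 "pi / 2"] assms show ?thesis
    by (simp add: field_simps)
qed

lemma norm_one_minus_cis_ge:
  assumes "\<bar>\<theta>\<bar> \<le> pi" shows "norm (1 - cis (- \<theta>)) \<ge> 2 * \<bar>\<theta>\<bar> / pi"
proof -
  have "norm (1 - cis (- \<theta>)) = 2 * \<bar>sin (\<theta> / 2)\<bar>"
    using dist_exp_i_1[of "- \<theta>"] by (simp add: cis_conv_exp norm_minus_commute)
  moreover have "\<bar>sin (\<theta> / 2)\<bar> = sin (\<bar>\<theta>\<bar> / 2)"
  proof -
    have "sin (\<bar>\<theta>\<bar> / 2) \<ge> 0" using assms by (intro sin_ge_zero) auto
    moreover have "sin (\<bar>\<theta>\<bar> / 2) = sin (\<theta> / 2) \<or> sin (\<bar>\<theta>\<bar> / 2) = - sin (\<theta> / 2)"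
      by (cases "\<theta> \<ge> 0") simp_all
    ultimately show ?thesis by linarith
  qed
  moreover have "2 * (\<bar>\<theta>\<bar> / 2) / pi \<le> sin (\<bar>\<theta>\<bar> / 2)"
    using assms by (intro sin_ge_linear) auto
  ultimately show ?thesis by simp
qed

section \<open>A Schur test\<close>

text \<open>A smooth substitute for the minimum of t^\<delta> and t^(-\<delta>). Up to the factor
  \<delta> it is t times the derivative of t^\<delta> / (1 + t^\<delta>), so its integral against
  dt/t is explicit and its dyadic sums telescope.\<close>

definition rho :: "real \<Rightarrow> real \<Rightarrow> real" where
  "rho \<delta> t = t powr \<delta> / (1 + t powr \<delta>)\<^sup>2"

text \<open>The Schur kernel relating the scale \<open>h\<close> to the distance \<open>x\<close>;
  \<open>rho\<close> supplies the decay away from x = h.\<close>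

definition kap :: "real \<Rightarrow> real \<Rightarrow> real \<Rightarrow> real \<Rightarrow> real" where
  "kap p \<delta> h x = x powr (1 / p - 1) * h powr (- 1 / p) * rho \<delta> (x / h)"

lemma one_plus_powr_pos: "1 + (t::real) powr \<delta> > 0"
  by (intro add_pos_nonneg) auto

lemma rho_pos: "t > 0 \<Longrightarrow> rho \<delta> t > 0"
  unfolding rho_def using one_plus_powr_pos[of t \<delta>]
  by (intro divide_pos_pos zero_less_power) auto

lemma rho_nonneg [simp]: "rho \<delta> t \<ge> 0"
  by (simp add: rho_def)

lemma kap_pos: "x > 0 \<Longrightarrow> h > 0 \<Longrightarrow> kap p \<delta> h x > 0"
  by (simp add: kap_def rho_pos)

lemma continuous_on_rho [continuous_intros]:
  assumes "continuous_on S f" "\<And>x. x \<in> S \<Longrightarrow> f x > 0"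
  shows "continuous_on S (\<lambda>x. rho \<delta> (f x))"
proof -
  have "f x \<noteq> 0" "1 + f x powr \<delta> \<noteq> 0" if "x \<in> S" for x
    using assms(2)[OF that] one_plus_powr_pos[of "f x" \<delta>] by auto
  then show ?thesis unfolding rho_def using assms(1)
    by (intro continuous_on_divide continuous_on_power continuous_on_add continuous_on_const continuous_on_powr) auto
qed

lemma continuous_on_kap [continuous_intros]:
  assumes "continuous_on S f" "\<And>x. x \<in> S \<Longrightarrow> f x > 0" "h > 0"
  shows "continuous_on S (\<lambda>x. kap p \<delta> h (f x))"
proof -
  have "f x \<noteq> 0" if "x \<in> S" for x using assms(2)[OF that] by auto
  then show ?thesis unfolding kap_def using assms
    by (intro continuous_on_mult continuous_on_rho continuous_on_divide continuous_on_const continuous_on_powr) auto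
qed

text \<open>With a = t^\<delta> and b = 2^\<delta> the increment of a / (1 + a) under doubling of t
  is (b - 1) a / ((1 + b a)(1 + a)), and 1 / (1 + a) is at most b / (1 + b a) since b > 1.\<close>

lemma rho_le_telescope:
  assumes d: "\<delta> > 0" and t: "t > 0"
  shows "rho \<delta> t \<le> 2 powr \<delta> / (2 powr \<delta> - 1) * ((2 * t) powr \<delta> / (1 + (2 * t) powr \<delta>) - t powr \<delta> / (1 + t powr \<delta>))"
proof -
  define a b where "a = t powr \<delta>" and "b = (2::real) powr \<delta>"
  have ab: "a > 0" "b > 1" using t d by (auto simp: a_def b_def)
  have abp: "0 < 1 + b * a" "0 < 1 + a" using ab by (auto intro!: add_pos_pos)
  have e: "(2 * t) powr \<delta> = b * a" using t by (simp add: a_def b_def powr_mult)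
  have "b * a / (1 + b * a) - a / (1 + a) = (b - 1) * a / ((1 + b * a) * (1 + a))"
    using abp by (simp add: field_simps)
  moreover have ba: "b - 1 \<noteq> 0" using ab by simp
  moreover have "a / (1 + a)\<^sup>2 \<le> b / (b - 1) * ((b - 1) * a / ((1 + b * a) * (1 + a)))"
  proof -
    have "b / (b - 1) * ((b - 1) * a / ((1 + b * a) * (1 + a))) = (b / (1 + b * a)) * (a / (1 + a))"
    proof -
      have "b / (b - 1) * ((b - 1) * a / X) = b * a / X" for X using ab by (simp add: divide_simps)
      then show ?thesis by simp
    qed
    moreover have "1 / (1 + a) \<le> b / (1 + b * a)"
      using ab abp by (simp add: divide_simps algebra_simps)
    then have "1 / (1 + a) * (a / (1 + a)) \<le> b / (1 + b * a) * (a / (1 + a))"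
      using ab by (intro mult_right_mono) auto
    ultimately show ?thesis by (simp only: power2_eq_square times_divide_times_eq mult_1)
  qed
  ultimately show ?thesis unfolding rho_def e by (simp only: a_def[symmetric] b_def[symmetric])
qed

lemma sum_rho_le:
  assumes d: "\<delta> > 0" and t: "t > 0"
  shows "(\<Sum>k<N. rho \<delta> (2 ^ k * t)) \<le> 2 powr \<delta> / (2 powr \<delta> - 1)"
proof -
  define G where "G = (\<lambda>t::real. t powr \<delta> / (1 + t powr \<delta>))"
  have b: "(2::real) powr \<delta> > 1" using d by simp
  have "(\<Sum>k<N. rho \<delta> (2 ^ k * t)) \<le> (\<Sum>k<N. 2 powr \<delta> / (2 powr \<delta> - 1) * (G (2 ^ Suc k * t) - G (2 ^ k * t)))"
    using rho_le_telescope[OF d, of "2 ^ k * t" for k] t by (intro sum_mono) (simp add: G_def mult.assoc)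
  also have "\<dots> = 2 powr \<delta> / (2 powr \<delta> - 1) * (G (2 ^ N * t) - G (2 ^ 0 * t))"
    unfolding sum_distrib_left[symmetric] using sum_lessThan_telescope[of "\<lambda>k. G (2 ^ k * t)" N] by simp
  also have "\<dots> \<le> 2 powr \<delta> / (2 powr \<delta> - 1) * (1 - 0)"
  proof (intro mult_left_mono diff_mono)
    show "G (2 ^ N * t) \<le> 1" unfolding G_def using one_plus_powr_pos[of "2 ^ N * t" \<delta>] by simp
    show "0 \<le> G (2 ^ 0 * t)" unfolding G_def using one_plus_powr_pos[of t \<delta>] by simp
  qed (use b in auto)
  finally show ?thesis by simp
qed

lemma rho_antiderivative:
  assumes d: "\<delta> > 0" and h: "h > 0" and x: "x > 0"
  shows "((\<lambda>x. - (1 / \<delta>) / (1 + (x / h) powr \<delta>)) has_real_derivative rho \<delta> (x / h) / x) (at x)"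
proof -
  have "((\<lambda>x. - (1 / \<delta>) / (1 + (x / h) powr \<delta>)) has_real_derivative
      (1 / \<delta>) * (\<delta> * (x / h) powr (\<delta> - 1) * (1 / h)) / (1 + (x / h) powr \<delta>)\<^sup>2) (at x)"
    using assms one_plus_powr_pos[of "x / h" \<delta>]
    by (auto intro!: derivative_eq_intros simp: power2_eq_square)
  moreover have "(1 / \<delta>) * (\<delta> * (x / h) powr (\<delta> - 1) * (1 / h)) / (1 + (x / h) powr \<delta>)\<^sup>2 = rho \<delta> (x / h) / x"
    using assms by (simp add: rho_def powr_diff)
  ultimately show ?thesis by simp
qed

text \<open>The antiderivative takes values between -1/\<delta> and 0, so each half of the interval
  contributes at most 1/\<delta>, whatever \<open>h\<close> and \<open>\<eta>\<close> are.\<close>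

lemma integral_rho_le:
  assumes d: "\<delta> > 0" and h: "h > 0" and e: "\<eta> > 0"
  shows "integral {-pi..pi} (\<lambda>\<theta>. rho \<delta> ((\<eta> + \<bar>\<theta>\<bar>) / h) / (\<eta> + \<bar>\<theta>\<bar>)) \<le> 2 / \<delta>"
proof -
  let ?f = "\<lambda>\<theta>. rho \<delta> ((\<eta> + \<bar>\<theta>\<bar>) / h) / (\<eta> + \<bar>\<theta>\<bar>)"
  define G where "G = (\<lambda>x. - (1 / \<delta>) / (1 + (x / h) powr \<delta>))"
  have G: "- (1 / \<delta>) \<le> G x" "G x \<le> 0" for x
    using d one_plus_powr_pos[of "x / h" \<delta>] by (auto simp: G_def divide_simps)
  have dG: "(G has_real_derivative rho \<delta> (x / h) / x) (at x)" if "x > 0" for x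
    unfolding G_def using rho_antiderivative[OF d h that] .
  have "((\<lambda>\<theta>. ?f \<theta>) has_integral G (\<eta> + pi) - G (\<eta> + 0)) {0..pi}"
  proof (rule fundamental_theorem_of_calculus)
    fix \<theta> :: real assume t: "\<theta> \<in> {0..pi}"
    have "((\<lambda>\<theta>. G (\<eta> + \<theta>)) has_real_derivative rho \<delta> ((\<eta> + \<theta>) / h) / (\<eta> + \<theta>) * 1) (at \<theta> within {0..pi})"
      using t e by (intro DERIV_chain2[OF dG]) (auto intro!: derivative_eq_intros add_pos_nonneg)
    then show "((\<lambda>\<theta>. G (\<eta> + \<theta>)) has_vector_derivative ?f \<theta>) (at \<theta> within {0..pi})"
      using t by (simp add: has_real_derivative_iff_has_vector_derivative)
  qed auto
  moreover have "((\<lambda>\<theta>. ?f \<theta>) has_integral (- G (\<eta> - 0)) - (- G (\<eta> - (- pi)))) {-pi..0}"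
  proof (rule fundamental_theorem_of_calculus)
    fix \<theta> :: real assume t: "\<theta> \<in> {-pi..0}"
    have "((\<lambda>\<theta>. - G (\<eta> - \<theta>)) has_real_derivative - (rho \<delta> ((\<eta> - \<theta>) / h) / (\<eta> - \<theta>) * (- 1))) (at \<theta> within {-pi..0})"
      using t e by (intro DERIV_minus DERIV_chain2[OF dG]) (auto intro!: derivative_eq_intros)
    then show "((\<lambda>\<theta>. - G (\<eta> - \<theta>)) has_vector_derivative ?f \<theta>) (at \<theta> within {-pi..0})"
      using t by (simp add: has_real_derivative_iff_has_vector_derivative)
  qed auto
  ultimately have "((\<lambda>\<theta>. ?f \<theta>) has_integral ((- G (\<eta> - 0)) - (- G (\<eta> - (- pi)))) + (G (\<eta> + pi) - G (\<eta> + 0))) {-pi..pi}"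
    by (intro has_integral_combine[of "-pi" 0 pi]) auto
  then have "integral {-pi..pi} ?f = ((- G (\<eta> - 0)) - (- G (\<eta> - (- pi)))) + (G (\<eta> + pi) - G (\<eta> + 0))"
    by (rule integral_unique)
  moreover have "2 / \<delta> = 1 / \<delta> + 1 / \<delta>" by simp
  ultimately show ?thesis using G[of \<eta>] G[of "\<eta> + pi"] by simp
qed

text \<open>A Stieltjes-type transform. Up to a power of the height, 1 / (v + |\<theta>|) is the
  size in L^q of the kernel of the derivative at height \<open>v\<close>.\<close>

definition Aop :: "(real \<Rightarrow> real) \<Rightarrow> real \<Rightarrow> real" where
  "Aop \<phi> v = integral {-pi..pi} (\<lambda>\<theta>. \<phi> \<theta> / (v + \<bar>\<theta>\<bar>))"

text \<open>The common majorant at scale \<open>h\<close> of all quantities derived from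
  \<open>Aop\<close>. The offset \<open>\<eta>\<close> is the height of the line on which the image
  is measured, and it keeps the distance positive.\<close>

definition Sop :: "real \<Rightarrow> real \<Rightarrow> real \<Rightarrow> (real \<Rightarrow> real) \<Rightarrow> real \<Rightarrow> real" where
  "Sop p \<delta> \<eta> \<phi> h = integral {-pi..pi} (\<lambda>\<theta>. \<phi> \<theta> * kap p \<delta> h (\<eta> + \<bar>\<theta>\<bar>))"

text \<open>The kernel is homogeneous of degree \<open>-1\<close>, so the Schur test with weight \<open>x\<^sup>-\<^sup>1\<^sup>/\<^sup>p\<close> applies.\<close>

lemma sum_Sop_le:
  assumes p: "p > 1" and d: "\<delta> > 0" and e: "\<eta> > 0"
    and c: "continuous_on {-pi..pi} \<phi>" and nn: "\<And>\<theta>. \<phi> \<theta> \<ge> 0"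
  shows "(\<Sum>k<N. 2 * pi / 2 ^ k * Sop p \<delta> \<eta> \<phi> (2 * pi / 2 ^ k) powr p)
     \<le> (2 / \<delta>) powr (p - 1) * (2 powr \<delta> / (2 powr \<delta> - 1)) * integral {-pi..pi} (\<lambda>\<theta>. \<phi> \<theta> powr p)"
proof -
  define x where "x = (\<lambda>\<theta>::real. \<eta> + \<bar>\<theta>\<bar>)"
  have x: "x \<theta> > 0" for \<theta> using e by (simp add: x_def add_pos_nonneg)
  have xne: "x \<theta> \<noteq> 0" for \<theta> using x[of \<theta>] by simp
  have cx: "continuous_on S x" for S unfolding x_def by (intro continuous_intros)
  have p0: "p > 0" using p by simp
  have cp: "continuous_on {-pi..pi} (\<lambda>\<theta>. \<phi> \<theta> powr p)"
    using c nn p0 by (intro continuous_on_powr' continuous_on_const) auto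
  have step: "h * Sop p \<delta> \<eta> \<phi> h powr p \<le> (2 / \<delta>) powr (p - 1) * integral {-pi..pi} (\<lambda>\<theta>. \<phi> \<theta> powr p * rho \<delta> (x \<theta> / h))"
    if h: "h > 0" for h
  proof -
    \<comment> \<open>The kernel is x^(1/p) times this weight. The mass of \<open>w\<close> is at
      most h^(-1/p) 2/\<delta>, and the p-th power of the extra factor is just x, which cancels the
      denominator of \<open>w\<close>.\<close>
    define w where "w = (\<lambda>\<theta>. h powr (- 1 / p) * (rho \<delta> (x \<theta> / h) / x \<theta>))"
    have cw: "continuous_on {-pi..pi} w"
      unfolding w_def using x h
      by (intro continuous_on_mult continuous_on_const continuous_on_divide continuous_on_rho cx) (auto simp: xne)
    have w0: "w \<theta> > 0" for \<theta> using x h by (simp add: w_def rho_pos)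
    have "integral {-pi..pi} w = h powr (- 1 / p) * integral {-pi..pi} (\<lambda>\<theta>. rho \<delta> (x \<theta> / h) / x \<theta>)"
      unfolding w_def by (rule integral_mult_right)
    also have "\<dots> \<le> h powr (- 1 / p) * (2 / \<delta>)"
      using integral_rho_le[OF d h e] by (intro mult_left_mono) (auto simp: x_def)
    finally have iw: "integral {-pi..pi} w \<le> h powr (- 1 / p) * (2 / \<delta>)" .
    have "Sop p \<delta> \<eta> \<phi> h powr p \<le> (integral {-pi..pi} w) powr (p - 1) *
       integral {-pi..pi} (\<lambda>\<theta>. (\<phi> \<theta> * kap p \<delta> h (x \<theta>)) powr p * w \<theta> powr (1 - p))"
    proof -
      have "Sop p \<delta> \<eta> \<phi> h = integral {-pi..pi} (\<lambda>\<theta>. \<phi> \<theta> * kap p \<delta> h (x \<theta>))" by (simp add: Sop_def x_def)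
      then show ?thesis using p nn x h w0
        by (simp only:) (intro integral_powr_le_weighted cw continuous_on_mult c continuous_on_kap cx;
          auto intro!: mult_nonneg_nonneg less_imp_le[OF kap_pos])
    qed
    also have "(\<lambda>\<theta>. (\<phi> \<theta> * kap p \<delta> h (x \<theta>)) powr p * w \<theta> powr (1 - p)) = (\<lambda>\<theta>. h powr (- 1 / p) * (\<phi> \<theta> powr p * rho \<delta> (x \<theta> / h)))"
    proof
      fix \<theta>
      have k: "kap p \<delta> h (x \<theta>) = x \<theta> powr (1 / p) * w \<theta>"
        using x[of \<theta>] by (simp add: kap_def w_def powr_diff)
      have "(\<phi> \<theta> * kap p \<delta> h (x \<theta>)) powr p = \<phi> \<theta> powr p * (x \<theta> * w \<theta> powr p)"
        unfolding k using p0 x[of \<theta>] by (simp add: powr_mult powr_powr)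
      moreover have "w \<theta> powr p * w \<theta> powr (1 - p) = w \<theta>"
        using w0[of \<theta>] by (simp flip: powr_add)
      ultimately have "(\<phi> \<theta> * kap p \<delta> h (x \<theta>)) powr p * w \<theta> powr (1 - p) = \<phi> \<theta> powr p * (x \<theta> * w \<theta>)"
        by (simp add: mult.assoc)
      then show "(\<phi> \<theta> * kap p \<delta> h (x \<theta>)) powr p * w \<theta> powr (1 - p) = h powr (- 1 / p) * (\<phi> \<theta> powr p * rho \<delta> (x \<theta> / h))"
        using less_imp_neq[OF x[of \<theta>]] by (simp add: w_def)
    qed
    also have "(integral {-pi..pi} w) powr (p - 1) * integral {-pi..pi} (\<lambda>\<theta>. h powr (- 1 / p) * (\<phi> \<theta> powr p * rho \<delta> (x \<theta> / h)))
       \<le> (h powr (- 1 / p) * (2 / \<delta>)) powr (p - 1) * integral {-pi..pi} (\<lambda>\<theta>. h powr (- 1 / p) * (\<phi> \<theta> powr p * rho \<delta> (x \<theta> / h)))"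
    proof (intro mult_right_mono powr_mono2 iw)
      show "0 \<le> integral {-pi..pi} w"
        using w0 by (intro integral_nonneg integrable_continuous_interval cw) (auto intro: less_imp_le)
      show "0 \<le> integral {-pi..pi} (\<lambda>\<theta>. h powr (- 1 / p) * (\<phi> \<theta> powr p * rho \<delta> (x \<theta> / h)))"
        using x h by (intro integral_nonneg integrable_continuous_interval continuous_on_mult continuous_on_const cp continuous_on_rho continuous_on_divide cx) auto
    qed (use p in auto)
    finally have "h * Sop p \<delta> \<eta> \<phi> h powr p \<le> h * ((h powr (- 1 / p) * (2 / \<delta>)) powr (p - 1) * (h powr (- 1 / p) * integral {-pi..pi} (\<lambda>\<theta>. \<phi> \<theta> powr p * rho \<delta> (x \<theta> / h))))"
      using h by (intro mult_left_mono) auto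
    also have "\<dots> = (h * h powr (- 1 / p * (p - 1)) * h powr (- 1 / p)) * ((2 / \<delta>) powr (p - 1) * integral {-pi..pi} (\<lambda>\<theta>. \<phi> \<theta> powr p * rho \<delta> (x \<theta> / h)))"
    proof -
      have "(h powr (- 1 / p) * (2 / \<delta>)) powr (p - 1) = h powr (- 1 / p * (p - 1)) * (2 / \<delta>) powr (p - 1)"
        by (simp only: powr_mult powr_powr)
      then show ?thesis by (simp only: mult_ac)
    qed
    \<comment> \<open>All powers of \<open>h\<close> cancel, so that only \<open>rho\<close> still
      depends on the scale and can be summed over it.\<close>
    also have "h * h powr (- 1 / p * (p - 1)) * h powr (- 1 / p) = h powr (1 + - 1 / p * (p - 1) + - 1 / p)"
      using h by (simp only: powr_add powr_one[OF less_imp_le[OF h]])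
    also have "1 + - 1 / p * (p - 1) + - 1 / p = 0" using p0 by (simp add: field_simps)
    finally show ?thesis using h by simp
  qed
  have "(\<Sum>k<N. 2 * pi / 2 ^ k * Sop p \<delta> \<eta> \<phi> (2 * pi / 2 ^ k) powr p)
     \<le> (\<Sum>k<N. (2 / \<delta>) powr (p - 1) * integral {-pi..pi} (\<lambda>\<theta>. \<phi> \<theta> powr p * rho \<delta> (x \<theta> / (2 * pi / 2 ^ k))))"
    by (intro sum_mono step) auto
  also have "\<dots> = (2 / \<delta>) powr (p - 1) * (\<Sum>k<N. integral {-pi..pi} (\<lambda>\<theta>. \<phi> \<theta> powr p * rho \<delta> (x \<theta> / (2 * pi / 2 ^ k))))"
    by (rule sum_distrib_left[symmetric])
  also have "(\<Sum>k<N. integral {-pi..pi} (\<lambda>\<theta>. \<phi> \<theta> powr p * rho \<delta> (x \<theta> / (2 * pi / 2 ^ k))))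
      = integral {-pi..pi} (\<lambda>\<theta>. \<Sum>k<N. \<phi> \<theta> powr p * rho \<delta> (x \<theta> / (2 * pi / 2 ^ k)))"
    using x by (intro integral_sum[symmetric] integrable_continuous_interval continuous_on_mult cp
        continuous_on_rho continuous_on_divide cx continuous_on_const) auto
  also have "(2 / \<delta>) powr (p - 1) * \<dots> \<le> (2 / \<delta>) powr (p - 1) * integral {-pi..pi} (\<lambda>\<theta>. 2 powr \<delta> / (2 powr \<delta> - 1) * \<phi> \<theta> powr p)"
  proof (intro mult_left_mono integral_le integrable_continuous_interval)
    show "continuous_on {-pi..pi} (\<lambda>\<theta>. \<Sum>k<N. \<phi> \<theta> powr p * rho \<delta> (x \<theta> / (2 * pi / 2 ^ k)))"
      using x by (intro continuous_on_sum continuous_on_mult cp continuous_on_rho continuous_on_divide cx continuous_on_const) auto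
    show "continuous_on {-pi..pi} (\<lambda>\<theta>. 2 powr \<delta> / (2 powr \<delta> - 1) * \<phi> \<theta> powr p)"
      by (intro continuous_on_mult continuous_on_const cp)
    fix \<theta>
    \<comment> \<open>Halving the scale doubles the argument of \<open>rho\<close>; this is the
      telescoping dyadic sum.\<close>
    have "(\<Sum>k<N. rho \<delta> (x \<theta> / (2 * pi / 2 ^ k))) \<le> 2 powr \<delta> / (2 powr \<delta> - 1)"
      using sum_rho_le[OF d, of "x \<theta> / (2 * pi)" N] x[of \<theta>] by (simp add: mult.commute)
    from mult_left_mono[OF this, of "\<phi> \<theta> powr p"]
    show "(\<Sum>k<N. \<phi> \<theta> powr p * rho \<delta> (x \<theta> / (2 * pi / 2 ^ k))) \<le> 2 powr \<delta> / (2 powr \<delta> - 1) * \<phi> \<theta> powr p"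
      by (simp add: sum_distrib_left mult.commute)
  qed auto
  finally show ?thesis by (simp add: mult.assoc)
qed

text \<open>With t = x/h and a = t^\<delta>, the two power bounds say that Z is at most M h^(-1)
  t^(-s) times min(a, 1/a). Since 1 + a is at most twice max(1, a), this minimum is at most 4 a / (1
  + a)^2.\<close>

lemma kap_dominates:
  assumes h: "h > 0" and x: "x > 0" and M: "M \<ge> 0"
    and 1: "Z \<le> M * (h powr (s + \<delta> - 1) * x powr (- (s + \<delta>)))"
    and 2: "Z \<le> M * (h powr (s - \<delta> - 1) * x powr (- (s - \<delta>)))"
    and s: "s = 1 - 1 / p" and d: "\<delta> > 0"
  shows "Z \<le> 4 * M * kap p \<delta> h x"
proof -
  define t where "t = x / h"
  have t: "t > 0" using x h by (simp add: t_def)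
  have e: "h powr (r - 1) * x powr (- r) = h powr (- 1) * t powr (- r)" for r
    using x h by (simp add: t_def powr_divide powr_minus powr_diff divide_simps)
  have kap: "kap p \<delta> h x = h powr (- 1) * t powr (- s) * rho \<delta> t"
    using e[of s] by (simp add: kap_def s t_def mult_ac)
  define a where "a = t powr \<delta>"
  have a: "a > 0" using t by (simp add: a_def)
  have B: "h powr (- 1) * t powr (- s) \<ge> 0" by simp
  have z1: "Z \<le> M * (h powr (- 1) * t powr (- s)) * (1 / a)"
    using 1 unfolding e using t by (simp add: a_def powr_diff powr_minus mult_ac divide_simps)
  have z2: "Z \<le> M * (h powr (- 1) * t powr (- s)) * a"
    using 2 unfolding e using t by (simp add: a_def powr_diff powr_minus mult_ac divide_simps)
  have "min a (1 / a) \<le> 4 * (a / (1 + a)\<^sup>2)"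
  proof (cases "a \<le> 1")
    case True
    have "(1 + a)\<^sup>2 \<le> 2\<^sup>2" using True a by (intro power_mono) auto
    then have "a * (1 + a)\<^sup>2 \<le> a * 4" using a by (intro mult_left_mono) auto
    then have "a \<le> 4 * a / (1 + a)\<^sup>2" using a by (simp add: pos_le_divide_eq zero_less_power add_pos_pos mult.commute)
    then show ?thesis by simp
  next
    case False
    have "(1 + a)\<^sup>2 \<le> (2 * a)\<^sup>2" using False a by (intro power_mono) auto
    then have "1 / a * (1 + a)\<^sup>2 \<le> 1 / a * (4 * a\<^sup>2)" using a by (intro mult_left_mono) (auto simp: power2_eq_square)
    also have "1 / a * (4 * a\<^sup>2) = 4 * a" using a by (simp add: power2_eq_square)
    finally have "1 / a \<le> 4 * a / (1 + a)\<^sup>2" using a by (simp add: pos_le_divide_eq zero_less_power add_pos_pos)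
    then show ?thesis by simp
  qed
  then have "M * (h powr (- 1) * t powr (- s)) * min a (1 / a) \<le> M * (h powr (- 1) * t powr (- s)) * (4 * (a / (1 + a)\<^sup>2))"
    using M by (intro mult_left_mono) auto
  moreover have "Z \<le> M * (h powr (- 1) * t powr (- s)) * min a (1 / a)" using z1 z2 by (cases "a \<le> 1 / a") (simp_all only: min_def if_True if_False)
  ultimately show ?thesis by (simp add: kap rho_def a_def mult_ac)
qed

text \<open>The weighted inequality between arithmetic and geometric means, with the exponent
  \<open>s\<close> free to be moved to either side of the critical value.\<close>

lemma inverse_add_le:
  fixes v x s :: real
  assumes "v > 0" "x > 0" "0 \<le> s" "s \<le> 1"
  shows "1 / (v + x) \<le> v powr (s - 1) * x powr (- s)"
proof -
  have "v powr (1 - s) * x powr s \<le> (1 - s) * v + s * x"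
    using assms by (intro Youngs_inequality_0) auto
  also have "\<dots> \<le> 1 * v + 1 * x" using assms by (intro add_mono mult_right_mono) auto
  finally have "1 / (v + x) \<le> 1 / (v powr (1 - s) * x powr s)"
    using assms by (intro divide_left_mono mult_pos_pos) auto
  also have "\<dots> = v powr (s - 1) * x powr (- s)"
    using assms by (simp add: powr_diff powr_minus divide_simps)
  finally show ?thesis .
qed

lemma powr_add_le:
  fixes a b m :: real
  assumes "a > 0" "b > 0" "0 \<le> m" "m \<le> 1"
  shows "(a + b) powr m \<le> a powr m + b powr m"
proof -
  have "(a + b) powr m = (a + b) * (a + b) powr (m - 1)" using assms by (simp add: powr_diff)
  also have "\<dots> = a * (a + b) powr (m - 1) + b * (a + b) powr (m - 1)" by (simp add: distrib_right)
  also have "\<dots> \<le> a * a powr (m - 1) + b * b powr (m - 1)"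
    using assms by (intro add_mono mult_left_mono powr_mono2') auto
  also have "\<dots> = a powr m + b powr m" using assms by (simp add: powr_diff)
  finally show ?thesis .
qed

text \<open>After splitting the denominator by \<open>inverse_add_le\<close> the power of y + \<eta>
  under the integral is 1/q - 2 + s. The condition \<open>1 - 1 / q < s\<close> makes it integrable
  at 0, uniformly in \<open>\<eta>\<close>.\<close>

lemma kernel_integral_low:
  fixes q s \<eta> h t :: real
  assumes q: "q \<ge> 1" and s: "1 - 1 / q < s" "s \<le> 1" and e: "\<eta> > 0" and h: "h > 0" and t: "t \<ge> 0"
  shows "integral {0..h} (\<lambda>y. (y + \<eta>) powr (1 / q - 1) * (1 / (y + \<eta> + t)))
    \<le> 2 / (1 / q - 1 + s) * h powr (1 / q) * (h powr (s - 1) * (\<eta> + t) powr (- s))"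
proof -
  define m where "m = 1 / q - 1 + s"
  have "1 / q \<le> 1" using q by simp
  then have m: "0 < m" "m \<le> 1" and s0: "0 \<le> s" using s unfolding m_def by linarith+
  define x where "x = \<eta> + t"
  have x: "x > 0" using e t unfolding x_def by linarith
  have pw: "((\<lambda>y. (y + \<eta>) powr (m - 1)) has_integral (h + \<eta>) powr m / m - (0 + \<eta>) powr m / m) {0..h}"
  proof (rule fundamental_theorem_of_calculus)
    fix y :: real assume y: "y \<in> {0..h}"
    have "((\<lambda>y. (y + \<eta>) powr m / m) has_real_derivative (y + \<eta>) powr (m - 1)) (at y)"
      using y e m by (auto intro!: derivative_eq_intros add_nonneg_pos)
    then show "((\<lambda>y. (y + \<eta>) powr m / m) has_vector_derivative (y + \<eta>) powr (m - 1)) (at y within {0..h})"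
      by (simp add: has_real_derivative_iff_has_vector_derivative has_vector_derivative_at_within)
  qed (use h in auto)
  have pos: "y \<in> {0..h} \<Longrightarrow> y + \<eta> > 0" for y using e by auto
  have "integral {0..h} (\<lambda>y. (y + \<eta>) powr (1 / q - 1) * (1 / (y + \<eta> + t)))
     \<le> integral {0..h} (\<lambda>y. 2 * x powr (- s) * (y + \<eta>) powr (m - 1))"
  proof (intro integral_le integrable_continuous_interval)
    show "continuous_on {0..h} (\<lambda>y. (y + \<eta>) powr (1 / q - 1) * (1 / (y + \<eta> + t)))"
      using t pos by (intro continuous_intros) (auto dest!: pos)
    show "continuous_on {0..h} (\<lambda>y. 2 * x powr (- s) * (y + \<eta>) powr (m - 1))"
      using pos by (intro continuous_intros) (auto dest!: pos)
    fix y assume y: "y \<in> {0..h}"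
    define v where "v = y + \<eta>"
    have v: "v > 0" "\<eta> \<le> v" using pos[OF y] y by (auto simp: v_def)
    \<comment> \<open>Since v is at least \<eta>, v + x = v + \<eta> + t is at most 2 (v +
      t).\<close>
    have "1 / (v + t) \<le> 2 * (1 / (v + x))"
      using v t x by (simp add: divide_simps x_def)
    also have "\<dots> \<le> 2 * (v powr (s - 1) * x powr (- s))"
      using v x s0 s by (intro mult_left_mono inverse_add_le) auto
    finally have "v powr (1 / q - 1) * (1 / (v + t)) \<le> v powr (1 / q - 1) * (2 * (v powr (s - 1) * x powr (- s)))"
      by (intro mult_left_mono) auto
    also have "\<dots> = 2 * x powr (- s) * (v powr (1 / q - 1) * v powr (s - 1))" by (simp add: mult_ac)
    also have "v powr (1 / q - 1) * v powr (s - 1) = v powr (m - 1)"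
      by (simp add: m_def powr_add[symmetric])
    finally show "(y + \<eta>) powr (1 / q - 1) * (1 / (y + \<eta> + t)) \<le> 2 * x powr (- s) * (y + \<eta>) powr (m - 1)"
      by (simp add: v_def)
  qed
  also have "\<dots> = 2 * x powr (- s) * (((h + \<eta>) powr m - \<eta> powr m) / m)"
    using integral_unique[OF pw] by (simp add: diff_divide_distrib)
  also have "\<dots> \<le> 2 * x powr (- s) * (h powr m / m)"
    using powr_add_le[OF h e, of m] m by (intro mult_left_mono divide_right_mono) auto
  also have "h powr m = h powr (1 / q) * h powr (s - 1)"
    by (simp add: m_def powr_add[symmetric] algebra_simps)
  finally show ?thesis by (simp add: x_def m_def mult_ac)
qed

text \<open>The same splitting leaves the power y^(s-2), and \<open>s < 1\<close> makes it
  integrable at infinity, so the bound does not involve \<open>H\<close>.\<close>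

lemma kernel_integral_high:
  fixes s \<eta> h H t :: real
  assumes s: "0 \<le> s" "s < 1" and e: "\<eta> > 0" and h: "0 < h" "h \<le> H" and t: "t \<ge> 0"
  shows "integral {h..H} (\<lambda>y. 1 / (y + \<eta>) * (1 / (y + \<eta> + t))) \<le> 1 / (1 - s) * (h powr (s - 1) * (\<eta> + t) powr (- s))"
proof -
  define x where "x = \<eta> + t"
  have x: "x > 0" using e t unfolding x_def by linarith
  have pw: "((\<lambda>y. y powr (s - 2)) has_integral H powr (s - 1) / (s - 1) - h powr (s - 1) / (s - 1)) {h..H}"
  proof (rule fundamental_theorem_of_calculus)
    fix y :: real assume y: "y \<in> {h..H}"
    have "((\<lambda>y. y powr (s - 1) / (s - 1)) has_real_derivative y powr (s - 2)) (at y)"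
      using y h s by (auto intro!: derivative_eq_intros)
    then show "((\<lambda>y. y powr (s - 1) / (s - 1)) has_vector_derivative y powr (s - 2)) (at y within {h..H})"
      by (simp add: has_real_derivative_iff_has_vector_derivative has_vector_derivative_at_within)
  qed (use h in auto)
  have pos: "y \<in> {h..H} \<Longrightarrow> y > 0" for y using h by auto
  have "integral {h..H} (\<lambda>y. 1 / (y + \<eta>) * (1 / (y + \<eta> + t))) \<le> integral {h..H} (\<lambda>y. x powr (- s) * y powr (s - 2))"
  proof (intro integral_le integrable_continuous_interval)
    show "continuous_on {h..H} (\<lambda>y. 1 / (y + \<eta>) * (1 / (y + \<eta> + t)))"
      using e t by (intro continuous_intros) (auto dest!: pos)
    show "continuous_on {h..H} (\<lambda>y. x powr (- s) * y powr (s - 2))"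
      by (intro continuous_intros) (auto dest!: pos)
    fix y assume "y \<in> {h..H}"
    then have y: "y > 0" by (rule pos)
    have "1 / (y + \<eta>) * (1 / (y + \<eta> + t)) \<le> 1 / y * (1 / (y + x))"
      using y e t unfolding x_def by (intro mult_mono divide_left_mono) (auto simp: add_ac)
    also have "\<dots> \<le> 1 / y * (y powr (s - 1) * x powr (- s))"
      using y x s by (intro mult_left_mono inverse_add_le) auto
    also have "\<dots> = x powr (- s) * y powr (s - 2)"
      using y by (simp add: powr_diff power2_eq_square)
    finally show "1 / (y + \<eta>) * (1 / (y + \<eta> + t)) \<le> x powr (- s) * y powr (s - 2)" .
  qed
  also have "\<dots> = x powr (- s) * ((h powr (s - 1) - H powr (s - 1)) / (1 - s))"
    using integral_unique[OF pw] s by (simp add: divide_simps) (simp add: algebra_simps)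
  also have "\<dots> \<le> x powr (- s) * (h powr (s - 1) / (1 - s))"
    using s by (intro mult_left_mono divide_right_mono) auto
  finally show ?thesis by (simp add: x_def mult_ac)
qed

lemma Aop_swap:
  assumes e: "\<eta> > 0" and a: "0 \<le> a" and c: "continuous_on {-pi..pi} \<phi>" and g: "continuous_on {a..b} g"
  shows "integral {a..b} (\<lambda>y. g y * Aop \<phi> (y + \<eta>))
     = integral {-pi..pi} (\<lambda>\<theta>. \<phi> \<theta> * integral {a..b} (\<lambda>y. g y * (1 / (y + \<eta> + \<bar>\<theta>\<bar>))))"
    and "continuous_on {a..b} (\<lambda>y. Aop \<phi> (y + \<eta>))"
    and "continuous_on {-pi..pi} (\<lambda>\<theta>. \<phi> \<theta> * integral {a..b} (\<lambda>y. g y * (1 / (y + \<eta> + \<bar>\<theta>\<bar>))))"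
proof -
  let ?F = "\<lambda>y \<theta>. g y * (\<phi> \<theta> / (y + \<eta> + \<bar>\<theta>\<bar>))"
  have ne: "y + \<eta> + \<bar>\<theta>\<bar> \<noteq> 0" if "y \<in> {a..b}" for y \<theta> using that e a by auto
  have cF: "continuous_on ({a..b} \<times> {-pi..pi}) (\<lambda>(y, \<theta>). ?F y \<theta>)"
    unfolding case_prod_unfold using ne
    by (intro continuous_on_mult continuous_on_divide continuous_on_add continuous_on_const
        continuous_on_compose2[OF g] continuous_on_compose2[OF c] continuous_on_fst continuous_on_snd
        continuous_on_id continuous_on_rabs) auto
  have c0: "continuous_on ({a..b} \<times> cbox (-pi) pi) (\<lambda>(y, \<theta>). \<phi> \<theta> / (y + \<eta> + \<bar>\<theta>\<bar>))"
    unfolding case_prod_unfold using ne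
    by (intro continuous_on_divide continuous_on_add continuous_on_const
        continuous_on_compose2[OF c] continuous_on_fst continuous_on_snd
        continuous_on_id continuous_on_rabs) auto
  show "continuous_on {a..b} (\<lambda>y. Aop \<phi> (y + \<eta>))"
    using integral_continuous_on_param[OF c0] by (simp add: Aop_def)
  have e1: "integral {-pi..pi} (\<lambda>\<theta>. ?F y \<theta>) = g y * Aop \<phi> (y + \<eta>)" for y
    unfolding Aop_def by (rule integral_mult_right)
  have e2: "integral {a..b} (\<lambda>y. ?F y \<theta>) = \<phi> \<theta> * integral {a..b} (\<lambda>y. g y * (1 / (y + \<eta> + \<bar>\<theta>\<bar>)))" for \<theta>
    by (subst integral_mult_right[symmetric]) (simp add: mult_ac)
  have "continuous_on (cbox (a, -pi) (b, pi)) (\<lambda>(y, \<theta>). ?F y \<theta>)"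
    using cF by (simp add: cbox_Pair_eq)
  from integral_swap_continuous[OF this]
  show "integral {a..b} (\<lambda>y. g y * Aop \<phi> (y + \<eta>))
     = integral {-pi..pi} (\<lambda>\<theta>. \<phi> \<theta> * integral {a..b} (\<lambda>y. g y * (1 / (y + \<eta> + \<bar>\<theta>\<bar>))))"
    unfolding interval_cbox[symmetric] e1 e2 .
  have "continuous_on ({-pi..pi} \<times> cbox a b) (\<lambda>(\<theta>, y). ?F y \<theta>)"
    using continuous_on_Times_swap[OF cF] by simp
  from integral_continuous_on_param[OF this]
  show "continuous_on {-pi..pi} (\<lambda>\<theta>. \<phi> \<theta> * integral {a..b} (\<lambda>y. g y * (1 / (y + \<eta> + \<bar>\<theta>\<bar>))))"
    unfolding interval_cbox[symmetric] e2 .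
qed

text \<open>Exchanging integrals reduces all three estimates to the kernel 1 / (y + \<eta> +
  |\<theta>|). The kernel bounds hold for exponents in an open interval around the critical s = 1 -
  1/p, because q < p; using them at s + \<delta> and s - \<delta> yields the two-sided decay of
  \<open>kap\<close>.\<close>

lemma Aop_le_Sop:
  fixes p q :: real
  assumes q: "1 \<le> q" "q < p"
  shows "\<exists>\<delta>>0. \<exists>C>0. \<forall>\<eta> \<phi> h. 0 < \<eta> \<longrightarrow> 0 < h \<longrightarrow> h \<le> 2 * pi \<longrightarrow> continuous_on {-pi..pi} \<phi> \<longrightarrow> (\<forall>\<theta>. \<phi> \<theta> \<ge> 0) \<longrightarrow>
     integral {0..h} (\<lambda>y. (y + \<eta>) powr (1 / q - 1) * Aop \<phi> (y + \<eta>)) \<le> C * h powr (1 / q) * Sop p \<delta> \<eta> \<phi> h \<and>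
     integral {h..2 * pi} (\<lambda>y. 1 / (y + \<eta>) * Aop \<phi> (y + \<eta>)) \<le> C * Sop p \<delta> \<eta> \<phi> h \<and>
     Aop \<phi> (h + \<eta>) \<le> C * Sop p \<delta> \<eta> \<phi> h"
proof -
  define s where "s = 1 - 1 / p"
  \<comment> \<open>Half the distance from s = 1 - 1/p to the nearer of the limits 1 - 1/q and 1
    imposed by the low and the high kernel integral.\<close>
  define \<delta> where "\<delta> = min (1 / p) (1 / q - 1 / p) / 2"
  have inv: "0 < 1 / p" "1 / p < 1 / q" "1 / q \<le> 1" using q by (auto simp: field_simps)
  define m where "m = min (1 / p) (1 / q - 1 / p)"
  have "m > 0" "m \<le> 1 / p" "m \<le> 1 / q - 1 / p" using inv by (auto simp: m_def)
  moreover have "\<delta> = m / 2" by (simp add: \<delta>_def m_def)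
  ultimately have d: "\<delta> > 0" "\<delta> < 1 / p" "\<delta> < 1 / q - 1 / p" by linarith+
  define m1 m2 where "m1 = 2 / (1 / q - 1 + (s + \<delta>))" and "m2 = 2 / (1 / q - 1 + (s - \<delta>))"
  define n1 n2 where "n1 = 1 / (1 - (s + \<delta>))" and "n2 = 1 / (1 - (s - \<delta>))"
  have pos: "m1 > 0" "m2 > 0" "n1 > 0" "n2 > 0"
    unfolding m1_def m2_def n1_def n2_def s_def using d inv by (auto intro!: divide_pos_pos)
  define M where "M = m1 + m2 + n1 + n2 + 1"
  have M: "M > 0" "m1 \<le> M" "m2 \<le> M" "n1 \<le> M" "n2 \<le> M" "1 \<le> M" using pos by (auto simp: M_def)
  have s: "1 - 1 / q < s + \<delta>" "s + \<delta> \<le> 1" "1 - 1 / q < s - \<delta>" "s - \<delta> \<le> 1"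
    "0 \<le> s + \<delta>" "0 \<le> s - \<delta>" "s + \<delta> < 1" "s - \<delta> < 1"
    using d inv by (auto simp: s_def)
  show ?thesis
  proof (rule exI[of _ \<delta>], rule conjI[OF d(1)], rule exI[of _ "4 * M"], intro conjI allI impI)
    show "0 < 4 * M" using M by simp
    fix \<eta> h :: real and \<phi> :: "real \<Rightarrow> real"
    assume e: "0 < \<eta>" and h: "0 < h" "h \<le> 2 * pi" and c: "continuous_on {-pi..pi} \<phi>" and nn: "\<forall>\<theta>. \<phi> \<theta> \<ge> 0"
    have x: "\<eta> + \<bar>\<theta>\<bar> > 0" for \<theta> using e by linarith
    have cS: "continuous_on {-pi..pi} (\<lambda>\<theta>. C * (\<phi> \<theta> * kap p \<delta> h (\<eta> + \<bar>\<theta>\<bar>)))" for C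
      using x h by (intro continuous_on_mult continuous_on_const c continuous_on_kap continuous_on_add continuous_on_rabs continuous_on_id) auto
    have *: "integral {-pi..pi} (\<lambda>\<theta>. \<phi> \<theta> * T \<theta>) \<le> C * Sop p \<delta> \<eta> \<phi> h"
      if T: "\<And>\<theta>. T \<theta> \<le> C * kap p \<delta> h (\<eta> + \<bar>\<theta>\<bar>)" and cT: "continuous_on {-pi..pi} (\<lambda>\<theta>. \<phi> \<theta> * T \<theta>)" for T C
    proof -
      have "integral {-pi..pi} (\<lambda>\<theta>. \<phi> \<theta> * T \<theta>) \<le> integral {-pi..pi} (\<lambda>\<theta>. C * (\<phi> \<theta> * kap p \<delta> h (\<eta> + \<bar>\<theta>\<bar>)))"
      proof (rule integral_le)
        show "(\<lambda>\<theta>. \<phi> \<theta> * T \<theta>) integrable_on {-pi..pi}"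
          by (rule integrable_continuous_interval[OF cT])
        show "(\<lambda>\<theta>. C * (\<phi> \<theta> * kap p \<delta> h (\<eta> + \<bar>\<theta>\<bar>))) integrable_on {-pi..pi}"
          by (rule integrable_continuous_interval[OF cS])
        show "\<phi> \<theta> * T \<theta> \<le> C * (\<phi> \<theta> * kap p \<delta> h (\<eta> + \<bar>\<theta>\<bar>))" for \<theta>
          using mult_left_mono[OF T[of \<theta>] spec[OF nn, of \<theta>]] by (simp add: mult_ac)
      qed
      then show ?thesis by (simp add: Sop_def)
    qed
    have mono: "m * X \<le> M * X" if "m \<le> M" "X \<ge> 0" for m X using that by (intro mult_right_mono)
    have g1: "continuous_on {0..h} (\<lambda>y. (y + \<eta>) powr (1 / q - 1))"
      using e by (intro continuous_intros) auto
    show "integral {0..h} (\<lambda>y. (y + \<eta>) powr (1 / q - 1) * Aop \<phi> (y + \<eta>)) \<le> 4 * M * h powr (1 / q) * Sop p \<delta> \<eta> \<phi> h"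
      unfolding Aop_swap(1)[OF e order_refl c g1]
    proof (rule *)
      fix \<theta> :: real
      let ?X = "\<lambda>r. h powr (r - 1) * (\<eta> + \<bar>\<theta>\<bar>) powr (- r)"
      let ?Z = "integral {0..h} (\<lambda>y. (y + \<eta>) powr (1 / q - 1) * (1 / (y + \<eta> + \<bar>\<theta>\<bar>)))"
      have "?Z \<le> m1 * h powr (1 / q) * ?X (s + \<delta>)"
        unfolding m1_def by (rule kernel_integral_low) (use q s e h in auto)
      also have "\<dots> \<le> (M * h powr (1 / q)) * ?X (s + \<delta>)" using mono[OF M(2)] by (simp add: mult.assoc)
      finally have 1: "?Z \<le> (M * h powr (1 / q)) * ?X (s + \<delta>)" .
      have "?Z \<le> m2 * h powr (1 / q) * ?X (s - \<delta>)"
        unfolding m2_def by (rule kernel_integral_low) (use q s e h in auto)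
      also have "\<dots> \<le> (M * h powr (1 / q)) * ?X (s - \<delta>)" using mono[OF M(3)] by (simp add: mult.assoc)
      finally have 2: "?Z \<le> (M * h powr (1 / q)) * ?X (s - \<delta>)" .
      have "?Z \<le> 4 * (M * h powr (1 / q)) * kap p \<delta> h (\<eta> + \<bar>\<theta>\<bar>)"
        by (rule kap_dominates[OF h(1) x _ 1 2 s_def d(1)]) (use M in auto)
      then show "?Z \<le> 4 * M * h powr (1 / q) * kap p \<delta> h (\<eta> + \<bar>\<theta>\<bar>)" by (simp add: mult_ac)
    qed (rule Aop_swap(3)[OF e order_refl c g1])
    have g2: "continuous_on {h..2 * pi} (\<lambda>y. 1 / (y + \<eta>))"
      using e h by (intro continuous_intros) auto
    show "integral {h..2 * pi} (\<lambda>y. 1 / (y + \<eta>) * Aop \<phi> (y + \<eta>)) \<le> 4 * M * Sop p \<delta> \<eta> \<phi> h"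
      unfolding Aop_swap(1)[OF e less_imp_le[OF h(1)] c g2]
    proof (rule *)
      fix \<theta> :: real
      let ?X = "\<lambda>r. h powr (r - 1) * (\<eta> + \<bar>\<theta>\<bar>) powr (- r)"
      let ?Z = "integral {h..2 * pi} (\<lambda>y. 1 / (y + \<eta>) * (1 / (y + \<eta> + \<bar>\<theta>\<bar>)))"
      have "?Z \<le> n1 * ?X (s + \<delta>)"
        unfolding n1_def by (rule kernel_integral_high) (use s e h in auto)
      also have "\<dots> \<le> M * ?X (s + \<delta>)" by (rule mono[OF M(4)]) simp
      finally have 1: "?Z \<le> M * ?X (s + \<delta>)" .
      have "?Z \<le> n2 * ?X (s - \<delta>)"
        unfolding n2_def by (rule kernel_integral_high) (use s e h in auto)
      also have "\<dots> \<le> M * ?X (s - \<delta>)" by (rule mono[OF M(5)]) simp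
      finally have 2: "?Z \<le> M * ?X (s - \<delta>)" .
      show "?Z \<le> 4 * M * kap p \<delta> h (\<eta> + \<bar>\<theta>\<bar>)"
        by (rule kap_dominates[OF h(1) x _ 1 2 s_def d(1)]) (use M in auto)
    qed (rule Aop_swap(3)[OF e less_imp_le[OF h(1)] c g2])
    have eqA: "Aop \<phi> (h + \<eta>) = integral {-pi..pi} (\<lambda>\<theta>. \<phi> \<theta> * (1 / (h + (\<eta> + \<bar>\<theta>\<bar>))))"
      by (simp add: Aop_def add_ac)
    show "Aop \<phi> (h + \<eta>) \<le> 4 * M * Sop p \<delta> \<eta> \<phi> h"
      unfolding eqA
    proof (rule *)
      fix \<theta> :: real
      let ?X = "\<lambda>r. h powr (r - 1) * (\<eta> + \<bar>\<theta>\<bar>) powr (- r)"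
      have "1 / (h + (\<eta> + \<bar>\<theta>\<bar>)) \<le> ?X (s + \<delta>)" by (rule inverse_add_le[OF h(1) x]) (use s in auto)
      also have "\<dots> = 1 * ?X (s + \<delta>)" by simp
      also have "\<dots> \<le> M * ?X (s + \<delta>)" by (rule mono[OF M(6)]) simp
      finally have 1: "1 / (h + (\<eta> + \<bar>\<theta>\<bar>)) \<le> M * ?X (s + \<delta>)" .
      have "1 / (h + (\<eta> + \<bar>\<theta>\<bar>)) \<le> ?X (s - \<delta>)" by (rule inverse_add_le[OF h(1) x]) (use s in auto)
      also have "\<dots> = 1 * ?X (s - \<delta>)" by simp
      also have "\<dots> \<le> M * ?X (s - \<delta>)" by (rule mono[OF M(6)]) simp
      finally have 2: "1 / (h + (\<eta> + \<bar>\<theta>\<bar>)) \<le> M * ?X (s - \<delta>)" .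
      show "1 / (h + (\<eta> + \<bar>\<theta>\<bar>)) \<le> 4 * M * kap p \<delta> h (\<eta> + \<bar>\<theta>\<bar>)"
        by (rule kap_dominates[OF h(1) x _ 1 2 s_def d(1)]) (use M in auto)
    next
      have "h + (\<eta> + \<bar>\<theta>\<bar>) \<noteq> 0" for \<theta> using x[of \<theta>] h by linarith
      then show "continuous_on {-pi..pi} (\<lambda>\<theta>. \<phi> \<theta> * (1 / (h + (\<eta> + \<bar>\<theta>\<bar>))))"
        by (intro continuous_on_mult c continuous_on_divide continuous_on_const continuous_on_add continuous_on_rabs continuous_on_id) auto
    qed
  qed
qed

section \<open>Mean estimates for the kernel and for derivatives of the image\<close>

lemma Hn_deriv_le_powr:
  assumes U: "per_hol U" and q: "q \<ge> 1" and y: "0 < y"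
    and H: "\<And>v. y / 2 \<le> v \<Longrightarrow> v \<le> 3 / 2 * y \<Longrightarrow> Hn q v U \<le> K * v powr (1 / q - 1)" and K: "K \<ge> 0"
  shows "Hn q y (deriv U) \<le> 4 * K * y powr (1 / q - 2)"
proof -
  have i: "0 < 1 / q" "1 / q \<le> 1" using q by auto
  \<comment> \<open>Cauchy's estimate with radius y/2. One factor 2 comes from the radius, the other
    from replacing v by y/2 in the decreasing power.\<close>
  have "Hn q y (deriv U) \<le> (2 * K * y powr (1 / q - 1)) / (y / 2)"
  proof (rule Hn_deriv_le[OF U q])
    fix v assume v: "\<bar>v - y\<bar> \<le> y / 2"
    then have v2: "y / 2 \<le> v" "v \<le> 3 / 2 * y" unfolding abs_le_iff by linarith+
    have "Hn q v U \<le> K * v powr (1 / q - 1)" using v2 by (rule H)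
    also have "\<dots> \<le> K * (y / 2) powr (1 / q - 1)"
      using v2 y i K by (intro mult_left_mono powr_mono2') auto
    also have "(y / 2) powr (1 / q - 1) = y powr (1 / q - 1) * 2 powr (1 - 1 / q)"
    proof -
      have "2 powr (1 - 1 / q) = 1 / (2::real) powr (1 / q - 1)" by (simp add: powr_minus_divide[symmetric])
      then show ?thesis using y by (simp add: powr_divide)
    qed
    also have "K * (y powr (1 / q - 1) * 2 powr (1 - 1 / q)) \<le> K * (y powr (1 / q - 1) * 2 powr 1)"
      using i K by (intro mult_left_mono powr_mono) auto
    finally show "Hn q v U \<le> 2 * K * y powr (1 / q - 1)" by (simp add: mult_ac)
  qed (use y in auto)
  also have "\<dots> = 4 * K * y powr (1 / q - 2)"
    using y by (simp add: powr_diff power2_eq_square)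
  finally show ?thesis .
qed

text \<open>By \<open>kern_mult\<close> the kernel is the lifted function P minus an increment of P
  over the step \<theta>, divided by a quantity of size |\<theta>|. The increment is at most
  |\<theta>| times the norm of P', which is good for |\<theta>| < y, and at most twice the norm of
  P, which is good for |\<theta>| > y.\<close>

lemma Lpn_kern_le:
  assumes c: "disc_series c" and q: "q \<ge> 1" and K: "K \<ge> 0"
    and H: "\<And>y. y > 0 \<Longrightarrow> Hn q y (lift (disc_fun c)) \<le> K * y powr (1 / q - 1)"
    and y: "0 < y" "y \<le> 4 * pi" and t: "\<bar>\<theta>\<bar> \<le> pi"
  shows "Lpn q (\<lambda>x. kern c (Complex x y) \<theta>) \<le> 8 * pi * K * y powr (1 / q - 1) / (y + \<bar>\<theta>\<bar>)"
proof -
  define P where "P = lift (disc_fun c)"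
  define X where "X = K * y powr (1 / q - 1)"
  have X0: "X \<ge> 0" using K by (simp add: X_def)
  have P: "per_hol P" unfolding P_def by (rule per_hol_lift_disc_fun[OF c])
  have q0: "q > 0" using q by simp
  have HP: "Hn q y P \<le> X" using H[OF y(1)] by (simp add: P_def X_def)
  have HP': "Hn q y (deriv P) \<le> 4 * X / y"
    using Hn_deriv_le_powr[OF P q y(1) _ K] H y by (simp add: P_def X_def powr_diff power2_eq_square)
  have cP: "continuous_on S (\<lambda>x. P (Complex x y))" "continuous_on S (\<lambda>x. deriv P (Complex x y))" for S
    using y by (auto intro!: per_hol_line per_hol_deriv P)
  have ck: "continuous_on {0..2*pi} (\<lambda>x. kern c (Complex x y) \<theta>)"
    using continuous_on_sliceR[OF continuous_on_kern[OF c y(1), of "UNIV \<times> {0..2*pi}"]] by simp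
  have pi3: "pi > 3" using pi_gt3 .
  show ?thesis
  proof (cases "\<theta> = 0")
    case True
    have "Lpn q (\<lambda>x. kern c (Complex x y) \<theta>) \<le> Hn q y P + Lpn q (\<lambda>x. \<i> * deriv P (Complex x y))"
    proof (rule Lpn_triangle_le[OF q cP(1) _ ck])
      show "continuous_on {0..2 * pi} (\<lambda>x. \<i> * deriv P (Complex x y))" by (intro continuous_intros cP)
      show "norm (kern c (Complex x y) \<theta>) \<le> norm (P (Complex x y)) + norm (\<i> * deriv P (Complex x y))" for x
        using kern_0[OF c, of "Complex x y"] y norm_triangle_ineq4[of "P (Complex x y)" "\<i> * deriv P (Complex x y)"]
        by (simp add: True P_def)
    qed
    also have "Lpn q (\<lambda>x. \<i> * deriv P (Complex x y)) = Hn q y (deriv P)" using q0 by (simp add: Lpn_cmult)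
    also have "Hn q y P + Hn q y (deriv P) \<le> X + 4 * X / y" using HP HP' by simp
    also have "\<dots> = (y + 4) * X / y" using y by (simp add: field_simps)
    also have "\<dots> \<le> (8 * pi) * X / y"
      using y X0 pi3 by (intro divide_right_mono mult_right_mono) auto
    finally show ?thesis by (simp add: True X_def mult_ac)
  next
    case False
    define N where "N = norm (1 - cis (- \<theta>))"
    have N: "N \<ge> 2 * \<bar>\<theta>\<bar> / pi" unfolding N_def by (rule norm_one_minus_cis_ge[OF t])
    moreover have "2 * \<bar>\<theta>\<bar> / pi > 0" using False by simp
    ultimately have N0: "N > 0" by linarith
    define E where "E = Lpn q (\<lambda>x. P (Complex x y + of_real (- \<theta>)) - P (Complex x y))"
    have cPt: "continuous_on {0..2*pi} (\<lambda>x. P (Complex x y + of_real (- \<theta>)))"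
      using y by (intro per_hol_continuous_compose[OF P] continuous_intros) auto
    have E1: "E \<le> \<bar>\<theta>\<bar> * (4 * X / y)"
      using Hn_diff_le[OF P q y(1), of "of_real (- \<theta>)" "4 * X / y"] HP' by (simp add: E_def)
    have "E \<le> Lpn q (\<lambda>x. P (Complex x y + of_real (- \<theta>))) + Hn q y P"
      unfolding E_def by (rule Lpn_triangle_le[OF q cPt cP(1) continuous_on_diff[OF cPt cP(1)]]) (rule norm_triangle_ineq4)
    also have "Lpn q (\<lambda>x. P (Complex x y + of_real (- \<theta>))) = Hn q y P"
      using Hn_shift[OF P q0, of y "of_real (- \<theta>)"] y by simp
    finally have E2: "E \<le> 2 * X" using HP by simp
    have "Lpn q (\<lambda>x. kern c (Complex x y) \<theta>) \<le> Hn q y P + Lpn q (\<lambda>x. of_real (1 / N) * (P (Complex x y + of_real (- \<theta>)) - P (Complex x y)))"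
    proof (rule Lpn_triangle_le[OF q cP(1) _ ck])
      show "continuous_on {0..2 * pi} (\<lambda>x. of_real (1 / N) * (P (Complex x y + of_real (- \<theta>)) - P (Complex x y)))"
        by (intro continuous_on_mult continuous_on_const continuous_on_diff cPt cP)
      fix x
      let ?w = "Complex x y"
      have "(1 - cis (- \<theta>)) * kern c ?w \<theta> = P ?w - cis (- \<theta>) * P (?w + of_real (- \<theta>))"
        using kern_mult[OF c, of ?w \<theta>] y by (simp add: P_def)
      also have "\<dots> = (1 - cis (- \<theta>)) * P ?w - cis (- \<theta>) * (P (?w + of_real (- \<theta>)) - P ?w)"
        by (simp add: algebra_simps)
      finally have "N * norm (kern c ?w \<theta>) = norm ((1 - cis (- \<theta>)) * P ?w - cis (- \<theta>) * (P (?w + of_real (- \<theta>)) - P ?w))"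
        by (simp only: N_def norm_mult[symmetric])
      also have "\<dots> \<le> N * norm (P ?w) + norm (P (?w + of_real (- \<theta>)) - P ?w)"
        by (rule order_trans[OF norm_triangle_ineq4]) (simp add: norm_mult N_def)
      finally have "norm (kern c ?w \<theta>) \<le> norm (P ?w) + norm (P (?w + of_real (- \<theta>)) - P ?w) / N"
        using N0 by (simp add: field_simps)
      then show "norm (kern c ?w \<theta>) \<le> norm (P ?w) + norm (of_real (1 / N) * (P (?w + of_real (- \<theta>)) - P ?w))"
        using N0 by (simp add: norm_divide)
    qed
    also have "Lpn q (\<lambda>x. of_real (1 / N) * (P (Complex x y + of_real (- \<theta>)) - P (Complex x y))) = E / N"
      unfolding E_def using Lpn_cmult[OF q0, of "of_real (1 / N)"] N0 by (simp add: norm_divide)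
    also have "Hn q y P + E / N \<le> X + E / N" using HP by simp
    finally have main: "Lpn q (\<lambda>x. kern c (Complex x y) \<theta>) \<le> X + E / N" .
    have E0: "E \<ge> 0" by (simp add: E_def)
    have "E / N \<le> E / (2 * \<bar>\<theta>\<bar> / pi)" using N False E0 N0 by (intro divide_left_mono) auto
    then have EN: "E / N * \<bar>\<theta>\<bar> \<le> E * pi / 2" using False by (simp add: field_simps)
    have "E / N * y \<le> 2 * pi * X"
    proof -
      have "\<bar>\<theta>\<bar> * (E / N * y) \<le> (E * pi / 2) * y" using mult_right_mono[OF EN, of y] y by (simp add: mult_ac)
      also have "\<dots> \<le> (\<bar>\<theta>\<bar> * (4 * X / y) * pi / 2) * y" using E1 y by (intro mult_right_mono divide_right_mono) auto
      also have "\<dots> = \<bar>\<theta>\<bar> * (2 * pi * X)" using y by simp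
      finally show ?thesis by (rule mult_left_le_imp_le) (use False in simp)
    qed
    moreover have "E / N * \<bar>\<theta>\<bar> \<le> pi * X"
    proof -
      have "E * pi / 2 \<le> 2 * X * pi / 2" using E2 by (intro divide_right_mono mult_right_mono) auto
      also have "\<dots> = pi * X" by simp
      finally show ?thesis using EN by linarith
    qed
    \<comment> \<open>The bounded ranges of y and \<theta> absorb the term X without decay. The four
      contributions 4 pi, pi, 2 pi and pi add up to the constant 8 pi.\<close>
    moreover have "X * y \<le> X * (4 * pi)" "X * \<bar>\<theta>\<bar> \<le> X * pi" using X0 y t by (auto intro: mult_left_mono)
    moreover have "(X + E / N) * (y + \<bar>\<theta>\<bar>) = X * y + X * \<bar>\<theta>\<bar> + E / N * y + E / N * \<bar>\<theta>\<bar>"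
      by (simp only: distrib_left distrib_right add_ac)
    ultimately have "(X + E / N) * (y + \<bar>\<theta>\<bar>) \<le> X * (4 * pi) + X * pi + 2 * pi * X + pi * X"
      by linarith
    then have "(X + E / N) * (y + \<bar>\<theta>\<bar>) \<le> 8 * pi * X" by (simp only: mult_ac)
    moreover have "y + \<bar>\<theta>\<bar> > 0" using y by linarith
    ultimately have "X + E / N \<le> 8 * pi * X / (y + \<bar>\<theta>\<bar>)" by (simp add: pos_le_divide_eq)
    with main show ?thesis by (simp add: X_def mult_ac)
  qed
qed

text \<open>The derivative of the image is the integral of the function against \<open>kern\<close>
  for the differentiated symbol, and Minkowski moves the norm onto the kernel. The constant 4 is 8
  pi / (2 pi). A positive majorant \<open>\<phi>\<close> replaces the modulus because the Minkowski
  weight must not vanish.\<close>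

lemma Hn_rhaly_deriv_le:
  assumes c: "disc_series \<eta>" and q: "q \<ge> 1" and K: "K > 0"
    and H: "\<And>y. y > 0 \<Longrightarrow> Hn q y (deriv (lift (disc_fun \<eta>))) \<le> K * y powr (1 / q - 1)"
    and a: "disc_series a" and r: "0 \<le> r" "r < 1" and y: "0 < y" "y \<le> 4 * pi"
    and \<phi>: "continuous_on {-pi..pi} \<phi>" "\<And>\<theta>. norm (disc_fun a (of_real r * cis \<theta>)) \<le> \<phi> \<theta>" "\<And>\<theta>. \<phi> \<theta> > 0"
  shows "disc_series (\<lambda>n. \<eta> n * (\<Sum>k\<le>n. a k * of_real r ^ k))"
    "Hn q y (deriv (lift (disc_fun (\<lambda>n. \<eta> n * (\<Sum>k\<le>n. a k * of_real r ^ k))))) \<le> 4 * K * y powr (1 / q - 1) * Aop \<phi> y"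
proof -
  define d where "d = (\<lambda>n. \<i> * of_nat n * \<eta> n)"
  have d: "disc_series d" unfolding d_def by (rule disc_series_i_nat[OF c])
  let ?f = "\<lambda>\<theta>. disc_fun a (of_real r * cis \<theta>)"
  let ?S = "\<lambda>n. \<Sum>k\<le>n. a k * of_real r ^ k"
  show g: "disc_series (\<lambda>n. \<eta> n * ?S n)" by (rule integral_kern(2)[OF c a r, where w = \<i>]) simp
  have q0: "q > 0" using q by simp
  have HP: "Hn q v (lift (disc_fun d)) \<le> K * v powr (1 / q - 1)" if "v > 0" for v
    using H[OF that] deriv_lift_disc_fun[OF c] that by (simp add: d_def)
  have cf: "continuous_on S ?f" for S
    by (rule continuous_on_compose2[OF holomorphic_on_imp_continuous_on[OF disc_fun_holomorphic[OF a]]])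
       (use r in \<open>auto intro!: continuous_intros simp: norm_mult\<close>)
  let ?G = "lift (disc_fun (\<lambda>n. \<eta> n * ?S n))"
  have G: "deriv ?G w = of_real (1 / (2 * pi)) * integral {-pi..pi} (\<lambda>\<theta>. ?f \<theta> * kern d w \<theta>)" if w: "Im w > 0" for w
  proof -
    have "deriv ?G w = lift (disc_fun (\<lambda>n. d n * ?S n)) w"
      using deriv_lift_disc_fun[OF g w] by (simp add: d_def mult_ac)
    then show ?thesis using integral_kern(1)[OF d a r w] by simp
  qed
  have ne: "y + \<bar>\<theta>\<bar> > 0" for \<theta> using y by linarith
  have ne': "y + \<bar>\<theta>\<bar> \<noteq> 0" for \<theta> using ne[of \<theta>] by simp
  have ck: "continuous_on ({-pi..pi} \<times> {0..2*pi}) (\<lambda>(\<theta>, x). kern d (Complex x y) \<theta>)"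
    by (rule continuous_on_kern[OF d y(1)])
  define w where "w = (\<lambda>\<theta>. 4 * K * y powr (1 / q - 1) * (\<phi> \<theta> / (y + \<bar>\<theta>\<bar>)))"
  have "Hn q y (deriv ?G) \<le> integral {-pi..pi} w"
  proof (rule Lpn_minkowski_integral[OF q])
    show "continuous_on ({-pi..pi} \<times> {0..2*pi}) (\<lambda>(\<theta>, x). of_real (1 / (2 * pi)) * (?f \<theta> * kern d (Complex x y) \<theta>))"
      using ck unfolding case_prod_unfold
      by (intro continuous_on_mult continuous_on_const continuous_on_compose2[OF cf continuous_on_fst[OF continuous_on_id]]) auto
    show "continuous_on {-pi..pi} w"
      unfolding w_def using ne' by (intro continuous_on_mult continuous_on_const continuous_on_divide \<phi>(1) continuous_on_add continuous_on_rabs continuous_on_id) auto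
    show "w \<theta> > 0" for \<theta> unfolding w_def using K y \<phi>(3) ne by simp
    show "Lpn q (\<lambda>x. of_real (1 / (2 * pi)) * (?f \<theta> * kern d (Complex x y) \<theta>)) \<le> w \<theta>" if t: "\<theta> \<in> {-pi..pi}" for \<theta>
    proof -
      have t': "\<bar>\<theta>\<bar> \<le> pi" using t by auto
      have "Lpn q (\<lambda>x. (of_real (1 / (2 * pi)) * ?f \<theta>) * kern d (Complex x y) \<theta>) = 1 / (2 * pi) * norm (?f \<theta>) * Lpn q (\<lambda>x. kern d (Complex x y) \<theta>)"
        by (subst Lpn_cmult[OF q0]) (simp add: norm_mult norm_divide)
      also have "\<dots> \<le> 1 / (2 * pi) * \<phi> \<theta> * (8 * pi * K * y powr (1 / q - 1) / (y + \<bar>\<theta>\<bar>))"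
        using \<phi>(2)[of \<theta>] \<phi>(3)[of \<theta>] K by (intro mult_mono Lpn_kern_le[OF d q _ HP y t']) auto
      also have "\<dots> = w \<theta>" by (simp add: w_def)
      finally show ?thesis by (simp add: mult.assoc)
    qed
    show "continuous_on {0..2 * pi} (\<lambda>x. deriv ?G (Complex x y))"
      using y by (intro per_hol_line per_hol_deriv per_hol_lift_disc_fun g)
    fix x assume x: "x \<in> {0..2*pi}"
    have ckx: "continuous_on {-pi..pi} (\<lambda>\<theta>. kern d (Complex x y) \<theta>)"
      using continuous_on_sliceL[OF ck x] .
    have "deriv ?G (Complex x y) = integral {-pi..pi} (\<lambda>\<theta>. of_real (1 / (2 * pi)) * (?f \<theta> * kern d (Complex x y) \<theta>))"
      using G[of "Complex x y"] y integral_mult_right[of "{-pi..pi}" "of_real (1 / (2 * pi))"] by simp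
    also have "norm \<dots> \<le> integral {-pi..pi} (\<lambda>\<theta>. norm (of_real (1 / (2 * pi)) * (?f \<theta> * kern d (Complex x y) \<theta>)))"
      by (intro integral_norm_bound_integral integrable_continuous_interval continuous_on_norm continuous_on_mult continuous_on_const cf ckx) auto
    finally show "norm (deriv ?G (Complex x y)) \<le> integral {-pi..pi} (\<lambda>\<theta>. norm (of_real (1 / (2 * pi)) * (?f \<theta> * kern d (Complex x y) \<theta>)))" .
  qed simp
  also have "\<dots> = 4 * K * y powr (1 / q - 1) * Aop \<phi> y"
    unfolding w_def Aop_def by (rule integral_mult_right)
  finally show "Hn q y (deriv ?G) \<le> 4 * K * y powr (1 / q - 1) * Aop \<phi> y" .
qed

lemma Aop_pos:
  assumes "v > 0" "continuous_on {-pi..pi} \<phi>" "\<And>\<theta>. \<phi> \<theta> > 0"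
  shows "Aop \<phi> v > 0"
proof -
  have ne: "v + \<bar>\<theta>\<bar> > 0" for \<theta> using assms(1) by linarith
  have ne': "v + \<bar>\<theta>\<bar> \<noteq> 0" for \<theta> using ne[of \<theta>] by simp
  show ?thesis unfolding Aop_def
    using assms ne ne' by (intro integral_pos_continuous continuous_on_divide continuous_on_add continuous_on_rabs continuous_on_id continuous_on_const) auto
qed

text \<open>The second part holds because u / (u + |\<theta>|) increases with u. Together they say
  that \<open>Aop\<close> changes by at most a factor 2 when the height is doubled.\<close>

lemma Aop_antimono:
  assumes v: "0 < u" "u \<le> v" and c: "continuous_on {-pi..pi} \<phi>" "\<And>\<theta>. \<phi> \<theta> > 0"
  shows "Aop \<phi> v \<le> Aop \<phi> u" "u * Aop \<phi> u \<le> v * Aop \<phi> v"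
proof -
  have ne: "u + \<bar>\<theta>\<bar> > 0" "v + \<bar>\<theta>\<bar> > 0" for \<theta> using v by linarith+
  have ne': "u + \<bar>\<theta>\<bar> \<noteq> 0" "v + \<bar>\<theta>\<bar> \<noteq> 0" for \<theta> using ne[of \<theta>] by auto
  have cont: "continuous_on {-pi..pi} (\<lambda>\<theta>. \<phi> \<theta> / (u + \<bar>\<theta>\<bar>))" "continuous_on {-pi..pi} (\<lambda>\<theta>. \<phi> \<theta> / (v + \<bar>\<theta>\<bar>))"
    using c ne' by (auto intro!: continuous_on_divide continuous_on_add continuous_on_rabs continuous_on_id continuous_on_const)
  show "Aop \<phi> v \<le> Aop \<phi> u" unfolding Aop_def
    using c(2)[THEN less_imp_le] v ne by (intro integral_le integrable_continuous_interval cont divide_left_mono) auto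
  have "integral {-pi..pi} (\<lambda>\<theta>. u * (\<phi> \<theta> / (u + \<bar>\<theta>\<bar>))) \<le> integral {-pi..pi} (\<lambda>\<theta>. v * (\<phi> \<theta> / (v + \<bar>\<theta>\<bar>)))"
  proof (intro integral_le integrable_continuous_interval continuous_on_mult continuous_on_const cont)
    fix \<theta>
    have "u / (u + \<bar>\<theta>\<bar>) \<le> v / (v + \<bar>\<theta>\<bar>)"
      using v ne[of \<theta>] by (simp add: divide_simps mult_right_mono distrib_left mult.commute)
    from mult_right_mono[OF this less_imp_le[OF c(2)[of \<theta>]]]
    show "u * (\<phi> \<theta> / (u + \<bar>\<theta>\<bar>)) \<le> v * (\<phi> \<theta> / (v + \<bar>\<theta>\<bar>))" by simp
  qed
  then show "u * Aop \<phi> u \<le> v * Aop \<phi> v" unfolding Aop_def by (simp only: integral_mult_right)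
qed

text \<open>Cauchy's estimate once more, with \<open>Aop\<close> frozen at y/2 at the cost of a
  factor 2. Heights up to 3y/2 are used, so the bound 8/3 pi on y keeps them below 4 pi.\<close>

lemma Hn_second_deriv_le:
  assumes U: "per_hol U" and q: "q \<ge> 1" and y: "0 < y" "y \<le> 8 / 3 * pi" and M: "M > 0"
    and c: "continuous_on {-pi..pi} \<phi>" "\<And>\<theta>. \<phi> \<theta> > 0"
    and H: "\<And>v. 0 < v \<Longrightarrow> v \<le> 4 * pi \<Longrightarrow> Hn q v (deriv U) \<le> M * v powr (1 / q - 1) * Aop \<phi> v"
  shows "Hn q y (deriv (deriv U)) \<le> 8 * M * y powr (1 / q - 2) * Aop \<phi> y"
proof -
  have A: "Aop \<phi> y > 0" "Aop \<phi> (y / 2) > 0" using y by (auto intro!: Aop_pos c)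
  have "Hn q y (deriv (deriv U)) \<le> 4 * (M * Aop \<phi> (y / 2)) * y powr (1 / q - 2)"
  proof (rule Hn_deriv_le_powr[OF per_hol_deriv[OF U] q y(1)])
    fix v assume v: "y / 2 \<le> v" "v \<le> 3 / 2 * y"
    have v0: "0 < v" "v \<le> 4 * pi" using v y by linarith+
    have "Hn q v (deriv U) \<le> M * v powr (1 / q - 1) * Aop \<phi> v" by (rule H[OF v0])
    also have "\<dots> \<le> M * v powr (1 / q - 1) * Aop \<phi> (y / 2)"
      using M v v0 y c by (intro mult_left_mono Aop_antimono(1)) auto
    finally show "Hn q v (deriv U) \<le> M * Aop \<phi> (y / 2) * v powr (1 / q - 1)" by (simp add: mult_ac)
  qed (use M A in auto)
  also have "\<dots> \<le> 4 * (M * (2 * Aop \<phi> y)) * y powr (1 / q - 2)"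
  proof -
    have "y / 2 * Aop \<phi> (y / 2) \<le> y * Aop \<phi> y" using y c by (intro Aop_antimono(2)) auto
    then have "Aop \<phi> (y / 2) \<le> 2 * Aop \<phi> y" using y by simp
    then show ?thesis using M by (intro mult_left_mono mult_right_mono) auto
  qed
  finally show ?thesis by (simp add: mult_ac)
qed

section \<open>Dyadic averages\<close>

lemma powr_sum4_le:
  fixes a b c d :: real
  assumes "p > 0" "a \<ge> 0" "b \<ge> 0" "c \<ge> 0" "d \<ge> 0"
  shows "(a + b + c + d) powr p \<le> 4 powr p * (a powr p + b powr p + c powr p + d powr p)"
proof -
  define m where "m = max (max a b) (max c d)"
  have m: "a \<le> m" "b \<le> m" "c \<le> m" "d \<le> m" "m \<ge> 0" using assms by (auto simp: m_def)
  have "(a + b + c + d) powr p \<le> (4 * m) powr p" using assms m by (intro powr_mono2) auto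
  also have "\<dots> = 4 powr p * m powr p" by (rule powr_mult)
  also have "m powr p \<le> a powr p + b powr p + c powr p + d powr p"
  proof -
    have "m = a \<or> m = b \<or> m = c \<or> m = d" by (auto simp: m_def max_def)
    then show ?thesis
      using powr_ge_zero[of a p] powr_ge_zero[of b p] powr_ge_zero[of c p] powr_ge_zero[of d p]
      by (elim disjE) auto
  qed
  finally show ?thesis by simp
qed

lemma powr_add_le2:
  fixes a b :: real
  assumes "p > 0" "a \<ge> 0" "b \<ge> 0"
  shows "(a + b) powr p \<le> 4 powr p * (a powr p + b powr p)"
  using powr_sum4_le[OF assms, of 0 0] assms by simp

text \<open>Clarkson's inequality replaces the orthogonality of martingale differences.\<close>

lemma clarkson_le:
  fixes m d :: complex
  assumes p: "1 < p" "p \<le> 2"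
  shows "norm (m + d) powr p + norm (m - d) powr p \<le> 2 * norm m powr p + 2 * norm d powr p"
proof (cases "m = 0 \<or> d = 0")
  case True
  then show ?thesis using p by auto
next
  case False
  define s where "s = p / 2"
  have s: "0 < s" "s \<le> 1" using p by (auto simp: s_def)
  define a b where "a = (norm m)\<^sup>2" and "b = (norm d)\<^sup>2"
  have ab: "a > 0" "b > 0" using False by (auto simp: a_def b_def)
  define x where "x = a + b"
  have x: "x > 0" using ab by (simp add: x_def)
  have sq: "(z::real) powr p = (z\<^sup>2) powr s" if "z \<ge> 0" for z
    using that by (simp add: s_def powr_powr flip: powr_numeral)
  \<comment> \<open>The concave function t^s lies below its tangent at x. By the parallelogram law x
    is the mean of |m + d|^2 and |m - d|^2, so the linear terms cancel in the sum.\<close>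
  have tang: "t powr s \<le> x powr (s - 1) * (s * t + (1 - s) * x)" if t: "t \<ge> 0" for t
  proof (cases "t = 0")
    case True
    then show ?thesis using s x by simp
  next
    case False
    then have "t powr s * x powr (1 - s) \<le> s * t + (1 - s) * x"
      using s x t by (intro Youngs_inequality_0) auto
    from mult_left_mono[OF this, of "x powr (s - 1)"]
    have "t powr s * (x powr (s - 1) * x powr (1 - s)) \<le> x powr (s - 1) * (s * t + (1 - s) * x)"
      by (simp add: mult_ac)
    then show ?thesis using x by (simp flip: powr_add)
  qed
  have par: "(norm (m + d))\<^sup>2 + (norm (m - d))\<^sup>2 = 2 * x"
    unfolding x_def a_def b_def cmod_power2 by (simp add: power2_eq_square algebra_simps)
  have "norm (m + d) powr p + norm (m - d) powr p = ((norm (m + d))\<^sup>2) powr s + ((norm (m - d))\<^sup>2) powr s"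
    by (simp add: sq)
  also have "\<dots> \<le> x powr (s - 1) * (s * (norm (m + d))\<^sup>2 + (1 - s) * x) + x powr (s - 1) * (s * (norm (m - d))\<^sup>2 + (1 - s) * x)"
    by (intro add_mono tang) auto
  also have "\<dots> = x powr (s - 1) * (s * ((norm (m + d))\<^sup>2 + (norm (m - d))\<^sup>2) + 2 * (1 - s) * x)"
    by (simp add: algebra_simps)
  also have "\<dots> = 2 * (x powr (s - 1) * x)" unfolding par by (simp add: algebra_simps)
  also have "x powr (s - 1) * x = x powr s" using x by (simp add: powr_diff)
  also have "x powr s \<le> a powr s + b powr s" unfolding x_def using ab s by (intro powr_add_le) auto
  also have "a powr s + b powr s = norm m powr p + norm d powr p" by (simp add: sq a_def b_def)
  finally show ?thesis by simp
qed

lemma sum_lessThan_double: "(\<Sum>j<2 * n. f j) = (\<Sum>j<n. f (2 * j) + f (Suc (2 * j)))"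
  for f :: "nat \<Rightarrow> 'a::comm_monoid_add"
  by (induction n) (auto simp: add_ac)

text \<open>At each height the samples are estimated by \<open>sum_samples_le\<close>; the resulting
  bound on the p-norm of y |U'| over the sample points is proportional to \<open>Aop\<close>. Jensen
  with \<open>Aop\<close> as weight then carries this through the vertical integral.\<close>

lemma sum_vertical_samples_le:
  assumes U: "per_hol U" and p: "p \<ge> 1" and e: "\<eta> > 0" and h: "0 < h" "h \<le> d" and nd: "real n * d = 2 * pi" and d: "d \<le> 2 * pi" "\<eta> \<le> 1"
    and M: "M > 0" and c: "continuous_on {-pi..pi} \<phi>" "\<And>\<theta>. \<phi> \<theta> > 0"
    and H: "\<And>v. 0 < v \<Longrightarrow> v \<le> 4 * pi \<Longrightarrow> Hn p v (deriv U) \<le> M * v powr (1 / p - 1) * Aop \<phi> v"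
  shows "(\<Sum>j<n. (integral {0..h} (\<lambda>y. y * norm (deriv U (Complex (b + real j * d) (y + \<eta>))))) powr p)
     \<le> 2 powr (p - 1) * (2 * pi) * (1 + 8 powr p) * M powr p * (integral {0..h} (\<lambda>y. Aop \<phi> (y + \<eta>))) powr p"
proof -
  define C where "C = 2 powr (p - 1) * (2 * pi) * (1 + 8 powr p) * M powr p"
  have C: "C \<ge> 0" by (simp add: C_def)
  have p0: "p > 0" using p by simp
  define A where "A = (\<lambda>y. Aop \<phi> (y + \<eta>))"
  have A: "y \<ge> 0 \<Longrightarrow> A y > 0" for y unfolding A_def using e by (intro Aop_pos c) auto
  have cA: "continuous_on {0..h} A" unfolding A_def using Aop_swap(2)[OF e order_refl c(1), of h "\<lambda>_. 0"] by simp
  define V where "V = (\<lambda>j y. norm (deriv U (Complex (b + real j * d) (y + \<eta>))))"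
  have cV: "continuous_on {0..h} (V j)" for j
    unfolding V_def using e by (intro continuous_on_norm per_hol_continuous_compose[OF per_hol_deriv[OF U]]) (auto intro!: continuous_intros)
  have samples: "y powr p * (\<Sum>j<n. V j y powr p) \<le> C * A y powr p" if y: "0 \<le> y" "y \<le> h" for y
  proof (cases "y = 0")
    case True
    then show ?thesis using C p0 by simp
  next
    case False
    then have y0: "y > 0" using y by simp
    define v where "v = y + \<eta>"
    have v: "v > 0" "y \<le> v" using y0 e by (auto simp: v_def)
    \<comment> \<open>v is at most 2 pi + 1, and 1 is less than 2/3 pi.\<close>
    have vle: "v \<le> 8 / 3 * pi" using y h d pi_gt3 unfolding v_def by linarith
    have U': "per_hol (deriv U)" by (rule per_hol_deriv[OF U])
    have 1: "Hn p v (deriv U) powr p \<le> M powr p * y powr (1 - p) * A y powr p"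
    proof -
      have "Hn p v (deriv U) powr p \<le> (M * v powr (1 / p - 1) * A y) powr p"
        using H[of v] v vle p0 unfolding A_def v_def by (intro powr_mono2) auto
      also have "\<dots> = M powr p * v powr (1 - p) * A y powr p"
        using p0 by (simp add: powr_mult powr_powr left_diff_distrib)
      also have "\<dots> \<le> M powr p * y powr (1 - p) * A y powr p"
        using p v y0 by (intro mult_left_mono mult_right_mono powr_mono2') auto
      finally show ?thesis .
    qed
    have 2: "Hn p v (deriv (deriv U)) powr p \<le> 8 powr p * M powr p * y powr (1 - 2 * p) * A y powr p"
    proof -
      have "Hn p v (deriv (deriv U)) powr p \<le> (8 * M * v powr (1 / p - 2) * A y) powr p"
        using Hn_second_deriv_le[OF U p v(1) vle M c H] p0 unfolding A_def v_def by (intro powr_mono2) auto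
      also have "\<dots> = 8 powr p * M powr p * v powr (1 - 2 * p) * A y powr p"
        using p0 by (simp add: powr_mult powr_powr left_diff_distrib)
      also have "\<dots> \<le> 8 powr p * M powr p * y powr (1 - 2 * p) * A y powr p"
        using p v y0 by (intro mult_left_mono mult_right_mono powr_mono2') auto
      finally show ?thesis .
    qed
    \<comment> \<open>The sampling blocks have length y, which balances the two terms: both become
      of order y^(-p).\<close>
    have "(\<Sum>j<n. V j y powr p) \<le> 2 powr (p - 1) * (2 * pi) * (Hn p v (deriv U) powr p / y + y powr (p - 1) * Hn p v (deriv (deriv U)) powr p)"
      unfolding V_def v_def[symmetric] using y h by (intro sum_samples_le[OF U' p v(1) y0 _ nd]) auto
    also have "\<dots> \<le> 2 powr (p - 1) * (2 * pi) * ((M powr p * y powr (1 - p) * A y powr p) / y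
        + y powr (p - 1) * (8 powr p * M powr p * y powr (1 - 2 * p) * A y powr p))"
      using y0 by (intro mult_left_mono add_mono divide_right_mono 1 2) auto
    also have "\<dots> = C * (y powr (- p) * A y powr p)"
    proof -
      have e1: "y powr (1 - p) / y = y powr (- p)" using y0 by (simp add: powr_diff powr_minus divide_simps)
      have e2: "y powr (p - 1) * y powr (1 - 2 * p) = y powr (- p)" by (simp add: powr_add[symmetric])
      have "(M powr p * y powr (1 - p) * A y powr p) / y = M powr p * (y powr (1 - p) / y) * A y powr p" by simp
      moreover have "y powr (p - 1) * (8 powr p * M powr p * y powr (1 - 2 * p) * A y powr p)
         = 8 powr p * M powr p * (y powr (p - 1) * y powr (1 - 2 * p)) * A y powr p" by (simp only: mult_ac)
      ultimately show ?thesis unfolding e1 e2 C_def by (simp add: algebra_simps)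
    qed
    finally have "y powr p * (\<Sum>j<n. V j y powr p) \<le> y powr p * (C * (y powr (- p) * A y powr p))"
      by (intro mult_left_mono) auto
    also have "\<dots> = C * A y powr p" using y0 by (simp add: powr_minus)
    finally show ?thesis .
  qed
  define I where "I = integral {0..h} A"
  have I: "I > 0" unfolding I_def using h A by (intro integral_pos_continuous cA) auto
  have cterm: "continuous_on {0..h} (\<lambda>y. (y * V j y) powr p * A y powr (1 - p))" for j
    using A p0 by (intro continuous_on_mult continuous_on_powr' continuous_on_id cV cA continuous_on_const)
      (auto simp: V_def dest!: A)
  have "(\<Sum>j<n. (integral {0..h} (\<lambda>y. y * V j y)) powr p)
     \<le> (\<Sum>j<n. I powr (p - 1) * integral {0..h} (\<lambda>y. (y * V j y) powr p * A y powr (1 - p)))"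
    unfolding I_def using p h A
    by (intro sum_mono integral_powr_le_weighted continuous_on_mult continuous_on_id cV cA) (auto simp: V_def)
  also have "\<dots> = I powr (p - 1) * (\<Sum>j<n. integral {0..h} (\<lambda>y. (y * V j y) powr p * A y powr (1 - p)))"
    by (rule sum_distrib_left[symmetric])
  also have "(\<Sum>j<n. integral {0..h} (\<lambda>y. (y * V j y) powr p * A y powr (1 - p)))
      = integral {0..h} (\<lambda>y. \<Sum>j<n. (y * V j y) powr p * A y powr (1 - p))"
    by (intro integral_sum[symmetric] integrable_continuous_interval cterm) auto
  also have "I powr (p - 1) * integral {0..h} (\<lambda>y. \<Sum>j<n. (y * V j y) powr p * A y powr (1 - p))
     \<le> I powr (p - 1) * integral {0..h} (\<lambda>y. C * A y)"
  proof (intro mult_left_mono integral_le integrable_continuous_interval continuous_on_sum cterm)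
    show "continuous_on {0..h} (\<lambda>y. C * A y)" by (intro continuous_on_mult continuous_on_const cA)
    fix y assume y: "y \<in> {0..h}"
    have "(\<Sum>j<n. (y * V j y) powr p * A y powr (1 - p)) = (y powr p * (\<Sum>j<n. V j y powr p)) * A y powr (1 - p)"
      by (simp add: powr_mult sum_distrib_left sum_distrib_right)
    also have "\<dots> \<le> (C * A y powr p) * A y powr (1 - p)" using y by (intro mult_right_mono samples) auto
    also have "\<dots> = C * A y" using A[of y] y by (simp add: mult.assoc flip: powr_add)
    finally show "(\<Sum>j<n. (y * V j y) powr p * A y powr (1 - p)) \<le> C * A y" .
  qed auto
  also have "\<dots> = C * (I powr (p - 1) * I)" by (simp add: I_def)
  also have "I powr (p - 1) * I = I powr p" using I by (simp add: powr_diff)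
  finally show ?thesis by (simp add: V_def C_def I_def A_def)
qed

text \<open>The second difference of a primitive, computed by moving the points up by \<open>h\<close>.\<close>

lemma second_difference_le:
  assumes U: "per_hol U" and e: "\<eta> > 0" and h: "h > 0"
    and G: "\<And>w. Im w > 0 \<Longrightarrow> (\<Gamma> has_field_derivative U w) (at w)"
  shows "norm (\<Gamma> (Complex (a + 2 * h) \<eta>) - 2 * \<Gamma> (Complex (a + h) \<eta>) + \<Gamma> (Complex a \<eta>))
    \<le> 2 * h * integral {a..a + 2 * h} (\<lambda>s. norm (deriv U (Complex s (h + \<eta>))))
      + integral {0..h} (\<lambda>y. y * norm (deriv U (Complex a (y + \<eta>))))
      + 2 * integral {0..h} (\<lambda>y. y * norm (deriv U (Complex (a + h) (y + \<eta>))))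
      + integral {0..h} (\<lambda>y. y * norm (deriv U (Complex (a + 2 * h) (y + \<eta>))))"
proof -
  define t where "t = h + \<eta>"
  have t: "t > 0" using e h by (simp add: t_def)
  have U': "per_hol (deriv U)" by (rule per_hol_deriv[OF U])
  define T where "T = (\<lambda>x. integral {0..h} (\<lambda>y. of_real y * deriv U (Complex x (y + \<eta>))))"
  define \<Gamma>' where "\<Gamma>' = (\<lambda>x. \<Gamma> (Complex x t) - \<i> * of_real h * U (Complex x t))"
  have hor: "((\<lambda>x. Complex x y) has_vector_derivative 1) (at x within S)" for x y S
    using has_vector_derivative_add[OF has_vector_derivative_of_real[OF DERIV_ident] has_vector_derivative_const[of "\<i> * of_real y"]]
    by (simp add: Complex_eq)
  have ver: "((\<lambda>y. Complex x (y + \<eta>)) has_vector_derivative \<i>) (at y within S)" for x y S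
  proof -
    have "((\<lambda>y. of_real x + \<i> * of_real \<eta> + \<i> * of_real y) has_vector_derivative 0 + \<i> * of_real 1) (at y within S)"
      by (intro has_vector_derivative_add has_vector_derivative_const has_vector_derivative_mult_right
          has_vector_derivative_of_real DERIV_ident)
    then show ?thesis by (simp add: Complex_eq algebra_simps)
  qed
  have dG: "((\<lambda>s. \<Gamma> (f s)) has_vector_derivative f' * U (f s)) (at s within S)"
    if "(f has_vector_derivative f') (at s within S)" "Im (f s) > 0" for f f' s S
    using field_vector_diff_chain_within[OF that(1) has_field_derivative_at_within[OF G[OF that(2)]]]
    by (simp add: o_def mult.commute)
  have cV: "continuous_on {0..h} (\<lambda>y. deriv U (Complex x (y + \<eta>)))" for x
    using e by (intro per_hol_continuous_compose[OF U']) (auto intro!: continuous_intros)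
  have cH: "continuous_on S (\<lambda>s. deriv U (Complex s t))" "continuous_on S (\<lambda>s. U (Complex s t))" for S
    using t by (auto intro!: per_hol_line U U')
  \<comment> \<open>A Taylor formula with integral remainder in the vertical direction: the
    derivative of \<Gamma> - i y U along the segment is y U'.\<close>
  have Teq: "\<Gamma> (Complex x \<eta>) = \<Gamma>' x - T x" for x
  proof -
    define F where "F = (\<lambda>y. \<Gamma> (Complex x (y + \<eta>)) - \<i> * of_real y * U (Complex x (y + \<eta>)))"
    have "((\<lambda>y. of_real y * deriv U (Complex x (y + \<eta>))) has_integral F h - F 0) {0..h}"
    proof (rule fundamental_theorem_of_calculus)
      fix y :: real assume y: "y \<in> {0..h}"
      have pos: "Im (Complex x (y + \<eta>)) > 0" using y e by simp
      have "(F has_vector_derivative \<i> * U (Complex x (y + \<eta>)) -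
          ((\<i> * of_real y) * (\<i> * deriv U (Complex x (y + \<eta>))) + (\<i> * of_real 1) * U (Complex x (y + \<eta>)))) (at y within {0..h})"
        unfolding F_def
        by (intro has_vector_derivative_diff dG[OF ver pos] has_vector_derivative_mult
            has_vector_derivative_mult_right has_vector_derivative_of_real DERIV_ident has_vector_derivative_per_hol[OF U ver pos])
      then show "(F has_vector_derivative of_real y * deriv U (Complex x (y + \<eta>))) (at y within {0..h})"
        by (simp add: algebra_simps)
    qed (use h in auto)
    then have "T x = F h - F 0" unfolding T_def by (rule integral_unique)
    then show ?thesis by (simp add: F_def \<Gamma>'_def t_def)
  qed
  have Tle: "norm (T x) \<le> integral {0..h} (\<lambda>y. y * norm (deriv U (Complex x (y + \<eta>))))" for x
    unfolding T_def
    by (intro integral_norm_bound_integral integrable_continuous_interval continuous_on_mult cV continuous_on_norm continuous_on_of_real continuous_on_id)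
       (simp add: norm_mult)
  define J where "J = integral {a..a + 2 * h} (\<lambda>s. norm (deriv U (Complex s t)))"
  have Udiff: "norm (U (Complex v t) - U (Complex u t)) \<le> integral {u..v} (\<lambda>s. norm (deriv U (Complex s t)))" if "u \<le> v" for u v
  proof -
    have "((\<lambda>s. deriv U (Complex s t)) has_integral U (Complex v t) - U (Complex u t)) {u..v}"
      using that has_vector_derivative_per_hol[OF U hor, of _ t] t
      by (intro fundamental_theorem_of_calculus) auto
    then have "U (Complex v t) - U (Complex u t) = integral {u..v} (\<lambda>s. deriv U (Complex s t))" by (simp add: integral_unique)
    also have "norm \<dots> \<le> integral {u..v} (\<lambda>s. norm (deriv U (Complex s t)))"
      by (intro integral_norm_bound_integral integrable_continuous_interval cH continuous_on_norm) auto
    finally show ?thesis .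
  qed
  have Jsub: "integral {u..v} (\<lambda>s. norm (deriv U (Complex s t))) \<le> J" if "a \<le> u" "v \<le> a + 2 * h" for u v
    unfolding J_def using that by (intro integral_subset_le integrable_continuous_interval cH continuous_on_norm) auto
  \<comment> \<open>At the upper height the second difference of the primitive is the integral of a
    first difference of U, hence controlled by U' on the line.\<close>
  have "((\<lambda>s. U (Complex (s + h) t) - U (Complex s t)) has_integral
      (\<Gamma> (Complex (a + h + h) t) - \<Gamma> (Complex (a + h) t)) - (\<Gamma> (Complex (a + h) t) - \<Gamma> (Complex a t))) {a..a + h}"
  proof (rule has_integral_diff)
    have hor': "((\<lambda>s. Complex (s + h) t) has_vector_derivative 1) (at x within S)" for x S
    proof -
      have "((\<lambda>s. of_real h + \<i> * of_real t + of_real s) has_vector_derivative 0 + of_real 1) (at x within S)"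
        by (intro has_vector_derivative_add has_vector_derivative_const has_vector_derivative_of_real DERIV_ident)
      then show ?thesis by (simp add: Complex_eq algebra_simps)
    qed
    show "((\<lambda>s. U (Complex (s + h) t)) has_integral \<Gamma> (Complex (a + h + h) t) - \<Gamma> (Complex (a + h) t)) {a..a + h}"
      using h dG[OF hor'] t by (intro fundamental_theorem_of_calculus) auto
    show "((\<lambda>s. U (Complex s t)) has_integral \<Gamma> (Complex (a + h) t) - \<Gamma> (Complex a t)) {a..a + h}"
      using h dG[OF hor] t by (intro fundamental_theorem_of_calculus) auto
  qed
  then have g1: "\<Gamma> (Complex (a + 2 * h) t) - 2 * \<Gamma> (Complex (a + h) t) + \<Gamma> (Complex a t) = integral {a..a + h} (\<lambda>s. U (Complex (s + h) t) - U (Complex s t))"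
    by (simp add: integral_unique algebra_simps)
  have "norm (integral {a..a + h} (\<lambda>s. U (Complex (s + h) t) - U (Complex s t))) \<le> integral {a..a + h} (\<lambda>s. J)"
  proof (intro integral_norm_bound_integral integrable_continuous_interval)
    show "continuous_on {a..a + h} (\<lambda>s. U (Complex (s + h) t) - U (Complex s t))"
      using t by (intro continuous_on_diff cH per_hol_continuous_compose[OF U]) (auto intro!: continuous_intros)
    fix s assume s: "s \<in> {a..a + h}"
    have "norm (U (Complex (s + h) t) - U (Complex s t)) \<le> integral {s..s + h} (\<lambda>s. norm (deriv U (Complex s t)))"
      using h by (intro Udiff) auto
    also have "\<dots> \<le> J" using s by (intro Jsub) auto
    finally show "norm (U (Complex (s + h) t) - U (Complex s t)) \<le> J" .
  qed auto
  then have g2: "norm (\<Gamma> (Complex (a + 2 * h) t) - 2 * \<Gamma> (Complex (a + h) t) + \<Gamma> (Complex a t)) \<le> h * J"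
    unfolding g1 using h by simp
  have u2: "norm (U (Complex (a + 2 * h) t) - 2 * U (Complex (a + h) t) + U (Complex a t)) \<le> J"
  proof -
    have "U (Complex (a + 2 * h) t) - 2 * U (Complex (a + h) t) + U (Complex a t)
      = (U (Complex (a + 2 * h) t) - U (Complex (a + h) t)) - (U (Complex (a + h) t) - U (Complex a t))" by simp
    also have "norm \<dots> \<le> norm (U (Complex (a + 2 * h) t) - U (Complex (a + h) t)) + norm (U (Complex (a + h) t) - U (Complex a t))"
      by (rule norm_triangle_ineq4)
    also have "\<dots> \<le> integral {a + h..a + 2 * h} (\<lambda>s. norm (deriv U (Complex s t))) + integral {a..a + h} (\<lambda>s. norm (deriv U (Complex s t)))"
      using h by (intro add_mono Udiff) auto
    also have "\<dots> = J"
      unfolding J_def using h Henstock_Kurzweil_Integration.integral_combine[of a "a + h" "a + 2 * h" "\<lambda>s. norm (deriv U (Complex s t))"]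
      by (simp add: add.commute integrable_continuous_interval continuous_on_norm cH)
    finally show ?thesis .
  qed
  have "\<Gamma> (Complex (a + 2 * h) \<eta>) - 2 * \<Gamma> (Complex (a + h) \<eta>) + \<Gamma> (Complex a \<eta>)
    = (\<Gamma> (Complex (a + 2 * h) t) - 2 * \<Gamma> (Complex (a + h) t) + \<Gamma> (Complex a t))
      - \<i> * of_real h * (U (Complex (a + 2 * h) t) - 2 * U (Complex (a + h) t) + U (Complex a t))
      - T a + 2 * T (a + h) - T (a + 2 * h)"
    unfolding Teq \<Gamma>'_def by (simp add: algebra_simps)
  also have "norm \<dots> \<le> h * J + h * J + norm (T a) + 2 * norm (T (a + h)) + norm (T (a + 2 * h))"
  proof -
    have "norm (\<i> * of_real h * (U (Complex (a + 2 * h) t) - 2 * U (Complex (a + h) t) + U (Complex a t))) \<le> h * J"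
      using u2 h by (simp add: norm_mult mult_left_mono)
    moreover have "norm (X - Y - A + 2 * B - D) \<le> norm X + norm Y + norm A + 2 * norm B + norm D" for X Y A B D :: complex
      using norm_triangle_ineq4[of "X - Y - A + 2 * B" D] norm_triangle_ineq[of "X - Y - A" "2 * B"]
        norm_triangle_ineq4[of "X - Y" A] norm_triangle_ineq4[of X Y] by (simp add: norm_mult)
    ultimately show ?thesis using g2 by (smt (verit))
  qed
  also have "\<dots> \<le> h * J + h * J + integral {0..h} (\<lambda>y. y * norm (deriv U (Complex a (y + \<eta>))))
      + 2 * integral {0..h} (\<lambda>y. y * norm (deriv U (Complex (a + h) (y + \<eta>))))
      + integral {0..h} (\<lambda>y. y * norm (deriv U (Complex (a + 2 * h) (y + \<eta>))))"
    using Tle[of a] Tle[of "a + h"] Tle[of "a + 2 * h"] by linarith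
  finally show ?thesis by (simp add: J_def t_def)
qed

lemma sum_integral_blocks_eq:
  fixes g :: "real \<Rightarrow> real"
  assumes c: "continuous_on UNIV g" and d: "0 \<le> d"
  shows "(\<Sum>j<n. integral {b + real j * d..b + real j * d + d} g) = integral {b..b + real n * d} g"
proof (induction n)
  case (Suc n)
  have int: "g integrable_on {s..t}" for s t
    using c by (intro integrable_continuous_interval) (rule continuous_on_subset, auto)
  have "integral {b..b + real n * d} g + integral {b + real n * d..b + real n * d + d} g = integral {b..b + real n * d + d} g"
    using d by (intro Henstock_Kurzweil_Integration.integral_combine int) auto
  with Suc show ?case by (simp add: algebra_simps)
qed simp

lemma Hn_powr_le_weighted:
  assumes p: "p \<ge> 1" and c: "continuous_on {-pi..pi} \<phi>" "\<And>\<theta>. \<phi> \<theta> > 0" and M: "M > 0"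
    and y: "0 < y" "y \<le> v" and H: "Hn p v W \<le> M * v powr (1 / p - 1) * Aop \<phi> v"
  shows "Hn p v W powr p \<le> M powr p * y powr (1 - p) * Aop \<phi> v powr p"
proof -
  have "Hn p v W powr p \<le> (M * v powr (1 / p - 1) * Aop \<phi> v) powr p"
    using H p by (intro powr_mono2) auto
  also have "\<dots> = M powr p * v powr (1 - p) * Aop \<phi> v powr p"
    using p by (simp add: powr_mult powr_powr left_diff_distrib)
  also have "\<dots> \<le> M powr p * y powr (1 - p) * Aop \<phi> v powr p"
    using p y by (intro mult_left_mono mult_right_mono powr_mono2') auto
  finally show ?thesis .
qed

text \<open>The line of height \<eta> is cut into 2^k equal arcs and U is replaced by its averages
  on them. Halving the arcs turns an average g into g + d and g - d, so by Clarkson the p-norm grows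
  only by the sum of |d|^p. Each d is a second difference of a primitive, and the sums of |d|^p over
  one scale are bounded by \<open>Sop\<close> at that scale, to which the Schur test
  applies.\<close>

lemma dyadic_bound:
  assumes p: "1 < p" "p \<le> 2"
  shows "\<exists>C>0. \<forall>U \<phi> \<eta> M m. per_hol U \<longrightarrow> 0 < \<eta> \<longrightarrow> \<eta> \<le> 1 \<longrightarrow> M > 0 \<longrightarrow> continuous_on {-pi..pi} \<phi> \<longrightarrow> (\<forall>\<theta>. \<phi> \<theta> > 0) \<longrightarrow>
    (\<forall>v. 0 < v \<longrightarrow> v \<le> 4 * pi \<longrightarrow> Hn p v (deriv U) \<le> M * v powr (1 / p - 1) * Aop \<phi> v) \<longrightarrow>
    (\<forall>v>0. norm (integral {0..2*pi} (\<lambda>x. U (Complex x v))) \<le> 2 * pi * m) \<longrightarrow>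
    Hn p \<eta> U powr p \<le> C * (m powr p + M powr p * integral {-pi..pi} (\<lambda>\<theta>. \<phi> \<theta> powr p))"
proof -
  have p1: "p \<ge> 1" and p0: "p > 0" using p by auto
  \<comment> \<open>The instance with exponent 1 is taken: sampling has already absorbed the power
    of the height, so \<open>Aop\<close> is integrated without weight.\<close>
  obtain \<delta> C1 where \<delta>: "\<delta> > 0" and C1: "C1 > 0"
    and AS: "\<And>\<eta> \<phi> h. 0 < \<eta> \<Longrightarrow> 0 < h \<Longrightarrow> h \<le> 2 * pi \<Longrightarrow> continuous_on {-pi..pi} \<phi> \<Longrightarrow> (\<forall>\<theta>. \<phi> \<theta> \<ge> 0) \<Longrightarrow>
     integral {0..h} (\<lambda>y. (y + \<eta>) powr (1 / 1 - 1) * Aop \<phi> (y + \<eta>)) \<le> C1 * h powr (1 / 1) * Sop p \<delta> \<eta> \<phi> h \<and>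
     integral {h..2 * pi} (\<lambda>y. 1 / (y + \<eta>) * Aop \<phi> (y + \<eta>)) \<le> C1 * Sop p \<delta> \<eta> \<phi> h \<and>
     Aop \<phi> (h + \<eta>) \<le> C1 * Sop p \<delta> \<eta> \<phi> h"
    using Aop_le_Sop[of 1 p] p(1) by auto
  define c where "c = 2 powr (p - 1) * (2 * pi) * (1 + 8 powr p)"
  define C2 where "C2 = 4 * 4 powr p * c * C1 powr p"
  define C3 where "C3 = (2 / \<delta>) powr (p - 1) * (2 powr \<delta> / (2 powr \<delta> - 1))"
  have c: "c > 0" unfolding c_def by (intro mult_pos_pos add_pos_nonneg) auto
  have C2: "C2 > 0" using c C1 by (simp add: C2_def)
  have C3: "C3 > 0" using \<delta> by (simp add: C3_def)
  define C where "C = 4 powr p * (2 * pi + 2 * C2 * C3)"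
  have C: "C > 0" unfolding C_def using C2 C3 by (intro mult_pos_pos add_pos_pos) auto
  have main: "Hn p \<eta> U powr p \<le> C * (m powr p + M powr p * integral {-pi..pi} (\<lambda>\<theta>. \<phi> \<theta> powr p))"
    if U: "per_hol U" and e: "0 < \<eta>" "\<eta> \<le> 1" and M: "M > 0" and cphi: "continuous_on {-pi..pi} \<phi>" and phi: "\<And>\<theta>. \<phi> \<theta> > 0"
      and H: "\<And>v. 0 < v \<Longrightarrow> v \<le> 4 * pi \<Longrightarrow> Hn p v (deriv U) \<le> M * v powr (1 / p - 1) * Aop \<phi> v"
      and m: "norm (integral {0..2*pi} (\<lambda>x. U (Complex x \<eta>))) \<le> 2 * pi * m"
    for U \<phi> \<eta> M m
  proof -
    define S where "S = Sop p \<delta> \<eta> \<phi>"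
    define h where "h = (\<lambda>k::nat. 2 * pi / 2 ^ k)"
    have h: "h k > 0" "h k \<le> 2 * pi" "h k = 2 * h (Suc k)" "real (2 ^ k) * h k = 2 * pi" for k
      by (auto simp: h_def divide_simps)
    have phi0: "\<forall>\<theta>. \<phi> \<theta> \<ge> 0" using phi by (simp add: less_imp_le)
    have cu: "continuous_on S (\<lambda>x. U (Complex x \<eta>))" for S using e by (intro per_hol_line U)
    obtain \<Gamma> where \<Gamma>: "\<And>w. w \<in> uhp \<Longrightarrow> (\<Gamma> has_field_derivative U w) (at w)"
    proof -
      have "convex uhp" unfolding uhp_def by (rule convex_halfspace_Im_gt)
      from holomorphic_convex_primitive'[OF this open_uhp per_hol_holomorphic[OF U]]
      obtain g where g: "\<And>w. w \<in> uhp \<Longrightarrow> (g has_field_derivative U w) (at w within uhp)" by blast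
      have "(g has_field_derivative U w) (at w)" if "w \<in> uhp" for w
        using g[OF that] at_within_open[OF that open_uhp] by simp
      then show thesis by (rule that)
    qed
    have G: "\<And>w. Im w > 0 \<Longrightarrow> (\<Gamma> has_field_derivative U w) (at w)" using \<Gamma> by simp
    have intG: "((\<lambda>x. U (Complex x \<eta>)) has_integral \<Gamma> (Complex b \<eta>) - \<Gamma> (Complex a \<eta>)) {a..b}" if "a \<le> b" for a b
    proof (rule fundamental_theorem_of_calculus[OF that])
      fix x
      have "((\<lambda>x. Complex x \<eta>) has_vector_derivative 1) (at x within {a..b})"
        using has_vector_derivative_add[OF has_vector_derivative_of_real[OF DERIV_ident] has_vector_derivative_const[of "\<i> * of_real \<eta>"]]
        by (simp add: Complex_eq)
      from field_vector_diff_chain_within[OF this has_field_derivative_at_within[OF G]] e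
      show "((\<lambda>x. \<Gamma> (Complex x \<eta>)) has_vector_derivative U (Complex x \<eta>)) (at x within {a..b})"
        by (simp add: o_def)
    qed
    \<comment> \<open>The average of U over the j-th arc of length \<open>h k\<close>;
      \<open>P k\<close> is the integral of the p-th power of this step function.\<close>
    define g where "g = (\<lambda>k j. (\<Gamma> (Complex (real j * h k + h k) \<eta>) - \<Gamma> (Complex (real j * h k) \<eta>)) / of_real (h k))"
    define P where "P = (\<lambda>k. h k * (\<Sum>j<2 ^ k. norm (g k j) powr p))"
    have step: "P (Suc k) \<le> P k + 2 * C2 * M powr p * (h (Suc k) * S (h (Suc k)) powr p)" for k
    proof -
      define s where "s = h (Suc k)"
      have s: "s > 0" "s \<le> 2 * pi" "s \<le> pi" "h k = 2 * s" "real (2 ^ k) * (2 * s) = 2 * pi"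
        using h(1,2)[of "Suc k"] h(3)[of k] h(4)[of k] h(2)[of k] by (auto simp: s_def)
      \<comment> \<open>Half the difference of the averages over the two halves of the arc.\<close>
      define d where "d = (\<lambda>j. (\<Gamma> (Complex (real j * (2 * s) + 2 * s) \<eta>) - 2 * \<Gamma> (Complex (real j * (2 * s) + s) \<eta>) + \<Gamma> (Complex (real j * (2 * s)) \<eta>)) / of_real (2 * s))"
      have gd: "g (Suc k) (Suc (2 * j)) = g k j + d j" "g (Suc k) (2 * j) = g k j - d j" for j
      proof -
        have e1: "real (Suc (2 * j)) * s + s = real j * (2 * s) + 2 * s" "real (Suc (2 * j)) * s = real j * (2 * s) + s"
          "real (2 * j) * s + s = real j * (2 * s) + s" "real (2 * j) * s = real j * (2 * s)"
          by (simp_all add: algebra_simps)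
        show "g (Suc k) (Suc (2 * j)) = g k j + d j"
          unfolding g_def d_def s_def[symmetric] s(4) e1 using s(1) by (simp add: field_simps)
        show "g (Suc k) (2 * j) = g k j - d j"
          unfolding g_def d_def s_def[symmetric] s(4) e1 using s(1) by (simp add: field_simps)
      qed
      have "P (Suc k) = s * (\<Sum>j<2 ^ k. norm (g k j - d j) powr p + norm (g k j + d j) powr p)"
        by (simp add: P_def s_def[symmetric] sum_lessThan_double gd)
      also have "\<dots> \<le> s * (\<Sum>j<2 ^ k. 2 * norm (g k j) powr p + 2 * norm (d j) powr p)"
      proof (intro mult_left_mono sum_mono)
        show "norm (g k j - d j) powr p + norm (g k j + d j) powr p \<le> 2 * norm (g k j) powr p + 2 * norm (d j) powr p" for j
          using clarkson_le[OF p, of "g k j" "d j"] by linarith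
      qed (use s(1) in auto)
      also have "\<dots> = P k + 2 * s * (\<Sum>j<2 ^ k. norm (d j) powr p)"
        by (simp add: P_def s(4) sum.distrib sum_distrib_left[symmetric] distrib_left)
      finally have 1: "P (Suc k) \<le> P k + 2 * s * (\<Sum>j<2 ^ k. norm (d j) powr p)" .
      define A where "A = Aop \<phi> (s + \<eta>)"
      define I where "I = integral {0..s} (\<lambda>y. Aop \<phi> (y + \<eta>))"
      have A0: "A > 0" unfolding A_def using s e by (intro Aop_pos cphi phi) auto
      have AS1: "A \<le> C1 * S s" using AS[OF e(1) s(1,2) cphi phi0] by (simp add: A_def S_def)
      have "integral {0..s} (\<lambda>y. (y + \<eta>) powr (1 / 1 - 1) * Aop \<phi> (y + \<eta>)) = I"
        unfolding I_def by (rule integral_cong) (use e in auto)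
      then have IS: "I \<le> C1 * s * S s" using AS[OF e(1) s(1,2) cphi phi0] s by (simp add: S_def)
      have I0: "I \<ge> 0"
      proof -
        have "continuous_on {0..s} (\<lambda>y. Aop \<phi> (y + \<eta>))"
          using Aop_swap(2)[OF e(1) order_refl cphi, of s "\<lambda>_. 0"] by simp
        then show ?thesis unfolding I_def using e phi
          by (intro integral_nonneg integrable_continuous_interval less_imp_le[OF Aop_pos] cphi) auto
      qed
      have Ss: "S s \<ge> 0" 
      proof -
        have "0 \<le> C1 * S s" using A0 AS1 by linarith
        then show ?thesis using C1 by (simp add: zero_le_mult_iff)
      qed
      define al where "al = (\<lambda>j. integral {real j * (2 * s)..real j * (2 * s) + 2 * s} (\<lambda>x. norm (deriv U (Complex x (s + \<eta>)))))"
      define be where "be = (\<lambda>b j. integral {0..s} (\<lambda>y. y * norm (deriv U (Complex (b + real j * (2 * s)) (y + \<eta>)))))"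
      have cU': "continuous_on S (\<lambda>x. deriv U (Complex x (s + \<eta>)))" for S
        using s e by (intro per_hol_line per_hol_deriv U) auto
      have cUv: "continuous_on {0..s} (\<lambda>y. deriv U (Complex x (y + \<eta>)))" for x
        using e by (intro per_hol_continuous_compose[OF per_hol_deriv[OF U]]) (auto intro!: continuous_intros)
      have al0: "al j \<ge> 0" for j unfolding al_def by (intro integral_nonneg integrable_continuous_interval continuous_on_norm cU') auto
      have be0: "be b j \<ge> 0" for b j unfolding be_def
        by (intro integral_nonneg integrable_continuous_interval continuous_on_mult continuous_on_id continuous_on_norm cUv) auto
      \<comment> \<open>The bound is uniform in the offset \<open>b\<close>; it is used for the left
        end, the midpoint and the right end of the arcs.\<close>
      have be_sum: "(\<Sum>j<2 ^ k. be b j powr p) \<le> c * M powr p * (C1 * s * S s) powr p" for b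
      proof -
        have "(\<Sum>j<2 ^ k. be b j powr p) \<le> c * M powr p * I powr p"
          unfolding be_def c_def I_def using s e pi_gt3
          by (intro sum_vertical_samples_le[OF U p1 e(1) s(1) _ s(5) _ e(2) M cphi phi H]) auto
        also have "\<dots> \<le> c * M powr p * (C1 * s * S s) powr p"
          using c IS I0 p0 by (intro mult_left_mono powr_mono2) auto
        finally show ?thesis .
      qed
      have al_sum: "(\<Sum>j<2 ^ k. (2 * s * al j) powr p) \<le> (2 * s) powr p * (c * M powr p * (C1 * S s) powr p)"
      proof -
        have "(\<Sum>j<2 ^ k. al j powr p) \<le> (\<Sum>j<2 ^ k. (2 * s) powr (p - 1) * integral {real j * (2 * s)..real j * (2 * s) + 2 * s} (\<lambda>x. norm (deriv U (Complex x (s + \<eta>))) powr p))"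
        proof (rule sum_mono)
          fix j
          have "al j powr p \<le> (integral {real j * (2 * s)..real j * (2 * s) + 2 * s} (\<lambda>x. 1)) powr (p - 1) *
              integral {real j * (2 * s)..real j * (2 * s) + 2 * s} (\<lambda>x. norm (deriv U (Complex x (s + \<eta>))) powr p * 1 powr (1 - p))"
            unfolding al_def using s by (intro integral_powr_le_weighted[OF p1] continuous_on_norm cU' continuous_on_const) auto
          then show "al j powr p \<le> (2 * s) powr (p - 1) * integral {real j * (2 * s)..real j * (2 * s) + 2 * s} (\<lambda>x. norm (deriv U (Complex x (s + \<eta>))) powr p)"
            using s by simp
        qed
        also have "\<dots> = (2 * s) powr (p - 1) * (\<Sum>j<2 ^ k. integral {0 + real j * (2 * s)..0 + real j * (2 * s) + 2 * s} (\<lambda>x. norm (deriv U (Complex x (s + \<eta>))) powr p))"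
          by (simp add: sum_distrib_left)
        also have "\<dots> = (2 * s) powr (p - 1) * (2 * pi * Hn p (s + \<eta>) (deriv U) powr p)"
        proof -
          have "(\<Sum>j<2 ^ k. integral {0 + real j * (2 * s)..0 + real j * (2 * s) + 2 * s} (\<lambda>x. norm (deriv U (Complex x (s + \<eta>))) powr p))
             = integral {0..0 + real (2 ^ k) * (2 * s)} (\<lambda>x. norm (deriv U (Complex x (s + \<eta>))) powr p)"
            using s by (intro sum_integral_blocks_eq continuous_on_norm_powr cU' p0) auto
          then show ?thesis unfolding s(5) using p0 by (simp add: integral_eq_Lpn)
        qed
        also have "\<dots> \<le> (2 * s) powr (p - 1) * (2 * pi * (M powr p * s powr (1 - p) * A powr p))"
          unfolding A_def using s e pi_gt3
          by (intro mult_left_mono Hn_powr_le_weighted[OF p1 cphi phi M s(1)] H) auto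
        also have "\<dots> = 2 powr (p - 1) * (2 * pi) * M powr p * A powr p"
        proof -
          have "(2 * s) powr (p - 1) * s powr (1 - p) = 2 powr (p - 1) * (s powr (p - 1) * s powr (1 - p))"
            by (simp add: powr_mult)
          also have "s powr (p - 1) * s powr (1 - p) = 1" using s by (simp flip: powr_add)
          finally have e3: "(2 * s) powr (p - 1) * s powr (1 - p) = 2 powr (p - 1)" by simp
          have "(2 * s) powr (p - 1) * (2 * pi * (M powr p * s powr (1 - p) * A powr p))
             = ((2 * s) powr (p - 1) * s powr (1 - p)) * (2 * pi) * M powr p * A powr p" by (simp only: mult_ac)
          then show ?thesis by (simp only: e3)
        qed
        also have "\<dots> \<le> c * M powr p * (C1 * S s) powr p"
        proof (intro mult_mono powr_mono2)
          show "2 powr (p - 1) * (2 * pi) \<le> c"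
            unfolding c_def using mult_left_mono[of 1 "1 + 8 powr p" "2 powr (p - 1) * (2 * pi)"] by simp
        qed (use A0 AS1 c p0 M in auto)
        finally have "(2 * s) powr p * (\<Sum>j<2 ^ k. al j powr p) \<le> (2 * s) powr p * (c * M powr p * (C1 * S s) powr p)"
          by (intro mult_left_mono) auto
        then show ?thesis by (simp add: sum_distrib_left powr_mult)
      qed
      define B where "B = c * M powr p * (C1 * S s) powr p"
      have B: "B \<ge> 0" using c by (simp add: B_def)
      have be_sum': "(\<Sum>j<2 ^ k. be b j powr p) \<le> s powr p * B" for b
        using be_sum[of b] s by (simp add: B_def powr_mult mult_ac)
      have dle: "norm (d j) powr p \<le> 4 powr p / (2 * s) powr p * ((2 * s * al j) powr p + be 0 j powr p + 2 powr p * be s j powr p + be (2 * s) j powr p)" for j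
      proof -
        let ?a = "real j * (2 * s)"
        have "norm (d j) = norm (\<Gamma> (Complex (?a + 2 * s) \<eta>) - 2 * \<Gamma> (Complex (?a + s) \<eta>) + \<Gamma> (Complex ?a \<eta>)) / (2 * s)"
          unfolding d_def norm_divide using s by simp
        also have "\<dots> \<le> (2 * s * al j + be 0 j + 2 * be s j + be (2 * s) j) / (2 * s)"
          using second_difference_le[OF U e(1) s(1) G, of ?a] s
          by (intro divide_right_mono) (auto simp: al_def be_def add_ac)
        finally have "norm (d j) powr p \<le> ((2 * s * al j + be 0 j + 2 * be s j + be (2 * s) j) / (2 * s)) powr p"
          using p0 by (intro powr_mono2) auto
        also have "\<dots> = (2 * s * al j + be 0 j + 2 * be s j + be (2 * s) j) powr p / (2 * s) powr p"
          by (rule powr_divide)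
        also have "\<dots> \<le> (4 powr p * ((2 * s * al j) powr p + be 0 j powr p + (2 * be s j) powr p + be (2 * s) j powr p)) / (2 * s) powr p"
          using al0[of j] be0 s p0 by (intro divide_right_mono powr_sum4_le) auto
        finally show ?thesis by (simp add: powr_mult)
      qed
      have "(\<Sum>j<2 ^ k. norm (d j) powr p) \<le> (\<Sum>j<2 ^ k. 4 powr p / (2 * s) powr p * ((2 * s * al j) powr p + be 0 j powr p + 2 powr p * be s j powr p + be (2 * s) j powr p))"
        by (intro sum_mono dle)
      also have "\<dots> = 4 powr p / (2 * s) powr p * ((\<Sum>j<2 ^ k. (2 * s * al j) powr p) + (\<Sum>j<2 ^ k. be 0 j powr p) + 2 powr p * (\<Sum>j<2 ^ k. be s j powr p) + (\<Sum>j<2 ^ k. be (2 * s) j powr p))"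
        by (simp only: sum_distrib_left[symmetric] sum.distrib)
      also have "\<dots> \<le> 4 powr p / (2 * s) powr p * ((2 * s) powr p * B + s powr p * B + 2 powr p * (s powr p * B) + s powr p * B)"
        using al_sum be_sum' by (intro mult_left_mono add_mono) (auto simp: B_def)
      also have "\<dots> \<le> 4 powr p / (2 * s) powr p * (4 * ((2 * s) powr p * B))"
      proof (rule mult_left_mono)
        have "s powr p \<le> (2 * s) powr p" using s p0 by (intro powr_mono2) auto
        then have "s powr p * B \<le> (2 * s) powr p * B" using B by (intro mult_right_mono)
        moreover have "2 powr p * (s powr p * B) = (2 * s) powr p * B" by (simp add: powr_mult)
        ultimately show "(2 * s) powr p * B + s powr p * B + 2 powr p * (s powr p * B) + s powr p * B \<le> 4 * ((2 * s) powr p * B)"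
          by linarith
      qed simp
      also have "\<dots> = 4 * 4 powr p * B" using s by simp
      also have "\<dots> = C2 * M powr p * S s powr p" by (simp add: B_def C2_def powr_mult mult_ac)
      finally have "2 * s * (\<Sum>j<2 ^ k. norm (d j) powr p) \<le> 2 * s * (C2 * M powr p * S s powr p)"
        using s by (intro mult_left_mono) auto
      with 1 show ?thesis by (simp add: s_def mult_ac)
    qed
    define F where "F = integral {-pi..pi} (\<lambda>\<theta>. \<phi> \<theta> powr p)"
    \<comment> \<open>At the coarsest level there is a single arc, and the average is the mean over
      the period.\<close>
    have P0: "P 0 \<le> 2 * pi * m powr p"
    proof -
      have "\<Gamma> (Complex (2 * pi) \<eta>) - \<Gamma> (Complex 0 \<eta>) = integral {0..2 * pi} (\<lambda>x. U (Complex x \<eta>))"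
        using intG[of 0 "2 * pi"] by (simp add: integral_unique)
      then have "norm (g 0 0) \<le> m" using m by (simp add: g_def h_def norm_divide divide_simps mult_ac)
      then have "norm (g 0 0) powr p \<le> m powr p" using p0 by (intro powr_mono2) auto
      then show ?thesis by (simp add: P_def h_def)
    qed
    have Psum: "P N \<le> P 0 + 2 * C2 * M powr p * (\<Sum>k<N. h (Suc k) * S (h (Suc k)) powr p)" for N
    proof (induction N)
      case (Suc N)
      then show ?case using step[of N] by (simp add: distrib_left)
    qed simp
    have PN: "P N \<le> (2 * pi + 2 * C2 * C3) * (m powr p + M powr p * F)" for N
    proof -
      have F0: "F \<ge> 0" unfolding F_def
        using p0 phi0 by (intro integral_nonneg integrable_continuous_interval continuous_on_powr' cphi continuous_on_const) auto
      have "(\<Sum>k<N. h (Suc k) * S (h (Suc k)) powr p) \<le> (\<Sum>k<Suc N. h k * S (h k) powr p)"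
        unfolding sum.lessThan_Suc_shift using h(1)[of 0] by simp
      also have "\<dots> \<le> C3 * F"
        unfolding h_def S_def C3_def F_def using sum_Sop_le[OF p(1) \<delta> e(1) cphi, of "Suc N"] phi0 by simp
      finally have "2 * C2 * M powr p * (\<Sum>k<N. h (Suc k) * S (h (Suc k)) powr p) \<le> 2 * C2 * M powr p * (C3 * F)"
        using C2 by (intro mult_left_mono) auto
      with Psum[of N] P0 have "P N \<le> 2 * pi * m powr p + 2 * C2 * C3 * (M powr p * F)"
        by (simp add: mult_ac)
      also have "\<dots> \<le> (2 * pi + 2 * C2 * C3) * (m powr p + M powr p * F)"
        unfolding distrib_left distrib_right using F0 C2 C3 by (auto intro!: add_increasing add_increasing2 simp: algebra_simps)
      finally show ?thesis .
    qed
    \<comment> \<open>The bounds on \<open>P\<close> do not depend on the level. By uniform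
      continuity on the fixed line, U differs from its averages by at most \<open>r\<close> once the
      arcs are short, and \<open>r\<close> is chosen so that the loss is exactly
      \<open>\<epsilon>\<close>.\<close>
    have fin: "2 * pi * Hn p \<eta> U powr p \<le> C * (m powr p + M powr p * F) + \<epsilon>" if eps: "\<epsilon> > 0" for \<epsilon>
    proof -
      define r where "r = (\<epsilon> / (4 powr p * (2 * pi))) powr (1 / p)"
      have r: "r > 0" "4 powr p * (2 * pi * r powr p) = \<epsilon>" using eps p0 by (auto simp: r_def powr_powr)
      have "uniformly_continuous_on {0..2*pi} (\<lambda>x. U (Complex x \<eta>))"
        by (intro compact_uniformly_continuous cu compact_Icc)
      then obtain dd where dd: "dd > 0" and unif: "\<And>x y. x \<in> {0..2*pi} \<Longrightarrow> y \<in> {0..2*pi} \<Longrightarrow> dist y x < dd \<Longrightarrow> dist (U (Complex y \<eta>)) (U (Complex x \<eta>)) < r"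
        using r unfolding uniformly_continuous_on_def by metis
      obtain N where N: "h N < dd"
      proof -
        obtain N where "(1 / 2) ^ N < dd / (2 * pi)" using real_arch_pow_inv[of "dd / (2 * pi)" "1 / 2"] dd by auto
        then have "h N < dd" by (simp add: h_def power_divide divide_simps mult_ac)
        then show thesis by (rule that)
      qed
      have blk: "integral {0 + real j * h N..0 + real j * h N + h N} (\<lambda>x. norm (U (Complex x \<eta>)) powr p) \<le> h N * (4 powr p * (norm (g N j) powr p + r powr p))"
        if j: "j < 2 ^ N" for j
      proof -
        let ?a = "real j * h N"
        have a: "?a \<ge> 0" "?a + h N \<le> 2 * pi"
        proof -
          show "?a \<ge> 0" using h(1)[of N] by simp
          have "?a + h N = real (Suc j) * h N" by (simp add: algebra_simps)
          also have "\<dots> \<le> real (2 ^ N) * h N" using j h(1)[of N] by (intro mult_right_mono) (auto simp del: of_nat_Suc of_nat_power)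
          finally show "?a + h N \<le> 2 * pi" using h(4)[of N] by simp
        qed
        have pt: "norm (U (Complex x \<eta>)) \<le> norm (g N j) + r" if x: "x \<in> {?a..?a + h N}" for x
        proof -
          have "((\<lambda>s. U (Complex s \<eta>) - U (Complex x \<eta>)) has_integral (\<Gamma> (Complex (?a + h N) \<eta>) - \<Gamma> (Complex ?a \<eta>)) - h N *\<^sub>R U (Complex x \<eta>)) {?a..?a + h N}"
            using has_integral_const_real[of "U (Complex x \<eta>)" ?a "?a + h N"] h(1)[of N]
            by (intro has_integral_diff intG) auto
          moreover have "of_real (h N) * (g N j - U (Complex x \<eta>)) = (\<Gamma> (Complex (?a + h N) \<eta>) - \<Gamma> (Complex ?a \<eta>)) - h N *\<^sub>R U (Complex x \<eta>)"
          proof -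
            have "of_real (h N) * g N j = \<Gamma> (Complex (?a + h N) \<eta>) - \<Gamma> (Complex ?a \<eta>)"
              using h(1)[of N] by (simp add: g_def)
            then show ?thesis by (simp only: right_diff_distrib scaleR_conv_of_real)
          qed
          ultimately have "of_real (h N) * (g N j - U (Complex x \<eta>)) = integral {?a..?a + h N} (\<lambda>s. U (Complex s \<eta>) - U (Complex x \<eta>))"
            by (simp add: integral_unique)
          also have "norm \<dots> \<le> integral {?a..?a + h N} (\<lambda>s. r)"
          proof (intro integral_norm_bound_integral integrable_continuous_interval continuous_on_diff cu continuous_on_const)
            fix s assume s: "s \<in> {?a..?a + h N}"
            have dsx: "dist s x \<le> h N" using s x by (auto simp: dist_real_def abs_le_iff)
            have "dist (U (Complex s \<eta>)) (U (Complex x \<eta>)) < r"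
            proof (rule unif)
              show "x \<in> {0..2 * pi}" "s \<in> {0..2 * pi}" using a s x unfolding atLeastAtMost_iff by linarith+
            qed (use dsx N in linarith)
            then show "norm (U (Complex s \<eta>) - U (Complex x \<eta>)) \<le> r" by (simp add: dist_norm)
          qed
          finally have "h N * norm (g N j - U (Complex x \<eta>)) \<le> h N * r" using h(1)[of N] by (simp add: norm_mult)
          then have "norm (g N j - U (Complex x \<eta>)) \<le> r" using h(1)[of N] by simp
          then show ?thesis using norm_triangle_ineq2[of "U (Complex x \<eta>)" "g N j"] by (simp add: norm_minus_commute)
        qed
        have "integral {?a..?a + h N} (\<lambda>x. norm (U (Complex x \<eta>)) powr p) \<le> integral {?a..?a + h N} (\<lambda>x. 4 powr p * (norm (g N j) powr p + r powr p))"
        proof (intro integral_le integrable_continuous_interval continuous_on_norm_powr cu p0 continuous_on_const)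
          fix x assume x: "x \<in> {?a..?a + h N}"
          have "norm (U (Complex x \<eta>)) powr p \<le> (norm (g N j) + r) powr p"
            using pt[OF x] p0 by (intro powr_mono2) auto
          also have "\<dots> \<le> 4 powr p * (norm (g N j) powr p + r powr p)"
            using r p0 by (intro powr_add_le2) auto
          finally show "norm (U (Complex x \<eta>)) powr p \<le> 4 powr p * (norm (g N j) powr p + r powr p)" .
        qed
        then show ?thesis using h(1)[of N] by (simp add: mult_ac)
      qed
      have "2 * pi * Hn p \<eta> U powr p = integral {0..0 + real (2 ^ N) * h N} (\<lambda>x. norm (U (Complex x \<eta>)) powr p)"
        unfolding h(4) using p0 by (simp add: integral_eq_Lpn)
      also have "\<dots> = (\<Sum>j<2 ^ N. integral {0 + real j * h N..0 + real j * h N + h N} (\<lambda>x. norm (U (Complex x \<eta>)) powr p))"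
        using h(1)[of N] by (intro sum_integral_blocks_eq[symmetric] continuous_on_norm_powr cu p0) auto
      also have "\<dots> \<le> (\<Sum>j<2 ^ N. h N * (4 powr p * (norm (g N j) powr p + r powr p)))"
        by (intro sum_mono blk) auto
      also have "\<dots> = 4 powr p * P N + 4 powr p * (real (2 ^ N) * h N * r powr p)"
        by (simp add: P_def distrib_left sum.distrib sum_distrib_left[symmetric] mult_ac)
      also have "4 powr p * (real (2 ^ N) * h N * r powr p) = \<epsilon>" unfolding h(4) using r by simp
      also have "4 powr p * P N \<le> 4 powr p * ((2 * pi + 2 * C2 * C3) * (m powr p + M powr p * F))"
        by (intro mult_left_mono PN) auto
      finally show ?thesis by (simp add: C_def mult.assoc)
    qed
    then have "2 * pi * Hn p \<eta> U powr p \<le> C * (m powr p + M powr p * F)" by (rule field_le_epsilon)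
    moreover have "Hn p \<eta> U powr p \<le> 2 * pi * Hn p \<eta> U powr p"
      using pi_gt3 mult_right_mono[of 1 "2 * pi" "Hn p \<eta> U powr p"] by simp
    ultimately show ?thesis unfolding F_def by linarith
  qed
  show ?thesis
  proof (rule exI[of _ C], rule conjI[OF C], intro allI impI)
    fix U \<phi> and \<eta> M m :: real
    assume "per_hol U" "0 < \<eta>" "\<eta> \<le> 1" "M > 0" "continuous_on {-pi..pi} \<phi>" "\<forall>\<theta>. \<phi> \<theta> > 0"
      "\<forall>v. 0 < v \<longrightarrow> v \<le> 4 * pi \<longrightarrow> Hn p v (deriv U) \<le> M * v powr (1 / p - 1) * Aop \<phi> v"
      "\<forall>v>0. norm (integral {0..2*pi} (\<lambda>x. U (Complex x v))) \<le> 2 * pi * m"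
    then show "Hn p \<eta> U powr p \<le> C * (m powr p + M powr p * integral {-pi..pi} (\<lambda>\<theta>. \<phi> \<theta> powr p))"
      by (intro main) auto
  qed
qed

section \<open>Level sets\<close>

text \<open>Let j be the first index with a at most \<open>lam j\<close>. If j = 0 the first term
  suffices; otherwise a exceeds the preceding level, whose \<open>e\<close> is then at least 1 and
  pays for \<open>lam j\<close>. If no such j occurs up to N, the last term pays with the crude
  bound Q. The levels need not be monotone.\<close>

lemma levelset_pointwise:
  fixes a :: real and lam e :: "nat \<Rightarrow> real"
  assumes p: "p > 0" and a: "0 \<le> a" "a \<le> Q" and e: "\<And>k. e k \<ge> 0" and le: "\<And>k. a > lam k \<Longrightarrow> e k \<ge> 1"
  shows "a powr p \<le> \<bar>lam 0\<bar> powr p + (\<Sum>k<N. \<bar>lam (Suc k)\<bar> powr p * e k) + Q powr p * e N"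
proof -
  let ?t = "\<lambda>k. \<bar>lam (Suc k)\<bar> powr p * e k"
  have nn: "(\<Sum>k<N. ?t k) \<ge> 0" "Q powr p * e N \<ge> 0" "\<bar>lam 0\<bar> powr p \<ge> 0"
    using e by (auto intro!: sum_nonneg)
  have b: "a powr p \<le> \<bar>lam k\<bar> powr p" if "a \<le> lam k" for k
    using that a p by (intro powr_mono2) auto
  show ?thesis
  proof (cases "\<exists>k\<le>N. a \<le> lam k")
    case True
    define j where "j = (LEAST k. a \<le> lam k)"
    have j: "a \<le> lam j" "j \<le> N" unfolding j_def using True by (auto intro: LeastI order_trans[OF Least_le])
    show ?thesis
    proof (cases j)
      case 0
      then show ?thesis using b[OF j(1)] nn by simp
    next
      case (Suc i)
      then have "\<not> a \<le> lam i" using not_less_Least[of i "\<lambda>k. a \<le> lam k"] by (simp add: j_def)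
      then have "e i \<ge> 1" by (intro le) auto
      then have "\<bar>lam j\<bar> powr p * 1 \<le> \<bar>lam j\<bar> powr p * e i" by (intro mult_left_mono) auto
      also have "\<dots> \<le> (\<Sum>k<N. ?t k)"
        using Suc j e member_le_sum[of i "{..<N}" ?t] by auto
      finally show ?thesis using b[OF j(1)] nn by linarith
    qed
  next
    case False
    then have "e N \<ge> 1" by (intro le) auto
    then have "Q powr p * 1 \<le> Q powr p * e N" by (intro mult_left_mono) auto
    moreover have "a powr p \<le> Q powr p" using a p by (intro powr_mono2) auto
    ultimately show ?thesis using nn by linarith
  qed
qed

text \<open>At height \<open>h\<close> the function is bounded pointwise by \<open>\<lambda>\<close>-levels of order \<open>S(h)\<close>, and the rest is at most
  \<open>h\<^sup>1\<^sup>/\<^sup>q S(h)\<close> in \<open>L\<^sup>q\<close>. So the decreasing rearrangement at \<open>h\<close> is at most of order \<open>S(h)\<close>.\<close>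

lemma rearrangement_bound:
  fixes p q :: real
  assumes q: "1 < q" "q < p"
  shows "\<exists>C>0. \<forall>U \<phi> \<eta> M m. per_hol U \<longrightarrow> 0 < \<eta> \<longrightarrow> \<eta> \<le> 1 \<longrightarrow> M > 0 \<longrightarrow> continuous_on {-pi..pi} \<phi> \<longrightarrow> (\<forall>\<theta>. \<phi> \<theta> > 0) \<longrightarrow>
    (\<forall>v. 0 < v \<longrightarrow> v \<le> 4 * pi \<longrightarrow> Hn q v (deriv U) \<le> M * v powr (1 / q - 1) * Aop \<phi> v) \<longrightarrow>
    (\<forall>v>0. norm (integral {0..2*pi} (\<lambda>x. U (Complex x v))) \<le> 2 * pi * m) \<longrightarrow>
    Hn p \<eta> U powr p \<le> C * (m powr p + M powr p * integral {-pi..pi} (\<lambda>\<theta>. \<phi> \<theta> powr p))"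
proof -
  have q1: "q \<ge> 1" and q0: "q > 0" and p0: "p > 0" and p1: "p > 1" using q by auto
  obtain \<delta> C1 where \<delta>: "\<delta> > 0" and C1: "C1 > 0"
    and AS: "\<And>\<eta> \<phi> h. 0 < \<eta> \<Longrightarrow> 0 < h \<Longrightarrow> h \<le> 2 * pi \<Longrightarrow> continuous_on {-pi..pi} \<phi> \<Longrightarrow> (\<forall>\<theta>. \<phi> \<theta> \<ge> 0) \<Longrightarrow>
     integral {0..h} (\<lambda>y. (y + \<eta>) powr (1 / q - 1) * Aop \<phi> (y + \<eta>)) \<le> C1 * h powr (1 / q) * Sop p \<delta> \<eta> \<phi> h \<and>
     integral {h..2 * pi} (\<lambda>y. 1 / (y + \<eta>) * Aop \<phi> (y + \<eta>)) \<le> C1 * Sop p \<delta> \<eta> \<phi> h \<and>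
     Aop \<phi> (h + \<eta>) \<le> C1 * Sop p \<delta> \<eta> \<phi> h"
    using Aop_le_Sop[OF q1 q(2)] by auto
  define c where "c = (2 powr (q - 1) * (2 * pi) * (2 + 8 powr q)) powr (1 / q)"
  have "2 + 8 powr q > (0::real)" by (intro add_pos_nonneg) auto
  then have c: "c > 0" unfolding c_def by simp
  define C2 where "C2 = c * C1 + C1"
  define C3 where "C3 = (2 / \<delta>) powr (p - 1) * (2 powr \<delta> / (2 powr \<delta> - 1))"
  have C2: "C2 > 0" using c C1 by (simp add: C2_def add_pos_pos)
  have C3: "C3 > 0" using \<delta> by (simp add: C3_def)
  define K where "K = 4 powr p * 4 powr p * (1 + (c * C1) powr p * C3 + C2 powr p * C3)"
  have K: "K > 0" unfolding K_def using C3 by (intro mult_pos_pos add_pos_nonneg) auto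
  define C where "C = 8 * pi * K"
  have C: "C > 0" using K by (simp add: C_def)
  have main: "Hn p \<eta> U powr p \<le> C * (m powr p + M powr p * integral {-pi..pi} (\<lambda>\<theta>. \<phi> \<theta> powr p))"
    if U: "per_hol U" and e: "0 < \<eta>" "\<eta> \<le> 1" and M: "M > 0" and cphi: "continuous_on {-pi..pi} \<phi>" and phi: "\<And>\<theta>. \<phi> \<theta> > 0"
      and H: "\<And>v. 0 < v \<Longrightarrow> v \<le> 4 * pi \<Longrightarrow> Hn q v (deriv U) \<le> M * v powr (1 / q - 1) * Aop \<phi> v"
      and m: "\<And>v. v > 0 \<Longrightarrow> norm (integral {0..2*pi} (\<lambda>x. U (Complex x v))) \<le> 2 * pi * m"
    for U \<phi> \<eta> M m
  proof -
    define S where "S = Sop p \<delta> \<eta> \<phi>"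
    define F where "F = integral {-pi..pi} (\<lambda>\<theta>. \<phi> \<theta> powr p)"
    define h where "h = (\<lambda>k::nat. 2 * pi / 2 ^ k)"
    have h: "h k > 0" "h k \<le> 2 * pi" "h k = 2 * h (Suc k)" for k
      by (auto simp: h_def divide_simps)
    have phi0: "\<forall>\<theta>. \<phi> \<theta> \<ge> 0" using phi by (simp add: less_imp_le)
    have F0: "F \<ge> 0" unfolding F_def
      using p0 phi0 by (intro integral_nonneg integrable_continuous_interval continuous_on_powr' cphi continuous_on_const) auto
    have m0: "m \<ge> 0" using order_trans[OF norm_ge_zero m[of 1]] pi_gt_zero by (auto simp: zero_le_mult_iff)
    have U': "per_hol (deriv U)" by (rule per_hol_deriv[OF U])
    have cu: "continuous_on S (\<lambda>x. U (Complex x v))" if "v > 0" for S v using that by (intro per_hol_line U)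
    have cu': "continuous_on S (\<lambda>x. deriv U (Complex x v))" if "v > 0" for S v using that by (intro per_hol_line U')
    have cv': "continuous_on {a..b} (\<lambda>y. deriv U (Complex x (y + \<eta>)))" if "0 \<le> a" for a b x
      using e that by (intro per_hol_continuous_compose[OF U']) (auto intro!: continuous_intros)
    have Apos: "v > 0 \<Longrightarrow> Aop \<phi> v > 0" for v by (intro Aop_pos cphi phi)
    have cA: "continuous_on {a..b} (\<lambda>y. Aop \<phi> (y + \<eta>))" if "0 \<le> a" for a b
      using Aop_swap(2)[OF e(1) that cphi, of b "\<lambda>_. 0"] by simp
    have S0: "S (h k) > 0" for k
    proof -
      have "0 < Aop \<phi> (h k + \<eta>)" using h(1)[of k] e by (intro Apos) auto
      also have "\<dots> \<le> C1 * S (h k)" using AS[OF e(1) h(1,2) cphi phi0] by (simp add: S_def)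
      finally show ?thesis using C1 by (simp add: zero_less_mult_iff)
    qed
    \<comment> \<open>The sampling inequality with a single sample per period and block length v/2
      gives a pointwise bound for the derivative.\<close>
    have sup: "norm (deriv U (Complex x v)) \<le> c * M * (Aop \<phi> v / v)" if v: "0 < v" "v \<le> 8 / 3 * pi" for x v
    proof -
      have v4: "v \<le> 4 * pi" using v pi_gt_zero by linarith
      have A: "Aop \<phi> v > 0" using v by (intro Apos)
      have "norm (deriv U (Complex x v)) powr q = (\<Sum>j<1. norm (deriv U (Complex (x + real j * (2 * pi)) v)) powr q)" by simp
      also have "\<dots> \<le> 2 powr (q - 1) * (2 * pi) * (Hn q v (deriv U) powr q / (v / 2) + (v / 2) powr (q - 1) * Hn q v (deriv (deriv U)) powr q)"
        using v pi_gt_zero by (intro sum_samples_le[OF U' q1]) auto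
      also have "\<dots> \<le> 2 powr (q - 1) * (2 * pi) * ((M powr q * v powr (1 - q) * Aop \<phi> v powr q) / (v / 2)
          + v powr (q - 1) * ((8 * M * v powr (1 / q - 2) * Aop \<phi> v) powr q))"
        using v q0 by (intro mult_left_mono add_mono divide_right_mono mult_mono powr_mono2
            Hn_powr_le_weighted[OF q1 cphi phi M v(1) order_refl H[OF v(1) v4]]
            Hn_second_deriv_le[OF U q1 v M cphi phi H]) (use q1 in auto)
      also have "\<dots> = (c * M * (Aop \<phi> v / v)) powr q"
      proof -
        have e1: "v powr (1 - q) / (v / 2) = 2 * v powr (- q)" using v by (simp add: powr_diff powr_minus divide_simps)
        have e4: "(8 * M * v powr (1 / q - 2) * Aop \<phi> v) powr q = 8 powr q * M powr q * v powr (1 - 2 * q) * Aop \<phi> v powr q"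
          using q0 by (simp add: powr_mult powr_powr left_diff_distrib)
        have e5: "v powr (q - 1) * v powr (1 - 2 * q) = v powr (- q)" by (simp add: powr_add[symmetric])
        have "a * (b * m * d * z) = b * m * (a * d) * z" for a b m d z :: real by (simp only: mult_ac)
        then have e2: "v powr (q - 1) * ((8 * M * v powr (1 / q - 2) * Aop \<phi> v) powr q) = 8 powr q * M powr q * v powr (- q) * Aop \<phi> v powr q"
          unfolding e4 e5[symmetric] by blast
        have e3: "(M powr q * v powr (1 - q) * Aop \<phi> v powr q) / (v / 2) = M powr q * (v powr (1 - q) / (v / 2)) * Aop \<phi> v powr q" by simp
        have "c powr q = 2 powr (q - 1) * (2 * pi) * (2 + 8 powr q)" using q0 by (simp add: c_def powr_powr add_nonneg_nonneg)
        moreover have "(c * M * (Aop \<phi> v / v)) powr q = c powr q * M powr q * (Aop \<phi> v powr q * v powr (- q))"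
          by (simp only: powr_mult powr_divide) (simp add: powr_minus_divide)
        ultimately show ?thesis unfolding e2 e3 e1 by (simp add: algebra_simps)
      qed
      finally have le: "norm (deriv U (Complex x v)) powr q \<le> (c * M * (Aop \<phi> v / v)) powr q" .
      show ?thesis
      proof (rule ccontr)
        assume "\<not> ?thesis"
        then have "(c * M * (Aop \<phi> v / v)) powr q < norm (deriv U (Complex x v)) powr q"
          using c M A v q0 by (intro powr_less_mono2) auto
        with le show False by simp
      qed
    qed
    \<comment> \<open>The top line, at height \<open>h 0 + \<eta>\<close>, from which all vertical
      paths descend.\<close>
    define V where "V = 2 * pi + \<eta>"
    have V: "V > 0" "V \<le> 8 / 3 * pi" "V \<ge> 2 * pi" using e pi_gt3 by (auto simp: V_def)
    define b0 where "b0 = m + c * M * (C1 * S (h 0))"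
    \<comment> \<open>On the top line U differs from its mean by at most 2 pi times the supremum of
      the derivative, and 2 pi / V is at most 1.\<close>
    have b0: "norm (U (Complex x V)) \<le> b0" for x
    proof -
      have osc: "norm (U (Complex x V) - U (Complex s V)) \<le> c * M * (Aop \<phi> V / V) * (2 * pi)" if "s \<in> {x..x + 2 * pi}" for s
      proof -
        have hor: "((\<lambda>x. Complex x V) has_vector_derivative 1) (at x within S)" for x S
          using has_vector_derivative_add[OF has_vector_derivative_of_real[OF DERIV_ident] has_vector_derivative_const[of "\<i> * of_real V"]]
          by (simp add: Complex_eq)
        have "((\<lambda>s. deriv U (Complex s V)) has_integral U (Complex s V) - U (Complex x V)) {x..s}"
          using that has_vector_derivative_per_hol[OF U hor] V by (intro fundamental_theorem_of_calculus) auto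
        then have "U (Complex s V) - U (Complex x V) = integral {x..s} (\<lambda>s. deriv U (Complex s V))" by (simp add: integral_unique)
        also have "norm \<dots> \<le> integral {x..s} (\<lambda>s. c * M * (Aop \<phi> V / V))"
          using V sup by (intro integral_norm_bound_integral integrable_continuous_interval cu' continuous_on_const) auto
        also have "\<dots> = (s - x) * (c * M * (Aop \<phi> V / V))" using that by simp
        also have "\<dots> \<le> (2 * pi) * (c * M * (Aop \<phi> V / V))"
          using that c M Apos[OF V(1)] V by (intro mult_right_mono) auto
        finally show ?thesis by (simp only: norm_minus_commute[of "U (Complex x V)"] mult.commute)
      qed
      define J where "J = integral {x..x + 2 * pi} (\<lambda>s. U (Complex s V))"
      have "J = integral {0..2 * pi} (\<lambda>s. U (Complex s V))"
        unfolding J_def using V by (intro integral_periodic_shift cu per_hol_periodic U) auto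
      then have J: "norm J \<le> 2 * pi * m" using m[OF V(1)] by simp
      have "((\<lambda>s. U (Complex x V) - U (Complex s V)) has_integral (2 * pi) *\<^sub>R U (Complex x V) - J) {x..x + 2 * pi}"
        unfolding J_def using has_integral_const_real[of "U (Complex x V)" x "x + 2 * pi"] V
        by (intro has_integral_diff integrable_integral integrable_continuous_interval cu) auto
      then have "(2 * pi) *\<^sub>R U (Complex x V) - J = integral {x..x + 2 * pi} (\<lambda>s. U (Complex x V) - U (Complex s V))"
        by (simp add: integral_unique)
      also have "norm \<dots> \<le> integral {x..x + 2 * pi} (\<lambda>s. c * M * (Aop \<phi> V / V) * (2 * pi))"
        using V osc by (intro integral_norm_bound_integral integrable_continuous_interval continuous_on_diff cu continuous_on_const) auto
      also have "\<dots> = 2 * pi * (c * M * Aop \<phi> V * (2 * pi / V))" by simp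
      also have "\<dots> \<le> 2 * pi * (c * M * Aop \<phi> V * 1)"
        using V c M Apos[OF V(1)] by (intro mult_left_mono) auto
      finally have "norm ((2 * pi) *\<^sub>R U (Complex x V)) \<le> 2 * pi * (c * M * Aop \<phi> V) + 2 * pi * m"
        using J norm_triangle_ineq2[of "(2 * pi) *\<^sub>R U (Complex x V)" J] by simp
      also have "\<dots> = 2 * pi * (c * M * Aop \<phi> V + m)" by (simp add: distrib_left)
      finally have "norm (U (Complex x V)) \<le> c * M * Aop \<phi> V + m" by simp
      also have "\<dots> \<le> c * M * (C1 * S (h 0)) + m"
        using AS[OF e(1) h(1,2)[of 0] cphi phi0] c M by (intro add_right_mono mult_left_mono) (auto simp: S_def V_def h_def)
      finally show ?thesis by (simp add: b0_def)
    qed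
    have b00: "b0 \<ge> 0" using order_trans[OF norm_ge_zero b0] .
    \<comment> \<open>Descending from the top line to height \<open>h k + \<eta>\<close> costs the
      integral of \<open>Aop\<close> over the height, which is the second estimate of
      \<open>Aop_le_Sop\<close>.\<close>
    have low: "norm (U (Complex x (h k + \<eta>))) \<le> b0 + c * M * (C1 * S (h k))" for x k
    proof -
      have ver: "((\<lambda>y. Complex x (y + \<eta>)) has_vector_derivative \<i>) (at y within S)" for x y S
      proof -
        have "((\<lambda>y. of_real x + \<i> * of_real \<eta> + \<i> * of_real y) has_vector_derivative 0 + \<i> * of_real 1) (at y within S)"
          by (intro has_vector_derivative_add has_vector_derivative_const has_vector_derivative_mult_right
              has_vector_derivative_of_real DERIV_ident)
        then show ?thesis by (simp add: Complex_eq algebra_simps)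
      qed
      have hk: "0 \<le> h k" using h(1)[of k] by simp
      have "((\<lambda>y. \<i> * deriv U (Complex x (y + \<eta>))) has_integral U (Complex x (2 * pi + \<eta>)) - U (Complex x (h k + \<eta>))) {h k..2 * pi}"
        using h(2)[of k] hk e has_vector_derivative_per_hol[OF U ver]
        by (intro fundamental_theorem_of_calculus) auto
      then have "U (Complex x V) - U (Complex x (h k + \<eta>)) = integral {h k..2 * pi} (\<lambda>y. \<i> * deriv U (Complex x (y + \<eta>)))"
        unfolding V_def by (rule integral_unique[symmetric])
      also have "norm \<dots> \<le> integral {h k..2 * pi} (\<lambda>y. c * M * (1 / (y + \<eta>) * Aop \<phi> (y + \<eta>)))"
      proof (intro integral_norm_bound_integral integrable_continuous_interval)
        show "continuous_on {h k..2 * pi} (\<lambda>y. \<i> * deriv U (Complex x (y + \<eta>)))"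
          by (intro continuous_on_mult continuous_on_const cv' hk)
        have ne: "y \<in> {h k..2 * pi} \<Longrightarrow> y + \<eta> \<noteq> 0" for y using h(1)[of k] e by auto
        then show "continuous_on {h k..2 * pi} (\<lambda>y. c * M * (1 / (y + \<eta>) * Aop \<phi> (y + \<eta>)))"
          by (intro continuous_on_mult continuous_on_const cA hk continuous_on_divide continuous_on_add continuous_on_id) auto
        fix y assume y: "y \<in> {h k..2 * pi}"
        have "norm (deriv U (Complex x (y + \<eta>))) \<le> c * M * (Aop \<phi> (y + \<eta>) / (y + \<eta>))"
          using y h(1)[of k] e pi_gt3 by (intro sup) auto
        then show "norm (\<i> * deriv U (Complex x (y + \<eta>))) \<le> c * M * (1 / (y + \<eta>) * Aop \<phi> (y + \<eta>))"
          by (simp add: norm_mult)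
      qed
      also have "\<dots> = c * M * integral {h k..2 * pi} (\<lambda>y. 1 / (y + \<eta>) * Aop \<phi> (y + \<eta>))"
        by (rule integral_mult_right)
      also have "\<dots> \<le> c * M * (C1 * S (h k))"
        using AS[OF e(1) h(1,2) cphi phi0] c M by (intro mult_left_mono) (auto simp: S_def)
      finally show ?thesis using b0[of x] norm_triangle_ineq2[of "U (Complex x (h k + \<eta>))" "U (Complex x V)"]
        by (simp add: norm_minus_commute)
    qed
    define d where "d = (\<lambda>k x. U (Complex x (h k + \<eta>)) - U (Complex x \<eta>))"
    have cd: "continuous_on S (d k)" for S k
      unfolding d_def using e h(1)[of k] by (intro continuous_on_diff cu) auto
    \<comment> \<open>The rest of the descent is measured in L^q; it is the first estimate of
      \<open>Aop_le_Sop\<close>.\<close>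
    have Ld: "Lpn q (d k) \<le> h k powr (1 / q) * (M * C1 * S (h k))" for k
    proof -
      have hk: "0 < h k" "0 \<le> h k" using h(1)[of k] by simp_all
      define w where "w = (\<lambda>y. M * ((y + \<eta>) powr (1 / q - 1) * Aop \<phi> (y + \<eta>)))"
      have "Lpn q (d k) \<le> integral {0..h k} w"
      proof (rule Lpn_minkowski_integral[OF q1 hk(1) _ _ _ _ cd])
        show "continuous_on ({0..h k} \<times> {0..2 * pi}) (\<lambda>(y, x). deriv U (Complex x (y + \<eta>)))"
          unfolding case_prod_unfold using e
          by (intro per_hol_continuous_compose[OF U']) (auto intro!: continuous_intros)
        have "y \<in> {0..h k} \<Longrightarrow> y + \<eta> \<noteq> 0" for y using e by auto
        then show "continuous_on {0..h k} w" unfolding w_def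
          by (intro continuous_on_mult continuous_on_const cA order_refl continuous_on_powr continuous_on_add continuous_on_id) auto
        fix y assume y: "y \<in> {0..h k}"
        have v: "0 < y + \<eta>" "y + \<eta> \<le> 4 * pi" using y e h(2)[of k] pi_gt3 by auto
        show "w y > 0" unfolding w_def using M Apos[OF v(1)] v by (intro mult_pos_pos) auto
        show "Lpn q (\<lambda>x. deriv U (Complex x (y + \<eta>))) \<le> w y" using H[OF v] by (simp add: w_def mult.assoc)
      next
        fix x
        have i: "((\<lambda>s. (\<i> * of_real (h k)) * deriv U (Complex x \<eta> + of_real s * (\<i> * of_real (h k)))) has_integral U (Complex x \<eta> + \<i> * of_real (h k)) - U (Complex x \<eta>)) {0..1}"
          using e hk by (intro per_hol_diff_integral U) auto
        have ver: "((\<lambda>y. Complex x (y + \<eta>)) has_vector_derivative \<i>) (at y within S)" for y S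
        proof -
          have "((\<lambda>y. of_real x + \<i> * of_real \<eta> + \<i> * of_real y) has_vector_derivative 0 + \<i> * of_real 1) (at y within S)"
            by (intro has_vector_derivative_add has_vector_derivative_const has_vector_derivative_mult_right
                has_vector_derivative_of_real DERIV_ident)
          then show ?thesis by (simp add: Complex_eq algebra_simps)
        qed
        have "((\<lambda>y. \<i> * deriv U (Complex x (y + \<eta>))) has_integral U (Complex x (h k + \<eta>)) - U (Complex x (0 + \<eta>))) {0..h k}"
          using hk e has_vector_derivative_per_hol[OF U ver] by (intro fundamental_theorem_of_calculus) auto
        from integral_unique[OF this]
        have "d k x = integral {0..h k} (\<lambda>y. \<i> * deriv U (Complex x (y + \<eta>)))" by (simp only: d_def add_0)
        also have "norm \<dots> \<le> integral {0..h k} (\<lambda>y. norm (deriv U (Complex x (y + \<eta>))))"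
          by (intro integral_norm_bound_integral integrable_continuous_interval continuous_on_mult continuous_on_const cv' continuous_on_norm order_refl) (simp add: norm_mult)
        finally show "norm (d k x) \<le> integral {0..h k} (\<lambda>y. norm (deriv U (Complex x (y + \<eta>))))" .
      qed
      also have "\<dots> = M * integral {0..h k} (\<lambda>y. (y + \<eta>) powr (1 / q - 1) * Aop \<phi> (y + \<eta>))"
        unfolding w_def by (rule integral_mult_right)
      also have "\<dots> \<le> M * (C1 * h k powr (1 / q) * S (h k))"
        using AS[OF e(1) h(1,2) cphi phi0] M by (intro mult_left_mono) (auto simp: S_def)
      finally show ?thesis by (simp add: mult_ac)
    qed
    define D where "D = (\<lambda>k. M * C1 * S (h k))"
    have D: "D k > 0" for k using M C1 S0 by (simp add: D_def)
    \<comment> \<open>A Chebyshev majorant. Where |U| exceeds \<open>lam k\<close> the pointwise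
      part cannot account for it, so |d| exceeds \<open>D k\<close> and \<open>ee\<close> is at
      least 1; its integral is at most 2 pi \<open>h k\<close>.\<close>
    define ee where "ee = (\<lambda>k x. (norm (d k x) / D k) powr q)"
    define lam where "lam = (\<lambda>k. b0 + C2 * M * S (h k))"
    have lam0: "lam k \<ge> 0" for k unfolding lam_def using b00 C2 M S0[of k] by (intro add_nonneg_nonneg) auto
    have cee: "continuous_on S (ee k)" for S k
      unfolding ee_def powr_divide using D[of k] q0 by (intro continuous_on_divide continuous_on_norm_powr cd continuous_on_const) auto
    have iee: "integral {0..2 * pi} (ee k) \<le> 2 * pi * h k" for k
    proof -
      have "integral {0..2 * pi} (ee k) = (1 / D k powr q) * integral {0..2 * pi} (\<lambda>x. norm (d k x) powr q)"
        unfolding ee_def powr_divide by (simp add: divide_inverse mult.commute)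
      also have "\<dots> = (1 / D k powr q) * (2 * pi * Lpn q (d k) powr q)" by (simp only: integral_eq_Lpn[OF q0])
      also have "\<dots> \<le> (1 / D k powr q) * (2 * pi * (h k powr (1 / q) * D k) powr q)"
        using Ld[of k] q0 by (intro mult_left_mono powr_mono2) (auto simp: D_def)
      also have "\<dots> = 2 * pi * h k" using D[of k] h(1)[of k] q0 by (simp add: powr_mult powr_powr)
      finally show ?thesis .
    qed
    have lev: "ee k x \<ge> 1" if "norm (U (Complex x \<eta>)) > lam k" for k x
    proof -
      have "norm (U (Complex x \<eta>)) \<le> norm (U (Complex x (h k + \<eta>))) + norm (d k x)"
        unfolding d_def using norm_triangle_ineq3[of "U (Complex x (h k + \<eta>))" "U (Complex x \<eta>)"] by linarith
      also have "\<dots> \<le> b0 + c * M * (C1 * S (h k)) + norm (d k x)" using low by simp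
      finally have "D k < norm (d k x)" using that by (simp add: lam_def D_def C2_def algebra_simps)
      then have "1 \<le> norm (d k x) / D k" using D[of k] by simp
      then show ?thesis unfolding ee_def using q0 by (intro ge_one_powr_ge_zero) auto
    qed
    have "bounded ((\<lambda>x. U (Complex x \<eta>)) ` {0..2 * pi})"
      by (intro compact_imp_bounded compact_continuous_image cu compact_Icc e)
    then obtain Q where Q: "\<And>x. x \<in> {0..2 * pi} \<Longrightarrow> norm (U (Complex x \<eta>)) \<le> Q" unfolding bounded_iff by blast
    have Sum: "(\<Sum>k<N. h k * S (h k) powr p) \<le> C3 * F" for N
      unfolding h_def S_def C3_def F_def using sum_Sop_le[OF p1 \<delta> e(1) cphi, of N] phi0 by simp
    define T where "T = m powr p + M powr p * F"
    have T0: "T \<ge> 0" unfolding T_def using F0 by simp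
    have Sk: "h k * S (h k) powr p \<le> C3 * F" for k
    proof -
      have "h k * S (h k) powr p \<le> (\<Sum>k<Suc k. h k * S (h k) powr p)"
        by (intro member_le_sum[of k "{..<Suc k}" "\<lambda>k. h k * S (h k) powr p"])
           (auto intro!: mult_nonneg_nonneg less_imp_le[OF h(1)])
      with Sum[of "Suc k"] show ?thesis by simp
    qed
    have b0p: "b0 powr p \<le> 4 powr p * (1 + (c * C1) powr p * C3) * T"
    proof -
      have "b0 powr p \<le> 4 powr p * (m powr p + (c * M * (C1 * S (h 0))) powr p)"
        unfolding b0_def using m0 c M C1 S0[of 0] p0 by (intro powr_add_le2) auto
      also have "(c * M * (C1 * S (h 0))) powr p = (c * C1) powr p * (M powr p * S (h 0) powr p)"
        by (simp add: powr_mult mult_ac)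
      also have "S (h 0) powr p \<le> C3 * F"
      proof -
        have "1 * S (h 0) powr p \<le> h 0 * S (h 0) powr p"
          using pi_gt3 by (intro mult_right_mono) (auto simp: h_def)
        with Sk[of 0] show ?thesis by simp
      qed
      finally have "b0 powr p \<le> 4 powr p * (m powr p + (c * C1) powr p * (M powr p * (C3 * F)))"
        by (simp add: mult_left_mono)
      also have "m powr p + (c * C1) powr p * (M powr p * (C3 * F)) \<le> (1 + (c * C1) powr p * C3) * T"
        unfolding T_def distrib_left distrib_right using F0 C3 by (simp add: mult_ac)
      finally show ?thesis by (simp add: mult.assoc mult_left_mono)
    qed
    have lamp: "lam k powr p \<le> 4 powr p * (b0 powr p + C2 powr p * (M powr p * S (h k) powr p))" for k
    proof -
      have "lam k powr p \<le> 4 powr p * (b0 powr p + (C2 * M * S (h k)) powr p)"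
        unfolding lam_def using b00 C2 M S0[of k] p0 by (intro powr_add_le2) auto
      then show ?thesis by (simp add: powr_mult mult_ac)
    qed
    have hsum: "(\<Sum>k<N. h k) \<le> 4 * pi" for N
    proof -
      have "(\<Sum>k<N. h k) = 4 * pi - 2 * h N" by (induction N) (auto simp: h_def)
      then show ?thesis using h(1)[of N] by simp
    qed
    have lamsum: "(\<Sum>k<N. h k * lam k powr p) \<le> 4 * pi * K * T" for N
    proof -
      have "(\<Sum>k<N. h k * lam k powr p) \<le> (\<Sum>k<N. h k * (4 powr p * (b0 powr p + C2 powr p * (M powr p * S (h k) powr p))))"
        using lamp less_imp_le[OF h(1)] by (intro sum_mono mult_left_mono) auto
      also have "\<dots> = 4 powr p * (b0 powr p * (\<Sum>k<N. h k) + C2 powr p * (M powr p * (\<Sum>k<N. h k * S (h k) powr p)))"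
        by (simp add: sum_distrib_left sum.distrib distrib_left mult_ac)
      also have "\<dots> \<le> 4 powr p * (b0 powr p * (4 * pi) + C2 powr p * (M powr p * (C3 * F)))"
        by (intro mult_left_mono add_mono hsum Sum) auto
      also have "\<dots> \<le> 4 powr p * ((4 powr p * (1 + (c * C1) powr p * C3) * T) * (4 * pi) + (4 * pi) * 4 powr p * (C2 powr p * C3 * T))"
      proof (intro mult_left_mono add_mono mult_right_mono b0p)
        have "C2 powr p * (M powr p * (C3 * F)) \<le> C2 powr p * C3 * T"
          unfolding T_def using C3 by (simp add: distrib_left mult_ac)
        also have "\<dots> \<le> (4 * pi * 4 powr p) * (C2 powr p * C3 * T)"
        proof -
          have "1 * 1 \<le> 4 * pi * 4 powr p" using p0 pi_gt3 by (intro mult_mono ge_one_powr_ge_zero) auto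
          then have "1 * (C2 powr p * C3 * T) \<le> (4 * pi * 4 powr p) * (C2 powr p * C3 * T)"
            using C3 T0 by (intro mult_right_mono) auto
          then show ?thesis by simp
        qed
        finally show "C2 powr p * (M powr p * (C3 * F)) \<le> 4 * pi * 4 powr p * (C2 powr p * C3 * T)" .
      qed auto
      also have "\<dots> = 4 * pi * K * T" by (simp add: K_def algebra_simps)
      finally show ?thesis .
    qed
    have bound: "2 * pi * Hn p \<eta> U powr p \<le> 4 * pi * (4 * pi * K * T) + Q powr p * (2 * pi * h N)" for N
    proof -
      have "integral {0..2 * pi} (\<lambda>x. norm (U (Complex x \<eta>)) powr p)
        \<le> integral {0..2 * pi} (\<lambda>x. \<bar>lam 0\<bar> powr p + (\<Sum>k<N. \<bar>lam (Suc k)\<bar> powr p * ee k x) + Q powr p * ee N x)"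
      proof (intro integral_le integrable_continuous_interval continuous_on_norm_powr cu e p0
          continuous_on_add continuous_on_sum continuous_on_mult continuous_on_const cee)
        fix x assume "x \<in> {0..2 * pi}"
        then show "norm (U (Complex x \<eta>)) powr p \<le> \<bar>lam 0\<bar> powr p + (\<Sum>k<N. \<bar>lam (Suc k)\<bar> powr p * ee k x) + Q powr p * ee N x"
          by (intro levelset_pointwise p0 Q lev) (auto simp: ee_def)
      qed
      also have "\<dots> = 2 * pi * \<bar>lam 0\<bar> powr p + (\<Sum>k<N. \<bar>lam (Suc k)\<bar> powr p * integral {0..2 * pi} (ee k)) + Q powr p * integral {0..2 * pi} (ee N)"
      proof (rule integral_unique)
        have "((\<lambda>x. \<bar>lam 0\<bar> powr p) has_integral 2 * pi * \<bar>lam 0\<bar> powr p) {0..2 * pi}"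
          using has_integral_const_real[of "\<bar>lam 0\<bar> powr p" 0 "2 * pi"] by simp
        then show "((\<lambda>x. \<bar>lam 0\<bar> powr p + (\<Sum>k<N. \<bar>lam (Suc k)\<bar> powr p * ee k x) + Q powr p * ee N x) has_integral
          2 * pi * \<bar>lam 0\<bar> powr p + (\<Sum>k<N. \<bar>lam (Suc k)\<bar> powr p * integral {0..2 * pi} (ee k)) + Q powr p * integral {0..2 * pi} (ee N)) {0..2 * pi}"
          by (intro has_integral_add has_integral_sum has_integral_mult_right integrable_integral integrable_continuous_interval cee) auto
      qed
      also have "\<dots> \<le> h 0 * lam 0 powr p + (\<Sum>k<N. lam (Suc k) powr p * (2 * pi * h k)) + Q powr p * (2 * pi * h N)"
        using lam0 by (intro add_mono sum_mono mult_mono iee) (auto simp: h_def integral_nonneg ee_def intro!: integral_nonneg integrable_continuous_interval cee[unfolded ee_def])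
      \<comment> \<open>The set above level k is paid at level k + 1; since \<open>h k\<close> is
        twice \<open>h (Suc k)\<close>, the shift of the index costs a factor 2.\<close>
      also have "(\<Sum>k<N. lam (Suc k) powr p * (2 * pi * h k)) = 4 * pi * (\<Sum>k<N. h (Suc k) * lam (Suc k) powr p)"
        unfolding sum_distrib_left by (intro sum.cong refl) (simp add: h_def)
      also have "h 0 * lam 0 powr p + 4 * pi * (\<Sum>k<N. h (Suc k) * lam (Suc k) powr p) \<le> 4 * pi * (\<Sum>k<Suc N. h k * lam k powr p)"
      proof -
        have "1 * (h 0 * lam 0 powr p) \<le> 4 * pi * (h 0 * lam 0 powr p)"
          using h(1)[of 0] pi_gt3 by (intro mult_right_mono) auto
        then show ?thesis unfolding sum.lessThan_Suc_shift by (simp add: distrib_left)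
      qed
      also have "\<dots> \<le> 4 * pi * (4 * pi * K * T)" by (intro mult_left_mono lamsum) auto
      finally have "2 * pi * Hn p \<eta> U powr p \<le> 4 * pi * (4 * pi * K * T) + Q powr p * (2 * pi * h N)"
        using p0 by (simp add: integral_eq_Lpn)
      then show ?thesis .
    qed
    \<comment> \<open>The bound \<open>Q\<close> of U on the fixed line is not uniform, but it is
      multiplied by \<open>h N\<close>, which tends to 0.\<close>
    have "2 * pi * Hn p \<eta> U powr p \<le> 4 * pi * (4 * pi * K * T)"
    proof (rule LIMSEQ_le_const)
      have "(\<lambda>N. (1 / 2 :: real) ^ N) \<longlonglongrightarrow> 0" by (rule LIMSEQ_power_zero) simp
      then have "(\<lambda>N. 4 * pi * (4 * pi * K * T) + Q powr p * (2 * pi * (2 * pi * (1 / 2) ^ N))) \<longlonglongrightarrow> 4 * pi * (4 * pi * K * T) + Q powr p * (2 * pi * (2 * pi * 0))"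
        by (intro tendsto_add tendsto_mult tendsto_const)
      moreover have "h N = 2 * pi * (1 / 2) ^ N" for N by (simp add: h_def power_divide)
      ultimately show "(\<lambda>N. 4 * pi * (4 * pi * K * T) + Q powr p * (2 * pi * h N)) \<longlonglongrightarrow> 4 * pi * (4 * pi * K * T)" by simp
    qed (use bound in auto)
    also have "\<dots> = 2 * pi * (C * T)" by (simp add: C_def)
    finally have "Hn p \<eta> U powr p \<le> C * T" by (rule mult_left_le_imp_le) simp
    then show ?thesis unfolding T_def F_def .
  qed
  show ?thesis
  proof (rule exI[of _ C], rule conjI[OF C], intro allI impI)
    fix U \<phi> and \<eta> M m :: real
    assume "per_hol U" "0 < \<eta>" "\<eta> \<le> 1" "M > 0" "continuous_on {-pi..pi} \<phi>" "\<forall>\<theta>. \<phi> \<theta> > 0"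
      "\<forall>v. 0 < v \<longrightarrow> v \<le> 4 * pi \<longrightarrow> Hn q v (deriv U) \<le> M * v powr (1 / q - 1) * Aop \<phi> v"
      "\<forall>v>0. norm (integral {0..2*pi} (\<lambda>x. U (Complex x v))) \<le> 2 * pi * m"
    then show "Hn p \<eta> U powr p \<le> C * (m powr p + M powr p * integral {-pi..pi} (\<lambda>\<theta>. \<phi> \<theta> powr p))"
      by (intro main) auto
  qed
qed

section \<open>Hardy spaces\<close>

text \<open>The Poisson kernel of the point r on the real axis, with total mass 2 pi over a
  period.\<close>

definition Pk :: "real \<Rightarrow> real \<Rightarrow> real" where
  "Pk r t = (1 - r\<^sup>2) / (norm (cis t - of_real r))\<^sup>2"

lemma cis_ne_of_real: "0 \<le> r \<Longrightarrow> r < 1 \<Longrightarrow> cis t \<noteq> of_real r"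
  by (metis norm_cis norm_of_real abs_of_nonneg less_irrefl)

lemma Pk_pos: "0 \<le> r \<Longrightarrow> r < 1 \<Longrightarrow> Pk r t > 0"
  unfolding Pk_def using cis_ne_of_real[of r t]
  by (intro divide_pos_pos) (auto simp: power_less_one_iff abs_square_less_1)

lemma continuous_on_Pk [continuous_intros]:
  assumes "continuous_on S f" "0 \<le> r" "r < 1" shows "continuous_on S (\<lambda>x. Pk r (f x))"
  unfolding Pk_def using assms cis_ne_of_real[of r]
  by (intro continuous_on_divide continuous_intros) auto

text \<open>Cauchy's formula at r for f(u) (1 - r^2) / (1 - r u), a function that agrees with f at u
  = r. On the unit circle the conjugate of u is its inverse, whence u / ((u - r)(1 - r u)) = 1 / |u
  - r|^2 and the kernel becomes the Poisson kernel.\<close>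

lemma poisson_formula:
  assumes c: "continuous_on (cball 0 1) f" and h: "f holomorphic_on ball 0 1" and r: "0 \<le> r" "r < 1"
  shows "integral {0..2*pi} (\<lambda>t. of_real (Pk r t) * f (cis t)) = of_real (2 * pi) * f (of_real r)"
proof -
  let ?z = "of_real r :: complex"
  have ne: "1 - ?z * u \<noteq> 0" if "norm u \<le> 1" for u
  proof
    assume "1 - ?z * u = 0"
    then have "norm (?z * u) = 1" by (metis eq_iff_diff_eq_0 norm_one)
    moreover have "norm (?z * u) \<le> r * 1" unfolding norm_mult using that r by (intro mult_mono) auto
    ultimately show False using r by simp
  qed
  define F where "F = (\<lambda>u. f u * (1 - ?z\<^sup>2) / (1 - ?z * u))"
  have "((\<lambda>u. F u / (u - ?z)) has_contour_integral 2 * of_real pi * \<i> * F ?z) (circlepath 0 1)"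
  proof (rule Cauchy_integral_circlepath)
    show "continuous_on (cball 0 1) F" unfolding F_def using ne by (intro continuous_intros c) auto
    show "F holomorphic_on ball 0 1" unfolding F_def using ne by (intro holomorphic_intros h) auto
  qed (use r in simp)
  moreover have "F ?z = f ?z"
  proof -
    have "1 - ?z * ?z \<noteq> 0" using ne[of ?z] r by simp
    then show ?thesis by (simp add: F_def power2_eq_square)
  qed
  ultimately have 1: "((\<lambda>s. F (circlepath 0 1 s) / (circlepath 0 1 s - ?z) * vector_derivative (circlepath 0 1) (at s within {0..1})) has_integral
      2 * of_real pi * \<i> * f ?z) {0..1}"
    by (simp add: has_contour_integral_def)
  have 2: "F (circlepath 0 1 s) / (circlepath 0 1 s - ?z) * vector_derivative (circlepath 0 1) (at s within {0..1})
     = 2 * of_real pi * \<i> * (of_real (Pk r (2 * pi * s)) * f (cis (2 * pi * s)))" if "s \<in> {0..1}" for s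
  proof -
    define u where "u = cis (2 * pi * s)"
    have u: "circlepath 0 1 s = u" by (simp add: circlepath u_def cis_conv_exp mult_ac)
    have vd: "vector_derivative (circlepath 0 1) (at s within {0..1}) = 2 * of_real pi * \<i> * u"
      using vector_derivative_circlepath01[of s 0 1] that by (simp add: u_def cis_conv_exp mult_ac)
    have nu: "norm u = 1" by (simp add: u_def)
    have uu: "u * cnj u = 1" using complex_norm_square[of u] by (simp add: nu)
    have "of_real ((norm (u - ?z))\<^sup>2) = (u - ?z) * (cnj u - ?z)"
      unfolding complex_norm_square by simp
    moreover have "u * (cnj u - ?z) = 1 - ?z * u" by (simp add: right_diff_distrib uu mult.commute)
    ultimately have e: "u * of_real ((norm (u - ?z))\<^sup>2) = (u - ?z) * (1 - ?z * u)"
      by (simp add: mult.left_commute)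
    have n0: "u - ?z \<noteq> 0" "1 - ?z * u \<noteq> 0" "of_real ((norm (u - ?z))\<^sup>2) \<noteq> (0::complex)"
      using cis_ne_of_real[OF r, of "2 * pi * s"] ne[of u] nu by (auto simp: u_def)
    have "u / ((u - ?z) * (1 - ?z * u)) = 1 / of_real ((norm (u - ?z))\<^sup>2)"
      using e n0 by (simp add: frac_eq_eq)
    then have key: "(1 - ?z\<^sup>2) * (u / ((u - ?z) * (1 - ?z * u))) = of_real (Pk r (2 * pi * s))"
      by (simp add: Pk_def u_def[symmetric])
    have "F u / (u - ?z) * (2 * of_real pi * \<i> * u) = 2 * of_real pi * \<i> * (of_real (Pk r (2 * pi * s)) * f u)"
    proof -
      have "a * b / c / d * (k * e) = k * (b * (e / (d * c)) * a)" for a b c d k e :: complex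
        by (simp add: divide_inverse mult_ac)
      then have "F u / (u - ?z) * (2 * of_real pi * \<i> * u) = 2 * of_real pi * \<i> * ((1 - ?z\<^sup>2) * (u / ((u - ?z) * (1 - ?z * u))) * f u)"
        unfolding F_def .
      then show ?thesis unfolding key .
    qed
    then show ?thesis by (simp only: u vd u_def[symmetric])
  qed
  from 1 have "((\<lambda>s. 2 * of_real pi * \<i> * (of_real (Pk r (2 * pi * s)) * f (cis (2 * pi * s)))) has_integral 2 * of_real pi * \<i> * f ?z) {0..1}"
    by (rule has_integral_eq[rotated]) (rule 2)
  then have "((\<lambda>s. (1 / (2 * of_real pi * \<i>)) * (2 * of_real pi * \<i> * (of_real (Pk r (2 * pi * s)) * f (cis (2 * pi * s))))) has_integral
      (1 / (2 * of_real pi * \<i>)) * (2 * of_real pi * \<i> * f ?z)) {0..1}"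
    by (rule has_integral_mult_right)
  then have 3: "((\<lambda>s. of_real (Pk r (2 * pi * s)) * f (cis (2 * pi * s))) has_integral f ?z) (cbox 0 1)"
    by simp
  \<comment> \<open>The substitution t = 2 pi s from the parameter interval of the circle path to
    the angle.\<close>
  have "((\<lambda>t. of_real (Pk r (2 * pi * (1 / (2 * pi) * t + 0))) * f (cis (2 * pi * (1 / (2 * pi) * t + 0)))) has_integral
      (1 / \<bar>1 / (2 * pi)\<bar> ^ DIM(real)) *\<^sub>R f ?z) ((\<lambda>x. (1 / (1 / (2 * pi))) *\<^sub>R x + - ((1 / (1 / (2 * pi))) *\<^sub>R 0)) ` cbox 0 1)"
    using has_integral_affinity[OF 3, of "1 / (2 * pi)" 0] by simp
  moreover have "(\<lambda>x::real. (1 / (1 / (2 * pi))) *\<^sub>R x + - ((1 / (1 / (2 * pi))) *\<^sub>R 0)) ` cbox 0 1 = {0..2*pi}"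
    using image_affinity_atLeastAtMost[of "2 * pi" 0 0 1] by (simp add: mult.commute)
  ultimately have "((\<lambda>t. of_real (Pk r t) * f (cis t)) has_integral of_real (2 * pi) * f ?z) {0..2*pi}"
    by (simp add: scaleR_conv_of_real)
  then show ?thesis by (rule integral_unique)
qed

lemma integral_Pk:
  assumes "0 \<le> r" "r < 1" shows "integral {0..2*pi} (Pk r) = 2 * pi"
proof -
  have "integral {0..2*pi} (\<lambda>t. complex_of_real (Pk r t)) = of_real (2 * pi)"
    using poisson_formula[of "\<lambda>_. 1" r] assms by (simp del: of_real_mult)
  moreover have "((\<lambda>t. complex_of_real (Pk r t)) has_integral of_real (integral {0..2*pi} (Pk r))) {0..2*pi}"
    using assms by (intro has_integral_of_real integrable_integral integrable_continuous_interval continuous_intros)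
  ultimately show ?thesis by (simp add: integral_unique del: of_real_mult)
qed

text \<open>The formula on the unit disc for the rescaled function u \<mapsto> f(e^(-y) e^(ix) u),
  which is holomorphic beyond the closed disc. The disjunct \<open>y = v\<close> disposes of the
  degenerate radius 1.\<close>

lemma poisson_lift:
  assumes f: "f holomorphic_on ball 0 1" and y: "0 < y" "y \<le> v"
  shows "integral {0..2*pi} (\<lambda>t. of_real (Pk (exp (y - v)) t) * lift f (Complex (x + t) y)) = of_real (2 * pi) * lift f (Complex x v) \<or> y = v"
proof (cases "y = v")
  case False
  define r where "r = exp (y - v)"
  have r: "0 \<le> r" "r < 1" using False y by (auto simp: r_def)
  define g where "g = (\<lambda>u. f (of_real (exp (- y)) * cis x * u))"
  have sub: "of_real (exp (- y)) * cis x * u \<in> ball 0 1" if "norm u \<le> 1" for u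
  proof -
    have "norm (of_real (exp (- y)) * cis x * u) = exp (- y) * norm u" by (simp add: norm_mult)
    also have "\<dots> \<le> exp (- y) * 1" using that by (intro mult_left_mono) auto
    also have "\<dots> < 1" using y by simp
    finally show ?thesis by simp
  qed
  have "continuous_on (cball 0 1) g" unfolding g_def
    by (rule continuous_on_compose2[OF holomorphic_on_imp_continuous_on[OF f]]) (use sub in \<open>auto intro!: continuous_intros\<close>)
  moreover have "g holomorphic_on ball 0 1"
    unfolding g_def
    by (rule holomorphic_on_compose_gen[OF _ f, of "\<lambda>u. of_real (exp (- y)) * cis x * u" "ball 0 1", unfolded o_def])
       (use sub in \<open>auto intro!: holomorphic_intros\<close>)
  ultimately have "integral {0..2*pi} (\<lambda>t. of_real (Pk r t) * g (cis t)) = of_real (2 * pi) * g (of_real r)"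
    using r by (intro poisson_formula)
  moreover have "g (cis t) = lift f (Complex (x + t) y)" for t
    by (simp add: g_def lift_def exp_i_Complex mult.assoc cis_mult)
  moreover have "g (of_real r) = lift f (Complex x v)"
  proof -
    have "exp (- y) * r = exp (- v)" by (simp add: r_def flip: exp_add)
    then have "complex_of_real (exp (- y)) * of_real r = of_real (exp (- v))" by (simp only: of_real_mult[symmetric])
    moreover have "complex_of_real (exp (- y)) * cis x * of_real r = (of_real (exp (- y)) * of_real r) * cis x"
      by (simp only: mult_ac)
    ultimately have "complex_of_real (exp (- y)) * cis x * of_real r = of_real (exp (- v)) * cis x" by (simp only:)
    then show ?thesis unfolding g_def lift_def exp_i_Complex by (simp only:)
  qed
  ultimately show ?thesis by (simp add: r_def)
qed simp

text \<open>The normalised Poisson kernel is positive with mass 1 and translations preserve the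
  norm, so Minkowski shows that averaging is a contraction.\<close>

lemma Lpn_Pk_convolution:
  assumes g: "continuous_on UNIV g" "\<And>x. g (x + 2*pi) = g x" and p: "p \<ge> 1" and r: "0 \<le> r" "r < 1"
  shows "Lpn p (\<lambda>x. integral {0..2*pi} (\<lambda>t. of_real (1 / (2*pi) * Pk r t) * g (x + t))) \<le> Lpn p g"
    and "continuous_on S (\<lambda>x. integral {0..2*pi} (\<lambda>t. of_real (1 / (2*pi) * Pk r t) * g (x + t)))"
proof -
  have p0: "p > 0" using p by simp
  have cg: "continuous_on S f \<Longrightarrow> continuous_on S (\<lambda>x. g (f x))" for S and f :: "'c::topological_space \<Rightarrow> real"
    by (rule continuous_on_compose2[OF g(1)]) auto
  let ?F = "\<lambda>t x. of_real (1 / (2*pi) * Pk r t) * g (x + t)"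
  have cF: "continuous_on ({0..2*pi} \<times> S) (\<lambda>(t, x). ?F t x)" for S
    unfolding case_prod_unfold using r by (intro continuous_intros cg)
  have cF': "continuous_on (S \<times> cbox 0 (2*pi)) (\<lambda>(x, t). ?F t x)" for S
    using continuous_on_Times_swap[OF cF] by simp
  show cI: "continuous_on S (\<lambda>x. integral {0..2*pi} (\<lambda>t. ?F t x))" for S
    using integral_continuous_on_param[OF cF'] by simp
  show "Lpn p (\<lambda>x. integral {0..2*pi} (\<lambda>t. ?F t x)) \<le> Lpn p g"
  proof (rule field_le_epsilon)
    fix e :: real assume e: "e > 0"
    define N where "N = Lpn p g + e"
    have N: "N > 0" using e by (simp add: N_def add_nonneg_pos)
    have "Lpn p (\<lambda>x. integral {0..2*pi} (\<lambda>t. ?F t x)) \<le> integral {0..2*pi} (\<lambda>t. N / (2 * pi) * Pk r t)"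
    proof (rule Lpn_minkowski_integral[OF p _ cF _ _ _ cI])
      show "Lpn p (?F t) \<le> N / (2 * pi) * Pk r t" for t
      proof -
        have "Lpn p (?F t) = 1 / (2 * pi) * Pk r t * Lpn p (\<lambda>x. g (x + t))"
          using Pk_pos[OF r, of t] by (subst Lpn_cmult[OF p0]) (simp add: norm_mult norm_divide)
        also have "Lpn p (\<lambda>x. g (x + t)) = Lpn p g" by (rule Lpn_shift[OF p0 g])
        also have "1 / (2 * pi) * Pk r t * Lpn p g \<le> 1 / (2 * pi) * Pk r t * N"
          using Pk_pos[OF r, of t] e by (intro mult_left_mono) (auto simp: N_def)
        finally show ?thesis by (simp add: mult_ac)
      qed
      show "continuous_on {0..2*pi} (\<lambda>t. N / (2 * pi) * Pk r t)" using r by (intro continuous_intros)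
      show "N / (2 * pi) * Pk r t > 0" for t using N Pk_pos[OF r, of t] by simp
      show "norm (integral {0..2*pi} (\<lambda>t. ?F t x)) \<le> integral {0..2*pi} (\<lambda>t. norm (?F t x))" for x
        using r by (intro integral_norm_bound_integral integrable_continuous_interval continuous_intros cg) auto
    qed simp
    also have "\<dots> = N / (2 * pi) * integral {0..2*pi} (Pk r)" by (rule integral_mult_right)
    also have "\<dots> = N" using integral_Pk[OF r] by simp
    finally show "Lpn p (\<lambda>x. integral {0..2*pi} (\<lambda>t. ?F t x)) \<le> Lpn p g + e" by (simp add: N_def)
  qed
qed

lemma poisson_lift':
  assumes "f holomorphic_on ball 0 1" "0 < y" "y < v"
  shows "lift f (Complex x v) = integral {0..2*pi} (\<lambda>t. of_real (1 / (2*pi) * Pk (exp (y - v)) t) * lift f (Complex (x + t) y))"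
proof -
  have "integral {0..2*pi} (\<lambda>t. of_real (1 / (2*pi)) * (of_real (Pk (exp (y - v)) t) * lift f (Complex (x + t) y)))
    = of_real (1 / (2*pi)) * (of_real (2 * pi) * lift f (Complex x v))"
    using poisson_lift[OF assms(1,2), of v x] assms(3) by (subst integral_mult_right) auto
  then show ?thesis by (simp add: mult.assoc)
qed

text \<open>The values at the greater height are Poisson averages of those at the smaller
  one.\<close>

lemma Hn_antimono:
  assumes f: "f holomorphic_on ball 0 1" and p: "p \<ge> 1" and y: "0 < y" "y \<le> v"
  shows "Hn p v (lift f) \<le> Hn p y (lift f)"
proof (cases "y = v")
  case False
  then have yv: "y < v" using y by simp
  have U: "per_hol (lift f)" by (rule per_hol_lift[OF f])
  show ?thesis
    unfolding poisson_lift'[OF f y(1) yv]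
    using y yv by (intro Lpn_Pk_convolution(1) per_hol_line U per_hol_periodic p) auto
qed simp

section \<open>Hardy norms, coefficients and boundedness of the operator\<close>

lemma hardy_mean_le: "f \<in> hardy p \<Longrightarrow> 0 < r \<Longrightarrow> r < 1 \<Longrightarrow> integral_mean p r f \<le> hardy_norm p f"
  unfolding hardy_def hardy_norm_def by (intro cSUP_upper) auto

lemma Hn_le_hardy_norm: "f \<in> hardy p \<Longrightarrow> y > 0 \<Longrightarrow> Hn p y (lift f) \<le> hardy_norm p f"
  using hardy_mean_le[of f p "exp (- y)"] by (simp add: integral_mean_eq_Hn)

lemma hardy_norm_nonneg: "f \<in> hardy p \<Longrightarrow> hardy_norm p f \<ge> 0"
  using order_trans[OF Lpn_nonneg Hn_le_hardy_norm[of f p 1]] by simp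

lemma hardyI:
  assumes "f \<in> Hol_disc" and le: "\<And>y. y > 0 \<Longrightarrow> Hn p y (lift f) \<le> C"
  shows "f \<in> hardy p" "hardy_norm p f \<le> C"
proof -
  have "integral_mean p r f \<le> C" if "0 < r" "r < 1" for r
    using le[of "- ln r"] that by (simp add: integral_mean_eq_Hn')
  then show "f \<in> hardy p" "hardy_norm p f \<le> C"
    using assms(1) unfolding hardy_def hardy_norm_def by (auto intro!: bdd_aboveI2[of _ _ C] cSUP_least)
qed

lemma hardy_Hol_disc: "f \<in> hardy p \<Longrightarrow> f \<in> Hol_disc"
  by (simp add: hardy_def)

text \<open>The coefficient integral on the circle of radius e^(-y) loses the factor e^(ny), which
  disappears as y tends to 0.\<close>

lemma hardy_coeff_le:
  assumes f: "f \<in> hardy p" and p: "p \<ge> 1"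
  shows "norm (taylor_coeff f n) \<le> hardy_norm p f"
proof -
  note H = Hol_disc_taylor[OF hardy_Hol_disc[OF f]]
  have le: "norm (taylor_coeff f n) * exp (- y) ^ n \<le> hardy_norm p f" if y: "y > 0" for y
  proof -
    have r: "0 \<le> exp (- y)" "exp (- y) < 1" using y by auto
    let ?u = "\<lambda>t. lift f (Complex t y)"
    have cu: "continuous_on S ?u" for S
      by (intro per_hol_line per_hol_lift_Hol_disc hardy_Hol_disc[OF f] y)
    have "of_real (2 * pi) * taylor_coeff f n * of_real (exp (- y)) ^ n = integral {0..0 + 2*pi} (\<lambda>t. ?u t * cis (- (of_nat n * t)))"
      using disc_fun_coeff_integral[OF H(1) r, of 0 n] unfolding H(2) by (simp add: lift_def exp_i_Complex)
    also have "norm \<dots> \<le> integral {0..0 + 2*pi} (\<lambda>t. norm (?u t))"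
      by (intro integral_norm_bound_integral integrable_continuous_interval continuous_intros cu) (simp add: norm_mult)
    also have "\<dots> \<le> 2 * pi * Hn p y (lift f)" using integral_norm_le_Lpn[OF p cu] by simp
    also have "\<dots> \<le> 2 * pi * hardy_norm p f" using Hn_le_hardy_norm[OF f y] by simp
    finally show ?thesis by (simp add: norm_mult norm_power)
  qed
  have "((\<lambda>y. norm (taylor_coeff f n) * exp (- y) ^ n) \<longlongrightarrow> norm (taylor_coeff f n) * exp (- 0) ^ n) (at_right 0)"
    by (intro tendsto_intros)
  then have "norm (taylor_coeff f n) * exp (- 0) ^ n \<le> hardy_norm p f"
    by (rule tendsto_upperbound) (auto simp: eventually_at_right_field intro!: exI[of _ 1] le)
  then show ?thesis by simp
qed

lemma disc_fun_diff:
  assumes "disc_series a" "disc_series b"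
  shows "disc_series (\<lambda>n. a n - b n)" "disc_fun (\<lambda>n. a n - b n) = (\<lambda>z. disc_fun a z - disc_fun b z)"
  using assms by (auto simp: disc_series_def disc_fun_def fun_eq_iff left_diff_distrib summable_diff suminf_diff)

lemma disc_fun_add:
  assumes "disc_series a" "disc_series b"
  shows "disc_series (\<lambda>n. a n + b n)" "disc_fun (\<lambda>n. a n + b n) = (\<lambda>z. disc_fun a z + disc_fun b z)"
  using assms by (auto simp: disc_series_def disc_fun_def fun_eq_iff distrib_right summable_add suminf_add)

lemma disc_fun_cmult:
  assumes "disc_series a"
  shows "disc_series (\<lambda>n. c * a n)" "disc_fun (\<lambda>n. c * a n) = (\<lambda>z. c * disc_fun a z)"
  using assms by (auto simp: disc_series_def disc_fun_def fun_eq_iff mult.assoc summable_mult suminf_mult)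

lemma taylor_coeff_diff:
  assumes "f \<in> Hol_disc" "g \<in> Hol_disc"
  shows "taylor_coeff (\<lambda>z. f z - g z) = (\<lambda>n. taylor_coeff f n - taylor_coeff g n)"
  using taylor_coeff_disc_fun[OF disc_fun_diff(1)[OF Hol_disc_taylor(1)[OF assms(1)] Hol_disc_taylor(1)[OF assms(2)]]]
    disc_fun_diff(2)[OF Hol_disc_taylor(1)[OF assms(1)] Hol_disc_taylor(1)[OF assms(2)]]
  by (simp add: Hol_disc_taylor(2) assms)

lemma taylor_coeff_add:
  assumes "f \<in> Hol_disc" "g \<in> Hol_disc"
  shows "taylor_coeff (\<lambda>z. f z + g z) = (\<lambda>n. taylor_coeff f n + taylor_coeff g n)"
  using taylor_coeff_disc_fun[OF disc_fun_add(1)[OF Hol_disc_taylor(1)[OF assms(1)] Hol_disc_taylor(1)[OF assms(2)]]]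
    disc_fun_add(2)[OF Hol_disc_taylor(1)[OF assms(1)] Hol_disc_taylor(1)[OF assms(2)]]
  by (simp add: Hol_disc_taylor(2) assms)

lemma taylor_coeff_cmult:
  assumes "f \<in> Hol_disc"
  shows "taylor_coeff (\<lambda>z. c * f z) = (\<lambda>n. c * taylor_coeff f n)"
  using taylor_coeff_disc_fun[OF disc_fun_cmult(1)[OF Hol_disc_taylor(1)[OF assms]]]
    disc_fun_cmult(2)[OF Hol_disc_taylor(1)[OF assms]]
  by (simp add: Hol_disc_taylor(2) assms)

lemma Hol_disc_diff: "f \<in> Hol_disc \<Longrightarrow> g \<in> Hol_disc \<Longrightarrow> (\<lambda>z. f z - g z) \<in> Hol_disc"
  by (auto simp: Hol_disc_def intro!: holomorphic_intros)

lemma Hn_diff_triangle: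
  assumes "f \<in> Hol_disc" "g \<in> Hol_disc" "p \<ge> 1" "y > 0"
  shows "Hn p y (lift (\<lambda>z. f z - g z)) \<le> Hn p y (lift f) + Hn p y (lift g)"
  using assms
  by (intro Lpn_triangle_le per_hol_line per_hol_lift_Hol_disc Hol_disc_diff) (auto simp: lift_def norm_triangle_ineq4)

lemma hardy_diff:
  assumes "f \<in> hardy p" "g \<in> hardy p" "p \<ge> 1"
  shows "(\<lambda>z. f z - g z) \<in> hardy p" "hardy_norm p (\<lambda>z. f z - g z) \<le> hardy_norm p f + hardy_norm p g"
proof -
  have le: "Hn p y (lift (\<lambda>z. f z - g z)) \<le> hardy_norm p f + hardy_norm p g" if "y > 0" for y
    using Hn_diff_triangle[OF hardy_Hol_disc hardy_Hol_disc, OF assms that]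
      Hn_le_hardy_norm[OF assms(1) that] Hn_le_hardy_norm[OF assms(2) that] by simp
  have "(\<lambda>z. f z - g z) \<in> Hol_disc" using assms by (intro Hol_disc_diff hardy_Hol_disc)
  note I = hardyI[where C = "hardy_norm p f + hardy_norm p g" and p = p, OF this]
  show "(\<lambda>z. f z - g z) \<in> hardy p" by (rule I(1)) (rule le)
  show "hardy_norm p (\<lambda>z. f z - g z) \<le> hardy_norm p f + hardy_norm p g" by (rule I(2)) (rule le)
qed

lemma rhaly_coeff_series:
  assumes "disc_series \<eta>" "f \<in> hardy p" "p \<ge> 1"
  shows "disc_series (rhaly_coeff \<eta> f)"
proof (rule disc_series_le[OF disc_series_mult_Suc[OF assms(1)], of _ "hardy_norm p f"])
  fix n
  have "norm (\<Sum>k\<le>n. taylor_coeff f k) \<le> (\<Sum>k\<le>n. hardy_norm p f)"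
    by (intro order_trans[OF norm_sum] sum_mono hardy_coeff_le assms)
  then have "norm (\<eta> n) * norm (\<Sum>k\<le>n. taylor_coeff f k) \<le> norm (\<eta> n) * (real (Suc n) * hardy_norm p f)"
    by (intro mult_left_mono) auto
  then show "norm (rhaly_coeff \<eta> f n) \<le> hardy_norm p f * norm (of_nat (Suc n) * \<eta> n)"
    by (simp add: rhaly_coeff_def norm_mult mult_ac del: of_nat_Suc)
qed

text \<open>The norm is bounded linearly in the size of the symbol, with a constant that is the same
  for all symbols. Compactness needs this uniformity, because the estimate is applied there to the
  difference of the symbol and its dilate.\<close>

theorem rhaly_bounded:
  fixes p q :: real
  assumes q: "1 < q" "q < p \<or> q = p \<and> p \<le> 2"
  shows "\<exists>C>0. \<forall>\<eta> K f. disc_series \<eta> \<longrightarrow> K > 0 \<longrightarrow>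
    (\<forall>y>0. Hn q y (deriv (lift (disc_fun \<eta>))) \<le> K * y powr (1 / q - 1)) \<longrightarrow> f \<in> hardy p \<longrightarrow>
    rhaly \<eta> f \<in> hardy p \<and> hardy_norm p (rhaly \<eta> f) \<le> C * (norm (\<eta> 0) + K) * hardy_norm p f"
proof -
  have p: "p > 1" "p \<ge> 1" "p > 0" and q1: "q \<ge> 1" using q by auto
  have "\<exists>C>0. \<forall>U \<phi> \<eta> M m. per_hol U \<longrightarrow> 0 < \<eta> \<longrightarrow> \<eta> \<le> 1 \<longrightarrow> M > 0 \<longrightarrow> continuous_on {-pi..pi} \<phi> \<longrightarrow> (\<forall>\<theta>. \<phi> \<theta> > 0) \<longrightarrow>
    (\<forall>v. 0 < v \<longrightarrow> v \<le> 4 * pi \<longrightarrow> Hn q v (deriv U) \<le> M * v powr (1 / q - 1) * Aop \<phi> v) \<longrightarrow>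
    (\<forall>v>0. norm (integral {0..2*pi} (\<lambda>x. U (Complex x v))) \<le> 2 * pi * m) \<longrightarrow>
    Hn p \<eta> U powr p \<le> C * (m powr p + M powr p * integral {-pi..pi} (\<lambda>\<theta>. \<phi> \<theta> powr p))"
  proof (cases "q < p")
    case True
    show ?thesis by (rule rearrangement_bound[OF q(1) True])
  next
    case False
    then have qp: "q = p" "p \<le> 2" using q(2) by auto
    show ?thesis unfolding qp(1) by (rule dyadic_bound[OF p(1) qp(2)])
  qed
  then obtain C0 where C0: "C0 > 0" and core0: "\<forall>U \<phi> \<eta> M m. per_hol U \<longrightarrow> 0 < \<eta> \<longrightarrow> \<eta> \<le> 1 \<longrightarrow> M > 0 \<longrightarrow> continuous_on {-pi..pi} \<phi> \<longrightarrow> (\<forall>\<theta>. \<phi> \<theta> > 0) \<longrightarrow>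
    (\<forall>v. 0 < v \<longrightarrow> v \<le> 4 * pi \<longrightarrow> Hn q v (deriv U) \<le> M * v powr (1 / q - 1) * Aop \<phi> v) \<longrightarrow>
    (\<forall>v>0. norm (integral {0..2*pi} (\<lambda>x. U (Complex x v))) \<le> 2 * pi * m) \<longrightarrow>
    Hn p \<eta> U powr p \<le> C0 * (m powr p + M powr p * integral {-pi..pi} (\<lambda>\<theta>. \<phi> \<theta> powr p))"
    by (elim exE conjE) (rule that)
  note core = core0[rule_format]
  \<comment> \<open>The 1 belongs to the mean value, the first 4^p to the constant 4 of the
    derivative estimate, and the rest to the integral of \<open>\<phi>\<close> to the power
    p.\<close>
  define L where "L = C0 * (1 + 4 powr p * (4 powr p * (4 * pi)))"
  have L: "L > 0" unfolding L_def using C0 by (intro mult_pos_pos add_pos_nonneg) auto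
  define C where "C = L powr (1 / p)"
  have C: "C > 0" using L by (simp add: C_def)
  have Cp: "C powr p = L" using L p by (simp add: C_def powr_powr)
  have main: "rhaly \<eta> f \<in> hardy p \<and> hardy_norm p (rhaly \<eta> f) \<le> C * (norm (\<eta> 0) + K) * hardy_norm p f"
    if eta: "disc_series \<eta>" and K: "K > 0" and H: "\<And>y. y > 0 \<Longrightarrow> Hn q y (deriv (lift (disc_fun \<eta>))) \<le> K * y powr (1 / q - 1)"
      and f: "f \<in> hardy p" for \<eta> K f
  proof -
    define a where "a = taylor_coeff f"
    have a: "disc_series a" "disc_fun a = f" unfolding a_def using Hol_disc_taylor[OF hardy_Hol_disc[OF f]] by auto
    define N where "N = hardy_norm p f"
    have N: "N \<ge> 0" unfolding N_def by (rule hardy_norm_nonneg[OF f])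
    have an: "norm (a n) \<le> N" for n unfolding a_def N_def by (rule hardy_coeff_le[OF f p(2)])
    define X where "X = norm (\<eta> 0) + K"
    have X: "X > 0" using K by (simp add: X_def add_nonneg_pos)
    \<comment> \<open>The coefficients of the image of the dilate f(\<rho> z), for which the
      integral representation is available.\<close>
    define c where "c = (\<lambda>\<rho> n. \<eta> n * (\<Sum>k\<le>n. a k * of_real \<rho> ^ k))"
    have c: "disc_series (c \<rho>)" if "0 \<le> \<rho>" "\<rho> < 1" for \<rho>
      unfolding c_def by (rule integral_kern(2)[OF eta a(1) that, where w = \<i>]) simp
    \<comment> \<open>A number above the norm is added to |f|, so that \<open>\<phi>\<close> is
      positive even where f vanishes, while its p-norm stays comparable to that number.\<close>
    have step1: "Hn p y (lift (disc_fun (c \<rho>))) \<le> C * X * N'" if y: "0 < y" "y \<le> 1" and r: "0 < \<rho>" "\<rho> < 1" and N': "N' > N" for y \<rho> N'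
    proof -
      have N'0: "N' > 0" using N N' by linarith
      let ?f = "\<lambda>\<theta>. disc_fun a (of_real \<rho> * cis \<theta>)"
      define \<phi> where "\<phi> = (\<lambda>\<theta>. norm (?f \<theta>) + N')"
      have cf: "continuous_on S ?f" for S
        by (rule continuous_on_compose2[OF holomorphic_on_imp_continuous_on[OF disc_fun_holomorphic[OF a(1)]]])
           (use r in \<open>auto intro!: continuous_intros simp: norm_mult\<close>)
      have cphi: "continuous_on {-pi..pi} \<phi>" unfolding \<phi>_def by (intro continuous_intros cf)
      have phi: "\<phi> \<theta> > 0" for \<theta> using N'0 by (simp add: \<phi>_def add_nonneg_pos)
      have fle: "norm (?f \<theta>) \<le> \<phi> \<theta>" for \<theta> using N'0 by (simp add: \<phi>_def)
      let ?U = "lift (disc_fun (c \<rho>))"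
      have U: "per_hol ?U" using c r by (intro per_hol_lift_disc_fun) auto
      have mean: "norm (integral {0..2*pi} (\<lambda>x. ?U (Complex x v))) \<le> 2 * pi * (norm (\<eta> 0) * N')" if v: "v > 0" for v
      proof -
        have "integral {0..0 + 2*pi} (\<lambda>x. ?U (Complex x v)) = of_real (2 * pi) * (\<eta> 0 * a 0)"
          using disc_fun_coeff_integral[OF c[of \<rho>], of "exp (- v)" 0 0] r v
          by (simp add: lift_def exp_i_Complex c_def)
        then have "norm (integral {0..2*pi} (\<lambda>x. ?U (Complex x v))) = 2 * pi * (norm (\<eta> 0) * norm (a 0))"
          by (simp add: norm_mult)
        also have "\<dots> \<le> 2 * pi * (norm (\<eta> 0) * N')"
          using an[of 0] N' by (intro mult_left_mono) auto
        finally show ?thesis .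
      qed
      have der: "Hn q v (deriv ?U) \<le> 4 * K * v powr (1 / q - 1) * Aop \<phi> v" if "0 < v" "v \<le> 4 * pi" for v
        unfolding c_def using r by (intro Hn_rhaly_deriv_le(2)[OF eta q1 K H a(1) _ _ that cphi fle phi]) auto
      have I: "integral {-pi..pi} (\<lambda>\<theta>. \<phi> \<theta> powr p) \<le> 4 powr p * (4 * pi) * N' powr p"
      proof -
        have per: "integral {-pi..-pi + 2*pi} (\<lambda>\<theta>. norm (?f \<theta>) powr p) = integral {0..2*pi} (\<lambda>\<theta>. norm (?f \<theta>) powr p)"
          by (rule integral_periodic_shift) (use cf p in \<open>auto intro!: continuous_intros simp flip: cis_mult\<close>)
        have mN: "integral {0..2*pi} (\<lambda>\<theta>. norm (?f \<theta>) powr p) \<le> 2 * pi * N powr p"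
          using hardy_mean_le[OF f r] N p unfolding a(2) N_def integral_mean_def Lpn_def[symmetric] Lpn_le_iff
          by (simp add: Lpn_le_iff[symmetric] Lpn_def)
        have "integral {-pi..pi} (\<lambda>\<theta>. \<phi> \<theta> powr p) \<le> integral {-pi..pi} (\<lambda>\<theta>. 4 powr p * (norm (?f \<theta>) powr p + N' powr p))"
        proof (intro integral_le integrable_continuous_interval)
          show "continuous_on {-pi..pi} (\<lambda>\<theta>. \<phi> \<theta> powr p)"
            using phi p by (intro continuous_on_powr' cphi continuous_on_const) (auto intro: less_imp_le)
          show "continuous_on {-pi..pi} (\<lambda>\<theta>. 4 powr p * (norm (?f \<theta>) powr p + N' powr p))"
            using p by (intro continuous_on_mult continuous_on_add continuous_on_const continuous_on_norm_powr cf)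
          show "\<phi> \<theta> powr p \<le> 4 powr p * (norm (?f \<theta>) powr p + N' powr p)" for \<theta>
            unfolding \<phi>_def using p N'0 by (intro powr_add_le2) auto
        qed
        also have "\<dots> = 4 powr p * (integral {-pi..pi} (\<lambda>\<theta>. norm (?f \<theta>) powr p) + 2 * pi * N' powr p)"
        proof (rule integral_unique)
          have "((\<lambda>\<theta>. N' powr p) has_integral 2 * pi * N' powr p) {-pi..pi}"
            using has_integral_const_real[of "N' powr p" "-pi" pi] by simp
          then show "((\<lambda>\<theta>. 4 powr p * (norm (?f \<theta>) powr p + N' powr p)) has_integral 4 powr p * (integral {-pi..pi} (\<lambda>\<theta>. norm (?f \<theta>) powr p) + 2 * pi * N' powr p)) {-pi..pi}"
            using p by (intro has_integral_mult_right has_integral_add integrable_integral integrable_continuous_interval continuous_on_norm_powr cf)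
        qed
        also have "\<dots> \<le> 4 powr p * (2 * pi * N' powr p + 2 * pi * N' powr p)"
        proof (intro mult_left_mono add_right_mono)
          have "2 * pi * N powr p \<le> 2 * pi * N' powr p" using N N' p by (intro mult_left_mono powr_mono2) auto
          then show "integral {-pi..pi} (\<lambda>\<theta>. norm (?f \<theta>) powr p) \<le> 2 * pi * N' powr p"
          proof -
            have "-pi + 2*pi = pi" by simp
            with per have "integral {-pi..pi} (\<lambda>\<theta>. norm (?f \<theta>) powr p) = integral {0..2*pi} (\<lambda>\<theta>. norm (?f \<theta>) powr p)"
              by (simp only:)
            then show ?thesis using mN \<open>2 * pi * N powr p \<le> 2 * pi * N' powr p\<close> by linarith
          qed
        qed simp
        finally show ?thesis by simp
      qed
      have "Hn p y ?U powr p \<le> C0 * ((norm (\<eta> 0) * N') powr p + (4 * K) powr p * integral {-pi..pi} (\<lambda>\<theta>. \<phi> \<theta> powr p))"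
        using K y phi der mean by (intro core[OF U _ _ _ cphi]) auto
      also have "\<dots> \<le> C0 * ((X * N') powr p + (4 * X) powr p * (4 powr p * (4 * pi) * N' powr p))"
      proof -
        have I0: "0 \<le> integral {-pi..pi} (\<lambda>\<theta>. \<phi> \<theta> powr p)"
          using phi p by (intro integral_nonneg integrable_continuous_interval continuous_on_powr' cphi continuous_on_const)
            (auto intro: less_imp_le)
        show ?thesis
          using C0 I I0 K N'0 p
          by (intro mult_left_mono add_mono mult_mono powr_mono2 mult_right_mono) (auto simp: X_def)
      qed
      also have "\<dots> = (C * X * N') powr p"
        by (simp add: powr_mult Cp L_def algebra_simps)
      finally have "Hn p y ?U powr p \<le> (C * X * N') powr p" .
      moreover have "C * X * N' \<ge> 0" using C X N'0 by simp
      ultimately show ?thesis using powr_less_mono2[of p "C * X * N'" "Hn p y ?U"] p by (cases "Hn p y ?U \<le> C * X * N'") auto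
    qed
    \<comment> \<open>Greater heights follow by monotonicity of the means.\<close>
    have step2: "Hn p y (lift (disc_fun (c \<rho>))) \<le> C * X * N'" if y: "0 < y" and r: "0 < \<rho>" "\<rho> < 1" and N': "N' > N" for y \<rho> N'
    proof -
      have "Hn p y (lift (disc_fun (c \<rho>))) \<le> Hn p (min y 1) (lift (disc_fun (c \<rho>)))"
        using y r c by (intro Hn_antimono disc_fun_holomorphic p) auto
      also have "\<dots> \<le> C * X * N'" using y r N' by (intro step1) auto
      finally show ?thesis .
    qed
    define d where "d = rhaly_coeff \<eta> f"
    have d: "disc_series d" unfolding d_def by (rule rhaly_coeff_series[OF eta f p(2)])
    have rh: "rhaly \<eta> f = disc_fun d" by (simp add: rhaly_def d_def)
    have step3: "Hn p y (lift (disc_fun d)) \<le> C * X * N'" if y: "0 < y" and N': "N' > N" for y N'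
    proof -
      \<comment> \<open>One factor n + 1 counts the terms of the partial sum, the other comes from
        Bernoulli's bound of 1 - \<rho>^k by k (1 - \<rho>). At fixed height the error is therefore
        O(1 - \<rho>).\<close>
      define T where "T = (\<lambda>n. norm (of_nat (Suc n) * (of_nat (Suc n) * \<eta> n)) * exp (- y) ^ n)"
      have T: "summable T" unfolding T_def
        using y by (intro disc_series_summable_norm disc_series_mult_Suc eta) auto
      have le: "Hn p y (lift (disc_fun d)) \<le> C * X * N' + (1 - \<rho>) * (N * suminf T)" if r: "0 < \<rho>" "\<rho> < 1" for \<rho>
      proof -
        have cr: "disc_series (c \<rho>)" using c r by auto
        let ?e = "\<lambda>n. d n - c \<rho> n"
        have e: "disc_series ?e" "disc_fun ?e = (\<lambda>z. disc_fun d z - disc_fun (c \<rho>) z)"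
          using disc_fun_diff[OF d cr] by auto
        have en: "norm (?e n) \<le> (1 - \<rho>) * (N * norm (of_nat (Suc n) * (of_nat (Suc n) * \<eta> n)))" for n
        proof -
          have "?e n = \<eta> n * (\<Sum>k\<le>n. a k * (1 - of_real \<rho> ^ k))"
            by (simp add: d_def c_def rhaly_coeff_def a_def right_diff_distrib sum_subtractf)
          moreover have "norm (\<Sum>k\<le>n. a k * (1 - of_real \<rho> ^ k)) \<le> (\<Sum>k\<le>n. N * (real (Suc n) * (1 - \<rho>)))"
          proof (rule order_trans[OF norm_sum], rule sum_mono)
            fix k assume k: "k \<in> {..n}"
            have "norm (1 - complex_of_real \<rho> ^ k) = 1 - \<rho> ^ k"
            proof -
              have "1 - complex_of_real \<rho> ^ k = of_real (1 - \<rho> ^ k)" by simp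
              then show ?thesis using r by (simp only: norm_of_real) (simp add: power_le_one)
            qed
            also have "\<dots> \<le> real k * (1 - \<rho>)"
              using Bernoulli_inequality[of "\<rho> - 1" k] r by (simp add: algebra_simps)
            also have "\<dots> \<le> real (Suc n) * (1 - \<rho>)" using k r by (intro mult_right_mono) auto
            finally show "norm (a k * (1 - of_real \<rho> ^ k)) \<le> N * (real (Suc n) * (1 - \<rho>))"
              unfolding norm_mult using an N by (intro mult_mono) auto
          qed
          ultimately have "norm (?e n) \<le> norm (\<eta> n) * (\<Sum>k\<le>n. N * (real (Suc n) * (1 - \<rho>)))"
            by (simp add: norm_mult mult_left_mono)
          then show ?thesis by (simp add: norm_mult mult_ac del: of_nat_Suc)
        qed
        have "norm (lift (disc_fun ?e) (Complex x y)) \<le> (1 - \<rho>) * (N * suminf T)" for x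
        proof -
          have s: "(\<lambda>n. ?e n * exp (\<i> * Complex x y) ^ n) sums lift (disc_fun ?e) (Complex x y)"
            using y by (intro lift_sums e) auto
          have "norm (?e n * exp (\<i> * Complex x y) ^ n) \<le> (1 - \<rho>) * (N * T n)" for n
            using mult_right_mono[OF en[of n], of "exp (- y) ^ n"]
            by (simp add: norm_mult norm_power T_def mult.assoc del: of_nat_Suc)
          then have "norm (\<Sum>n. ?e n * exp (\<i> * Complex x y) ^ n) \<le> (\<Sum>n. (1 - \<rho>) * (N * T n))"
            by (intro norm_suminf_le summable_mult T)
          also have "\<dots> = (1 - \<rho>) * (N * suminf T)" using T by (simp add: suminf_mult summable_mult)
          finally show ?thesis using s by (simp add: sums_iff)
        qed
        then have E: "Hn p y (lift (disc_fun ?e)) \<le> (1 - \<rho>) * (N * suminf T)"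
          using y p N r T
          by (intro Lpn_le_const per_hol_line per_hol_lift_disc_fun e) (auto intro!: mult_nonneg_nonneg suminf_nonneg simp: T_def)
        have "Hn p y (lift (disc_fun d)) \<le> Hn p y (lift (disc_fun (c \<rho>))) + Hn p y (lift (disc_fun ?e))"
        proof (intro Lpn_triangle_le p(2) per_hol_line per_hol_lift_disc_fun cr d e y)
          show "norm (lift (disc_fun d) (Complex x y)) \<le> norm (lift (disc_fun (c \<rho>)) (Complex x y)) + norm (lift (disc_fun ?e) (Complex x y))" for x
            unfolding e(2) lift_def using norm_triangle_ineq[of "disc_fun (c \<rho>) (exp (\<i> * Complex x y))" "disc_fun d (exp (\<i> * Complex x y)) - disc_fun (c \<rho>) (exp (\<i> * Complex x y))"] by simp
        qed
        also have "\<dots> \<le> C * X * N' + (1 - \<rho>) * (N * suminf T)"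
          using step2[OF y r N'] E by simp
        finally show ?thesis .
      qed
      have "((\<lambda>\<rho>. C * X * N' + (1 - \<rho>) * (N * suminf T)) \<longlongrightarrow> C * X * N' + (1 - 1) * (N * suminf T)) (at_left 1)"
        by (intro tendsto_intros)
      then have "Hn p y (lift (disc_fun d)) \<le> C * X * N' + (1 - 1) * (N * suminf T)"
        by (rule tendsto_lowerbound) (auto simp: eventually_at_left_field intro!: exI[of _ 0] le)
      then show ?thesis by simp
    qed
    have step4: "Hn p y (lift (rhaly \<eta> f)) \<le> C * X * N" if y: "0 < y" for y
    proof (rule field_le_epsilon)
      fix e :: real assume e: "e > 0"
      have "Hn p y (lift (disc_fun d)) \<le> C * X * (N + e / (C * X))" using e C X by (intro step3 y) auto
      also have "\<dots> = C * X * N + e" using C X by (simp add: distrib_left)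
      finally show "Hn p y (lift (rhaly \<eta> f)) \<le> C * X * N + e" by (simp add: rh)
    qed
    have "rhaly \<eta> f \<in> Hol_disc" unfolding rh by (rule disc_fun_Hol_disc[OF d])
    from hardyI[OF this step4] show ?thesis by (simp add: X_def N_def)
  qed
  show ?thesis
  proof (rule exI[of _ C], rule conjI[OF C], intro allI impI)
    fix \<eta> f and K :: real
    assume "disc_series \<eta>" "K > 0" "\<forall>y>0. Hn q y (deriv (lift (disc_fun \<eta>))) \<le> K * y powr (1 / q - 1)" "f \<in> hardy p"
    then show "rhaly \<eta> f \<in> hardy p \<and> hardy_norm p (rhaly \<eta> f) \<le> C * (norm (\<eta> 0) + K) * hardy_norm p f"
      by (intro main) auto
  qed
qed

section \<open>Compactness\<close>

text \<open>The little-oh condition on the derivative, in epsilon form: the hub through which the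
  Lipschitz space and compactness communicate.\<close>

definition small_deriv :: "real \<Rightarrow> (complex \<Rightarrow> complex) \<Rightarrow> bool" where
  "small_deriv p F \<longleftrightarrow> (\<forall>e>0. \<exists>y0>0. \<forall>y. 0 < y \<longrightarrow> y < y0 \<longrightarrow> Hn p y (deriv (lift F)) \<le> e * y powr (1 / p - 1))"

lemma norm_lift_disc_fun_le:
  assumes c: "disc_series c" and y: "y > 0"
  shows "norm (lift (disc_fun c) (Complex x y)) \<le> (\<Sum>n. norm (c n) * exp (- y) ^ n)"
proof -
  have s: "(\<lambda>n. c n * exp (\<i> * Complex x y) ^ n) sums lift (disc_fun c) (Complex x y)"
    using y by (intro lift_sums c) auto
  have "norm (\<Sum>n. c n * exp (\<i> * Complex x y) ^ n) \<le> (\<Sum>n. norm (c n) * exp (- y) ^ n)"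
    using y by (intro norm_suminf_le disc_series_summable_norm c) (auto simp: norm_mult norm_power)
  then show ?thesis using s by (simp add: sums_iff)
qed

lemma Hn_disc_fun_le:
  assumes c: "disc_series c" and y: "y > 0" and p: "p > 0"
  shows "Hn p y (lift (disc_fun c)) \<le> (\<Sum>n. norm (c n) * exp (- y) ^ n)"
  using y p by (intro Lpn_le_const per_hol_line per_hol_lift_disc_fun c norm_lift_disc_fun_le suminf_nonneg disc_series_summable_norm) auto

text \<open>Without constant term the series decays like e^(-y). Half of the exponent is spent on
  convergence at height y1/2, the other half beats the power of y.\<close>

lemma Hn_far_le:
  assumes c: "disc_series c" "c 0 = 0" and y: "0 < y1" "y1 \<le> y" and q: "q \<ge> 1"
  shows "Hn q y (lift (disc_fun c)) \<le> 2 * (\<Sum>n. norm (c n) * exp (- y1 / 2) ^ n) * y powr (1 / q - 1)"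
proof -
  have y0: "y > 0" using y by simp
  have sm: "summable (\<lambda>n. norm (c n) * exp (- y1 / 2) ^ n)"
    using y by (intro disc_series_summable_norm c) auto
  have le: "norm (c n) * exp (- y) ^ n \<le> exp (- y / 2) * (norm (c n) * exp (- y1 / 2) ^ n)" for n
  proof (cases n)
    case 0
    then show ?thesis using c by simp
  next
    case (Suc m)
    have "exp (- y / 2) ^ n \<le> exp (- y / 2) ^ 1" using Suc y0 by (intro power_decreasing) auto
    moreover have "exp (- y / 2) ^ n \<le> exp (- y1 / 2) ^ n" using y by (intro power_mono) auto
    ultimately have "exp (- y / 2) ^ n * exp (- y / 2) ^ n \<le> exp (- y / 2) * exp (- y1 / 2) ^ n"
      by (intro mult_mono) auto
    moreover have "exp (- y) ^ n = exp (- y / 2) ^ n * exp (- y / 2) ^ n"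
      by (simp flip: power_mult_distrib exp_add)
    ultimately have "norm (c n) * exp (- y) ^ n \<le> norm (c n) * (exp (- y / 2) * exp (- y1 / 2) ^ n)"
      by (intro mult_left_mono) auto
    then show ?thesis by (simp add: mult_ac)
  qed
  define T where "T = (\<Sum>n. norm (c n) * exp (- y1 / 2) ^ n)"
  have T: "T \<ge> 0" unfolding T_def using sm by (intro suminf_nonneg) auto
  have "Hn q y (lift (disc_fun c)) \<le> (\<Sum>n. norm (c n) * exp (- y) ^ n)"
    using q y0 by (intro Hn_disc_fun_le c) auto
  also have "\<dots> \<le> (\<Sum>n. exp (- y / 2) * (norm (c n) * exp (- y1 / 2) ^ n))"
    using y0 by (intro suminf_le le summable_mult sm disc_series_summable_norm c) auto
  also have "\<dots> = exp (- y / 2) * T" using sm by (simp add: T_def suminf_mult)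
  also have "\<dots> \<le> (2 * y powr (1 / q - 1)) * T"
  proof (rule mult_right_mono[OF _ T])
    have "y powr (1 - 1 / q) \<le> 1 + y"
    proof (cases "y \<le> 1")
      case True
      have "y powr (1 - 1 / q) \<le> 1 powr (1 - 1 / q)" using True y0 q by (intro powr_mono2) auto
      then show ?thesis using y0 by simp
    next
      case False
      have "y powr (1 - 1 / q) \<le> y powr 1" using False q by (intro powr_mono) auto
      then show ?thesis using y0 by simp
    qed
    also have "\<dots> \<le> 2 * (1 + y / 2)" using y0 by simp
    also have "\<dots> \<le> 2 * exp (y / 2)" by (intro mult_left_mono exp_ge_add_one_self) simp
    finally have "exp (- y / 2) * y powr (1 - 1 / q) * y powr (1 / q - 1) \<le> exp (- y / 2) * (2 * exp (y / 2)) * y powr (1 / q - 1)"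
      by (intro mult_right_mono mult_left_mono) auto
    then have "exp (- y / 2) * (y powr (1 - 1 / q) * y powr (1 / q - 1)) \<le> exp (- y / 2) * (2 * exp (y / 2)) * y powr (1 / q - 1)"
      by (simp only: mult.assoc)
    moreover have "y powr (1 - 1 / q) * y powr (1 / q - 1) = 1" using y0 by (simp flip: powr_add)
    moreover have "exp (- y / 2) * (2 * exp (y / 2)) = 2" by (simp flip: exp_add)
    ultimately show "exp (- y / 2) \<le> 2 * y powr (1 / q - 1)" by (simp only: mult_1_right)
  qed
  finally show ?thesis by (simp add: T_def mult_ac)
qed

lemma Hn_deriv_lift_disc_fun:
  "disc_series c \<Longrightarrow> y > 0 \<Longrightarrow> Hn p y (deriv (lift (disc_fun c))) = Hn p y (lift (disc_fun (\<lambda>n. \<i> * of_nat n * c n)))"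
  using deriv_lift_disc_fun[of c] by simp

text \<open>The little-oh condition covers small heights. Away from the real line the bound is
  automatic, because the differentiated series has no constant term.\<close>

lemma small_deriv_bound:
  assumes eta: "disc_series \<eta>" and sd: "small_deriv q (disc_fun \<eta>)" and q: "q \<ge> 1"
  shows "\<exists>K>0. \<forall>y>0. Hn q y (deriv (lift (disc_fun \<eta>))) \<le> K * y powr (1 / q - 1)"
proof -
  obtain y0 where y0: "y0 > 0" "\<And>y. 0 < y \<Longrightarrow> y < y0 \<Longrightarrow> Hn q y (deriv (lift (disc_fun \<eta>))) \<le> 1 * y powr (1 / q - 1)"
    using sd unfolding small_deriv_def by (meson zero_less_one)
  define T where "T = (\<Sum>n. norm (\<i> * of_nat n * \<eta> n) * exp (- y0 / 2) ^ n)"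
  have T: "T \<ge> 0" unfolding T_def
    using y0 by (intro suminf_nonneg disc_series_summable_norm disc_series_i_nat eta) auto
  have "Hn q y (deriv (lift (disc_fun \<eta>))) \<le> (1 + 2 * T) * y powr (1 / q - 1)" if y: "y > 0" for y
  proof (cases "y < y0")
    case True
    have "Hn q y (deriv (lift (disc_fun \<eta>))) \<le> 1 * y powr (1 / q - 1)" using y0(2)[OF y True] .
    also have "\<dots> \<le> (1 + 2 * T) * y powr (1 / q - 1)" using T by (intro mult_right_mono) auto
    finally show ?thesis .
  next
    case False
    have "Hn q y (lift (disc_fun (\<lambda>n. \<i> * of_nat n * \<eta> n))) \<le> 2 * T * y powr (1 / q - 1)"
      unfolding T_def using False y0 q by (intro Hn_far_le disc_series_i_nat eta) auto
    also have "\<dots> \<le> (1 + 2 * T) * y powr (1 / q - 1)" by (intro mult_right_mono) auto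
    finally show ?thesis using Hn_deriv_lift_disc_fun[OF eta y] by simp
  qed
  then show ?thesis using T by (intro exI[of _ "1 + 2 * T"]) auto
qed

text \<open>The dilates \<open>F(e\<^sup>-\<^sup>\<delta> z)\<close> approximate \<open>F\<close> in the Lipschitz norm, exactly because \<open>F\<close> lies in the
  little-oh space.\<close>

lemma dilate_approx:
  assumes eta: "disc_series \<eta>" and sd: "small_deriv q (disc_fun \<eta>)" and q: "q \<ge> 1" and e: "e > 0"
  shows "\<exists>\<delta>>0. disc_series (\<lambda>n. \<eta> n * (1 - of_real (exp (- \<delta>)) ^ n)) \<and>
    (\<forall>y>0. Hn q y (deriv (lift (disc_fun (\<lambda>n. \<eta> n * (1 - of_real (exp (- \<delta>)) ^ n))))) \<le> e * y powr (1 / q - 1))"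
proof -
  obtain y0 where y0: "y0 > 0" and sm: "\<And>y. 0 < y \<Longrightarrow> y < y0 \<Longrightarrow> Hn q y (deriv (lift (disc_fun \<eta>))) \<le> e / 2 * y powr (1 / q - 1)"
    using sd e unfolding small_deriv_def by (meson half_gt_zero)
  have q0: "q > 0" using q by simp
  \<comment> \<open>One factor n is the derivative, the other comes from bounding 1 - e^(-\<delta>
    n) by \<delta> n.\<close>
  define c where "c = (\<lambda>n. of_nat n * (of_nat n * \<eta> n))"
  have c: "disc_series c" unfolding c_def by (intro disc_series_mult_nat eta)
  define T where "T = (\<Sum>n. norm (c n) * exp (- (y0 / 2) / 2) ^ n)"
  have smT: "summable (\<lambda>n. norm (c n) * exp (- (y0 / 2) / 2) ^ n)"
    using y0 by (intro disc_series_summable_norm c) auto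
  have T: "T \<ge> 0" unfolding T_def using smT by (intro suminf_nonneg) auto
  \<comment> \<open>The first bound keeps y + \<delta> in the range of the little-oh estimate when y
    < y0/2; the second makes the contribution of all greater heights at most
    \<open>e\<close>.\<close>
  define \<delta> where "\<delta> = min (y0 / 2) (e / (2 * T + 1))"
  have d2: "\<delta> \<le> y0 / 2" unfolding \<delta>_def by (rule min.cobounded1)
  have d1: "\<delta> > 0" using y0 e T by (simp add: \<delta>_def)
  note d = d1 d2
  have "\<delta> * (2 * T) \<le> e"
  proof -
    have "\<delta> * (2 * T + 1) \<le> e / (2 * T + 1) * (2 * T + 1)" using T by (intro mult_right_mono) (auto simp: \<delta>_def)
    also have "\<dots> = e" using T by simp
    finally show ?thesis using d by (simp add: distrib_left)
  qed
  define \<kappa> where "\<kappa> = (\<lambda>n. \<eta> n * (1 - of_real (exp (- \<delta>)) ^ n))"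
  have fac: "norm (1 - complex_of_real (exp (- \<delta>)) ^ n) \<le> 1" "norm (1 - complex_of_real (exp (- \<delta>)) ^ n) \<le> \<delta> * n" for n
  proof -
    have "1 - complex_of_real (exp (- \<delta>)) ^ n = of_real (1 - exp (- \<delta>) ^ n)" by simp
    then have n: "norm (1 - complex_of_real (exp (- \<delta>)) ^ n) = 1 - exp (- \<delta>) ^ n"
      using d by (simp only: norm_of_real) (simp add: power_le_one)
    show "norm (1 - complex_of_real (exp (- \<delta>)) ^ n) \<le> 1" unfolding n by simp
    show "norm (1 - complex_of_real (exp (- \<delta>)) ^ n) \<le> \<delta> * n"
      unfolding n using exp_ge_add_one_self[of "- (\<delta> * n)"] by (simp add: exp_of_nat_mult[symmetric] mult.commute)
  qed
  have k: "disc_series \<kappa>"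
    unfolding \<kappa>_def using mult_left_mono[OF fac(1)] by (intro disc_series_le[OF eta, of _ 1]) (auto simp: norm_mult)
  have dil: "lift (disc_fun \<kappa>) w = lift (disc_fun \<eta>) w - lift (disc_fun \<eta>) (w + \<i> * of_real \<delta>)" if w: "Im w > 0" for w
  proof -
    have "(\<lambda>n. \<eta> n * exp (\<i> * w) ^ n - \<eta> n * exp (\<i> * (w + \<i> * of_real \<delta>)) ^ n) sums
      (lift (disc_fun \<eta>) w - lift (disc_fun \<eta>) (w + \<i> * of_real \<delta>))"
      using w d by (intro sums_diff lift_sums eta) auto
    moreover have "\<eta> n * exp (\<i> * w) ^ n - \<eta> n * exp (\<i> * (w + \<i> * of_real \<delta>)) ^ n = \<kappa> n * exp (\<i> * w) ^ n" for n
    proof -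
      have "exp (\<i> * (w + \<i> * of_real \<delta>)) = exp (\<i> * w) * of_real (exp (- \<delta>))"
        by (simp add: distrib_left exp_add[symmetric] exp_of_real[symmetric] flip: mult.assoc)
      then show ?thesis by (simp add: \<kappa>_def power_mult_distrib algebra_simps)
    qed
    ultimately show ?thesis using lift_sums[OF k w] sums_unique2 by (metis (no_types, lifting) sums_cong)
  qed
  have U: "per_hol (lift (disc_fun \<eta>))" by (rule per_hol_lift_disc_fun[OF eta])
  have dder: "deriv (lift (disc_fun \<kappa>)) w = deriv (lift (disc_fun \<eta>)) w - deriv (lift (disc_fun \<eta>)) (w + \<i> * of_real \<delta>)" if w: "Im w > 0" for w
  proof -
    have "deriv (lift (disc_fun \<kappa>)) w = deriv (\<lambda>w. lift (disc_fun \<eta>) w - lift (disc_fun \<eta>) (w + \<i> * of_real \<delta>)) w"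
      using w dil by (intro deriv_cong_ev eventually_mono[OF eventually_nhds_in_open[of uhp]]) auto
    also have "\<dots> = deriv (lift (disc_fun \<eta>)) w - deriv (\<lambda>w. lift (disc_fun \<eta>) (w + \<i> * of_real \<delta>)) w"
      using d w by (intro deriv_per_hol_diff U per_hol_shift) auto
    also have "deriv (\<lambda>w. lift (disc_fun \<eta>) (w + \<i> * of_real \<delta>)) w = deriv (lift (disc_fun \<eta>)) (w + \<i> * of_real \<delta>)"
      using d w by (intro deriv_shift U) auto
    finally show ?thesis .
  qed
  have "Hn q y (deriv (lift (disc_fun \<kappa>))) \<le> e * y powr (1 / q - 1)" if y: "y > 0" for y
  proof (cases "y < y0 / 2")
    case True
    let ?P = "deriv (lift (disc_fun \<eta>))"
    have P: "per_hol ?P" by (rule per_hol_deriv[OF U])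
    have cPd: "continuous_on S (\<lambda>x. ?P (Complex x y + \<i> * of_real \<delta>))" for S
      using y d by (intro per_hol_continuous_compose[OF P] continuous_intros) auto
    have "Hn q y (deriv (lift (disc_fun \<kappa>))) \<le> Hn q y ?P + Lpn q (\<lambda>x. ?P (Complex x y + \<i> * of_real \<delta>))"
      using y by (intro Lpn_triangle_le q per_hol_line P cPd per_hol_deriv per_hol_lift_disc_fun k)
        (auto simp: dder norm_triangle_ineq4)
    also have "Lpn q (\<lambda>x. ?P (Complex x y + \<i> * of_real \<delta>)) = Hn q (y + \<delta>) ?P"
      using Hn_shift[OF P q0, of y "\<i> * of_real \<delta>"] y d by simp
    also have "Hn q y ?P + Hn q (y + \<delta>) ?P \<le> e / 2 * y powr (1 / q - 1) + e / 2 * (y + \<delta>) powr (1 / q - 1)"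
      using y d True y0 by (intro add_mono sm) auto
    also have "\<dots> \<le> e / 2 * y powr (1 / q - 1) + e / 2 * y powr (1 / q - 1)"
      using y d e q by (intro add_left_mono mult_left_mono powr_mono2') auto
    also have "\<dots> = e * y powr (1 / q - 1)" by (simp add: field_simps)
    finally show ?thesis .
  next
    case False
    have "Hn q y (lift (disc_fun (\<lambda>n. \<i> * of_nat n * \<kappa> n))) \<le> 2 * (\<Sum>n. norm (\<i> * of_nat n * \<kappa> n) * exp (- (y0 / 2) / 2) ^ n) * y powr (1 / q - 1)"
      using False y0 q by (intro Hn_far_le disc_series_i_nat k) auto
    also have "(\<Sum>n. norm (\<i> * of_nat n * \<kappa> n) * exp (- (y0 / 2) / 2) ^ n) \<le> (\<Sum>n. \<delta> * (norm (c n) * exp (- (y0 / 2) / 2) ^ n))"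
    proof (intro suminf_le summable_mult smT)
      fix n
      have *: "norm (\<eta> n) * norm (1 - complex_of_real (exp (- \<delta>)) ^ n) \<le> norm (\<eta> n) * (\<delta> * n)"
        by (rule mult_left_mono[OF fac(2)]) simp
      have "real n * (norm (\<eta> n) * norm (1 - complex_of_real (exp (- \<delta>)) ^ n)) * exp (- (y0 / 2) / 2) ^ n \<le> real n * (norm (\<eta> n) * (\<delta> * n)) * exp (- (y0 / 2) / 2) ^ n"
        by (rule mult_right_mono[OF mult_left_mono[OF *]]) auto
      then show "norm (\<i> * of_nat n * \<kappa> n) * exp (- (y0 / 2) / 2) ^ n \<le> \<delta> * (norm (c n) * exp (- (y0 / 2) / 2) ^ n)"
        by (simp add: \<kappa>_def c_def norm_mult mult_ac)
    qed (use y0 in \<open>auto intro!: disc_series_summable_norm disc_series_i_nat k\<close>)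
    also have "(\<Sum>n. \<delta> * (norm (c n) * exp (- (y0 / 2) / 2) ^ n)) = \<delta> * T" using smT by (simp add: T_def suminf_mult)
    also have "2 * (\<delta> * T) * y powr (1 / q - 1) \<le> e * y powr (1 / q - 1)"
      using \<open>\<delta> * (2 * T) \<le> e\<close> by (intro mult_right_mono) auto
    finally show ?thesis using Hn_deriv_lift_disc_fun[OF k y] by (simp add: mult_right_mono)
  qed
  then show ?thesis using d k by (auto simp: \<kappa>_def)
qed

lemma suminf_coeff_tendsto_0:
  assumes B: "\<And>n k. norm (c n k) \<le> B k" and sm: "summable (\<lambda>k. B k * r ^ k)" and r: "r \<ge> 0"
    and lim: "\<And>k. (\<lambda>n. c n k) \<longlonglongrightarrow> (0::complex)"
  shows "(\<lambda>n. \<Sum>k. norm (c n k) * r ^ k) \<longlonglongrightarrow> 0"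
proof -
  have "((\<lambda>n. \<Sum>k. norm (c n k) * r ^ k) \<longlongrightarrow> (\<Sum>k. 0 * r ^ k)) sequentially"
  proof (rule tannerys_theorem[THEN conjunct2, THEN conjunct2])
    show "((\<lambda>n. norm (c n k) * r ^ k) \<longlongrightarrow> 0 * r ^ k) sequentially" for k
      using tendsto_norm_zero[OF lim[of k]] by (intro tendsto_mult tendsto_const)
    show "\<forall>\<^sub>F (k, n) in at_top \<times>\<^sub>F sequentially. norm (norm (c n k) * r ^ k) \<le> B k * r ^ k"
      using B r by (intro always_eventually) (auto intro!: mult_right_mono simp: abs_mult)
  qed (use sm in auto)
  then show ?thesis by simp
qed

section \<open>Linearity of the Rhaly operator and its compactness\<close>

lemma rhaly_add:
  assumes "disc_series \<eta>" "f \<in> hardy p" "g \<in> hardy p" "p \<ge> 1"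
  shows "rhaly \<eta> (\<lambda>z. f z + g z) = (\<lambda>z. rhaly \<eta> f z + rhaly \<eta> g z)"
proof -
  have "rhaly_coeff \<eta> (\<lambda>z. f z + g z) = (\<lambda>n. rhaly_coeff \<eta> f n + rhaly_coeff \<eta> g n)"
    using assms by (simp add: rhaly_coeff_def taylor_coeff_add hardy_Hol_disc sum.distrib distrib_left fun_eq_iff)
  then show ?thesis using assms by (simp add: rhaly_def disc_fun_add(2) rhaly_coeff_series)
qed

lemma rhaly_diff:
  assumes "disc_series \<eta>" "f \<in> hardy p" "g \<in> hardy p" "p \<ge> 1"
  shows "rhaly \<eta> (\<lambda>z. f z - g z) = (\<lambda>z. rhaly \<eta> f z - rhaly \<eta> g z)"
proof -
  have "rhaly_coeff \<eta> (\<lambda>z. f z - g z) = (\<lambda>n. rhaly_coeff \<eta> f n - rhaly_coeff \<eta> g n)"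
    using assms by (simp add: rhaly_coeff_def taylor_coeff_diff hardy_Hol_disc sum_subtractf right_diff_distrib fun_eq_iff)
  then show ?thesis using assms by (simp add: rhaly_def disc_fun_diff(2) rhaly_coeff_series)
qed

lemma rhaly_cmult:
  assumes "disc_series \<eta>" "f \<in> hardy p" "p \<ge> 1"
  shows "rhaly \<eta> (\<lambda>z. c * f z) = (\<lambda>z. c * rhaly \<eta> f z)"
proof -
  have "rhaly_coeff \<eta> (\<lambda>z. c * f z) = (\<lambda>n. c * rhaly_coeff \<eta> f n)"
    using assms by (simp add: rhaly_coeff_def taylor_coeff_cmult hardy_Hol_disc sum_distrib_left mult_ac fun_eq_iff)
  then show ?thesis using assms by (simp add: rhaly_def disc_fun_cmult(2) rhaly_coeff_series)
qed

lemma disc_series_bounded: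
  assumes "\<And>k. norm (b k) \<le> C" shows "disc_series b"
proof (rule disc_seriesI)
  fix r :: real assume r: "0 < r" "r < 1"
  have "summable (\<lambda>n. C * r ^ n)" using r by (intro summable_mult summable_geometric) auto
  then show "summable (\<lambda>n. norm (b n) * r ^ n)"
    by (rule summable_comparison_test'[of _ 0]) (use assms r in \<open>auto simp: abs_mult intro!: mult_right_mono\<close>)
qed

text \<open>A form of weak compactness of balls. Coefficients are bounded by the norm, so a diagonal
  subsequence converges coefficientwise; on each line of positive height the convergence is uniform,
  which passes the norm bound to the limit.\<close>

lemma hardy_coeff_subsequence:
  assumes u: "\<And>n. u n \<in> hardy p" and C: "\<And>n. hardy_norm p (u n) \<le> C" and p: "p \<ge> 1"
  obtains f s where "f \<in> hardy p" "hardy_norm p f \<le> C" "strict_mono (s :: nat \<Rightarrow> nat)"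
    "\<And>k. (\<lambda>n. taylor_coeff (\<lambda>z. u (s n) z - f z) k) \<longlonglongrightarrow> 0"
proof -
  have bd: "norm (taylor_coeff (u n) k) \<le> C" for n k
    using hardy_coeff_le[OF u[of n] p, of k] C[of n] by linarith
  obtain s where s: "strict_mono (s :: nat \<Rightarrow> nat)" "\<And>k. k \<in> UNIV \<Longrightarrow> \<exists>l. (\<lambda>n. taylor_coeff (u (s n)) k) \<longlonglongrightarrow> l"
    using function_convergent_subsequence[of "UNIV :: nat set" "\<lambda>n. taylor_coeff (u n)" C] bd by auto
  then obtain b where b: "\<And>k. (\<lambda>n. taylor_coeff (u (s n)) k) \<longlonglongrightarrow> b k" by (metis UNIV_I)
  have bC: "norm (b k) \<le> C" for k
    by (rule tendsto_upperbound[OF tendsto_norm[OF b]]) (use bd in auto)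
  have bs: "disc_series b" by (rule disc_series_bounded[OF bC])
  define f where "f = disc_fun b"
  have fH: "f \<in> Hol_disc" unfolding f_def by (rule disc_fun_Hol_disc[OF bs])
  have tf: "taylor_coeff f = b" unfolding f_def by (rule taylor_coeff_disc_fun[OF bs])
  have cf: "(\<lambda>n. taylor_coeff (\<lambda>z. u (s n) z - f z) k) \<longlonglongrightarrow> 0" for k
    using tendsto_diff[OF b[of k] tendsto_const[of "b k"]]
    by (simp add: taylor_coeff_diff[OF hardy_Hol_disc[OF u] fH] tf)
  have "Hn p y (lift f) \<le> C" if y: "y > 0" for y
  proof -
    define E where "E = (\<lambda>n. \<Sum>k. norm (taylor_coeff (\<lambda>z. u (s n) z - f z) k) * exp (- y) ^ k)"
    have E: "E \<longlonglongrightarrow> 0"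
      unfolding E_def
    proof (rule suminf_coeff_tendsto_0[where B = "\<lambda>_. 2 * C"])
      show "norm (taylor_coeff (\<lambda>z. u (s n) z - f z) k) \<le> 2 * C" for n k
        using norm_triangle_ineq4[of "taylor_coeff (u (s n)) k" "b k"] bd[of "s n" k] bC[of k]
        by (simp add: taylor_coeff_diff[OF hardy_Hol_disc[OF u] fH] tf)
      show "summable (\<lambda>k. 2 * C * exp (- y) ^ k)" using y by (intro summable_mult summable_geometric) auto
    qed (use cf in auto)
    have "Hn p y (lift f) \<le> C + E n" for n
    proof -
      let ?d = "\<lambda>z. u (s n) z - f z"
      have dH: "?d \<in> Hol_disc" by (intro Hol_disc_diff hardy_Hol_disc[OF u] fH)
      have "Hn p y (lift f) \<le> Hn p y (lift (u (s n))) + Hn p y (lift ?d)"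
      proof (intro Lpn_triangle_le p per_hol_line per_hol_lift_Hol_disc fH dH hardy_Hol_disc[OF u] y)
        show "norm (lift f (Complex x y)) \<le> norm (lift (u (s n)) (Complex x y)) + norm (lift ?d (Complex x y))" for x
          unfolding lift_def using norm_triangle_ineq4[of "u (s n) (exp (\<i> * Complex x y))" "u (s n) (exp (\<i> * Complex x y)) - f (exp (\<i> * Complex x y))"] by simp
      qed
      also have "Hn p y (lift (u (s n))) \<le> C" using Hn_le_hardy_norm[OF u[of "s n"] y] C[of "s n"] by simp
      also have "Hn p y (lift ?d) \<le> E n"
        using Hn_disc_fun_le[OF Hol_disc_taylor(1)[OF dH] y, of p] p unfolding Hol_disc_taylor(2)[OF dH] by (simp add: E_def)
      finally show ?thesis by simp
    qed
    then have "Hn p y (lift f) \<le> C + 0"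
      by (intro LIMSEQ_le_const[OF tendsto_add[OF tendsto_const[of C] E]]) auto
    then show ?thesis by simp
  qed
  note fh = hardyI[OF fH, of p C, OF this]
  show thesis by (rule that[OF fh s(1) cf])
qed

text \<open>Let v be a subsequence minus its coefficientwise limit. With the symbol \<kappa> of the
  difference between F and its dilate, the image of v splits into the image under \<kappa>, small in
  norm uniformly in n, and a series with coefficients damped by e^(-\<delta> k), which tends to 0
  uniformly on the disc.\<close>

theorem rhaly_compactI:
  fixes p q :: real
  assumes q: "1 < q" "q < p \<or> q = p \<and> p \<le> 2"
    and eta: "disc_series \<eta>" and sd: "small_deriv q (disc_fun \<eta>)"
  shows "rhaly_compact \<eta> p"
proof -
  have p: "p \<ge> 1" and q1: "q \<ge> 1" using q by auto
  obtain C where C: "C > 0" and bnd: "\<And>\<eta> K f. disc_series \<eta> \<Longrightarrow> K > 0 \<Longrightarrow>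
    (\<forall>y>0. Hn q y (deriv (lift (disc_fun \<eta>))) \<le> K * y powr (1 / q - 1)) \<Longrightarrow> f \<in> hardy p \<Longrightarrow>
    rhaly \<eta> f \<in> hardy p \<and> hardy_norm p (rhaly \<eta> f) \<le> C * (norm (\<eta> 0) + K) * hardy_norm p f"
    using rhaly_bounded[OF q] by (elim exE conjE) blast
  obtain K where K: "K > 0" "\<forall>y>0. Hn q y (deriv (lift (disc_fun \<eta>))) \<le> K * y powr (1 / q - 1)"
    using small_deriv_bound[OF eta sd q1] by blast
  have maps: "rhaly \<eta> f \<in> hardy p" if "f \<in> hardy p" for f using bnd[OF eta K that] by simp
  have comp: "\<exists>g\<in>hardy p. \<exists>s :: nat \<Rightarrow> nat. strict_mono s \<and> (\<lambda>n. hardy_norm p (\<lambda>z. rhaly \<eta> (u (s n)) z - g z)) \<longlonglongrightarrow> 0"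
    if u: "\<forall>n. u n \<in> hardy p" and B: "\<forall>n. hardy_norm p (u n) \<le> B" for u :: "nat \<Rightarrow> complex \<Rightarrow> complex" and B
  proof -
    obtain f s where f: "f \<in> hardy p" "hardy_norm p f \<le> B" and s: "strict_mono (s :: nat \<Rightarrow> nat)"
      and cf: "\<And>k. (\<lambda>n. taylor_coeff (\<lambda>z. u (s n) z - f z) k) \<longlonglongrightarrow> 0"
      using hardy_coeff_subsequence[of u p B] u B p by blast
    define v where "v = (\<lambda>n z. u (s n) z - f z)"
    have B0: "B \<ge> 0" using hardy_norm_nonneg[OF f(1)] f(2) by linarith
    have v: "v n \<in> hardy p" "hardy_norm p (v n) \<le> 2 * B" for n
    proof -
      have us: "u (s n) \<in> hardy p" "hardy_norm p (u (s n)) \<le> B" using u B by auto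
      show "v n \<in> hardy p" unfolding v_def by (rule hardy_diff(1)[OF us(1) f(1) p])
      show "hardy_norm p (v n) \<le> 2 * B" unfolding v_def using hardy_diff(2)[OF us(1) f(1) p] us(2) f(2) by linarith
    qed
    have vc: "norm (taylor_coeff (v n) k) \<le> 2 * B" for n k
      using hardy_coeff_le[OF v(1)[of n] p, of k] v(2)[of n] by linarith
    have Rv: "rhaly \<eta> (v n) = (\<lambda>z. rhaly \<eta> (u (s n)) z - rhaly \<eta> f z)" for n
      unfolding v_def using u f p by (intro rhaly_diff eta) auto
    have "(\<lambda>n. hardy_norm p (rhaly \<eta> (v n))) \<longlonglongrightarrow> 0"
    proof (rule LIMSEQ_I)
      fix e :: real assume e: "e > 0"
      define X where "X = 2 * B + 1"
      have X: "X > 0" "2 * B \<le> X" using B0 by (auto simp: X_def)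
      define e1 where "e1 = e / (2 * (C * X))"
      have e1: "e1 > 0" using e C X by (simp add: e1_def)
      have e1': "C * e1 * (2 * B) \<le> e / 2"
      proof -
        have "C * e1 * (2 * B) \<le> C * e1 * X" using C e1 X by (intro mult_left_mono) auto
        also have "\<dots> = e / 2" using C X by (simp add: e1_def)
        finally show ?thesis .
      qed
      obtain \<delta> where d: "\<delta> > 0" and ks: "disc_series (\<lambda>n. \<eta> n * (1 - of_real (exp (- \<delta>)) ^ n))"
        and kb: "\<forall>y>0. Hn q y (deriv (lift (disc_fun (\<lambda>n. \<eta> n * (1 - of_real (exp (- \<delta>)) ^ n))))) \<le> e1 * y powr (1 / q - 1)"
        using dilate_approx[OF eta sd q1 e1] by blast
      define \<kappa> where "\<kappa> = (\<lambda>n. \<eta> n * (1 - of_real (exp (- \<delta>)) ^ n))"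
      have Rk: "rhaly \<kappa> (v n) \<in> hardy p" "hardy_norm p (rhaly \<kappa> (v n)) \<le> e / 2" for n
      proof -
        have "rhaly \<kappa> (v n) \<in> hardy p \<and> hardy_norm p (rhaly \<kappa> (v n)) \<le> C * (norm (\<kappa> 0) + e1) * hardy_norm p (v n)"
          unfolding \<kappa>_def by (rule bnd[OF ks e1 kb v(1)])
        \<comment> \<open>\<open>\<kappa> 0\<close> is 0, so the constant term of the symbol drops
          out of the norm estimate.\<close>
        moreover have "C * (norm (\<kappa> 0) + e1) * hardy_norm p (v n) \<le> C * e1 * (2 * B)"
          using v(2)[of n] C e1 by (simp add: \<kappa>_def mult_left_mono)
        ultimately show "rhaly \<kappa> (v n) \<in> hardy p" "hardy_norm p (rhaly \<kappa> (v n)) \<le> e / 2" using e1' by auto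
      qed
      define E where "E = (\<lambda>n. \<Sum>k. norm (rhaly_coeff \<eta> (v n) k) * exp (- \<delta>) ^ k)"
      have "E \<longlonglongrightarrow> 0"
        unfolding E_def
      proof (rule suminf_coeff_tendsto_0[where B = "\<lambda>k. 2 * B * norm (of_nat (Suc k) * \<eta> k)"])
        show "norm (rhaly_coeff \<eta> (v n) k) \<le> 2 * B * norm (of_nat (Suc k) * \<eta> k)" for n k
        proof -
          have "norm (\<Sum>i\<le>k. taylor_coeff (v n) i) \<le> (\<Sum>i\<le>k. 2 * B)"
            by (intro order_trans[OF norm_sum] sum_mono vc)
          then have "norm (\<eta> k) * norm (\<Sum>i\<le>k. taylor_coeff (v n) i) \<le> norm (\<eta> k) * (real (Suc k) * (2 * B))"
            by (intro mult_left_mono) auto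
          then show ?thesis by (simp add: rhaly_coeff_def norm_mult mult_ac del: of_nat_Suc)
        qed
        show "summable (\<lambda>k. 2 * B * norm (of_nat (Suc k) * \<eta> k) * exp (- \<delta>) ^ k)"
          unfolding mult.assoc[of "2 * B"] using d by (intro summable_mult disc_series_summable_norm disc_series_mult_Suc eta) auto
        have "(\<lambda>n. \<eta> k * (\<Sum>i\<le>k. taylor_coeff (v n) i)) \<longlonglongrightarrow> \<eta> k * (\<Sum>i\<le>k. 0)" for k
          unfolding v_def by (intro tendsto_mult tendsto_const tendsto_sum cf)
        then show "(\<lambda>n. rhaly_coeff \<eta> (v n) k) \<longlonglongrightarrow> 0" for k by (simp add: rhaly_coeff_def)
      qed simp
      then obtain N where N: "\<And>n. n \<ge> N \<Longrightarrow> norm (E n - 0) < e / 2" using e LIMSEQ_D[of E 0 "e / 2"] by auto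
      have "norm (hardy_norm p (rhaly \<eta> (v n)) - 0) < e" if n: "n \<ge> N" for n
      proof -
        let ?c = "rhaly_coeff \<eta> (v n)" and ?k = "rhaly_coeff \<kappa> (v n)"
        have c: "disc_series ?c" by (rule rhaly_coeff_series[OF eta v(1) p])
        have k: "disc_series ?k" unfolding \<kappa>_def by (rule rhaly_coeff_series[OF ks v(1) p])
        let ?t = "\<lambda>i. ?c i - ?k i"
        have t: "disc_series ?t" "disc_fun ?t = (\<lambda>z. disc_fun ?c z - disc_fun ?k z)" using disc_fun_diff[OF c k] by auto
        \<comment> \<open>The remaining part is the image dilated by e^(-\<delta>); its absolute
          series \<open>E n\<close> bounds it at every height.\<close>
        have tn: "?t i = ?c i * of_real (exp (- \<delta>)) ^ i" for i
          by (simp add: rhaly_coeff_def \<kappa>_def algebra_simps)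
        have smE: "summable (\<lambda>i. norm (?c i) * exp (- \<delta>) ^ i)" using d by (intro disc_series_summable_norm c) auto
        have "Hn p y (lift (disc_fun ?c)) \<le> e / 2 + E n" if y: "y > 0" for y
        proof -
          have "Hn p y (lift (disc_fun ?c)) \<le> Hn p y (lift (disc_fun ?k)) + Hn p y (lift (disc_fun ?t))"
          proof (intro Lpn_triangle_le p per_hol_line per_hol_lift_disc_fun c k t y)
            show "norm (lift (disc_fun ?c) (Complex x y)) \<le> norm (lift (disc_fun ?k) (Complex x y)) + norm (lift (disc_fun ?t) (Complex x y))" for x
              unfolding t(2) lift_def using norm_triangle_ineq[of "disc_fun ?k (exp (\<i> * Complex x y))" "disc_fun ?c (exp (\<i> * Complex x y)) - disc_fun ?k (exp (\<i> * Complex x y))"] by simp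
          qed
          also have "Hn p y (lift (disc_fun ?k)) \<le> e / 2"
            using Hn_le_hardy_norm[OF Rk(1)[of n] y] Rk(2)[of n] by (simp add: rhaly_def)
          also have "Hn p y (lift (disc_fun ?t)) \<le> (\<Sum>i. norm (?t i) * exp (- y) ^ i)"
            using p by (intro Hn_disc_fun_le t y) auto
          also have "\<dots> \<le> E n"
            unfolding E_def
          proof (intro suminf_le smE)
            show "norm (?t i) * exp (- y) ^ i \<le> norm (?c i) * exp (- \<delta>) ^ i" for i
            proof -
              have "exp (- y) ^ i \<le> 1" using y by (intro power_le_one) auto
              then have "(norm (?c i) * exp (- \<delta>) ^ i) * exp (- y) ^ i \<le> (norm (?c i) * exp (- \<delta>) ^ i) * 1"
                by (intro mult_left_mono) auto
              then show ?thesis unfolding tn by (simp add: norm_mult norm_power)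
            qed
          qed (use y in \<open>auto intro!: disc_series_summable_norm t\<close>)
          finally show ?thesis by simp
        qed
        then have "hardy_norm p (disc_fun ?c) \<le> e / 2 + E n" by (intro hardyI(2) disc_fun_Hol_disc c)
        moreover have "E n < e / 2" using N[OF n] by simp
        moreover have "hardy_norm p (rhaly \<eta> (v n)) \<ge> 0" by (intro hardy_norm_nonneg maps v)
        ultimately show ?thesis by (simp add: rhaly_def)
      qed
      then show "\<exists>no. \<forall>n\<ge>no. norm (hardy_norm p (rhaly \<eta> (v n)) - 0) < e" by blast
    qed
    then show ?thesis using maps[OF f(1)] s unfolding Rv by blast
  qed
  show ?thesis
    unfolding rhaly_compact_def rhaly_well_defined_def compact_linear_op_def
  proof (intro conjI ballI allI impI)
    show "disc_series (rhaly_coeff \<eta> f)" if "f \<in> hardy p" for f by (rule rhaly_coeff_series[OF eta that p])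
    show "rhaly \<eta> (\<lambda>z. f z + g z) = (\<lambda>z. rhaly \<eta> f z + rhaly \<eta> g z)" if "f \<in> hardy p" "g \<in> hardy p" for f g
      by (rule rhaly_add[OF eta that p])
    show "rhaly \<eta> (\<lambda>z. c * f z) = (\<lambda>z. c * rhaly \<eta> f z)" if "f \<in> hardy p" for c f
      by (rule rhaly_cmult[OF eta that p])
    show "\<exists>g\<in>hardy p. \<exists>s :: nat \<Rightarrow> nat. strict_mono s \<and> (\<lambda>n. hardy_norm p (\<lambda>z. rhaly \<eta> (u (s n)) z - g z)) \<longlonglongrightarrow> 0"
      if "(\<forall>n. u n \<in> hardy p) \<and> (\<exists>C. \<forall>n. hardy_norm p (u n) \<le> C)" for u :: "nat \<Rightarrow> complex \<Rightarrow> complex"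
      using that comp by blast
  qed (use maps in auto)
qed

section \<open>Boundary values\<close>

lemma AE_lborel_negligible:
  assumes "AE x in lborel. P x" shows "negligible {x::real. \<not> P x}"
proof -
  obtain N where N: "N \<in> null_sets lborel" "{x \<in> space lborel. \<not> P x} \<subseteq> N"
    using assms by (auto simp: eventually_ae_filter)
  have "negligible N" using null_sets_completionI[OF N(1)] by (simp add: negligible_iff_null_sets)
  then show ?thesis by (rule negligible_subset) (use N(2) in auto)
qed

text \<open>Fatou's lemma for the gauge integral, with integrability of the limit as part of the
  conclusion. The functions are truncated at level j; dominated convergence handles the limit in n,
  monotone convergence the limit in j.\<close>

lemma fatou_continuous:
  fixes f :: "nat \<Rightarrow> real \<Rightarrow> real"
  assumes c: "\<And>n. continuous_on {a..b} (f n)" and nn: "\<And>n x. f n x \<ge> 0"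
    and M: "\<And>n. integral {a..b} (f n) \<le> M" and N: "negligible N"
    and lim: "\<And>x. x \<in> {a..b} - N \<Longrightarrow> (\<lambda>n. f n x) \<longlonglongrightarrow> g x"
  shows "g integrable_on {a..b}" "integral {a..b} g \<le> M"
proof -
  let ?S = "{a..b} - N"
  have spike: "(h integrable_on ?S \<longleftrightarrow> h integrable_on {a..b}) \<and> integral ?S h = integral {a..b} h" for h :: "real \<Rightarrow> real"
  proof
    have n: "negligible (({a..b} - ?S) \<union> (?S - {a..b}))" by (rule negligible_subset[OF N]) auto
    show "h integrable_on ?S \<longleftrightarrow> h integrable_on {a..b}"
      by (rule integrable_spike_set_eq) (rule negligible_subset[OF N], auto)
    show "integral ?S h = integral {a..b} h"
      by (rule integral_spike_set) (rule negligible_subset[OF N], auto)+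
  qed
  have M0: "M \<ge> 0"
    using order_trans[OF integral_nonneg[OF integrable_continuous_interval[OF c[of 0]]] M[of 0]] nn by auto
  have 1: "(\<lambda>x. min (g x) (real j)) integrable_on ?S \<and> integral ?S (\<lambda>x. min (g x) (real j)) \<le> M" for j
  proof -
    have cm: "continuous_on {a..b} (\<lambda>x. min (f n x) (real j))" for n
      by (intro continuous_on_min c continuous_on_const)
    have im: "(\<lambda>x. min (f n x) (real j)) integrable_on ?S" for n
      using spike integrable_continuous_interval[OF cm] by blast
    have h1: "(\<lambda>x. real j) integrable_on ?S" using spike integrable_const_ivl by blast
    have h2: "norm (min (f n x) (real j)) \<le> real j" for n x using nn[of n x] by auto
    have h3: "(\<lambda>n. min (f n x) (real j)) \<longlonglongrightarrow> min (g x) (real j)" if "x \<in> ?S" for x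
      by (intro tendsto_min lim that tendsto_const)
    note dc = dominated_convergence[OF im h1 h2 h3]
    have "integral ?S (\<lambda>x. min (f n x) (real j)) \<le> M" for n
    proof -
      have "integral ?S (\<lambda>x. min (f n x) (real j)) = integral {a..b} (\<lambda>x. min (f n x) (real j))" using spike by blast
      also have "\<dots> \<le> integral {a..b} (f n)" by (intro integral_le integrable_continuous_interval cm c) auto
      finally show ?thesis using M[of n] by linarith
    qed
    then show ?thesis using dc(1) LIMSEQ_le_const2[OF dc(2)] by blast
  qed
  have g0: "g x \<ge> 0" if "x \<in> ?S" for x by (rule LIMSEQ_le_const[OF lim[OF that]]) (use nn in auto)
  have 2: "g integrable_on ?S \<and> (\<lambda>j. integral ?S (\<lambda>x. min (g x) (real j))) \<longlonglongrightarrow> integral ?S g"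
  proof (rule monotone_convergence_increasing)
    show "(\<lambda>j. min (g x) (real j)) \<longlonglongrightarrow> g x" for x
    proof (rule tendsto_eventually)
      obtain J where "g x \<le> real J" using real_arch_simple by blast
      then show "\<forall>\<^sub>F j in sequentially. min (g x) (real j) = g x"
        by (intro eventually_sequentiallyI[of J]) (auto simp: min_def)
    qed
    show "bounded (range (\<lambda>j. integral ?S (\<lambda>x. min (g x) (real j))))"
    proof (rule boundedI[of _ M])
      fix z assume "z \<in> range (\<lambda>j. integral ?S (\<lambda>x. min (g x) (real j)))"
      then obtain j where j: "z = integral ?S (\<lambda>x. min (g x) (real j))" by blast
      have "z \<ge> 0" unfolding j using 1 g0 by (intro integral_nonneg) auto
      then show "norm z \<le> M" using 1[of j] j by simp
    qed
  qed (use 1 in auto)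
  show "g integrable_on {a..b}" using 2 spike by blast
  have "integral ?S g \<le> M" using 2 1 by (intro LIMSEQ_le_const2[of "\<lambda>j. integral ?S (\<lambda>x. min (g x) (real j))"]) auto
  then show "integral {a..b} g \<le> M" using spike by simp
qed

definition no_bv :: "(complex \<Rightarrow> complex) \<Rightarrow> real set" where
  "no_bv f = {\<theta>. \<not> (\<exists>l. ((\<lambda>r. f (of_real r * cis \<theta>)) \<longlongrightarrow> l) (at_left (1::real)))}"

lemma negligible_no_bv: "has_boundary_values f \<Longrightarrow> negligible (no_bv f)"
  unfolding has_boundary_values_def no_bv_def by (rule AE_lborel_negligible)

lemma lift_tendsto_boundary_value:
  assumes "\<theta> \<notin> no_bv f" and y: "y \<longlonglongrightarrow> 0" "\<And>n. y n > 0"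
  shows "(\<lambda>n::nat. lift f (Complex \<theta> (y n))) \<longlonglongrightarrow> boundary_value f \<theta>"
proof -
  obtain l where l: "((\<lambda>r. f (of_real r * cis \<theta>)) \<longlongrightarrow> l) (at_left (1::real))"
    using assms(1) by (auto simp: no_bv_def)
  then have "boundary_value f \<theta> = l" unfolding boundary_value_def by (intro tendsto_Lim) auto
  moreover have "filterlim (\<lambda>n. exp (- y n)) (at_left 1) sequentially"
    unfolding filterlim_at
  proof
    have "(\<lambda>n. exp (- y n)) \<longlonglongrightarrow> exp (- 0)" by (intro tendsto_intros y)
    then show "(\<lambda>n. exp (- y n)) \<longlonglongrightarrow> 1" by simp
  qed (use y(2) in \<open>auto simp: less_imp_neq[symmetric] intro!: always_eventually\<close>)
  from filterlim_compose[OF l this] have "(\<lambda>n. f (of_real (exp (- y n)) * cis \<theta>)) \<longlonglongrightarrow> l" .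
  ultimately show ?thesis by (simp add: lift_def exp_i_Complex)
qed

text \<open>The quantity under the supremum in \<open>mean_modulus\<close>.\<close>

definition bv_increment :: "real \<Rightarrow> (complex \<Rightarrow> complex) \<Rightarrow> real \<Rightarrow> real" where
  "bv_increment p f t = (1 / (2 * pi) * integral {-pi..pi}
     (\<lambda>\<theta>. norm (boundary_value f (\<theta> + t) - boundary_value f \<theta>) powr p)) powr (1 / p)"

lemma integral_symmetric_period:
  fixes v :: "real \<Rightarrow> real"
  assumes "continuous_on UNIV v" "\<And>x. v (x + 2*pi) = v x"
  shows "integral {-pi..pi} v = integral {0..2*pi} v"
proof -
  have e: "-pi + 2*pi = pi" by simp
  show ?thesis using integral_periodic_shift[OF assms, of "-pi"] unfolding e .
qed

text \<open>Fatou's lemma along heights tending to 0. The exceptional set is doubled by a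
  translation because radial limits are needed at both \<theta> and \<theta> + t.\<close>

lemma bv_increment_le:
  assumes f: "f \<in> Hol_disc" and bv: "has_boundary_values f" and p: "p > 0" and y1: "y1 > 0"
    and M: "\<And>y. 0 < y \<Longrightarrow> y < y1 \<Longrightarrow> Hn p y (\<lambda>w. lift f (w + of_real t) - lift f w) \<le> M"
  shows "(\<lambda>\<theta>. norm (boundary_value f (\<theta> + t) - boundary_value f \<theta>) powr p) integrable_on {-pi..pi}"
    and "bv_increment p f t \<le> M"
proof -
  define U where "U = lift f"
  have U: "per_hol U" unfolding U_def by (rule per_hol_lift_Hol_disc[OF f])
  define y where "y = (\<lambda>n::nat. y1 / 2 * inverse (real (Suc n)))"
  have y: "y n > 0" "y n < y1" for n using y1 by (auto simp: y_def field_simps add_pos_nonneg)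
  have yl: "y \<longlonglongrightarrow> 0"
    using tendsto_mult[OF tendsto_const LIMSEQ_inverse_real_of_nat, of "y1 / 2"] by (simp add: y_def)
  define D where "D = (\<lambda>n \<theta>. U (Complex (\<theta> + t) (y n)) - U (Complex \<theta> (y n)))"
  have cD: "continuous_on S (D n)" for S n
    unfolding D_def using y by (intro continuous_on_diff per_hol_continuous_compose[OF U]) (auto intro!: continuous_intros)
  have M0: "M \<ge> 0" using order_trans[OF Lpn_nonneg M[OF y(1,2)[of 0]]] .
  let ?N = "no_bv f \<union> ((\<lambda>x. - t + x) ` no_bv f)"
  have N: "negligible ?N" using negligible_no_bv[OF bv] by (intro negligible_Un negligible_translation)
  have intD: "integral {-pi..pi} (\<lambda>\<theta>. norm (D n \<theta>) powr p) \<le> 2 * pi * M powr p" for n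
  proof -
    have "integral {-pi..pi} (\<lambda>\<theta>. norm (D n \<theta>) powr p) = integral {0..2*pi} (\<lambda>\<theta>. norm (D n \<theta>) powr p)"
    proof (intro integral_symmetric_period continuous_on_norm_powr cD p)
      have "D n (x + 2*pi) = D n x" for x
        using per_hol_periodic[OF U y(1)[of n], of "x + t"] per_hol_periodic[OF U y(1)[of n], of x]
        by (simp add: D_def add_ac)
      then show "norm (D n (x + 2*pi)) powr p = norm (D n x) powr p" for x by simp
    qed
    also have "\<dots> \<le> 2 * pi * M powr p"
    proof -
      have "Lpn p (D n) \<le> M" using M[OF y(1,2)[of n]] by (simp add: D_def U_def Complex_add_shift)
      then show ?thesis using Lpn_le_iff[OF p M0] by simp
    qed
    finally show ?thesis .
  qed
  have lim: "(\<lambda>n. norm (D n \<theta>) powr p) \<longlonglongrightarrow> norm (boundary_value f (\<theta> + t) - boundary_value f \<theta>) powr p"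
    if "\<theta> \<in> {-pi..pi} - ?N" for \<theta>
  proof -
    have t1: "\<theta> \<notin> no_bv f" using that by auto
    have t2: "\<theta> + t \<notin> no_bv f"
    proof
      assume "\<theta> + t \<in> no_bv f"
      then have "- t + (\<theta> + t) \<in> (\<lambda>x. - t + x) ` no_bv f" by (rule imageI)
      with that show False by simp
    qed
    have "(\<lambda>n. D n \<theta>) \<longlonglongrightarrow> boundary_value f (\<theta> + t) - boundary_value f \<theta>"
      unfolding D_def U_def by (intro tendsto_diff lift_tendsto_boundary_value t1 t2 yl y)
    then show ?thesis using p by (intro tendsto_powr2 tendsto_norm tendsto_const) auto
  qed
  note F = fatou_continuous[where f = "\<lambda>n \<theta>. norm (D n \<theta>) powr p", OF continuous_on_norm_powr[OF cD p] _ intD N lim]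
  show "(\<lambda>\<theta>. norm (boundary_value f (\<theta> + t) - boundary_value f \<theta>) powr p) integrable_on {-pi..pi}"
    by (rule F(1)) auto
  have "integral {-pi..pi} (\<lambda>\<theta>. norm (boundary_value f (\<theta> + t) - boundary_value f \<theta>) powr p) \<le> 2 * pi * M powr p"
    by (rule F(2)) auto
  then have "bv_increment p f t \<le> (M powr p) powr (1 / p)"
    unfolding bv_increment_def using p by (intro powr_mono2) (auto simp: field_simps)
  then show "bv_increment p f t \<le> M" using p M0 by (simp add: powr_powr)
qed

lemma Hn_increment_le:
  assumes f: "f \<in> hardy p" and p: "p \<ge> 1" and y: "y > 0"
  shows "Hn p y (\<lambda>w. lift f (w + of_real t) - lift f w) \<le> 2 * hardy_norm p f"
proof -
  define U where "U = lift f"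
  have U: "per_hol U" unfolding U_def by (rule per_hol_lift_Hol_disc[OF hardy_Hol_disc[OF f]])
  have cU: "continuous_on S (\<lambda>x. U (Complex x y + of_real t))" for S
    using y by (intro per_hol_continuous_compose[OF U] continuous_intros) auto
  have "Hn p y (\<lambda>w. U (w + of_real t) - U w) \<le> Lpn p (\<lambda>x. U (Complex x y + of_real t)) + Hn p y U"
    by (rule Lpn_triangle_le[OF p cU per_hol_line[OF U y] continuous_on_diff[OF cU per_hol_line[OF U y]]])
       (rule norm_triangle_ineq4)
  also have "Lpn p (\<lambda>x. U (Complex x y + of_real t)) = Hn p y U"
    using Hn_shift[OF U _ , of p y "of_real t"] y p by simp
  also have "Hn p y U \<le> hardy_norm p f" unfolding U_def by (rule Hn_le_hardy_norm[OF f y])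
  finally show ?thesis by (simp add: U_def)
qed

text \<open>A supremum bounds its members only over a bounded set; twice the Hardy norm bounds all
  increments.\<close>

lemma bv_increment_le_mean_modulus:
  assumes f: "f \<in> hardy p" and bv: "has_boundary_values f" and p: "p \<ge> 1" and t: "0 < \<bar>t\<bar>" "\<bar>t\<bar> \<le> \<delta>"
  shows "bv_increment p f t \<le> mean_modulus p \<delta> f"
proof -
  have "bv_increment p f s \<le> 2 * hardy_norm p f" for s
    using p by (intro bv_increment_le(2)[OF hardy_Hol_disc[OF f] bv _ zero_less_one] Hn_increment_le[OF f p]) auto
  then show ?thesis
    unfolding mean_modulus_def bv_increment_def[symmetric] using t
    by (intro cSUP_upper bdd_aboveI2[of _ _ "2 * hardy_norm p f"]) auto
qed

text \<open>The increments at height \<open>y\<close> are Poisson averages of those at a height \<open>\<epsilon> \<rightarrow> 0\<close>. Truncating the latter at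
  level \<open>\<lambda>\<close> makes the limit \<open>\<epsilon> \<rightarrow> 0\<close> dominated; since \<open>p > 1\<close>, the remainder is \<open>O(\<lambda>\<^sup>1\<^sup>-\<^sup>p)\<close> in \<open>L\<^sup>1\<close> uniformly in
  \<open>\<epsilon>\<close>, hence uniformly small after averaging.\<close>

lemma Hn_increment_le_bv_increment:
  assumes f: "f \<in> hardy p" and bv: "has_boundary_values f" and p: "p > 1" and y: "y > 0"
  shows "Hn p y (\<lambda>w. lift f (w + of_real t) - lift f w) \<le> bv_increment p f t"
proof -
  have p1: "p \<ge> 1" and p0: "p > 0" using p by auto
  define U where "U = lift f"
  have fH: "f \<in> Hol_disc" by (rule hardy_Hol_disc[OF f])
  have fh: "f holomorphic_on ball 0 1" using fH by (simp add: Hol_disc_def)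
  have U: "per_hol U" unfolding U_def by (rule per_hol_lift_Hol_disc[OF fH])
  define d where "d = (\<lambda>v x. U (Complex (x + t) v) - U (Complex x v))"
  have dper: "d v (x + 2*pi) = d v x" if "v > 0" for v x
    using per_hol_periodic[OF U that, of "x + t"] per_hol_periodic[OF U that, of x] by (simp add: d_def add_ac)
  have cd: "continuous_on S (d v)" if "v > 0" for S v
    unfolding d_def using that by (intro continuous_on_diff per_hol_continuous_compose[OF U]) (auto intro!: continuous_intros)
  define M where "M = 2 * hardy_norm p f"
  have M0: "M \<ge> 0" using hardy_norm_nonneg[OF f] by (simp add: M_def)
  have dM: "Lpn p (d v) \<le> M" if "v > 0" for v
    using Hn_increment_le[OF f p1 that, of t] by (simp add: d_def U_def M_def Complex_add_shift)
  define B where "B = (\<lambda>\<theta>. norm (boundary_value f (\<theta> + t) - boundary_value f \<theta>))"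
  have iB: "(\<lambda>\<theta>. B \<theta> powr p) integrable_on {-pi..pi}"
    unfolding B_def by (rule bv_increment_le(1)[OF fH bv p0 zero_less_one Hn_increment_le[OF f p1]])
  define X where "X = bv_increment p f t"
  have X0: "X \<ge> 0" by (simp add: X_def bv_increment_def)
  have IB: "integral {-pi..pi} (\<lambda>\<theta>. B \<theta> powr p) = 2 * pi * X powr p"
  proof -
    have "integral {-pi..pi} (\<lambda>\<theta>. B \<theta> powr p) \<ge> 0" by (intro integral_nonneg iB) auto
    then show ?thesis using p0 by (simp add: X_def bv_increment_def B_def powr_powr)
  qed
  define \<epsilon> where "\<epsilon> = (\<lambda>n::nat. y / 2 * inverse (real (Suc n)))"
  have eps: "\<epsilon> n > 0" "\<epsilon> n < y" "\<epsilon> n \<le> y / 2" for n using y by (auto simp: \<epsilon>_def field_simps add_pos_nonneg)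
  have epsl: "\<epsilon> \<longlonglongrightarrow> 0"
    using tendsto_mult[OF tendsto_const LIMSEQ_inverse_real_of_nat, of "y / 2"] by (simp add: \<epsilon>_def)
  let ?N = "no_bv f \<union> ((\<lambda>x. - t + x) ` no_bv f)"
  have N: "negligible ?N" using negligible_no_bv[OF bv] by (intro negligible_Un negligible_translation)
  have lim: "(\<lambda>n. norm (d (\<epsilon> n) \<theta>)) \<longlonglongrightarrow> B \<theta>" if "\<theta> \<notin> ?N" for \<theta>
  proof -
    have t1: "\<theta> \<notin> no_bv f" using that by auto
    have t2: "\<theta> + t \<notin> no_bv f"
    proof
      assume "\<theta> + t \<in> no_bv f"
      then have "- t + (\<theta> + t) \<in> (\<lambda>x. - t + x) ` no_bv f" by (rule imageI)
      with that show False by simp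
    qed
    show ?thesis
      unfolding d_def U_def B_def by (intro tendsto_norm tendsto_diff lift_tendsto_boundary_value t1 t2 epsl eps)
  qed
  \<comment> \<open>A bound for the Poisson kernel, which is at most 2 / (1 - r), from all heights
    \<epsilon> up to y/2 at once.\<close>
  define R where "R = 2 / (1 - exp (- y / 2))"
  have main: "Lpn p (d y) \<le> X + R * (L powr (1 - p) * M powr p)" if L: "L > 0" for L
  proof -
    \<comment> \<open>The radial retraction onto the disc of radius \<open>L\<close>. It is
      continuous, so the truncated increments can still be averaged as continuous functions.\<close>
    define tr where "tr = (\<lambda>z::complex. of_real (L / max L (norm z)) * z)"
    have mx: "max L (norm z) > 0" for z :: complex using L by (simp add: less_max_iff_disj)
    have ctr: "continuous_on S tr" for S
    proof -
      have "max L (norm z) \<noteq> 0" for z :: complex using mx[of z] by simp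
      then show ?thesis unfolding tr_def by (intro continuous_intros) auto
    qed
    have ntr: "norm (tr z) = min L (norm z)" for z
      using L mx[of z] by (auto simp: tr_def norm_mult norm_divide max_def min_def)
    have rest: "norm (z - tr z) \<le> L powr (1 - p) * norm z powr p" for z
    proof (cases "norm z \<le> L")
      case True
      then have "tr z = z" using L by (simp add: tr_def max_def)
      then show ?thesis by simp
    next
      case False
      then have z: "norm z > L" by simp
      have "z - tr z = of_real (1 - L / norm z) * z" using z by (simp add: tr_def max_def algebra_simps)
      then have "norm (z - tr z) = norm (of_real (1 - L / norm z) :: complex) * norm z" by (simp only: norm_mult)
      also have "\<dots> = (1 - L / norm z) * norm z" unfolding norm_of_real using z L by (simp add: abs_of_nonneg divide_le_eq)
      also have "\<dots> \<le> 1 * norm z" using z L by (intro mult_right_mono) auto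
      also have "1 * norm z = norm z powr (1 - p) * norm z powr p" using z L by (simp flip: powr_add)
      also have "\<dots> \<le> L powr (1 - p) * norm z powr p" using z L p by (intro mult_right_mono powr_mono2') auto
      finally show ?thesis .
    qed
    define A where "A = (\<lambda>n x. tr (d (\<epsilon> n) x))"
    have cA: "continuous_on S (A n)" for S n
      unfolding A_def by (rule continuous_on_compose2[OF ctr cd[OF eps(1)]]) auto
    have Aper: "A n (x + 2*pi) = A n x" for n x unfolding A_def using dper[OF eps(1)] by simp
    have step: "Lpn p (d y) \<le> Lpn p (A n) + R * (L powr (1 - p) * M powr p)" for n
    proof -
      define r where "r = exp (\<epsilon> n - y)"
      have r: "0 \<le> r" "r < 1" using eps(2)[of n] by (auto simp: r_def)
      have rR: "2 / (1 - r) \<le> R"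
      proof -
        have "r \<le> exp (- y / 2)" using eps(3)[of n] by (simp add: r_def)
        then show ?thesis unfolding R_def using y r by (intro divide_left_mono mult_pos_pos) auto
      qed
      let ?P = "\<lambda>g x. integral {0..2*pi} (\<lambda>s. of_real (1 / (2*pi) * Pk r s) * (g (x + s) :: complex))"
      have ci: "continuous_on {0..2*pi} (\<lambda>s. of_real (1 / (2*pi) * Pk r s) * (g (x + s) :: complex))"
        if "continuous_on UNIV g" for g x
        using r by (intro continuous_intros continuous_on_compose2[OF that]) auto
      define E where "E = (\<lambda>x. d (\<epsilon> n) x - A n x)"
      have cE: "continuous_on S E" for S unfolding E_def by (intro continuous_on_diff cd eps cA)
      have Eper: "E (x + 2*pi) = E x" for x unfolding E_def using dper[OF eps(1)] Aper by simp
      have pois: "d y x = ?P (d (\<epsilon> n)) x" for x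
      proof -
        have cU: "continuous_on UNIV (\<lambda>x. U (Complex x (\<epsilon> n)))" by (intro per_hol_line U eps)
        have "d y x = integral {0..2*pi} (\<lambda>s. of_real (1 / (2*pi) * Pk r s) * U (Complex (x + t + s) (\<epsilon> n)))
           - integral {0..2*pi} (\<lambda>s. of_real (1 / (2*pi) * Pk r s) * U (Complex (x + s) (\<epsilon> n)))"
          unfolding d_def U_def using poisson_lift'[OF fh eps(1,2), of "x + t" n] poisson_lift'[OF fh eps(1,2), of x n]
          by (simp only: r_def)
        also have "\<dots> = integral {0..2*pi} (\<lambda>s. of_real (1 / (2*pi) * Pk r s) * U (Complex (x + t + s) (\<epsilon> n)) - of_real (1 / (2*pi) * Pk r s) * U (Complex (x + s) (\<epsilon> n)))"
          by (rule integral_diff[symmetric]; rule integrable_continuous_interval; rule ci[OF cU])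
        also have "\<dots> = ?P (d (\<epsilon> n)) x"
          by (rule integral_cong) (simp add: d_def right_diff_distrib add_ac)
        finally show ?thesis .
      qed
      have split: "?P (d (\<epsilon> n)) x = ?P (A n) x + ?P E x" for x
      proof -
        have "?P (A n) x + ?P E x = integral {0..2*pi} (\<lambda>s. of_real (1 / (2*pi) * Pk r s) * A n (x + s) + of_real (1 / (2*pi) * Pk r s) * E (x + s))"
          by (rule integral_add[symmetric]; rule integrable_continuous_interval; rule ci; intro cA cE)
        also have "\<dots> = ?P (d (\<epsilon> n)) x" by (rule integral_cong) (simp only: distrib_left[symmetric] E_def, simp)
        finally show ?thesis by simp
      qed
      have Pk_le: "Pk r s \<le> R" for s
      proof -
        have "1 - r \<le> norm (cis s - of_real r)" using norm_triangle_ineq2[of "cis s" "of_real r"] r by simp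
        then have "(1 - r)\<^sup>2 \<le> (norm (cis s - of_real r))\<^sup>2" using r by (intro power_mono) auto
        then have "Pk r s \<le> (1 - r\<^sup>2) / (1 - r)\<^sup>2"
          unfolding Pk_def using r cis_ne_of_real[OF r, of s] by (intro divide_left_mono) (auto simp: abs_square_le_1)
        also have "\<dots> = (1 + r) / (1 - r)"
        proof -
          have "1 - r\<^sup>2 = (1 + r) * (1 - r)" by (simp add: power2_eq_square algebra_simps)
          then show ?thesis using r by (simp add: power2_eq_square)
        qed
        also have "\<dots> \<le> 2 / (1 - r)" using r by (intro divide_right_mono) auto
        finally show ?thesis using rR by linarith
      qed
      have PE: "norm (?P E x) \<le> R * (L powr (1 - p) * M powr p)" for x
      proof -
        have R0: "R \<ge> 0" using Pk_le[of 0] Pk_pos[OF r, of 0] by linarith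
        have cEx: "continuous_on {0..2*pi} (\<lambda>s. d (\<epsilon> n) (x + s))"
          by (rule continuous_on_compose2[OF cd[OF eps(1)]]) (auto intro!: continuous_intros)
        have "norm (?P E x) \<le> integral {0..2*pi} (\<lambda>s. R * L powr (1 - p) / (2*pi) * norm (d (\<epsilon> n) (x + s)) powr p)"
        proof (intro integral_norm_bound_integral integrable_continuous_interval ci cE)
          show "continuous_on {0..2*pi} (\<lambda>s. R * L powr (1 - p) / (2*pi) * norm (d (\<epsilon> n) (x + s)) powr p)"
            by (intro continuous_on_mult continuous_on_const continuous_on_norm_powr cEx p0)
          fix s
          have "norm (of_real (1 / (2*pi) * Pk r s) * E (x + s)) = 1 / (2*pi) * (Pk r s * norm (E (x + s)))"
            using Pk_pos[OF r, of s] by (simp add: norm_mult norm_divide)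
          also have "\<dots> \<le> 1 / (2*pi) * (R * (L powr (1 - p) * norm (d (\<epsilon> n) (x + s)) powr p))"
            using Pk_le[of s] R0 rest[of "d (\<epsilon> n) (x + s)"]
            by (intro mult_left_mono mult_mono) (auto simp: E_def A_def)
          finally show "norm (of_real (1 / (2*pi) * Pk r s) * E (x + s)) \<le> R * L powr (1 - p) / (2*pi) * norm (d (\<epsilon> n) (x + s)) powr p"
            by (simp add: mult_ac)
        qed
        also have "\<dots> = R * L powr (1 - p) / (2*pi) * integral {0..2*pi} (\<lambda>s. norm (d (\<epsilon> n) (s + x)) powr p)"
          by (simp add: add.commute)
        also have "integral {0..2*pi} (\<lambda>s. norm (d (\<epsilon> n) (s + x)) powr p) = 2 * pi * Lpn p (d (\<epsilon> n)) powr p"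
          using Lpn_shift[OF p0 cd[OF eps(1)] dper[OF eps(1)], of n x] integral_eq_Lpn[OF p0, of "\<lambda>s. d (\<epsilon> n) (s + x)"] by simp
        also have "R * L powr (1 - p) / (2*pi) * (2 * pi * Lpn p (d (\<epsilon> n)) powr p) \<le> R * L powr (1 - p) / (2*pi) * (2 * pi * M powr p)"
          using R0 dM[OF eps(1)] p0 by (intro mult_left_mono powr_mono2) auto
        finally show ?thesis by simp
      qed
      have cPA: "continuous_on S (?P (A n))" "continuous_on S (?P E)" for S
        using Lpn_Pk_convolution(2)[OF cA Aper p1 r] Lpn_Pk_convolution(2)[OF cE Eper p1 r] by auto
      have "Lpn p (d y) \<le> Lpn p (?P (A n)) + Lpn p (?P E)"
        unfolding pois split by (rule Lpn_triangle_le[OF p1 cPA continuous_on_add[OF cPA]]) (rule norm_triangle_ineq)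
      also have "Lpn p (?P (A n)) \<le> Lpn p (A n)" by (rule Lpn_Pk_convolution(1)[OF cA Aper p1 r])
      also have "Lpn p (?P E) \<le> R * (L powr (1 - p) * M powr p)"
        using order_trans[OF norm_ge_zero PE] by (intro Lpn_le_const p0 cPA PE)
      finally show ?thesis by simp
    qed
    have "(\<lambda>n. integral {-pi..pi} (\<lambda>x. norm (A n x) powr p)) \<longlonglongrightarrow> integral ({-pi..pi} - ?N) (\<lambda>x. min L (B x) powr p)"
      and iL: "(\<lambda>x. min L (B x) powr p) integrable_on ({-pi..pi} - ?N)"
    proof -
      have i: "(\<lambda>x. norm (A n x) powr p) integrable_on {-pi..pi}" for n
        by (intro integrable_continuous_interval continuous_on_norm_powr cA p0)
      have s1: "(h integrable_on ({-pi..pi} - ?N)) = (h integrable_on {-pi..pi})" for h :: "real \<Rightarrow> real"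
        by (rule integrable_spike_set_eq) (rule negligible_subset[OF N], auto)
      have s2: "integral ({-pi..pi} - ?N) h = integral {-pi..pi} h" for h :: "real \<Rightarrow> real"
        by (rule integral_spike_set) (rule negligible_subset[OF N], auto)+
      have bd: "norm (norm (A n x) powr p) \<le> L powr p" for n x
        using L p0 by (auto simp: A_def ntr intro!: powr_mono2)
      have cv: "(\<lambda>n. norm (A n x) powr p) \<longlonglongrightarrow> min L (B x) powr p" if "x \<in> {-pi..pi} - ?N" for x
      proof -
        have "(\<lambda>n. min L (norm (d (\<epsilon> n) x))) \<longlonglongrightarrow> min L (B x)" using that by (intro tendsto_min tendsto_const lim) auto
        then show ?thesis unfolding A_def ntr using p0 L by (intro tendsto_powr2 tendsto_const) auto
      qed
      have c: "(\<lambda>x. L powr p) integrable_on ({-pi..pi} - ?N)" unfolding s1 by (rule integrable_const_ivl)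
      note DC = dominated_convergence[where f = "\<lambda>n x. norm (A n x) powr p" and S = "{-pi..pi} - ?N", OF i[folded s1] c bd cv]
      show "(\<lambda>x. min L (B x) powr p) integrable_on ({-pi..pi} - ?N)" by (rule DC(1))
      show "(\<lambda>n. integral {-pi..pi} (\<lambda>x. norm (A n x) powr p)) \<longlonglongrightarrow> integral ({-pi..pi} - ?N) (\<lambda>x. min L (B x) powr p)"
        using DC(2) unfolding s2 .
    qed
    then have lim1: "(\<lambda>n. integral {-pi..pi} (\<lambda>x. norm (A n x) powr p)) \<longlonglongrightarrow> integral ({-pi..pi} - ?N) (\<lambda>x. min L (B x) powr p)" by simp
    have "integral ({-pi..pi} - ?N) (\<lambda>x. min L (B x) powr p) \<le> integral ({-pi..pi} - ?N) (\<lambda>x. B x powr p)"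
    proof (rule integral_le[OF iL])
      show "(\<lambda>x. B x powr p) integrable_on ({-pi..pi} - ?N)"
        using iB by (subst integrable_spike_set_eq) (rule negligible_subset[OF N], auto)
      show "min L (B x) powr p \<le> B x powr p" for x using L p0 by (intro powr_mono2) (auto simp: B_def)
    qed
    also have "\<dots> = integral {-pi..pi} (\<lambda>x. B x powr p)"
      by (rule integral_spike_set) (rule negligible_subset[OF N], auto)+
    finally have le1: "integral ({-pi..pi} - ?N) (\<lambda>x. min L (B x) powr p) \<le> 2 * pi * X powr p" by (simp add: IB)
    show ?thesis
    proof (rule field_le_epsilon)
      fix e :: real assume e: "e > 0"
      have "2 * pi * X powr p < 2 * pi * (X + e) powr p"
        using X0 e p0 by (intro mult_strict_left_mono powr_less_mono2) auto
      with le1 have "integral ({-pi..pi} - ?N) (\<lambda>x. min L (B x) powr p) < 2 * pi * (X + e) powr p" by linarith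
      from order_tendstoD(2)[OF lim1 this] obtain n where n: "integral {-pi..pi} (\<lambda>x. norm (A n x) powr p) < 2 * pi * (X + e) powr p"
        by (auto simp: eventually_sequentially)
      have "integral {0..2*pi} (\<lambda>x. norm (A n x) powr p) = integral {-pi..pi} (\<lambda>x. norm (A n x) powr p)"
        using Aper by (intro integral_symmetric_period[symmetric] continuous_on_norm_powr cA p0) simp
      with n have "Lpn p (A n) \<le> X + e" using X0 e p0 by (simp add: Lpn_le_iff)
      with step[of n] show "Lpn p (d y) \<le> X + R * (L powr (1 - p) * M powr p) + e" by linarith
    qed
  qed
  \<comment> \<open>The truncation level tends to infinity; L^(1-p) tends to 0 because p >
    1.\<close>
  have "Lpn p (d y) \<le> X + R * (0 * M powr p)"
  proof (rule tendsto_lowerbound)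
    have "((\<lambda>L::real. L powr (1 - p)) \<longlongrightarrow> 0) at_top" using p by (intro tendsto_neg_powr filterlim_ident) auto
    then show "((\<lambda>L. X + R * (L powr (1 - p) * M powr p)) \<longlongrightarrow> X + R * (0 * M powr p)) at_top"
      by (intro tendsto_add tendsto_mult tendsto_const)
    show "\<forall>\<^sub>F L in at_top. Lpn p (d y) \<le> X + R * (L powr (1 - p) * M powr p)"
      using main by (intro eventually_at_top_linorderI[of 1]) auto
  qed auto
  then show ?thesis by (simp add: X_def d_def U_def Complex_add_shift)
qed

text \<open>Horizontal increments of length up to y are controlled at every height by the boundary
  increments, and increments of step y determine the derivative at height y.\<close>

theorem little_lipschitz_imp_small_deriv:
  assumes f: "f \<in> little_lipschitz p (1 / p)" and p: "p > 1"
  shows "small_deriv p f"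
  unfolding small_deriv_def
proof (intro allI impI)
  fix e :: real assume e: "e > 0"
  have fh: "f \<in> hardy p" and bv: "has_boundary_values f" and o: "(\<lambda>\<delta>. mean_modulus p \<delta> f) \<in> o[at_right 0](\<lambda>\<delta>. \<delta> powr (1 / p))"
    using f by (auto simp: little_lipschitz_def)
  have p1: "p \<ge> 1" using p by simp
  define U where "U = lift f"
  have U: "per_hol U" unfolding U_def by (rule per_hol_lift_Hol_disc[OF hardy_Hol_disc[OF fh]])
  have "\<forall>\<^sub>F \<delta> in at_right 0. norm (mean_modulus p \<delta> f) \<le> e / 3 * norm (\<delta> powr (1 / p))"
    using landau_o.smallD[OF o, of "e / 3"] e by simp
  then obtain y0 where y0: "y0 > 0" "\<And>\<delta>. 0 < \<delta> \<Longrightarrow> \<delta> < y0 \<Longrightarrow> \<bar>mean_modulus p \<delta> f\<bar> \<le> e / 3 * \<delta> powr (1 / p)"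
    by (auto simp: eventually_at_right_field)
  have "Hn p y (deriv (lift f)) \<le> e * y powr (1 / p - 1)" if y: "0 < y" "y < y0" for y
  proof -
    \<comment> \<open>The estimate by increments yields B + 2B, hence the division by 3.\<close>
    define B where "B = e / 3 * y powr (1 / p)"
    have B0: "B \<ge> 0" using e by (simp add: B_def)
    have "norm (of_real y :: complex) * Hn p y (deriv U) \<le> B + norm (of_real y :: complex) * (2 * B / y)"
    proof (rule Hn_deriv_le_of_increments[OF U p1 y(1)])
      fix u v :: real assume u: "u \<in> {0..1}" and v: "v \<ge> y / 2"
      have v0: "v > 0" using v y by linarith
      show "Hn p v (\<lambda>w. U (w + of_real u * of_real y) - U w) \<le> B"
      proof (cases "u = 0")
        case True
        then show ?thesis using B0 p by (intro Lpn_le_const) auto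
      next
        case False
        then have uy: "0 < \<bar>u * y\<bar>" "\<bar>u * y\<bar> \<le> y" using u y by (auto simp: abs_mult mult_left_le_one_le)
        have "Hn p v (\<lambda>w. U (w + of_real (u * y)) - U w) \<le> bv_increment p f (u * y)"
          unfolding U_def by (rule Hn_increment_le_bv_increment[OF fh bv p v0])
        also have "\<dots> \<le> mean_modulus p y f" by (rule bv_increment_le_mean_modulus[OF fh bv p1 uy])
        also have "\<dots> \<le> B" using y0(2)[OF y] by (simp add: B_def)
        finally show ?thesis by simp
      qed
    qed simp
    then have "y * Hn p y (deriv U) \<le> 3 * B" using y by simp
    also have "3 * B = y * (e * y powr (1 / p - 1))" using y by (simp add: B_def powr_diff)
    finally show ?thesis using y by (simp add: U_def)
  qed
  then show "\<exists>y0>0. \<forall>y. 0 < y \<longrightarrow> y < y0 \<longrightarrow> Hn p y (deriv (lift f)) \<le> e * y powr (1 / p - 1)"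
    using y0(1) by blast
qed

section \<open>From the derivative condition back to boundary values and their modulus of
  continuity\<close>

lemma has_integral_powr_shifted:
  fixes a b \<alpha> :: real
  assumes "0 < a" "a \<le> b" "\<alpha> > 0"
  shows "((\<lambda>s. s powr (\<alpha> - 1)) has_integral (b powr \<alpha> - a powr \<alpha>) / \<alpha>) {a..b}"
proof -
  have "((\<lambda>s. s powr (\<alpha> - 1)) has_integral b powr \<alpha> / \<alpha> - a powr \<alpha> / \<alpha>) {a..b}"
  proof (rule fundamental_theorem_of_calculus[OF assms(2)])
    fix x assume "x \<in> {a..b}"
    then have x: "x > 0" using assms by simp
    have "((\<lambda>s. s powr \<alpha>) has_real_derivative \<alpha> * x powr (\<alpha> - 1)) (at x)"
      using x by (rule has_real_derivative_powr)
    from DERIV_cdivide[OF this, of \<alpha>]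
    have "((\<lambda>s. s powr \<alpha> / \<alpha>) has_real_derivative x powr (\<alpha> - 1)) (at x)" using assms by simp
    then show "((\<lambda>s. s powr \<alpha> / \<alpha>) has_vector_derivative x powr (\<alpha> - 1)) (at x within {a..b})"
      by (metis has_real_derivative_iff_has_vector_derivative has_vector_derivative_at_within)
  qed
  then show ?thesis by (simp add: diff_divide_distrib)
qed

lemma continuous_on_powr_exponent:
  assumes "0 < a" shows "continuous_on {a..b} (\<lambda>s::real. s powr \<alpha>)"
  using assms by (intro continuous_on_powr' continuous_on_id continuous_on_const) auto

lemma per_hol_vertical:
  assumes U: "per_hol U" and ab: "0 < a" "a \<le> b"
  shows "((\<lambda>s. \<i> * deriv U (Complex x s)) has_integral U (Complex x b) - U (Complex x a)) {a..b}"
    and "norm (U (Complex x b) - U (Complex x a)) \<le> integral {a..b} (\<lambda>s. norm (deriv U (Complex x s)))"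
proof -
  show i: "((\<lambda>s. \<i> * deriv U (Complex x s)) has_integral U (Complex x b) - U (Complex x a)) {a..b}"
  proof (rule fundamental_theorem_of_calculus[OF ab(2)])
    fix s assume "s \<in> {a..b}"
    then have s: "s > 0" using ab by simp
    have "((\<lambda>s. Complex x s) has_vector_derivative \<i>) (at s within {a..b})"
      unfolding Complex_eq by (auto intro!: derivative_eq_intros)
    then show "((\<lambda>s. U (Complex x s)) has_vector_derivative \<i> * deriv U (Complex x s)) (at s within {a..b})"
      using s by (intro has_vector_derivative_per_hol[OF U]) auto
  qed
  have "continuous_on {a..b} (\<lambda>s. deriv U (Complex x s))"
    using ab by (intro per_hol_continuous_compose[OF per_hol_deriv[OF U]]) (auto intro!: continuous_intros)
  then show "norm (U (Complex x b) - U (Complex x a)) \<le> integral {a..b} (\<lambda>s. norm (deriv U (Complex x s)))"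
    unfolding integral_unique[OF i, symmetric] using i
    by (intro integral_norm_bound_integral integrable_continuous_interval)
      (auto intro!: continuous_intros simp: norm_mult)
qed

lemma continuous_deriv_strip:
  assumes U: "per_hol U" and a: "0 < a"
  shows "continuous_on ({a..b} \<times> S) (\<lambda>(s, x). deriv U (Complex x s))"
  unfolding case_prod_unfold using a
  by (intro per_hol_continuous_compose[OF per_hol_deriv[OF U]]) (auto intro!: continuous_intros)

text \<open>The power s^(1/p-1) has primitive p s^(1/p), and subadditivity of the power 1/p removes
  the dependence on the starting height.\<close>

lemma Hn_vertical_increment_le:
  assumes U: "per_hol U" and p: "p \<ge> 1" and y: "y > 0" "h > 0" and E: "E > 0"
    and B: "\<And>s. s \<in> {y..y + h} \<Longrightarrow> Hn p s (deriv U) \<le> E * s powr (1 / p - 1)"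
  shows "Hn p y (\<lambda>w. U (w + \<i> * of_real h) - U w) \<le> p * E * h powr (1 / p)"
proof -
  have "Lpn p (\<lambda>x. U (Complex x (y + h)) - U (Complex x y)) \<le> integral {y..y + h} (\<lambda>s. E * s powr (1 / p - 1))"
  proof (rule Lpn_minkowski_integral[OF p _ continuous_deriv_strip[OF U y(1)]])
    show "continuous_on {y..y + h} (\<lambda>s. E * s powr (1 / p - 1))"
      by (intro continuous_on_mult continuous_on_const continuous_on_powr_exponent y)
    show "continuous_on {0..2*pi} (\<lambda>x. U (Complex x (y + h)) - U (Complex x y))"
      using y by (intro continuous_on_diff per_hol_line[OF U]) auto
    show "norm (U (Complex x (y + h)) - U (Complex x y)) \<le> integral {y..y + h} (\<lambda>s. norm (deriv U (Complex x s)))" for x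
      using y by (intro per_hol_vertical[OF U]) auto
  qed (use y E B in auto)
  also have "\<dots> = E * (((y + h) powr (1 / p) - y powr (1 / p)) / (1 / p))"
    using y p has_integral_powr_shifted[of y "y + h" "1 / p"] by (simp add: integral_unique)
  also have "\<dots> \<le> E * (h powr (1 / p) / (1 / p))"
    using powr_add_le[of y h "1 / p"] y p E by (intro mult_left_mono divide_right_mono) auto
  finally show ?thesis by (simp add: Complex_add_shift mult_ac)
qed

text \<open>To compare \<open>U(w + t)\<close> with \<open>U(w)\<close> at a low height, climb by \<open>\<bar>t\<bar>\<close>, move by \<open>t\<close>, and descend again.\<close>

lemma Hn_increment_small:
  assumes sd: "small_deriv p f" and f: "f \<in> Hol_disc" and p: "p \<ge> 1" and e: "e > 0"
  shows "\<exists>h0>0. \<forall>t y. 0 < \<bar>t\<bar> \<longrightarrow> \<bar>t\<bar> < h0 \<longrightarrow> 0 < y \<longrightarrow> y < h0 \<longrightarrow>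
    Hn p y (\<lambda>w. lift f (w + of_real t) - lift f w) \<le> e * \<bar>t\<bar> powr (1 / p)"
proof -
  define U where "U = lift f"
  have U: "per_hol U" unfolding U_def by (rule per_hol_lift_Hol_disc[OF f])
  \<comment> \<open>Each of the two vertical legs costs p E, the horizontal one costs E.\<close>
  define E where "E = e / (2 * p + 1)"
  have E: "E > 0" using e p by (simp add: E_def)
  have p0: "p > 0" using p by simp
  obtain y0 where y0: "y0 > 0" "\<And>y. 0 < y \<Longrightarrow> y < y0 \<Longrightarrow> Hn p y (deriv U) \<le> E * y powr (1 / p - 1)"
    using sd E unfolding small_deriv_def U_def by meson
  have "Hn p y (\<lambda>w. U (w + of_real t) - U w) \<le> e * \<bar>t\<bar> powr (1 / p)"
    if t: "0 < \<bar>t\<bar>" "\<bar>t\<bar> < y0 / 2" and y: "0 < y" "y < y0 / 2" for t y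
  proof -
    define h where "h = \<bar>t\<bar>"
    have h: "h > 0" "y + h < y0" using t y by (auto simp: h_def)
    define D where "D = (\<lambda>w. U (w + \<i> * of_real h) - U w)"
    have D: "per_hol D" unfolding D_def using h by (intro per_hol_diff per_hol_shift U) auto
    define G where "G = (\<lambda>w. U (w + of_real t) - U w)"
    have G: "per_hol G" unfolding G_def by (intro per_hol_diff per_hol_shift U) auto
    have d1: "Hn p y D \<le> p * E * h powr (1 / p)"
      unfolding D_def using y h by (intro Hn_vertical_increment_le[OF U p y(1) h(1) E] y0(2)) auto
    have d2: "Hn p y (\<lambda>w. D (w + of_real t)) = Hn p y D" using Hn_shift[OF D p0, of y "of_real t"] y by simp
    have d3: "Hn p (y + h) G \<le> norm (of_real t :: complex) * (E * (y + h) powr (1 / p - 1))"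
      unfolding G_def using y h by (intro Hn_diff_le[OF U p]) (auto intro!: y0(2))
    also have "\<dots> \<le> h * (E * h powr (1 / p - 1))"
      unfolding norm_of_real h_def[symmetric] using y h E p by (intro mult_left_mono powr_mono2') auto
    also have "\<dots> = E * h powr (1 / p)" using h by (simp add: powr_diff)
    finally have d3: "Hn p (y + h) G \<le> E * h powr (1 / p)" .
    let ?d = "\<lambda>x. D (Complex x y)" and ?dt = "\<lambda>x. D (Complex x y + of_real t)" and ?g = "\<lambda>x. G (Complex x (y + h))"
    have c: "continuous_on S ?d" "continuous_on S ?dt" "continuous_on S ?g" for S
      using y h by (auto intro!: per_hol_line[OF D] per_hol_line[OF G] per_hol_continuous_compose[OF D] continuous_intros)
    \<comment> \<open>The horizontal step at the upper height, minus the climb above x + t, plus the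
      climb above x.\<close>
    have id: "U (Complex x y + of_real t) - U (Complex x y) = (?g x - ?dt x) + ?d x" for x
      by (simp add: D_def G_def Complex_add_shift)
    have "Hn p y (\<lambda>w. U (w + of_real t) - U w) \<le> Lpn p (\<lambda>x. ?g x - ?dt x) + Lpn p ?d"
      unfolding id by (intro Lpn_triangle_le[OF p] continuous_on_add continuous_on_diff c norm_triangle_ineq)
    also have "Lpn p (\<lambda>x. ?g x - ?dt x) \<le> Lpn p ?g + Lpn p ?dt"
      by (intro Lpn_triangle_le[OF p] continuous_on_diff c norm_triangle_ineq4)
    also have "Lpn p ?g + Lpn p ?dt + Lpn p ?d \<le> E * h powr (1 / p) + p * E * h powr (1 / p) + p * E * h powr (1 / p)"
      using d1 d2 d3 by linarith
    also have "\<dots> = (2 * p + 1) * E * h powr (1 / p)" by (simp add: algebra_simps)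
    also have "(2 * p + 1) * E = e" using p by (simp add: E_def)
    finally show ?thesis by (simp add: h_def)
  qed
  then show ?thesis using y0(1) unfolding U_def by (intro exI[of _ "y0 / 2"]) auto
qed

text \<open>By monotone convergence the supremum of the sequence has finite integral, hence is
  finite almost everywhere.\<close>

lemma AE_bounded_of_integrals_bounded:
  fixes g :: "nat \<Rightarrow> real \<Rightarrow> real"
  assumes c: "\<And>n. continuous_on UNIV (g n)" and nn: "\<And>n x. g n x \<ge> 0"
    and inc: "\<And>n x. g n x \<le> g (Suc n) x" and M: "\<And>n. integral {a..b} (g n) \<le> M"
  shows "AE x in lborel. x \<in> {a..b} \<longrightarrow> (\<exists>C. \<forall>n. g n x \<le> C)"
proof -
  let ?G = "\<lambda>n x. ennreal (g n x) * indicator {a..b} x"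
  have gm [measurable]: "g n \<in> borel_measurable borel" for n
    using c by (intro borel_measurable_continuous_onI)
  have "(\<integral>\<^sup>+ x. (SUP n. ?G n x) \<partial>lborel) = (SUP n. \<integral>\<^sup>+ x. ?G n x \<partial>lborel)"
    by (rule nn_integral_monotone_convergence_SUP)
       (auto intro!: incseq_SucI le_funI mult_right_mono ennreal_leI inc)
  also have "\<dots> \<le> ennreal M"
  proof (rule SUP_least)
    fix n
    have "(g n has_integral integral {a..b} (g n)) {a..b}"
      by (intro integrable_integral integrable_continuous_interval continuous_on_subset[OF c]) auto
    from nn_integral_has_integral_lebesgue'[OF nn this]
    show "(\<integral>\<^sup>+ x. ?G n x \<partial>lborel) \<le> ennreal M" using M[of n] by (simp add: ennreal_leI)
  qed
  finally have "(\<integral>\<^sup>+ x. (SUP n. ?G n x) \<partial>lborel) \<noteq> \<infinity>" by (auto simp: top_unique)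
  then have "AE x in lborel. (SUP n. ?G n x) \<noteq> \<infinity>" by (intro nn_integral_PInf_AE) auto
  then show ?thesis
  proof (rule AE_mp, intro AE_I2 impI)
    fix x assume f: "(SUP n. ?G n x) \<noteq> \<infinity>" and x: "x \<in> {a..b}"
    then obtain C where C: "(SUP n. ?G n x) = ennreal C" "C \<ge> 0" by (cases "SUP n. ?G n x") auto
    have "g n x \<le> C" for n
    proof -
      have "ennreal (g n x) \<le> (SUP n. ?G n x)" using x by (intro SUP_upper2[of n]) auto
      then show ?thesis using C by simp
    qed
    then show "\<exists>C. \<forall>n. g n x \<le> C" by blast
  qed
qed

lemma AE_lborel_intervals:
  assumes "\<And>k::int. AE x in lborel. x \<in> {2*pi*k..2*pi*k + 2*pi} \<longrightarrow> P x"
  shows "AE x in lborel. P (x::real)"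
proof -
  have "AE x in lborel. \<forall>k::int. x \<in> {2*pi*k..2*pi*k + 2*pi} \<longrightarrow> P x"
    using assms by (subst AE_all_countable) blast
  then show ?thesis
  proof (rule AE_mp, intro AE_I2 impI)
    fix x :: real assume a: "\<forall>k::int. x \<in> {2*pi*k..2*pi*k + 2*pi} \<longrightarrow> P x"
    define k where "k = \<lfloor>x / (2*pi)\<rfloor>"
    have "of_int k \<le> x / (2*pi)" "x / (2*pi) < of_int k + 1" unfolding k_def by linarith+
    then have "x \<in> {2*pi*k..2*pi*k + 2*pi}" by (simp add: field_simps)
    then show "P x" using a by blast
  qed
qed

text \<open>The power y^(1/p-1) is integrable at 0, so the integral of |U'| over the strip near the
  real line is finite. Hence U has finite variation on almost every vertical segment, and the radial
  limit exists there.\<close>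

lemma small_deriv_imp_boundary_values:
  assumes sd: "small_deriv p f" and f: "f \<in> Hol_disc" and p: "p \<ge> 1"
  shows "has_boundary_values f"
proof -
  define U where "U = lift f"
  have U: "per_hol U" unfolding U_def by (rule per_hol_lift_Hol_disc[OF f])
  obtain y0 where y0: "y0 > 0" "\<And>y. 0 < y \<Longrightarrow> y < y0 \<Longrightarrow> Hn p y (deriv U) \<le> 1 * y powr (1 / p - 1)"
    using sd zero_less_one unfolding small_deriv_def U_def by meson
  define b where "b = y0 / 2"
  have b: "b > 0" "b < y0" using y0 by (auto simp: b_def)
  define a where "a = (\<lambda>n. b * inverse (real (Suc n)))"
  have a: "a n > 0" "a n \<le> b" "a (Suc n) \<le> a n" for n using b by (auto simp: a_def field_simps)
  have adec: "a m \<le> a n" if "n \<le> m" for n m using a(3) that by (rule lift_Suc_antimono_le)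
  have alim: "a \<longlonglongrightarrow> 0"
    using tendsto_mult[OF tendsto_const LIMSEQ_inverse_real_of_nat, of b] by (simp add: a_def)
  let ?u = "\<lambda>x s. norm (deriv U (Complex x s))"
  have cu: "continuous_on {c..d} (?u x)" if "c > 0" for c d x
    using that by (intro continuous_on_norm per_hol_continuous_compose[OF per_hol_deriv[OF U]]) (auto intro!: continuous_intros)
  define g where "g = (\<lambda>n x. integral {a n..b} (?u x))"
  have cu2: "continuous_on ({a n..b} \<times> S) (\<lambda>(s, x). ?u x s)" for n S
    using continuous_on_norm[OF continuous_deriv_strip[OF U a(1)], of n b S] by (simp add: case_prod_unfold)
  have cg: "continuous_on UNIV (g n)" for n
  proof -
    have "continuous_on (UNIV \<times> cbox (a n) b) (\<lambda>(x, s). ?u x s)"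
      using continuous_on_Times_swap[OF cu2] by simp
    from integral_continuous_on_param[OF this] show ?thesis by (simp add: g_def)
  qed
  have gdiff: "g m x - g n x = integral {a m..a n} (?u x)" if "n \<le> m" for n m x
    using Henstock_Kurzweil_Integration.integral_combine[of "a m" "a n" b "?u x"] adec[OF that] a
    by (simp add: g_def integrable_continuous_interval cu)
  have ginc: "g n x \<le> g m x" if "n \<le> m" for n m x
    using gdiff[OF that, of x] integral_nonneg[OF integrable_continuous_interval[OF cu[OF a(1)[of m]]], of "a n" x] by simp
  have g0: "g n x \<ge> 0" for n x
    unfolding g_def by (intro integral_nonneg integrable_continuous_interval cu a) auto
  have gper: "g n (x + 2*pi) = g n x" for n x
    unfolding g_def using a(1)[of n] by (intro integral_cong) (simp add: per_hol_periodic[OF per_hol_deriv[OF U]])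
  \<comment> \<open>The bound does not depend on how close to the real line the segments begin, nor
    on the period interval.\<close>
  have intg: "integral {2*pi*k..2*pi*k + 2*pi} (g n) \<le> 2 * pi * (p * b powr (1 / p))" for n and k :: int
  proof -
    have "integral {2*pi*k..2*pi*k + 2*pi} (g n) = integral {0..2*pi} (g n)"
      by (rule integral_periodic_shift[OF cg gper])
    also have "\<dots> = integral {a n..b} (\<lambda>s. integral {0..2*pi} (\<lambda>x. ?u x s))"
    proof -
      have "continuous_on (cbox (a n, 0) (b, 2*pi)) (\<lambda>(s, x). ?u x s)" using cu2 by (simp add: cbox_Pair_eq)
      from integral_swap_continuous[OF this] show ?thesis by (simp add: g_def)
    qed
    also have "\<dots> \<le> integral {a n..b} (\<lambda>s. 2 * pi * s powr (1 / p - 1))"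
    proof (intro integral_le integrable_continuous_interval continuous_on_mult continuous_on_const continuous_on_powr_exponent a)
      show "continuous_on {a n..b} (\<lambda>s. integral {0..2*pi} (\<lambda>x. ?u x s))"
      proof -
        have "continuous_on ({a n..b} \<times> cbox 0 (2*pi)) (\<lambda>(s, x). ?u x s)" using cu2 by simp
        from integral_continuous_on_param[OF this] show ?thesis by simp
      qed
      fix s assume "s \<in> {a n..b}"
      then have s: "0 < s" "s < y0" using a(1)[of n] b by auto
      have "integral {0..2*pi} (\<lambda>x. ?u x s) \<le> 2 * pi * Hn p s (deriv U)"
        by (intro integral_norm_le_Lpn[OF p] per_hol_line per_hol_deriv U s)
      also have "\<dots> \<le> 2 * pi * s powr (1 / p - 1)" using y0(2)[OF s] by simp
      finally show "integral {0..2*pi} (\<lambda>x. ?u x s) \<le> 2 * pi * s powr (1 / p - 1)" .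
    qed
    also have "\<dots> = 2 * pi * ((b powr (1 / p) - a n powr (1 / p)) / (1 / p))"
      using has_integral_powr_shifted[of "a n" b "1 / p"] a[of n] p by (simp add: integral_unique)
    also have "\<dots> \<le> 2 * pi * (b powr (1 / p) / (1 / p))"
      using p by (intro mult_left_mono divide_right_mono) auto
    finally show ?thesis by (simp add: mult_ac)
  qed
  have conv: "\<exists>l. ((\<lambda>r. f (of_real r * cis x)) \<longlongrightarrow> l) (at_left 1)" if C: "\<And>n. g n x \<le> C" for x C
  proof -
    have "Bseq (\<lambda>n. g n x)" using C g0 by (intro BseqI'[of _ C]) auto
    then have "convergent (\<lambda>n. g n x)" by (rule Bseq_mono_convergent) (use ginc in auto)
    then have Cg: "Cauchy (\<lambda>n. g n x)" by (rule convergent_Cauchy)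
    \<comment> \<open>The increment of U is at most the variation between the two heights, which is
      a difference of terms of the convergent sequence g. All intermediate heights are covered, so
      the limit is one along the whole radius and not only along \<open>a\<close>.\<close>
    have near: "\<exists>N. \<forall>n y y'. n \<ge> N \<longrightarrow> a n \<le> y \<longrightarrow> y \<le> y' \<longrightarrow> y' \<le> a N \<longrightarrow> norm (U (Complex x y') - U (Complex x y)) \<le> e" if "e > 0" for e
    proof -
      from CauchyD[OF Cg \<open>e > 0\<close>] obtain N where N: "\<And>m n. m \<ge> N \<Longrightarrow> n \<ge> N \<Longrightarrow> norm (g m x - g n x) < e" by blast
      have "norm (U (Complex x y') - U (Complex x y)) \<le> e" if n: "n \<ge> N" and y: "a n \<le> y" "y \<le> y'" "y' \<le> a N" for n y y'
      proof -
        have "norm (U (Complex x y') - U (Complex x y)) \<le> integral {y..y'} (?u x)"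
          using y a(1)[of n] by (intro per_hol_vertical[OF U]) auto
        also have "\<dots> \<le> integral {a n..a N} (?u x)"
          using y a(1)[of n] by (intro integral_subset_le integrable_continuous_interval cu) auto
        also have "\<dots> = g n x - g N x" by (rule gdiff[OF n, symmetric])
        also have "\<dots> \<le> e" using N[OF n order_refl] by simp
        finally show ?thesis .
      qed
      then show ?thesis by blast
    qed
    have "Cauchy (\<lambda>n. U (Complex x (a n)))"
    proof (rule CauchyI)
      fix e :: real assume e: "e > 0"
      then obtain N where N: "\<And>n y y'. n \<ge> N \<Longrightarrow> a n \<le> y \<Longrightarrow> y \<le> y' \<Longrightarrow> y' \<le> a N \<Longrightarrow> norm (U (Complex x y') - U (Complex x y)) \<le> e / 2"
        using near[of "e / 2"] by auto
      have "norm (U (Complex x (a m)) - U (Complex x (a n))) < e" if "m \<ge> N" "n \<ge> N" for m n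
        using N[OF that(2), of "a n" "a m"] N[OF that(1), of "a m" "a n"] adec[of m n] adec[of n m] adec[OF that(1)] adec[OF that(2)] e
        by (cases "m \<le> n") (auto simp: norm_minus_commute)
      then show "\<exists>M. \<forall>m\<ge>M. \<forall>n\<ge>M. norm (U (Complex x (a m)) - U (Complex x (a n))) < e" by blast
    qed
    then obtain l where l: "(\<lambda>n. U (Complex x (a n))) \<longlonglongrightarrow> l" using Cauchy_convergent convergent_def by blast
    have "((\<lambda>r. f (of_real r * cis x)) \<longlongrightarrow> l) (at_left 1)"
    proof (rule tendstoI)
      fix e :: real assume e: "e > 0"
      then obtain N where N: "\<And>n y y'. n \<ge> N \<Longrightarrow> a n \<le> y \<Longrightarrow> y \<le> y' \<Longrightarrow> y' \<le> a N \<Longrightarrow> norm (U (Complex x y') - U (Complex x y)) \<le> e / 2"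
        using near[of "e / 2"] by auto
      have close: "norm (U (Complex x y) - l) \<le> e / 2" if y: "0 < y" "y \<le> a N" for y
      proof (rule tendsto_upperbound)
        show "(\<lambda>n. norm (U (Complex x y) - U (Complex x (a n)))) \<longlonglongrightarrow> norm (U (Complex x y) - l)"
          by (intro tendsto_norm tendsto_diff tendsto_const l)
        have "\<forall>\<^sub>F n in sequentially. a n < y" using order_tendstoD(2)[OF alim y(1)] .
        then show "\<forall>\<^sub>F n in sequentially. norm (U (Complex x y) - U (Complex x (a n))) \<le> e / 2"
          using eventually_ge_at_top[of N] by eventually_elim (use N y in auto)
      qed auto
      have "exp (- a N) < 1" using a(1)[of N] by simp
      then have "\<forall>\<^sub>F r in at_left 1. r \<in> {exp (- a N)<..<1}" by (intro eventually_at_leftI[of "exp (- a N)"]) auto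
      then show "\<forall>\<^sub>F r in at_left 1. dist (f (of_real r * cis x)) l < e"
      proof eventually_elim
        case (elim r)
        then have r: "0 < r" "r < 1" using exp_gt_zero[of "- a N"] by (auto simp del: exp_gt_zero intro: less_trans)
        have "- a N < ln r" using elim r by (subst exp_less_cancel_iff[symmetric]) simp
        then have "norm (U (Complex x (- ln r)) - l) \<le> e / 2" using r by (intro close) auto
        moreover have "U (Complex x (- ln r)) = f (of_real r * cis x)"
          using r exp_i_Complex[of x "- ln r"] by (simp add: U_def lift_def)
        ultimately show ?case using e by (simp add: dist_norm)
      qed
    qed
    then show ?thesis by blast
  qed
  show ?thesis
    unfolding has_boundary_values_def
  proof (rule AE_lborel_intervals)
    fix k :: int
    have "AE x in lborel. x \<in> {2*pi*k..2*pi*k + 2*pi} \<longrightarrow> (\<exists>C. \<forall>n. g n x \<le> C)"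
      by (rule AE_bounded_of_integrals_bounded[OF cg g0 ginc intg]) simp
    then show "AE x in lborel. x \<in> {2*pi*k..2*pi*k + 2*pi} \<longrightarrow> (\<exists>l. ((\<lambda>r. f (of_real r * cis x)) \<longlongrightarrow> l) (at_left 1))"
      by (rule AE_mp) (intro AE_I2 impI, use conv in blast)
  qed
qed

text \<open>\<open>Hn_increment_small\<close> bounds the increments on all low lines by the same
  quantity, and Fatou's lemma carries that bound to the boundary.\<close>

theorem small_deriv_imp_little_lipschitz:
  assumes sd: "small_deriv p f" and f: "f \<in> hardy p" and p: "p \<ge> 1"
  shows "f \<in> little_lipschitz p (1 / p)"
proof -
  have fH: "f \<in> Hol_disc" by (rule hardy_Hol_disc[OF f])
  have bv: "has_boundary_values f" by (rule small_deriv_imp_boundary_values[OF sd fH p])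
  have p0: "p > 0" using p by simp
  have "(\<lambda>\<delta>. mean_modulus p \<delta> f) \<in> o[at_right 0](\<lambda>\<delta>. \<delta> powr (1 / p))"
  proof (rule landau_o.smallI)
    fix e :: real assume e: "e > 0"
    then obtain h0 where h0: "h0 > 0" and le: "\<And>t y. 0 < \<bar>t\<bar> \<Longrightarrow> \<bar>t\<bar> < h0 \<Longrightarrow> 0 < y \<Longrightarrow> y < h0 \<Longrightarrow>
        Hn p y (\<lambda>w. lift f (w + of_real t) - lift f w) \<le> e * \<bar>t\<bar> powr (1 / p)"
      using Hn_increment_small[OF sd fH p] by meson
    have "norm (mean_modulus p \<delta> f) \<le> e * norm (\<delta> powr (1 / p))" if d: "0 < \<delta>" "\<delta> < h0" for \<delta>
    proof -
      have b: "bv_increment p f t \<le> e * \<delta> powr (1 / p)" if t: "0 < \<bar>t\<bar>" "\<bar>t\<bar> \<le> \<delta>" for t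
      proof -
        have "bv_increment p f t \<le> e * \<bar>t\<bar> powr (1 / p)"
          using t d by (intro bv_increment_le(2)[OF fH bv p0 h0] le) auto
        also have "\<dots> \<le> e * \<delta> powr (1 / p)" using t e p by (intro mult_left_mono powr_mono2) auto
        finally show ?thesis .
      qed
      have "mean_modulus p \<delta> f \<le> e * \<delta> powr (1 / p)"
        unfolding mean_modulus_def bv_increment_def[symmetric]
      proof (rule cSUP_least)
        have "\<delta> \<in> {t. 0 < \<bar>t\<bar> \<and> \<bar>t\<bar> \<le> \<delta>}" using d by simp
        then show "{t. 0 < \<bar>t\<bar> \<and> \<bar>t\<bar> \<le> \<delta>} \<noteq> {}" by blast
      qed (use b in auto)
      moreover have "0 \<le> bv_increment p f \<delta>" by (simp add: bv_increment_def)
      then have "0 \<le> mean_modulus p \<delta> f"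
        using bv_increment_le_mean_modulus[OF f bv p, of \<delta> \<delta>] d by simp
      ultimately show ?thesis by simp
    qed
    then show "\<forall>\<^sub>F \<delta> in at_right 0. norm (mean_modulus p \<delta> f) \<le> e * norm (\<delta> powr (1 / p))"
      using h0 by (intro eventually_at_rightI[of 0 h0]) auto
  qed
  then show ?thesis using f bv by (simp add: little_lipschitz_def)
qed

section \<open>The test functions\<close>

text \<open>On \<open>{0..2*pi}\<close> the point 1 of the circle appears at both ends, hence the
  two singular terms. Each contributes at most d^(1-p) / (p - 1).\<close>

lemma integral_powr_neg_le:
  fixes d p :: real
  assumes d: "d > 0" and p: "p > 1"
  shows "integral {0..2*pi} (\<lambda>x. (d + x) powr (- p) + (d + (2*pi - x)) powr (- p)) \<le> 2 * (d powr (1 - p) / (p - 1))"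
proof -
  let ?g = "\<lambda>x. ((d + (2*pi - x)) powr (1 - p) - (d + x) powr (1 - p)) / (p - 1)"
  have "((\<lambda>x. (d + x) powr (- p) + (d + (2*pi - x)) powr (- p)) has_integral ?g (2*pi) - ?g 0) {0..2*pi}"
  proof (rule fundamental_theorem_of_calculus)
    fix x assume "x \<in> {0..2*pi}"
    then have x: "d + x > 0" "d + (2*pi - x) > 0" using d by auto
    have t: "((\<lambda>x. d + (2*pi - x)) has_real_derivative - 1) (at x)" "((\<lambda>x. d + x) has_real_derivative 1) (at x)"
      by (auto intro!: derivative_eq_intros)
    have "(?g has_real_derivative ((1 - p) * (d + (2*pi - x)) powr (1 - p - 1) * (- 1) - (1 - p) * (d + x) powr (1 - p - 1)) / (p - 1)) (at x)"
      using DERIV_cdivide[OF DERIV_diff[OF DERIV_chain2[OF has_real_derivative_powr[OF x(2)] t(1)]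
          DERIV_chain2[OF has_real_derivative_powr[OF x(1)] t(2)]], of "1 - p" "1 - p" "p - 1"]
      by (simp only: mult_1_right)
    moreover have "((1 - p) * A * (- 1) - (1 - p) * B) / (p - 1) = B + A" for A B
    proof (rule nonzero_divide_eq_eq[THEN iffD2])
      show "p - 1 \<noteq> 0" using p by simp
      show "(1 - p) * A * (- 1) - (1 - p) * B = (B + A) * (p - 1)" by algebra
    qed
    moreover have "1 - p - 1 = - p" by simp
    ultimately have "(?g has_real_derivative (d + x) powr (- p) + (d + (2*pi - x)) powr (- p)) (at x)" by (simp only:)
    then show "(?g has_vector_derivative (d + x) powr (- p) + (d + (2*pi - x)) powr (- p)) (at x within {0..2*pi})"
      unfolding has_real_derivative_iff_has_vector_derivative by (rule has_vector_derivative_at_within)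
  qed simp
  then have "integral {0..2*pi} (\<lambda>x. (d + x) powr (- p) + (d + (2*pi - x)) powr (- p)) = ?g (2*pi) - ?g 0"
    by (rule integral_unique)
  also have "\<dots> = 2 * (d powr (1 - p) / (p - 1)) - 2 * ((d + 2*pi) powr (1 - p) / (p - 1))"
    by (simp add: diff_divide_distrib)
  also have "\<dots> \<le> 2 * (d powr (1 - p) / (p - 1))" using p by simp
  finally show ?thesis .
qed

text \<open>The norm N is at least 1 - b, hence at least d. Replacing b by 1 costs another 1 - b, so
  Jordan's inequality gives |x| at most pi N. Adding the two bounds produces the constant 2
  pi.\<close>

lemma norm_one_minus_ge:
  assumes a: "0 \<le> b" "b \<le> 1 - d" and d: "d > 0" and x: "\<bar>x\<bar> \<le> pi"
  shows "norm (1 - of_real b * cis (- x)) \<ge> (d + \<bar>x\<bar>) / (2 * pi)"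
proof -
  let ?N = "norm (1 - of_real b * cis (- x))"
  have "1 - b \<le> ?N" using norm_triangle_ineq2[of 1 "of_real b * cis (- x)"] a by (simp add: norm_mult)
  then have 1: "d \<le> ?N" "1 - b \<le> ?N" using a by auto
  have "norm (1 - cis (- x)) \<le> ?N + norm (of_real b * cis (- x) - cis (- x))"
    using norm_triangle_ineq[of "1 - of_real b * cis (- x)" "of_real b * cis (- x) - cis (- x)"] by simp
  also have "norm (of_real b * cis (- x) - cis (- x)) = norm (of_real (b - 1) :: complex) * norm (cis (- x))"
    unfolding norm_mult[symmetric] by (simp add: algebra_simps)
  also have "\<dots> = 1 - b" unfolding norm_of_real norm_cis using a d by simp
  finally have "2 * \<bar>x\<bar> / pi \<le> 2 * ?N" using norm_one_minus_cis_ge[OF x] 1 by linarith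
  then have 2: "\<bar>x\<bar> \<le> pi * ?N" by (simp add: field_simps)
  have "1 * d \<le> pi * ?N" using 1 pi_gt3 d by (intro mult_mono) auto
  with 2 show ?thesis by (simp add: field_simps)
qed

text \<open>Given through its coefficients, because the operator acts on their partial sums, which
  are geometric.\<close>

definition cauchy_kernel :: "real \<Rightarrow> real \<Rightarrow> complex \<Rightarrow> complex" where
  "cauchy_kernel p a = disc_fun (\<lambda>k. of_real ((1 - a) powr (1 - 1 / p) * a ^ k))"

lemma cauchy_kernel_series:
  assumes "0 < a" "a < 1"
  shows "disc_series (\<lambda>k. of_real ((1 - a) powr (1 - 1 / p) * a ^ k))"
proof (rule disc_series_bounded)
  show "norm (complex_of_real ((1 - a) powr (1 - 1 / p) * a ^ k)) \<le> (1 - a) powr (1 - 1 / p) * 1" for k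
    unfolding norm_of_real abs_mult using assms by (intro mult_mono) (auto simp: power_le_one)
qed

lemma cauchy_kernel_eq:
  assumes a: "0 < a" "a < 1" and z: "norm z < 1"
  shows "cauchy_kernel p a z = of_real ((1 - a) powr (1 - 1 / p)) / (1 - of_real a * z)"
proof -
  have "norm (of_real a * z) < 1"
    using a z mult_strict_mono[of a 1 "norm z" 1] by (simp add: norm_mult)
  then have "(\<lambda>k. of_real ((1 - a) powr (1 - 1 / p)) * (of_real a * z) ^ k) sums (of_real ((1 - a) powr (1 - 1 / p)) * (1 / (1 - of_real a * z)))"
    by (intro sums_mult geometric_sums)
  moreover have "(\<lambda>k. of_real ((1 - a) powr (1 - 1 / p) * a ^ k) * z ^ k) sums cauchy_kernel p a z"
    unfolding cauchy_kernel_def using z by (intro disc_fun_sums cauchy_kernel_series a) auto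
  ultimately show ?thesis by (auto simp: power_mult_distrib mult_ac dest: sums_unique2)
qed

text \<open>On every circle the p-th power of the modulus is at most d^(p-1) times a multiple of (d
  + s)^(-p), with d = 1 - a and s the angular distance to 1. Its integral is of order d^(1-p), so
  the powers of d cancel.\<close>

lemma cauchy_kernel_hardy:
  assumes p: "p > 1"
  shows "\<exists>C. \<forall>a. 0 < a \<longrightarrow> a < 1 \<longrightarrow> cauchy_kernel p a \<in> hardy p \<and> hardy_norm p (cauchy_kernel p a) \<le> C"
proof -
  define J where "J = (2*pi) powr p * (2 / (p - 1))"
  have J: "J > 0" using p by (simp add: J_def)
  define C where "C = (J / (2*pi)) powr (1 / p)"
  have Cp: "2 * pi * C powr p = J" using J p by (simp add: C_def powr_powr)
  have C0: "C \<ge> 0" by (simp add: C_def)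
  have p0: "p > 0" using p by simp
  have "Hn p y (lift (cauchy_kernel p a)) \<le> C" if a: "0 < a" "a < 1" and y: "y > 0" for a y
  proof -
    define d where "d = 1 - a"
    have d: "d > 0" using a by (simp add: d_def)
    define b where "b = a * exp (- y)"
    have b: "0 \<le> b" "b \<le> 1 - d" using a y mult_left_mono[of "exp (- y)" 1 a] by (auto simp: b_def d_def)
    have ptw: "norm (lift (cauchy_kernel p a) (Complex x y)) powr p
        \<le> d powr (p - 1) * (2*pi) powr p * ((d + x) powr (- p) + (d + (2*pi - x)) powr (- p))" if x: "x \<in> {0..2*pi}" for x
    proof -
      \<comment> \<open>The distance from x to the nearer end of the period.\<close>
      define s where "s = (if x \<le> pi then x else 2*pi - x)"
      have s: "s \<ge> 0" using x by (auto simp: s_def)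
      have "norm (1 - of_real b * cis x) \<ge> (d + s) / (2*pi)"
      proof (cases "x \<le> pi")
        case True
        then show ?thesis using norm_one_minus_ge[OF b d, of "- x"] x by (simp add: s_def)
      next
        case False
        have "cis (- (2*pi - x)) = cis x" by (simp add: complex_eq_iff cos_diff sin_diff)
        then show ?thesis using norm_one_minus_ge[OF b d, of "2*pi - x"] False x by (simp add: s_def)
      qed
      moreover have "lift (cauchy_kernel p a) (Complex x y) = of_real (d powr (1 - 1 / p)) / (1 - of_real b * cis x)"
        unfolding lift_def using y by (subst cauchy_kernel_eq[OF a]) (auto simp: exp_i_Complex b_def d_def norm_mult mult_ac)
      ultimately have eq: "norm (lift (cauchy_kernel p a) (Complex x y)) = d powr (1 - 1 / p) / norm (1 - of_real b * cis x)"
        and ge: "norm (1 - of_real b * cis x) \<ge> (d + s) / (2*pi)" by (simp_all add: norm_divide)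
      have "(d + s) / (2*pi) > 0" using d s by (intro divide_pos_pos) auto
      with ge have "norm (lift (cauchy_kernel p a) (Complex x y)) \<le> d powr (1 - 1 / p) / ((d + s) / (2*pi))"
        unfolding eq by (intro divide_left_mono mult_pos_pos) auto
      then have "norm (lift (cauchy_kernel p a) (Complex x y)) powr p \<le> (d powr (1 - 1 / p) / ((d + s) / (2*pi))) powr p"
        using p0 by (intro powr_mono2) auto
      also have "\<dots> = d powr (p - 1) * (2*pi) powr p * (d + s) powr (- p)"
      proof -
        have "(d powr (1 - 1 / p)) powr p = d powr (p - 1)" using p by (simp add: powr_powr left_diff_distrib)
        then show ?thesis using d s by (simp add: powr_divide powr_mult powr_minus field_simps)
      qed
      also have "\<dots> \<le> d powr (p - 1) * (2*pi) powr p * ((d + x) powr (- p) + (d + (2*pi - x)) powr (- p))"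
        by (intro mult_left_mono) (auto simp: s_def)
      finally show ?thesis .
    qed
    have "integral {0..2*pi} (\<lambda>x. norm (lift (cauchy_kernel p a) (Complex x y)) powr p)
        \<le> integral {0..2*pi} (\<lambda>x. d powr (p - 1) * (2*pi) powr p * ((d + x) powr (- p) + (d + (2*pi - x)) powr (- p)))"
    proof (intro integral_le integrable_continuous_interval ptw)
      have U: "per_hol (lift (cauchy_kernel p a))"
        unfolding cauchy_kernel_def by (intro per_hol_lift_disc_fun cauchy_kernel_series a)
      show "continuous_on {0..2*pi} (\<lambda>x. norm (lift (cauchy_kernel p a) (Complex x y)) powr p)"
        by (intro continuous_on_norm_powr per_hol_line[OF U] y p0)
      have "continuous_on {0..2*pi} (\<lambda>x. (d + x) powr (- p))" "continuous_on {0..2*pi} (\<lambda>x. (d + (2*pi - x)) powr (- p))"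
        using d by (auto intro!: continuous_on_powr' continuous_intros)
      then show "continuous_on {0..2*pi} (\<lambda>x. d powr (p - 1) * (2*pi) powr p * ((d + x) powr (- p) + (d + (2*pi - x)) powr (- p)))"
        by (intro continuous_on_mult continuous_on_const continuous_on_add)
    qed
    also have "\<dots> = d powr (p - 1) * (2*pi) powr p * integral {0..2*pi} (\<lambda>x. (d + x) powr (- p) + (d + (2*pi - x)) powr (- p))"
      by (rule integral_mult_right)
    also have "\<dots> \<le> d powr (p - 1) * (2*pi) powr p * (2 * (d powr (1 - p) / (p - 1)))"
      by (intro mult_left_mono integral_powr_neg_le d p) auto
    also have "\<dots> = (d powr (p - 1) * d powr (1 - p)) * J" by (simp add: J_def)
    also have "d powr (p - 1) * d powr (1 - p) = 1" using d by (simp flip: powr_add)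
    finally show ?thesis using p0 C0 by (simp add: Lpn_le_iff Cp)
  qed
  then show ?thesis
    unfolding cauchy_kernel_def
    by (intro exI[of _ C] allI impI conjI hardyI[where C = C and p = p] disc_fun_Hol_disc cauchy_kernel_series)
qed

text \<open>The partial sums of a^k are (1 - a^(n+1)) / (1 - a), so the n-th coefficient of the
  image is a multiple of \<eta>_n - a \<eta>_n a^n. Multiplying z by a = e^(-h) is moving w up by
  h.\<close>

lemma lift_rhaly_cauchy_kernel:
  assumes eta: "disc_series \<eta>" and h: "h > 0" and w: "Im w > 0"
  shows "lift (rhaly \<eta> (cauchy_kernel p (exp (- h)))) w
    = of_real ((1 - exp (- h)) powr (- 1 / p)) * (lift (disc_fun \<eta>) w - of_real (exp (- h)) * lift (disc_fun \<eta>) (w + \<i> * of_real h))"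
proof -
  define a where "a = exp (- h)"
  have a: "0 < a" "a < 1" using h by (auto simp: a_def)
  let ?K = "complex_of_real ((1 - a) powr (- 1 / p))"
  let ?c = "rhaly_coeff \<eta> (cauchy_kernel p a)"
  have coeff: "?c n = ?K * (\<eta> n * (1 - of_real a ^ Suc n))" for n
  proof -
    have "(\<Sum>k\<le>n. of_real ((1 - a) powr (1 - 1 / p) * a ^ k)) = complex_of_real ((1 - a) powr (1 - 1 / p) * (\<Sum>k<Suc n. a ^ k))"
      by (simp only: of_real_sum sum_distrib_left lessThan_Suc_atMost)
    also have "(\<Sum>k<Suc n. a ^ k) = (1 - a ^ Suc n) / (1 - a)" using a sum_gp_strict[of a "Suc n"] by simp
    also have "(1 - a) powr (1 - 1 / p) * ((1 - a ^ Suc n) / (1 - a)) = (1 - a) powr (- 1 / p) * (1 - a ^ Suc n)"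
      using a powr_diff[of "1 - a" "1 - 1 / p" 1] by (simp add: powr_one)
    finally have sum: "(\<Sum>k\<le>n. of_real ((1 - a) powr (1 - 1 / p) * a ^ k)) = complex_of_real ((1 - a) powr (- 1 / p) * (1 - a ^ Suc n))" .
    show ?thesis
      unfolding rhaly_coeff_def cauchy_kernel_def taylor_coeff_disc_fun[OF cauchy_kernel_series[OF a]] sum by (simp add: mult_ac)
  qed
  have cs: "disc_series ?c"
  proof (rule disc_series_le[OF eta, of _ "norm ?K"])
    fix n
    have "norm (1 - complex_of_real a ^ Suc n) = \<bar>1 - a ^ Suc n\<bar>" by (metis norm_of_real of_real_1 of_real_diff of_real_power)
    also have "\<dots> \<le> 1" using a power_le_one[of a "Suc n"] by (simp add: abs_le_iff del: power_Suc)
    finally have "norm (1 - complex_of_real a ^ Suc n) \<le> 1" .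
    then have "norm (\<eta> n) * norm (1 - complex_of_real a ^ Suc n) \<le> norm (\<eta> n) * 1" by (intro mult_left_mono) auto
    then have "norm ?K * (norm (\<eta> n) * norm (1 - complex_of_real a ^ Suc n)) \<le> norm ?K * (norm (\<eta> n) * 1)"
      by (rule mult_left_mono) simp
    then show "norm (?c n) \<le> norm ?K * norm (\<eta> n)" unfolding coeff norm_mult by simp
  qed
  let ?q = "exp (\<i> * w)"
  have q': "exp (\<i> * (w + \<i> * of_real h)) = of_real a * ?q"
    by (simp add: a_def exp_of_real[symmetric] distrib_left exp_add[symmetric] mult.assoc[symmetric] add.commute)
  have "(\<lambda>n. \<eta> n * exp (\<i> * (w + \<i> * of_real h)) ^ n) sums lift (disc_fun \<eta>) (w + \<i> * of_real h)"
    using w h by (intro lift_sums[OF eta]) auto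
  then have "(\<lambda>n. \<eta> n * (of_real a * ?q) ^ n) sums lift (disc_fun \<eta>) (w + \<i> * of_real h)" unfolding q' .
  then have "(\<lambda>n. ?K * (\<eta> n * ?q ^ n - of_real a * (\<eta> n * (of_real a * ?q) ^ n))) sums
      (?K * (lift (disc_fun \<eta>) w - of_real a * lift (disc_fun \<eta>) (w + \<i> * of_real h)))"
    by (intro sums_mult sums_diff lift_sums[OF eta w])
  moreover have "?K * (\<eta> n * ?q ^ n - of_real a * (\<eta> n * (of_real a * ?q) ^ n)) = ?c n * ?q ^ n" for n
    unfolding coeff by (simp add: power_mult_distrib algebra_simps)
  ultimately have "(\<lambda>n. ?c n * ?q ^ n) sums (?K * (lift (disc_fun \<eta>) w - of_real a * lift (disc_fun \<eta>) (w + \<i> * of_real h)))"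
    by simp
  moreover have "(\<lambda>n. ?c n * ?q ^ n) sums lift (disc_fun ?c) w" by (rule lift_sums[OF cs w])
  ultimately show ?thesis unfolding rhaly_def a_def[symmetric] by (auto dest: sums_unique2)
qed

text \<open>Compactness gives a subsequence whose images converge in norm, hence coefficientwise.
  Each coefficient of an image is a finite combination of coefficients of \<open>u n\<close> and
  tends to 0, so the limit is the zero function.\<close>

lemma rhaly_compact_small:
  assumes K: "rhaly_compact \<eta> p" and p: "p \<ge> 1" and u: "\<And>n. u n \<in> hardy p" "\<And>n. hardy_norm p (u n) \<le> C"
    and lim: "\<And>k. (\<lambda>n. taylor_coeff (u n) k) \<longlonglongrightarrow> 0" and e: "e > 0"
  shows "\<exists>n::nat. hardy_norm p (rhaly \<eta> (u n)) < e"
proof -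
  have wd: "disc_series (rhaly_coeff \<eta> (u n))" for n
    using K u by (auto simp: rhaly_compact_def rhaly_well_defined_def)
  have op: "compact_linear_op (hardy p) (hardy_norm p) (hardy p) (hardy_norm p) (rhaly \<eta>)"
    using K by (simp add: rhaly_compact_def)
  have rh: "rhaly \<eta> (u n) \<in> hardy p" for n using op u(1) by (simp add: compact_linear_op_def)
  obtain g s where g: "g \<in> hardy p" and s: "strict_mono s"
    and sl: "(\<lambda>n. hardy_norm p (\<lambda>z. rhaly \<eta> (u (s n)) z - g z)) \<longlonglongrightarrow> 0"
    using op u unfolding compact_linear_op_def by blast
  have gH: "g \<in> Hol_disc" by (rule hardy_Hol_disc[OF g])
  have "taylor_coeff g k = 0" for k
  proof -
    have tc: "taylor_coeff (\<lambda>z. rhaly \<eta> (u (s n)) z - g z) k = rhaly_coeff \<eta> (u (s n)) k - taylor_coeff g k" for n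
      using taylor_coeff_diff[OF hardy_Hol_disc[OF rh[of "s n"]] gH] taylor_coeff_disc_fun[OF wd[of "s n"]]
      by (simp add: rhaly_def)
    have "(\<lambda>n. taylor_coeff (\<lambda>z. rhaly \<eta> (u (s n)) z - g z) k) \<longlonglongrightarrow> 0"
      by (rule Lim_null_comparison[OF always_eventually sl]) (use hardy_coeff_le[OF hardy_diff(1)[OF rh g p] p] in blast)
    moreover have "(\<lambda>n. rhaly_coeff \<eta> (u (s n)) k - taylor_coeff g k) \<longlonglongrightarrow> \<eta> k * (\<Sum>j\<le>k. 0) - taylor_coeff g k"
      unfolding rhaly_coeff_def using LIMSEQ_subseq_LIMSEQ[OF lim s]
      by (intro tendsto_diff tendsto_mult tendsto_const tendsto_sum) (simp add: o_def)
    ultimately show ?thesis unfolding tc using LIMSEQ_unique by fastforce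
  qed
  then have "taylor_coeff g = (\<lambda>k. 0)" by (rule ext)
  then have "g z = 0" for z using fun_cong[OF Hol_disc_taylor(2)[OF gH], of z] by (simp add: disc_fun_def fun_eq_iff split: if_splits)
  with sl have "(\<lambda>n. hardy_norm p (rhaly \<eta> (u (s n)))) \<longlonglongrightarrow> 0" by simp
  from order_tendstoD(2)[OF this e] show ?thesis by (auto simp: eventually_sequentially)
qed

text \<open>Otherwise there are h_n tending to 0 whose images stay above \<open>e\<close>. The
  coefficients of these kernels are at most (1 - e^(-h_n))^(1-1/p) and tend to 0, which contradicts
  \<open>rhaly_compact_small\<close>.\<close>

lemma rhaly_cauchy_kernel_small:
  assumes K: "rhaly_compact \<eta> p" and p: "p > 1" and e: "e > 0"
  shows "\<exists>h0>0. \<forall>h. 0 < h \<longrightarrow> h < h0 \<longrightarrow> hardy_norm p (rhaly \<eta> (cauchy_kernel p (exp (- h)))) \<le> e"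
proof (rule ccontr)
  assume "\<not> ?thesis"
  then have "\<exists>h. 0 < h \<and> h < inverse (real (Suc n)) \<and> hardy_norm p (rhaly \<eta> (cauchy_kernel p (exp (- h)))) > e" for n
    by (auto simp: not_le dest!: spec[of _ "inverse (real (Suc n))"])
  then obtain h where h: "\<And>n. 0 < h n" "\<And>n. h n < inverse (real (Suc n))"
    "\<And>n. hardy_norm p (rhaly \<eta> (cauchy_kernel p (exp (- h n)))) > e" by metis
  have hl: "h \<longlonglongrightarrow> 0"
    by (rule tendsto_sandwich[OF always_eventually always_eventually tendsto_const LIMSEQ_inverse_real_of_nat])
       (use h less_imp_le in blast)+
  obtain C where C: "\<And>a. 0 < a \<Longrightarrow> a < 1 \<Longrightarrow> cauchy_kernel p a \<in> hardy p \<and> hardy_norm p (cauchy_kernel p a) \<le> C"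
    using cauchy_kernel_hardy[OF p] by blast
  define u where "u = (\<lambda>n. cauchy_kernel p (exp (- h n)))"
  have "\<exists>n. hardy_norm p (rhaly \<eta> (u n)) < e"
  proof (rule rhaly_compact_small[OF K _ _ _ _ e])
    show "u n \<in> hardy p" "hardy_norm p (u n) \<le> C" for n using C[of "exp (- h n)"] h(1)[of n] by (auto simp: u_def)
    fix k
    have "(\<lambda>n. (1 - exp (- h n)) powr (1 - 1 / p)) \<longlonglongrightarrow> (1 - exp (- 0)) powr (1 - 1 / p)"
      using p h(1) by (intro tendsto_powr2 tendsto_intros hl) (auto intro!: always_eventually less_imp_le)
    then have l: "(\<lambda>n. (1 - exp (- h n)) powr (1 - 1 / p)) \<longlonglongrightarrow> 0" by simp
    show "(\<lambda>n. taylor_coeff (u n) k) \<longlonglongrightarrow> 0"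
    proof (rule Lim_null_comparison[OF always_eventually l], intro allI)
      fix n
      have a: "0 < exp (- h n)" "exp (- h n) < 1" using h(1)[of n] by auto
      have "norm (taylor_coeff (u n) k) = (1 - exp (- h n)) powr (1 - 1 / p) * exp (- h n) ^ k"
        unfolding u_def cauchy_kernel_def taylor_coeff_disc_fun[OF cauchy_kernel_series[OF a]] norm_of_real by simp
      also have "\<dots> \<le> (1 - exp (- h n)) powr (1 - 1 / p) * 1"
        using a by (intro mult_left_mono power_le_one) auto
      finally show "norm (taylor_coeff (u n) k) \<le> (1 - exp (- h n)) powr (1 - 1 / p)" by simp
    qed
  qed (use p in simp)
  then show False using h(3) by (auto simp: u_def dest: less_asym)
qed

text \<open>The constant function 1 has all partial sums equal to 1, so its image is the symbol
  itself.\<close>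

lemma rhaly_compact_symbol:
  assumes K: "rhaly_compact \<eta> p" and p: "p \<ge> 1"
  shows "disc_series \<eta>" "disc_fun \<eta> \<in> hardy p"
proof -
  define c where "c = (\<lambda>n::nat. if n = 0 then 1 else 0 :: complex)"
  have c: "disc_series c" by (rule disc_series_bounded[of _ 1]) (auto simp: c_def)
  have "disc_fun c \<in> hardy p"
  proof (rule hardyI[where C = 1])
    show "disc_fun c \<in> Hol_disc" by (rule disc_fun_Hol_disc[OF c])
    fix y :: real assume y: "y > 0"
    have "(\<lambda>n. norm (c n) * exp (- y) ^ n) sums (norm (c 0) * exp (- y) ^ 0)"
      using sums_finite[of "{0}" "\<lambda>n. norm (c n) * exp (- y) ^ n"] by (simp add: c_def)
    then show "Hn p y (lift (disc_fun c)) \<le> 1"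
      using Hn_disc_fun_le[OF c y, of p] p by (simp add: sums_iff c_def)
  qed
  moreover have "rhaly_coeff \<eta> (disc_fun c) = \<eta>"
    by (rule ext) (simp add: rhaly_coeff_def taylor_coeff_disc_fun[OF c], simp add: c_def)
  ultimately show "disc_series \<eta>" "disc_fun \<eta> \<in> hardy p"
    using K by (auto simp: rhaly_compact_def rhaly_well_defined_def compact_linear_op_def rhaly_def dest: bspec)
qed

text \<open>With \<open>\<Psi>(w) = e\<^sup>i\<^sup>w F(e\<^sup>i\<^sup>w)\<close> the image of the kernel \<open>(1 - a)\<^sup>1\<^sup>-\<^sup>1\<^sup>/\<^sup>p / (1 - a z)\<close>, \<open>a = e\<^sup>-\<^sup>h\<close>, is up to
  unimodular and bounded factors \<open>h\<^sup>-\<^sup>1\<^sup>/\<^sup>p (\<Psi>(w) - \<Psi>(w + i h))\<close>. The kernels are bounded and tend to \<open>0\<close>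
  coefficientwise, so their images tend to \<open>0\<close> in norm.\<close>

theorem rhaly_compact_imp_small_deriv:
  assumes K: "rhaly_compact \<eta> p" and p: "p > 1"
  shows "small_deriv p (disc_fun \<eta>)"
  unfolding small_deriv_def
proof (intro allI impI)
  fix e :: real assume e: "e > 0"
  have p1: "p \<ge> 1" and p0: "p > 0" using p by auto
  note eta = rhaly_compact_symbol(1)[OF K p1] and F = rhaly_compact_symbol(2)[OF K p1]
  \<comment> \<open>The increments of \<Psi> give 3 \<epsilon> for its derivative, the lower-order
    term in the product rule adds \<epsilon>, and passing back to \<Phi> costs e^y, which is at most
    3.\<close>
  define \<epsilon> where "\<epsilon> = e / 12"
  have eps: "\<epsilon> > 0" using e by (simp add: \<epsilon>_def)
  obtain h0 where h0: "h0 > 0" "\<And>h. 0 < h \<Longrightarrow> h < h0 \<Longrightarrow> hardy_norm p (rhaly \<eta> (cauchy_kernel p (exp (- h)))) \<le> \<epsilon>"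
    using rhaly_cauchy_kernel_small[OF K p eps] by blast
  obtain C where C: "\<And>a. 0 < a \<Longrightarrow> a < 1 \<Longrightarrow> cauchy_kernel p a \<in> hardy p \<and> hardy_norm p (cauchy_kernel p a) \<le> C"
    using cauchy_kernel_hardy[OF p] by blast
  define \<Phi> where "\<Phi> = lift (disc_fun \<eta>)"
  have Phi: "per_hol \<Phi>" unfolding \<Phi>_def by (rule per_hol_lift_disc_fun[OF eta])
  define \<Psi> where "\<Psi> = (\<lambda>w. exp (\<i> * w) * \<Phi> w)"
  have Psi: "per_hol \<Psi>"
    unfolding per_hol_def
  proof (intro conjI ballI)
    show "\<Psi> holomorphic_on uhp" unfolding \<Psi>_def by (intro holomorphic_intros per_hol_holomorphic[OF Phi])
    fix w assume "w \<in> uhp"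
    moreover have "exp (\<i> * (w + of_real (2*pi))) = exp (\<i> * w)"
      using exp_plus_2pin[of "\<i> * w" 1] by (simp add: algebra_simps)
    ultimately show "\<Psi> (w + of_real (2*pi)) = \<Psi> w"
      using Phi by (simp add: \<Psi>_def per_hol_def)
  qed
  have incr: "Hn p v (\<lambda>w. \<Psi> (w + \<i> * of_real h) - \<Psi> w) \<le> \<epsilon> * h powr (1 / p)" if h: "0 < h" "h < h0" and v: "v > 0" for h v
  proof -
    \<comment> \<open>The normalisation of the kernel involves \<open>d\<close>, which is at most
      \<open>h\<close>; so the bound for the image turns into one in powers of
      \<open>h\<close>.\<close>
    define d where "d = 1 - exp (- h)"
    have d: "0 < d" "d \<le> h" using h exp_ge_add_one_self[of "- h"] by (auto simp: d_def)
    let ?T = "rhaly \<eta> (cauchy_kernel p (exp (- h)))"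
    have ker: "cauchy_kernel p (exp (- h)) \<in> hardy p" using C[of "exp (- h)"] h by simp
    have T: "?T \<in> hardy p" using K ker by (simp add: rhaly_compact_def compact_linear_op_def)
    have UT: "per_hol (lift ?T)" by (rule per_hol_lift_Hol_disc[OF hardy_Hol_disc[OF T]])
    have le: "norm (\<Psi> (Complex x v + \<i> * of_real h) - \<Psi> (Complex x v)) \<le> norm (of_real (d powr (1 / p)) * lift ?T (Complex x v))" for x
    proof -
      let ?w = "Complex x v"
      have w: "Im ?w > 0" using v by simp
      have "exp (\<i> * (?w + \<i> * of_real h)) = exp (\<i> * ?w) * of_real (exp (- h))"
        by (simp add: exp_of_real[symmetric] distrib_left exp_add[symmetric] mult.assoc[symmetric] add.commute)
      then have "\<Psi> (?w + \<i> * of_real h) - \<Psi> ?w = - (exp (\<i> * ?w) * (\<Phi> ?w - of_real (exp (- h)) * \<Phi> (?w + \<i> * of_real h)))"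
        by (simp add: \<Psi>_def algebra_simps)
      also have "\<Phi> ?w - of_real (exp (- h)) * \<Phi> (?w + \<i> * of_real h) = of_real (d powr (1 / p)) * lift ?T ?w"
      proof -
        have "complex_of_real (d powr (1 / p)) * of_real (d powr (- 1 / p)) = 1"
          unfolding of_real_mult[symmetric] powr_add[symmetric] using d by simp
        then show ?thesis unfolding lift_rhaly_cauchy_kernel[OF eta h(1) w] \<Phi>_def d_def[symmetric] mult.assoc[symmetric] by simp
      qed
      finally have "norm (\<Psi> (?w + \<i> * of_real h) - \<Psi> ?w) = exp (- v) * norm (of_real (d powr (1 / p)) * lift ?T ?w)"
        by (simp add: norm_mult)
      also have "\<dots> \<le> 1 * norm (of_real (d powr (1 / p)) * lift ?T ?w)" using v by (intro mult_right_mono) auto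
      finally show ?thesis by simp
    qed
    have "Hn p v (\<lambda>w. \<Psi> (w + \<i> * of_real h) - \<Psi> w) \<le> Lpn p (\<lambda>x. of_real (d powr (1 / p)) * lift ?T (Complex x v))"
      using v h by (intro Lpn_mono p0 le continuous_on_mult continuous_on_const per_hol_line UT per_hol_diff per_hol_shift Psi) auto
    also have "\<dots> = d powr (1 / p) * Hn p v (lift ?T)" by (subst Lpn_cmult[OF p0]) simp
    also have "\<dots> \<le> h powr (1 / p) * \<epsilon>"
      using d p0 h0(2)[OF h] Hn_le_hardy_norm[OF T v] by (intro mult_mono powr_mono2 Lpn_nonneg) auto
    finally show ?thesis by (simp add: mult.commute)
  qed
  have dPsi: "Hn p y (deriv \<Psi>) \<le> 3 * \<epsilon> * y powr (1 / p - 1)" if y: "0 < y" "y < h0" for y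
  proof -
    define B where "B = \<epsilon> * y powr (1 / p)"
    have B0: "B \<ge> 0" using eps by (simp add: B_def)
    have "norm (\<i> * of_real y) * Hn p y (deriv \<Psi>) \<le> B + norm (\<i> * of_real y) * (2 * B / y)"
    proof (rule Hn_deriv_le_of_increments[OF Psi p1 y(1)])
      fix u v :: real assume u: "u \<in> {0..1}" and v: "v \<ge> y / 2"
      have v0: "v > 0" using v y by linarith
      show "Hn p v (\<lambda>w. \<Psi> (w + of_real u * (\<i> * of_real y)) - \<Psi> w) \<le> B"
      proof (cases "u = 0")
        case True
        then show ?thesis using B0 p0 by (intro Lpn_le_const) auto
      next
        case False
        then have uy: "0 < u * y" "u * y \<le> y" using u y by (auto simp: mult_left_le_one_le)
        have "Hn p v (\<lambda>w. \<Psi> (w + \<i> * of_real (u * y)) - \<Psi> w) \<le> \<epsilon> * (u * y) powr (1 / p)"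
          by (rule incr[OF uy(1) le_less_trans[OF uy(2) y(2)] v0])
        also have "\<dots> \<le> B" unfolding B_def using uy eps p0 by (intro mult_left_mono powr_mono2) auto
        finally show ?thesis by (simp add: mult_ac)
      qed
    qed (use y in simp)
    then have "y * Hn p y (deriv \<Psi>) \<le> 3 * B" using y by (simp add: norm_mult)
    also have "3 * B = y * (3 * \<epsilon> * y powr (1 / p - 1))" using y by (simp add: B_def powr_diff)
    finally show ?thesis using y by simp
  qed
  define N where "N = hardy_norm p (disc_fun \<eta>)"
  have N: "N \<ge> 0" unfolding N_def by (rule hardy_norm_nonneg[OF F])
  \<comment> \<open>Below this height the fixed norm N is at most \<epsilon> y^(1/p-1), since this
    power tends to infinity as y tends to 0.\<close>
  define y1 where "y1 = (\<epsilon> / (N + 1)) powr (1 / (1 - 1 / p))"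
  have y1: "y1 > 0" using eps N by (simp add: y1_def)
  have "Hn p y (deriv \<Phi>) \<le> e * y powr (1 / p - 1)" if y: "0 < y" "y < min 1 (min h0 y1)" for y
  proof -
    have "y powr (1 - 1 / p) \<le> y1 powr (1 - 1 / p)" using y p by (intro powr_mono2) auto
    also have "\<dots> = \<epsilon> / (N + 1)" using eps N p by (simp add: y1_def powr_powr)
    finally have "y powr (1 - 1 / p) * (N + 1) \<le> \<epsilon>" using N by (simp add: field_simps)
    then have "y powr (1 / p - 1) * (y powr (1 - 1 / p) * (N + 1)) \<le> y powr (1 / p - 1) * \<epsilon>"
      by (rule mult_left_mono) simp
    moreover have "y powr (1 / p - 1) * (y powr (1 - 1 / p) * (N + 1)) = N + 1"
      using y by (simp add: mult.assoc[symmetric] powr_add[symmetric])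
    ultimately have Ny: "N \<le> \<epsilon> * y powr (1 / p - 1)" by (simp only: mult.commute[of \<epsilon>])
    have ey: "exp y \<le> 3" using y exp_le exp_le_cancel_iff[of y 1] by linarith
    have le: "norm (deriv \<Phi> (Complex x y)) \<le> norm (of_real (exp y) * deriv \<Psi> (Complex x y)) + norm (of_real (exp y) * \<Psi> (Complex x y))" for x
    proof -
      let ?w = "Complex x y"
      have w: "Im ?w > 0" using y by simp
      have "(\<Phi> has_field_derivative deriv \<Phi> ?w) (at ?w)"
        using per_hol_field_differentiable[OF Phi w] field_differentiable_derivI by blast
      then have "(\<Psi> has_field_derivative \<i> * \<Psi> ?w + exp (\<i> * ?w) * deriv \<Phi> ?w) (at ?w)"
        unfolding \<Psi>_def by (auto intro!: derivative_eq_intros)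
      then have "deriv \<Psi> ?w = \<i> * \<Psi> ?w + exp (\<i> * ?w) * deriv \<Phi> ?w" by (rule DERIV_imp_deriv)
      then have "exp (\<i> * ?w) * deriv \<Phi> ?w = deriv \<Psi> ?w - \<i> * \<Psi> ?w" by simp
      then have "norm (exp (\<i> * ?w) * deriv \<Phi> ?w) \<le> norm (deriv \<Psi> ?w) + norm (\<i> * \<Psi> ?w)"
        by (simp only: norm_triangle_ineq4)
      then have "exp (- y) * norm (deriv \<Phi> ?w) \<le> norm (deriv \<Psi> ?w) + norm (\<Psi> ?w)" by (simp add: norm_mult)
      then have "exp y * (exp (- y) * norm (deriv \<Phi> ?w)) \<le> exp y * (norm (deriv \<Psi> ?w) + norm (\<Psi> ?w))"
        by (rule mult_left_mono) simp
      then show ?thesis by (simp add: norm_mult distrib_left mult.assoc[symmetric] exp_add[symmetric])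
    qed
    have c: "continuous_on {0..2*pi} (\<lambda>x. deriv \<Psi> (Complex x y))" "continuous_on {0..2*pi} (\<lambda>x. deriv \<Phi> (Complex x y))"
      "continuous_on {0..2*pi} (\<lambda>x. \<Psi> (Complex x y))" "continuous_on {0..2*pi} (\<lambda>x. \<Phi> (Complex x y))"
      using y by (auto intro!: per_hol_line per_hol_deriv Psi Phi)
    have "Hn p y \<Psi> \<le> Hn p y \<Phi>"
      using y by (intro Lpn_mono[OF p0] c) (auto simp: \<Psi>_def norm_mult mult_left_le_one_le)
    also have "\<dots> \<le> N" unfolding \<Phi>_def N_def using y by (intro Hn_le_hardy_norm F) auto
    finally have PN: "Hn p y \<Psi> \<le> N" .
    have "Hn p y (deriv \<Phi>) \<le> Lpn p (\<lambda>x. of_real (exp y) * deriv \<Psi> (Complex x y)) + Lpn p (\<lambda>x. of_real (exp y) * \<Psi> (Complex x y))"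
      by (intro Lpn_triangle_le[OF p1] continuous_on_mult continuous_on_const c le)
    also have "\<dots> = exp y * (Hn p y (deriv \<Psi>) + Hn p y \<Psi>)" by (simp add: Lpn_cmult[OF p0] distrib_left)
    also have "\<dots> \<le> 3 * (3 * \<epsilon> * y powr (1 / p - 1) + \<epsilon> * y powr (1 / p - 1))"
      using ey dPsi[of y] y PN Ny by (intro mult_mono add_mono add_nonneg_nonneg Lpn_nonneg) auto
    also have "\<dots> = e * y powr (1 / p - 1)" by (simp add: \<epsilon>_def)
    finally show ?thesis .
  qed
  moreover have "min 1 (min h0 y1) > 0" using h0 y1 by simp
  ultimately show "\<exists>y0>0. \<forall>y. 0 < y \<longrightarrow> y < y0 \<longrightarrow> Hn p y (deriv (lift (disc_fun \<eta>))) \<le> e * y powr (1 / p - 1)"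
    unfolding \<Phi>_def by blast
qed

text \<open>The derivative of z = e^(iw) has modulus e^(-y) on the whole line, so the chain rule
  gives an exact relation between the means.\<close>

lemma Hn_lift_deriv:
  assumes eta: "disc_series \<eta>" and y: "y > 0" and p: "p > 0"
  shows "Hn p y (lift (deriv (disc_fun \<eta>))) = exp y * Hn p y (deriv (lift (disc_fun \<eta>)))"
proof -
  have "norm (lift (deriv (disc_fun \<eta>)) (Complex x y)) = norm (of_real (exp y) * deriv (lift (disc_fun \<eta>)) (Complex x y))" for x
  proof -
    let ?w = "Complex x y"
    have "exp (\<i> * ?w) \<in> ball 0 1" using y by simp
    then have "(disc_fun \<eta> has_field_derivative deriv (disc_fun \<eta>) (exp (\<i> * ?w))) (at (exp (\<i> * ?w)))"
      using disc_fun_holomorphic[OF eta] by (intro holomorphic_derivI[of _ "ball 0 1"]) auto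
    moreover have "((\<lambda>w. exp (\<i> * w)) has_field_derivative \<i> * exp (\<i> * ?w)) (at ?w)"
      by (auto intro!: derivative_eq_intros)
    ultimately have "((\<lambda>w. disc_fun \<eta> (exp (\<i> * w))) has_field_derivative deriv (disc_fun \<eta>) (exp (\<i> * ?w)) * (\<i> * exp (\<i> * ?w))) (at ?w)"
      by (rule DERIV_chain2)
    then have "deriv (lift (disc_fun \<eta>)) ?w = deriv (disc_fun \<eta>) (exp (\<i> * ?w)) * (\<i> * exp (\<i> * ?w))"
      unfolding lift_def by (rule DERIV_imp_deriv)
    then have "norm (of_real (exp y) * deriv (lift (disc_fun \<eta>)) ?w) = (exp y * exp (- y)) * norm (lift (deriv (disc_fun \<eta>)) ?w)"
      by (simp add: norm_mult lift_def del: exp_minus_inverse)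
    also have "exp y * exp (- y) = 1" by (simp flip: exp_add)
    finally show ?thesis by simp
  qed
  then have "Hn p y (lift (deriv (disc_fun \<eta>))) = Lpn p (\<lambda>x. of_real (exp y) * deriv (lift (disc_fun \<eta>)) (Complex x y))"
    by (simp add: Lpn_def)
  then show ?thesis by (simp add: Lpn_cmult[OF p])
qed

text \<open>The height - ln r is at least 1 - r and the exponent 1/p - 1 is negative, so the height
  may be replaced by 1 - r. Near r = 1 the logarithm is at least 1 and only enlarges the right-hand
  side.\<close>

lemma small_deriv_imp_mean_smallo:
  assumes eta: "disc_series \<eta>" and sd: "small_deriv p (disc_fun \<eta>)" and p: "p > 1"
  shows "(\<lambda>r. integral_mean p r (deriv (disc_fun \<eta>))) \<in> o[at_left 1](\<lambda>r. ln (1 / (1 - r)) / (1 - r) powr (1 - 1 / p))"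
proof (rule landau_o.smallI)
  fix e :: real assume e: "e > 0"
  obtain y0 where y0: "y0 > 0" "\<And>y. 0 < y \<Longrightarrow> y < y0 \<Longrightarrow> Hn p y (deriv (lift (disc_fun \<eta>))) \<le> e / 2 * y powr (1 / p - 1)"
    using sd e half_gt_zero[OF e] unfolding small_deriv_def by meson
  \<comment> \<open>The three entries ensure that 1/r is at most 2, that the height - ln r is below
    \<open>y0\<close>, and that the logarithm is at least 1.\<close>
  define r0 where "r0 = Max {1 / 2, exp (- y0), 1 - exp (- 1)}"
  have r0: "1 / 2 \<le> r0" "exp (- y0) \<le> r0" "1 - exp (- 1) \<le> r0" "r0 < 1" using y0 by (auto simp: r0_def)
  have "norm (integral_mean p r (deriv (disc_fun \<eta>))) \<le> e * norm (ln (1 / (1 - r)) / (1 - r) powr (1 - 1 / p))"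
    if r: "r0 < r" "r < 1" for r
  proof -
    have r': "1 / 2 < r" "exp (- y0) < r" "1 - r < exp (- 1)" using r r0 by linarith+
    have "- y0 < ln r" using r' by (subst exp_less_cancel_iff[symmetric]) simp
    then have y: "0 < - ln r" "- ln r < y0" using r r' by auto
    have lr: "1 - r \<le> - ln r" using ln_le_minus_one[of r] r' by linarith
    have "ln (1 - r) \<le> - 1" using r r' by (subst exp_le_cancel_iff[symmetric]) simp
    then have L: "ln (1 / (1 - r)) \<ge> 1" using r by (simp add: ln_div)
    have "integral_mean p r (deriv (disc_fun \<eta>)) = exp (- ln r) * Hn p (- ln r) (deriv (lift (disc_fun \<eta>)))"
      using r' y p by (simp add: integral_mean_eq_Hn' Hn_lift_deriv[OF eta])
    also have "\<dots> \<le> 2 * (e / 2 * (- ln r) powr (1 / p - 1))"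
    proof (intro mult_mono y0(2)[OF y] Lpn_nonneg)
      show "exp (- ln r) \<le> 2" using r' by (simp add: exp_minus field_simps)
    qed auto
    also have "\<dots> \<le> 2 * (e / 2 * (1 - r) powr (1 / p - 1))"
      using e r p lr by (intro mult_left_mono powr_mono2') auto
    also have "\<dots> = e * ((1 - r) powr - (1 - 1 / p) * 1)" by simp
    also have "\<dots> \<le> e * ((1 - r) powr - (1 - 1 / p) * ln (1 / (1 - r)))"
      using e L by (intro mult_left_mono) auto
    also have "(1 - r) powr - (1 - 1 / p) * ln (1 / (1 - r)) = norm (ln (1 / (1 - r)) / (1 - r) powr (1 - 1 / p))"
      using L unfolding powr_minus by (simp add: field_simps)
    finally show ?thesis by (simp add: integral_mean_def)
  qed
  then show "\<forall>\<^sub>F r in at_left 1. norm (integral_mean p r (deriv (disc_fun \<eta>))) \<le> e * norm (ln (1 / (1 - r)) / (1 - r) powr (1 - 1 / p))"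
    using r0(4) by (intro eventually_at_leftI[of r0]) auto
qed

theorem theorem2:
  fixes \<eta> :: "nat \<Rightarrow> complex"
  shows
    "(\<forall>p::real. 1 < p \<longrightarrow> rhaly_compact \<eta> p \<longrightarrow>
        disc_series \<eta> \<and>
        (\<lambda>r. integral_mean p r (deriv (disc_fun \<eta>)))
          \<in> o[at_left 1](\<lambda>r. ln (1 / (1 - r)) / (1 - r) powr (1 - 1 / p))) \<and>
     (\<forall>p::real. 1 < p \<and> p \<le> 2 \<longrightarrow> symbol_in \<eta> (little_lipschitz p (1 / p)) \<longrightarrow>
        rhaly_compact \<eta> p) \<and>
     (\<forall>p::real. 2 < p \<longrightarrow>
        (\<exists>q::real. 2 < q \<and> q < p \<and> symbol_in \<eta> (little_lipschitz q (1 / q))) \<longrightarrow>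
        rhaly_compact \<eta> p) \<and>
     (rhaly_compact \<eta> 2 \<longleftrightarrow> symbol_in \<eta> (little_lipschitz 2 (1 / 2)))"
proof -
  \<comment> \<open>Part (b) and one direction of (d) are the case q = p, part (c) is the case q <
    p.\<close>
  have suff: "rhaly_compact \<eta> p"
    if "1 < q" "q < p \<or> q = p \<and> p \<le> 2" "symbol_in \<eta> (little_lipschitz q (1 / q))" for p q :: real
    using that by (intro rhaly_compactI[of q p]) (auto simp: symbol_in_def intro: little_lipschitz_imp_small_deriv)
  show ?thesis
  proof (intro conjI allI impI)
    fix p :: real assume p: "1 < p" and K: "rhaly_compact \<eta> p"
    show eta: "disc_series \<eta>" using p by (intro rhaly_compact_symbol(1)[OF K]) simp
    show "(\<lambda>r. integral_mean p r (deriv (disc_fun \<eta>)))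
        \<in> o[at_left 1](\<lambda>r. ln (1 / (1 - r)) / (1 - r) powr (1 - 1 / p))"
      by (rule small_deriv_imp_mean_smallo[OF eta rhaly_compact_imp_small_deriv[OF K p] p])
  next
    show "rhaly_compact \<eta> p" if "1 < p \<and> p \<le> 2" "symbol_in \<eta> (little_lipschitz p (1 / p))" for p
      using that by (intro suff[of p p]) auto
  next
    show "rhaly_compact \<eta> p" if "2 < p" "\<exists>q>2. q < p \<and> symbol_in \<eta> (little_lipschitz q (1 / q))" for p
    proof -
      from that obtain q where "2 < q" "q < p" "symbol_in \<eta> (little_lipschitz q (1 / q))" by blast
      then show ?thesis by (intro suff[of q p]) auto
    qed
  next
    show "rhaly_compact \<eta> 2 \<longleftrightarrow> symbol_in \<eta> (little_lipschitz 2 (1 / 2))"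
    proof
      assume K: "rhaly_compact \<eta> 2"
      show "symbol_in \<eta> (little_lipschitz 2 (1 / 2))"
        unfolding symbol_in_def
        using rhaly_compact_symbol[OF K] small_deriv_imp_little_lipschitz[OF rhaly_compact_imp_small_deriv[OF K]] by simp
    next
      show "rhaly_compact \<eta> 2" if "symbol_in \<eta> (little_lipschitz 2 (1 / 2))"
        using that by (intro suff[of 2 2]) auto
    qed
  qed
qed

end
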